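(* Let $\mathfrak q$ be a prime power, $N\ge1$, and let $\alpha_1\ge\dots\ge\alpha_N\ge0$ be real numbers with $\alpha_1+\dots+\alpha_N=1$. Let $w=\xi_1\xi_2\dots\xi_n$ be a random word with independent letters $\xi_i\in\{1,\dots,N\}$ such that $P(\xi_i=k)=\alpha_k$. If the randomized RSK insertion algorithm (described in the context) is applied to $w$, then the top row $\lambda^{(N)}=(\lambda^{(N)}_1\ge\dots\ge\lambda^{(N)}_N)$ of the resulting random interlacing array has distribution $$\mathrm{Prob}(\lambda^{(N)}=\lambda)=n!\,Q_\lambda(\alpha_1,\dots,\alpha_N\,|\,0,\mathfrak q^{-1})\,P_\lambda(\mathbf{Pl}_1\,|\,0,\mathfrak q^{-1}),\qquad|\lambda|=n.$$
   Context: Put $t=\mathfrak q^{-1}$. $P_\lambda(\cdot\,|\,0,t)$ and $Q_\lambda(\cdot\,|\,0,t)$ are the Hall--Littlewood symmetric functions in Macdonald's normalization ($P_\lambda$ has leading coefficient $1$, $Q_\lambda=P_\lambda/\langle P_\lambda,P_\lambda\rangle$ for the scalar product with $\langle p_\lambda,p_\mu\rangle=\mathbf 1_{\lambda=\mu}\prod_i i^{m_i}m_i!\prod_{i=1}^{\ell(\lambda)}(1-t^{\lambda_i})^{-1}$, where $\lambda$ has $m_i$ parts equal to $i$). $P_\lambda(\mathbf{Pl}_1\,|\,0,t)$ is the image of $P_\lambda$ under the algebra homomorphism $p_1\mapsto\frac1{1-t}$, $p_k\mapsto0$ ($k\ge2$). Partitions with at most $N$ parts are identified with weakly decreasing $N$-tuples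 of nonnegative integers. The algorithm acts on interlacing arrays of nonnegative integers $\{\lambda^{(m)}_i:1\le i\le m\le N\}$, $\lambda^{(m)}_{i+1}\le\lambda^{(m-1)}_i\le\lambda^{(m)}_i$; the numbers $\lambda^{(m)}_i$ are viewed as positions of particles at level $m$. A particle $\lambda^{(m)}_i$ is blocked if $i\ge2$ and $\lambda^{(m)}_i=\lambda^{(m-1)}_{i-1}$, and free otherwise. Initially all $\lambda^{(m)}_i=0$. Letters are inserted one by one. Inserting a letter $\xi$ does the following. First, at level $\xi$ the leftmost free particle (the free particle $\lambda^{(\xi)}_i$ with the largest index $i$) moves to the right by one. Then the move propagates successively to levels $\xi+1,\dots,N$, exactly one particle moving (right by one) on each of these levels: suppose $\lambda^{(m)}_i$ has just moved from position $x$ to $x+1$. (a) If $\lambda^{(m+1)}_i=x$, then $\lambda^{(m+1)}_i$ moves. (b) Otherwise, let $D$ be the number of particles of level $m$ at position $x$ after the move, and let $U$ be the number of particles of level $m+1$ at position $x$ (before any move at level $m+1$); then $U\in\{D,D+1\}$. Put $r=\frac{1-t}{1-t^{D+1}}$ if $U=D$ and $r=1-t$ if $U=D+1$. With probability $r$ the particle $\lambda^{(m+1)}_{k}$ moves, where $k$ is the largest index $k\le i$ such that $\lambda^{(m+1)}_k$ is free; with probability $1-r$ the particle $\lambda^{(m+1)}_{i+1}$ moves. All random choices are made independently given the current configuration. *)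

theory Defs
  imports
    "HOL-Probability.Probability"
    "HOL-Library.Poly_Mapping"
    "HOL-Library.Multiset"
    "HOL-Number_Theory.Prime_Powers"
begin

section \<open>Partitions\<close>

text \<open>
  A partition is the multiset of its (positive) parts. The \<open>N\<close>-tuples of nonnegative integers
  are lists of length \<open>N\<close>; a weakly decreasing tuple is identified with the partition
  \<open>partition_of_tuple\<close> obtained by dropping the zero entries.
\<close>

definition partitions :: "nat multiset set" where
  "partitions = {\<mu>. 0 \<notin># \<mu>}"

definition partition_of_tuple :: "nat list \<Rightarrow> nat multiset" where
  "partition_of_tuple a = filter_mset (\<lambda>k. 0 < k) (mset a)"

definition parts :: "nat multiset \<Rightarrow> nat list" where
  "parts \<mu> = rev (sorted_list_of_multiset \<mu>)"

definition strictly_dominated :: "nat multiset \<Rightarrow> nat multiset \<Rightarrow> bool" where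
  "strictly_dominated \<mu> \<nu> \<longleftrightarrow> \<mu> \<noteq> \<nu> \<and> sum_mset \<mu> = sum_mset \<nu> \<and>
     (\<forall>k. sum_list (take k (parts \<mu>)) \<le> sum_list (take k (parts \<nu>)))"

section \<open>Symmetric functions\<close>

text \<open>
  The algebra of symmetric functions over the reals is the polynomial algebra in the power sums
  \<open>p\<^sub>1, p\<^sub>2, \<dots>\<close>. A polynomial in the power sums is an element of the monoid algebra
  \<open>nat multiset \<Rightarrow>\<^sub>0 real\<close>, in which the multiset \<open>\<mu>\<close> stands for the product
  \<open>p\<^sub>\<mu> = \<Prod>k\<in>#\<mu>. p\<^sub>k\<close>; only positive indices \<open>k\<close> may occur.
\<close>

type_synonym symfun = "nat multiset \<Rightarrow>\<^sub>0 real"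

definition symmetric_functions :: "symfun set" where
  "symmetric_functions = {f. Poly_Mapping.keys f \<subseteq> partitions}"

text \<open>The algebra homomorphism to the reals with \<open>p\<^sub>k \<mapsto> \<pi> k\<close>.\<close>

definition specialize :: "(nat \<Rightarrow> real) \<Rightarrow> symfun \<Rightarrow> real" where
  "specialize \<pi> f =
     (\<Sum>\<mu>\<in>Poly_Mapping.keys f. Poly_Mapping.lookup f \<mu> * (\<Prod>k\<in>#\<mu>. \<pi> k))"

lemma specialize_superset:
  assumes "finite A" "Poly_Mapping.keys f \<subseteq> A"
  shows "specialize \<pi> f = (\<Sum>\<mu>\<in>A. Poly_Mapping.lookup f \<mu> * (\<Prod>k\<in>#\<mu>. \<pi> k))"
  unfolding specialize_def
  by (rule sum.mono_neutral_left) (use assms in \<open>auto simp: in_keys_iff\<close>)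

lemma specialize_add: "specialize \<pi> (f + g) = specialize \<pi> f + specialize \<pi> g"
proof -
  let ?A = "Poly_Mapping.keys f \<union> Poly_Mapping.keys g"
  have "Poly_Mapping.keys (f + g) \<subseteq> ?A"
    by (rule Poly_Mapping.keys_add)
  then show ?thesis
    by (simp add: specialize_superset[of ?A] lookup_add algebra_simps sum.distrib)
qed

lemma specialize_single:
  "specialize \<pi> (Poly_Mapping.single \<mu> c) = c * (\<Prod>k\<in>#\<mu>. \<pi> k)"
  by (simp add: specialize_def)

lemma specialize_one: "specialize \<pi> 1 = 1"
  by (simp flip: Poly_Mapping.single_one add: specialize_single)

lemma symfun_induct [case_names single add]:
  fixes f :: symfun
  assumes "\<And>\<mu> c. R (Poly_Mapping.single \<mu> c)" and "\<And>f g. R f \<Longrightarrow> R g \<Longrightarrow> R (f + g)"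
  shows "R f"
proof (induction f rule: Poly_Mapping.update_induct)
  case const
  show ?case using assms(1)[of "{#}" 0] by simp
next
  case (update f \<mu> c)
  have "Poly_Mapping.update \<mu> c f = f + Poly_Mapping.single \<mu> c"
    using update(1)
    by (intro poly_mapping_eqI)
       (auto simp: lookup_update lookup_add lookup_single when_def in_keys_iff)
  then show ?case using assms update by simp
qed

lemma specialize_mult: "specialize \<pi> (f * g) = specialize \<pi> f * specialize \<pi> g"
proof (induction f rule: symfun_induct)
  case (single \<mu> c)
  show ?case
    by (induction g rule: symfun_induct)
       (simp_all add: Poly_Mapping.mult_single specialize_single specialize_add distrib_left)
next
  case (add f f')
  then show ?case
    by (simp add: distrib_right specialize_add)
qed

definition eval_sym :: "symfun \<Rightarrow> real list \<Rightarrow> real" where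
  "eval_sym f xs = specialize (\<lambda>k. \<Sum>x\<leftarrow>xs. x ^ k) f"

text \<open>
  The monomial symmetric polynomial \<open>m\<^sub>\<mu>(x\<^sub>1, \<dots>, x\<^sub>n)\<close>: the sum of the monomials whose exponent
  vector is a rearrangement of \<open>\<mu>\<close> padded by zeros (so \<open>0\<close> if \<open>\<mu>\<close> has more than \<open>n\<close> parts).
\<close>

definition monomial_sym :: "nat multiset \<Rightarrow> real list \<Rightarrow> real" where
  "monomial_sym \<mu> xs =
     (\<Sum>a | length a = length xs \<and> partition_of_tuple a = \<mu>. \<Prod>i<length xs. (xs ! i) ^ (a ! i))"

section \<open>Hall--Littlewood symmetric functions\<close>

definition hl_norm :: "real \<Rightarrow> nat multiset \<Rightarrow> real" where
  "hl_norm t \<mu> = (\<Prod>i\<in>set_mset \<mu>. real i ^ count \<mu> i * fact (count \<mu> i))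
                  * (\<Prod>k\<in>#\<mu>. inverse (1 - t ^ k))"

text \<open>The bilinear form for which the \<open>p\<^sub>\<mu>\<close> are orthogonal with squared norms \<open>hl_norm t \<mu>\<close>.\<close>

definition hl_inner :: "real \<Rightarrow> symfun \<Rightarrow> symfun \<Rightarrow> real" where
  "hl_inner t f g = (\<Sum>\<mu>\<in>Poly_Mapping.keys f.
     Poly_Mapping.lookup f \<mu> * Poly_Mapping.lookup g \<mu> * hl_norm t \<mu>)"

lemma hl_inner_power_sums:
  "hl_inner t (Poly_Mapping.single \<nu> 1) (Poly_Mapping.single \<mu> 1) =
     (if \<nu> = \<mu> then hl_norm t \<mu> else 0)"
  by (auto simp: hl_inner_def lookup_single when_def)

text \<open>
  Macdonald's characterization, at \<open>q = 0\<close>: \<open>P\<^sub>\<nu> = m\<^sub>\<nu> + \<Sum>\<^bsub>\<mu><\<nu>\<^esub> u\<^sub>\<mu> m\<^sub>\<mu>\<close> with respect to the dominance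
  order, and the \<open>P\<^sub>\<nu>\<close> are pairwise orthogonal. The expansion is an identity of symmetric
  functions, that is, of polynomial functions in any number of variables.
  The values outside \<open>partitions\<close> are irrelevant and set to \<open>0\<close> to make the family unique.
\<close>

definition hl_family :: "real \<Rightarrow> (nat multiset \<Rightarrow> symfun) \<Rightarrow> bool" where
  "hl_family t P \<longleftrightarrow>
     (\<forall>\<nu>\<in>partitions. P \<nu> \<in> symmetric_functions \<and>
        (\<exists>u. \<forall>xs. eval_sym (P \<nu>) xs = monomial_sym \<nu> xs
              + (\<Sum>\<mu> | \<mu> \<in> partitions \<and> strictly_dominated \<mu> \<nu>. u \<mu> * monomial_sym \<mu> xs))) \<and>
     (\<forall>\<nu>\<in>partitions. \<forall>\<mu>\<in>partitions. \<nu> \<noteq> \<mu> \<longrightarrow> hl_inner t (P \<nu>) (P \<mu>) = 0) \<and>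
     (\<forall>\<nu>. \<nu> \<notin> partitions \<longrightarrow> P \<nu> = 0)"

definition hl_P :: "real \<Rightarrow> nat multiset \<Rightarrow> symfun" where
  "hl_P t = (THE P. hl_family t P)"

definition hl_Q :: "real \<Rightarrow> nat multiset \<Rightarrow> symfun" where
  "hl_Q t \<nu> =
     Poly_Mapping.map (\<lambda>c. c / hl_inner t (hl_P t \<nu>) (hl_P t \<nu>)) (hl_P t \<nu>)"

text \<open>The specialization usually denoted \<open>Pl\<^sub>1\<close>.\<close>

definition plancherel :: "real \<Rightarrow> symfun \<Rightarrow> real" where
  "plancherel t = specialize (\<lambda>k. if k = 1 then 1 / (1 - t) else 0)"

section \<open>The randomized RSK insertion\<close>

text \<open>
  \<open>\<Lambda> m i\<close> is the position of the \<open>i\<close>-th particle of level \<open>m\<close>, for \<open>1 \<le> i \<le> m \<le> N\<close>; entries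
  outside this range are never touched and stay \<open>0\<close>.
\<close>

type_synonym particles = "nat \<Rightarrow> nat \<Rightarrow> nat"

definition blocked :: "particles \<Rightarrow> nat \<Rightarrow> nat \<Rightarrow> bool" where
  "blocked \<Lambda> m i \<longleftrightarrow> 2 \<le> i \<and> \<Lambda> m i = \<Lambda> (m - 1) (i - 1)"

definition move :: "particles \<Rightarrow> nat \<Rightarrow> nat \<Rightarrow> particles" where
  "move \<Lambda> m i = \<Lambda>(m := (\<Lambda> m)(i := Suc (\<Lambda> m i)))"

text \<open>The free particle of level \<open>m\<close> with the largest index not exceeding \<open>i\<close>
  (the first particle of a level is always free).\<close>

definition last_free :: "particles \<Rightarrow> nat \<Rightarrow> nat \<Rightarrow> nat" where
  "last_free \<Lambda> m i = Max {k \<in> {1..i}. \<not> blocked \<Lambda> m k}"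

definition cluster_size :: "particles \<Rightarrow> nat \<Rightarrow> nat \<Rightarrow> nat" where
  "cluster_size \<Lambda> m x = card {j \<in> {1..m}. \<Lambda> m j = x}"

text \<open>
  \<open>next_mover t \<Lambda> m i\<close> is the random index of the particle moving at level \<open>m + 1\<close>, where \<open>\<Lambda>\<close> is
  the configuration right after particle \<open>i\<close> of level \<open>m\<close> has moved from \<open>x\<close> to \<open>x + 1\<close>.
  Freeness of a particle \<open>k \<le> i\<close> of level \<open>m + 1\<close> does not depend on whether it is
  evaluated before or after that move.
\<close>

definition next_mover :: "real \<Rightarrow> particles \<Rightarrow> nat \<Rightarrow> nat \<Rightarrow> nat pmf" where
  "next_mover t \<Lambda> m i =
     (let x = \<Lambda> m i - 1;
          D = cluster_size \<Lambda> m x;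
          U = cluster_size \<Lambda> (m + 1) x;
          r = (if U = D then (1 - t) / (1 - t ^ (D + 1)) else 1 - t)
      in if \<Lambda> (m + 1) i = x then return_pmf i
         else map_pmf (\<lambda>b. if b then last_free \<Lambda> (m + 1) i else i + 1) (bernoulli_pmf r))"

text \<open>Propagation through \<open>d\<close> further levels, after particle \<open>i\<close> of level \<open>m\<close> has moved.\<close>

primrec propagate :: "real \<Rightarrow> nat \<Rightarrow> nat \<Rightarrow> nat \<Rightarrow> particles \<Rightarrow> particles pmf" where
  "propagate t 0 m i \<Lambda> = return_pmf \<Lambda>"
| "propagate t (Suc d) m i \<Lambda> =
     bind_pmf (next_mover t \<Lambda> m i) (\<lambda>j. propagate t d (m + 1) j (move \<Lambda> (m + 1) j))"

definition insert_letter :: "real \<Rightarrow> nat \<Rightarrow> nat \<Rightarrow> particles \<Rightarrow> particles pmf" where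
  "insert_letter t N \<xi> \<Lambda> =
     (let i = last_free \<Lambda> \<xi> \<xi> in propagate t (N - \<xi>) \<xi> i (move \<Lambda> \<xi> i))"

primrec insert_word :: "real \<Rightarrow> nat \<Rightarrow> nat list \<Rightarrow> particles \<Rightarrow> particles pmf" where
  "insert_word t N [] \<Lambda> = return_pmf \<Lambda>"
| "insert_word t N (\<xi> # w) \<Lambda> = bind_pmf (insert_letter t N \<xi> \<Lambda>) (insert_word t N w)"

definition rsk :: "real \<Rightarrow> nat \<Rightarrow> nat list \<Rightarrow> particles pmf" where
  "rsk t N w = insert_word t N w (\<lambda>m i. 0)"

definition top_row :: "nat \<Rightarrow> particles \<Rightarrow> nat list" where
  "top_row N \<Lambda> = map (\<Lambda> N) [1..<Suc N]"

end

theory Submission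
  imports
    Defs
    "HOL-Computational_Algebra.Formal_Power_Series"
    "HOL-Combinatorics.Permutations"
begin

text \<open>
  The Hall--Littlewood functions are built from Macdonald's branching coefficients \<open>\<phi>\<close> and \<open>\<psi>\<close> of
  horizontal strips (\<open>cols \<mu> v\<close> is the length of the \<open>v\<close>-th column): adding one variable to \<open>Q\<^sub>\<rho>\<close>
  sums over the strips \<open>\<rho>/\<mu>\<close> with weight \<open>\<phi>\<close>, and to \<open>P\<^sub>\<rho>\<close> with weight \<open>\<psi>\<close>. A skew Cauchy identity for
  \<open>\<phi>\<close> and \<open>\<psi>\<close>, obtained by peeling off columns, gives symmetry and the Cauchy identity. Comparing the
  Cauchy kernel with its expansion in power sums shows that these functions are polynomials in the
  power sums and orthogonal; as they are also triangular in the monomial functions, they are the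
  \<open>P\<^sub>\<rho>\<close> and \<open>Q\<^sub>\<rho>\<close> of the theorem. Extracting the linear coefficient of one variable shows that
  \<open>n! P\<^sub>\<rho>(Pl\<^sub>1)\<close> is the sum over \<open>\<kappa>\<close>, one box smaller than \<open>\<rho>\<close>, of \<open>\<psi>(\<rho>, \<kappa>)/(1 - t)\<close> times
  \<open>(n - 1)! P\<^sub>\<kappa>(Pl\<^sub>1)\<close>.

  After \<open>n\<close> letters, the array \<open>\<Lambda>\<close> with top row \<open>\<rho>\<close> has probability \<open>n! P\<^sub>\<rho>(Pl\<^sub>1)\<close> times the product over
  the levels \<open>m\<close> of \<open>\<phi>\<close> for the rows \<open>m\<close> and \<open>m - 1\<close> and the power of \<open>\<alpha>\<^sub>m\<close> given by their difference in
  size. This is shown by induction on \<open>n\<close>, updating the levels from the bottom: an identity for two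
  neighbouring levels says that the weighted moves at level \<open>m\<close>, together with a letter starting at
  \<open>m + 1\<close>, produce the weighted moves at level \<open>m + 1\<close>; at the top level the recursion for
  \<open>n! P\<^sub>\<rho>(Pl\<^sub>1)\<close> applies. Summing over the lower levels turns the product of the \<open>\<phi>\<close> into \<open>Q\<^sub>\<rho>(\<alpha>)\<close>.
\<close>

section \<open>Horizontal strips\<close>

text \<open>The branching definition hides symmetry, and the scalar product is defined only on
  polynomials in the power sums. This forces the order of the argument: up to the Cauchy identity
  \<open>hlF\<close> and \<open>hlG\<close> are mere functions of a list of variables. Their linear
  independence comes from a leading-row argument that needs no symmetry. Finite combinations of
  point evaluations then read each function off the kernel, whose other side visibly consists of
  power sums. As \<open>hl_P\<close> is a definite description, existence of the family is not
  enough; uniqueness is a Gram--Schmidt argument along the dominance order. For the insertion the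
  obstacle is that half-updated arrays need weights of their own. The mismatch between the new rows
  up to level \<open>m\<close> and the old rows above is weighed by \<open>psi / (1 - t)\<close> of
  the box just added at level \<open>m\<close>. The jump rates are exactly those for which such
  weights pass to the next level: a jump, or a letter starting there, accounts for a share
  \<open>1 - t\<close> of the new weight, and a refused jump for \<open>t\<close> times a factor
  with multiplicities lowered by one.\<close>

definition Par :: "nat \<Rightarrow> nat multiset set" where
  "Par n = {\<mu> \<in> partitions. sum_mset \<mu> = n}"

definition cols :: "nat multiset \<Rightarrow> nat \<Rightarrow> nat" where
  "cols \<mu> v = size (filter_mset (\<lambda>k. v \<le> k) \<mu>)"

text \<open>Column form of interlacing: each column of the skew shape has at most one box. It suits
  multisets, whose rows carry no index. Columns are numbered from 1.\<close>

definition hstrip :: "nat multiset \<Rightarrow> nat multiset \<Rightarrow> bool" where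
  "hstrip \<rho> \<mu> \<longleftrightarrow> (\<forall>v\<ge>1. cols \<mu> v \<le> cols \<rho> v \<and> cols \<rho> v \<le> Suc (cols \<mu> v))"

text \<open>If the strip has \<theta>(v) boxes in column v, then
  \<open>count \<rho> v - count \<mu> v\<close> is \<theta>(v) - \<theta>(v+1). So the test
  \<open>a = Suc b\<close> selects in \<open>phi\<close> the columns with a box whose right
  neighbour has none, and in \<open>psi\<close>, with the roles exchanged, the empty columns
  followed by a box: Macdonald's two index sets.\<close>

definition mfac :: "real \<Rightarrow> nat \<Rightarrow> nat \<Rightarrow> real" where
  "mfac t a b = (if a = Suc b then 1 - t ^ a else 1)"

definition phi :: "real \<Rightarrow> nat multiset \<Rightarrow> nat multiset \<Rightarrow> real" where
  "phi t \<rho> \<mu> =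
    (if hstrip \<rho> \<mu> then \<Prod>v\<in>set_mset \<rho>. mfac t (count \<rho> v) (count \<mu> v) else 0)"

definition psi :: "real \<Rightarrow> nat multiset \<Rightarrow> nat multiset \<Rightarrow> real" where
  "psi t \<rho> \<mu> =
    (if hstrip \<rho> \<mu> then \<Prod>v\<in>set_mset \<mu>. mfac t (count \<mu> v) (count \<rho> v) else 0)"

lemma mfac_0 [simp]: "mfac t 0 b = 1"
  by (simp add: mfac_def)

lemma mfac_same [simp]: "mfac t a a = 1"
  by (simp add: mfac_def)

lemma mfac_Suc [simp]: "mfac t (Suc a) a = 1 - t ^ Suc a" "mfac t a (Suc a) = 1"
  by (simp_all add: mfac_def)

text \<open>Values that are not parts contribute 1, so products for different pairs can be written
  over one index set and compared factor by factor.\<close>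

lemma phi_superset:
  assumes "finite S" "set_mset \<rho> \<subseteq> S"
  shows "phi t \<rho> \<mu> = (if hstrip \<rho> \<mu> then \<Prod>v\<in>S. mfac t (count \<rho> v) (count \<mu> v) else 0)"
proof -
  have "(\<Prod>v\<in>set_mset \<rho>. mfac t (count \<rho> v) (count \<mu> v)) = (\<Prod>v\<in>S. mfac t (count \<rho> v) (count \<mu> v))"
    by (rule prod.mono_neutral_left) (use assms in \<open>auto simp: not_in_iff\<close>)
  then show ?thesis by (simp add: phi_def)
qed

lemma psi_superset:
  assumes "finite S" "set_mset \<mu> \<subseteq> S"
  shows "psi t \<rho> \<mu> = (if hstrip \<rho> \<mu> then \<Prod>v\<in>S. mfac t (count \<mu> v) (count \<rho> v) else 0)"
proof -
  have "(\<Prod>v\<in>set_mset \<mu>. mfac t (count \<mu> v) (count \<rho> v)) = (\<Prod>v\<in>S. mfac t (count \<mu> v) (count \<rho> v))"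
    by (rule prod.mono_neutral_left) (use assms in \<open>auto simp: not_in_iff\<close>)
  then show ?thesis by (simp add: psi_def)
qed

lemma cols_Suc: "cols \<mu> v = cols \<mu> (Suc v) + count \<mu> v"
proof (induction \<mu>)
  case empty
  then show ?case by (simp add: cols_def)
next
  case (add x \<mu>)
  then show ?case by (auto simp: cols_def)
qed

lemma cols_1: "\<mu> \<in> partitions \<Longrightarrow> cols \<mu> (Suc 0) = size \<mu>"
  by (induction \<mu>) (auto simp: cols_def partitions_def)

lemma cols_empty [simp]: "cols {#} v = 0"
  by (simp add: cols_def)

lemma cols_antimono: "v \<le> w \<Longrightarrow> cols \<mu> w \<le> cols \<mu> v"
  by (induction \<mu>) (auto simp: cols_def)

lemma cols_eq_0: "cols \<mu> v = 0 \<longleftrightarrow> (\<forall>k\<in>#\<mu>. k < v)"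
  by (auto simp: cols_def filter_mset_eq_conv)

lemma partitions_eqI:
  assumes "\<mu> \<in> partitions" "\<nu> \<in> partitions" "\<And>v. 1 \<le> v \<Longrightarrow> cols \<mu> v = cols \<nu> v"
  shows "\<mu> = \<nu>"
proof (rule multiset_eqI)
  fix v
  show "count \<mu> v = count \<nu> v"
  proof (cases "v = 0")
    case True
    then show ?thesis using assms(1,2) by (simp add: partitions_def not_in_iff)
  next
    case False
    then show ?thesis
      using assms(3)[of v] assms(3)[of "Suc v"] cols_Suc[of \<mu> v] cols_Suc[of \<nu> v] by simp
  qed
qed

text \<open>Counts the boxes of the diagram by columns instead of rows.\<close>

lemma sum_mset_cols:
  assumes "\<And>k. k \<in># \<mu> \<Longrightarrow> k \<le> B"
  shows "sum_mset \<mu> = (\<Sum>v=1..B. cols \<mu> v)"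
  using assms
proof (induction \<mu>)
  case empty
  then show ?case by simp
next
  case (add x \<mu>)
  have "cols (add_mset x \<mu>) v = cols \<mu> v + (if v \<le> x then 1 else 0)" for v
    by (simp add: cols_def)
  moreover have "(\<Sum>v=1..B. if v \<le> x then 1 else 0) = (\<Sum>v=1..x. 1::nat)"
    by (rule sum.mono_neutral_cong_right) (use add.prems in auto)
  ultimately show ?case
    using add by (simp add: sum.distrib)
qed

lemma mset_bound: obtains B :: nat where "\<And>k. k \<in># \<mu> \<Longrightarrow> k \<le> B" "\<And>k. k \<in># \<nu> \<Longrightarrow> k \<le> B"
proof -
  obtain B where "\<forall>k\<in>set_mset (\<mu> + \<nu>). k \<le> B"
    using finite_nat_set_iff_bounded_le[of "set_mset (\<mu> + \<nu>)"] by auto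
  then show ?thesis by (intro that[of B]) auto
qed

lemma sum_mset_bound:
  obtains B where "\<And>k. k \<in># \<mu> \<Longrightarrow> k \<le> B" "\<And>k. k \<in># \<nu> \<Longrightarrow> k \<le> B"
    "sum_mset \<mu> = (\<Sum>v=1..B. cols \<mu> v)" "sum_mset \<nu> = (\<Sum>v=1..B. cols \<nu> v)"
proof -
  obtain B where B: "\<And>k. k \<in># \<mu> \<Longrightarrow> k \<le> B" "\<And>k. k \<in># \<nu> \<Longrightarrow> k \<le> B"
    using mset_bound[of \<mu> \<nu>] by blast
  show ?thesis
    by (rule that[OF B sum_mset_cols[of \<mu> B] sum_mset_cols[of \<nu> B]]) (use B in blast)+
qed

lemma hstrip_sum_le: assumes "hstrip \<rho> \<mu>" shows "sum_mset \<mu> \<le> sum_mset \<rho>"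
proof -
  obtain B where "sum_mset \<mu> = (\<Sum>v=1..B. cols \<mu> v)" "sum_mset \<rho> = (\<Sum>v=1..B. cols \<rho> v)"
    by (rule sum_mset_bound[of \<mu> \<rho>]) (rule that)
  moreover have "(\<Sum>v=1..B. cols \<mu> v) \<le> (\<Sum>v=1..B. cols \<rho> v)"
    using assms by (intro sum_mono) (simp add: hstrip_def)
  ultimately show ?thesis by simp
qed

lemma hstrip_refl [simp]: "hstrip \<rho> \<rho>"
  by (simp add: hstrip_def)

lemma hstrip_eqI:
  assumes "hstrip \<rho> \<mu>" "\<rho> \<in> partitions" "\<mu> \<in> partitions" "sum_mset \<rho> = sum_mset \<mu>"
  shows "\<rho> = \<mu>"
proof (rule partitions_eqI[OF assms(2,3)])
  fix v :: nat assume v: "1 \<le> v"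
  obtain B where B: "\<And>k. k \<in># \<mu> \<Longrightarrow> k \<le> B" "\<And>k. k \<in># \<rho> \<Longrightarrow> k \<le> B"
    "sum_mset \<mu> = (\<Sum>v=1..B. cols \<mu> v)" "sum_mset \<rho> = (\<Sum>v=1..B. cols \<rho> v)"
    by (rule sum_mset_bound[of \<mu> \<rho>]) (rule that)
  show "cols \<rho> v = cols \<mu> v"
  proof (cases "v \<le> B")
    case True
    \<comment> \<open>Natural subtraction is exact since no column of \<open>\<mu>\<close> exceeds
      that of \<open>\<rho>\<close>; nonnegative differences with sum 0 all vanish.\<close>
    have "(\<Sum>v=1..B. cols \<rho> v - cols \<mu> v) = 0"
      using B assms by (subst sum_subtractf_nat) (auto simp: hstrip_def)
    then have "cols \<rho> v \<le> cols \<mu> v" using True v by simp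
    then show ?thesis using assms(1) v by (auto simp: hstrip_def intro: antisym)
  next
    case False
    then have "cols \<rho> v = 0" "cols \<mu> v = 0" using B(1,2) by (force simp: cols_eq_0)+
    then show ?thesis by simp
  qed
qed

lemma phi_self: "phi t \<rho> \<rho> = 1" and psi_self: "psi t \<rho> \<rho> = 1"
  by (simp_all add: phi_def psi_def)

section \<open>Finiteness of the sets of partitions of bounded size\<close>

lemma empty_partition [simp]: "{#} \<in> partitions"
  by (simp add: partitions_def)

lemma partitions_size_le: "\<mu> \<in> partitions \<Longrightarrow> size \<mu> \<le> sum_mset \<mu>"
  by (induction \<mu>) (auto simp: partitions_def)

lemma finite_bounded_mset: "finite {\<mu> :: nat multiset. set_mset \<mu> \<subseteq> {..n} \<and> size \<mu> \<le> m}"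
proof -
  have "{\<mu> :: nat multiset. set_mset \<mu> \<subseteq> {..n} \<and> size \<mu> \<le> m} \<subseteq> mset ` {xs. set xs \<subseteq> {..n} \<and> length xs \<le> m}"
  proof
    fix \<mu> assume *: "\<mu> \<in> {\<mu> :: nat multiset. set_mset \<mu> \<subseteq> {..n} \<and> size \<mu> \<le> m}"
    obtain xs where "mset xs = \<mu>" using ex_mset by blast
    then show "\<mu> \<in> mset ` {xs. set xs \<subseteq> {..n} \<and> length xs \<le> m}" using * by auto
  qed
  then show ?thesis using finite_lists_length_le[of "{..n}" m] finite_subset by blast
qed

lemma finite_partitions_le: "finite {\<mu> \<in> partitions. sum_mset \<mu> \<le> n}"
proof (rule finite_subset[OF _ finite_bounded_mset[of n n]])
  show "{\<mu> \<in> partitions. sum_mset \<mu> \<le> n} \<subseteq> {\<mu>. set_mset \<mu> \<subseteq> {..n} \<and> size \<mu> \<le> n}"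
  proof
    fix \<mu> assume "\<mu> \<in> {\<mu> \<in> partitions. sum_mset \<mu> \<le> n}"
    then have *: "\<mu> \<in> partitions" "sum_mset \<mu> \<le> n" by auto
    have "k \<le> n" if "k \<in># \<mu>" for k
      using sum_mset.remove[OF that] *(2) by simp
    moreover have "size \<mu> \<le> n" using partitions_size_le[OF *(1)] *(2) by linarith
    ultimately show "\<mu> \<in> {\<mu>. set_mset \<mu> \<subseteq> {..n} \<and> size \<mu> \<le> n}" by auto
  qed
qed

lemma finite_Par [simp]: "finite (Par n)"
  by (rule finite_subset[OF _ finite_partitions_le[of n]]) (auto simp: Par_def)

lemma Par_0 [simp]: "Par 0 = {{#}}"
proof -
  have "\<mu> = {#}" if "\<mu> \<in> partitions" "sum_mset \<mu> = 0" for \<mu>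
    using partitions_size_le[OF that(1)] that(2) by simp
  then show ?thesis by (auto simp: Par_def)
qed

section \<open>Removing the first column\<close>

text \<open>Prepends a column of length \<open>l\<close>: every row grows by one, and the remaining
  \<open>l - size \<mu>\<close> rows become parts 1. Because of the truncated subtraction it is
  meant for \<open>size \<mu> \<le> l\<close>.\<close>

definition ext :: "nat \<Rightarrow> nat multiset \<Rightarrow> nat multiset" where
  "ext l \<mu> = image_mset Suc \<mu> + replicate_mset (l - size \<mu>) 1"

definition peel :: "nat multiset \<Rightarrow> nat multiset" where
  "peel \<mu> = image_mset (\<lambda>k. k - 1) (filter_mset (\<lambda>k. 2 \<le> k) \<mu>)"

lemma peel_partition: "peel \<mu> \<in> partitions"
  by (auto simp: peel_def partitions_def)

lemma size_peel_le: "size (peel \<mu>) \<le> size \<mu>"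
  by (simp add: peel_def size_filter_mset_lesseq)

lemma ext_partition: "ext l \<mu> \<in> partitions"
  by (auto simp: ext_def partitions_def)

lemma ext_peel: "\<mu> \<in> partitions \<Longrightarrow> ext (size \<mu>) (peel \<mu>) = \<mu>"
proof (induction \<mu>)
  case empty
  then show ?case by (simp add: ext_def peel_def)
next
  case (add x \<mu>)
  have "\<mu> \<in> partitions" "x \<noteq> 0" using add.prems by (auto simp: partitions_def)
  then show ?case
    using add.IH size_peel_le[of \<mu>] 
    by (cases "x = 1") (auto simp: ext_def peel_def Suc_diff_le)
qed

lemma peel_ext: "\<mu> \<in> partitions \<Longrightarrow> peel (ext l \<mu>) = \<mu>"
proof -
  assume "\<mu> \<in> partitions"
  then have "image_mset (\<lambda>k. k - 1) (filter_mset (\<lambda>k. 2 \<le> k) (image_mset Suc \<mu>)) = \<mu>"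
    by (induction \<mu>) (auto simp: partitions_def)
  then show ?thesis by (simp add: peel_def ext_def)
qed

lemma size_ext: "size \<mu> \<le> l \<Longrightarrow> size (ext l \<mu>) = l"
  by (simp add: ext_def)

lemma sum_ext: assumes "size \<mu> \<le> l" shows "sum_mset (ext l \<mu>) = sum_mset \<mu> + l"
proof -
  have "sum_mset (image_mset Suc \<mu>) = sum_mset \<mu> + size \<mu>"
    by (induction \<mu>) auto
  then show ?thesis using assms by (simp add: ext_def sum_mset_replicate_mset)
qed

lemma count_ext_Suc: "\<mu> \<in> partitions \<Longrightarrow> count (ext l \<mu>) (Suc v) = (if v = 0 then l - size \<mu> else count \<mu> v)"
proof -
  assume "\<mu> \<in> partitions"
  then have "count (image_mset Suc \<mu>) (Suc v) = (if v = 0 then 0 else count \<mu> v)"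
    by (induction \<mu>) (auto simp: partitions_def)
  then show ?thesis by (simp add: ext_def)
qed

lemma cols_image_Suc: "cols (image_mset Suc \<mu>) (Suc v) = cols \<mu> v"
  by (induction \<mu>) (auto simp: cols_def)

lemma cols_ext:
  assumes "\<mu> \<in> partitions" "size \<mu> \<le> l"
  shows "cols (ext l \<mu>) (Suc v) = (if v = 0 then l else cols \<mu> v)"
proof (cases "v = 0")
  case True
  then show ?thesis using assms cols_1[OF ext_partition[of l \<mu>]] by (simp add: size_ext)
next
  case False
  then have "cols (replicate_mset m 1) (Suc v) = 0" for m
    by (auto simp: cols_eq_0 in_replicate_mset)
  moreover have "cols (ext l \<mu>) (Suc v) =
      cols (image_mset Suc \<mu>) (Suc v) + cols (replicate_mset (l - size \<mu>) 1) (Suc v)"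
    by (simp add: ext_def cols_def)
  ultimately show ?thesis using False by (simp add: cols_image_Suc)
qed

text \<open>The new first column contributes its own condition on \<open>a\<close> and
  \<open>l\<close>; all other columns are the old ones shifted by one.\<close>

lemma hstrip_ext:
  assumes "\<rho> \<in> partitions" "\<mu> \<in> partitions" "size \<rho> \<le> l" "size \<mu> \<le> a"
  shows "hstrip (ext l \<rho>) (ext a \<mu>) \<longleftrightarrow> a \<le> l \<and> l \<le> Suc a \<and> hstrip \<rho> \<mu>"
proof -
  have *: "(\<forall>v\<ge>1. P v) \<longleftrightarrow> P (Suc 0) \<and> (\<forall>v\<ge>1. P (Suc v))" for P
  proof safe
    fix v :: nat assume "P (Suc 0)" "\<forall>v\<ge>1. P (Suc v)" "1 \<le> v"
    then show "P v" by (cases v; cases "v - 1") auto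
  qed auto
  have "cols (ext a \<mu>) (Suc v) = cols \<mu> v" "cols (ext l \<rho>) (Suc v) = cols \<rho> v" if "1 \<le> v" for v
    using that assms by (simp_all add: cols_ext)
  moreover have "cols (ext a \<mu>) (Suc 0) = a" "cols (ext l \<rho>) (Suc 0) = l"
    using assms by (simp_all add: cols_ext)
  ultimately show ?thesis
    unfolding hstrip_def by (subst *) auto
qed

text \<open>Only the parts 1 are new, with multiplicities \<open>l - size \<rho>\<close> and
  \<open>a - size \<mu>\<close>. All other parts are old ones raised by one, with unchanged
  multiplicities.\<close>

lemma prod_mfac_ext:
  assumes "\<rho> \<in> partitions" "\<mu> \<in> partitions"
  shows "(\<Prod>v\<in>set_mset (ext l \<rho>). mfac t (count (ext l \<rho>) v) (count (ext a \<mu>) v)) =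
     mfac t (l - size \<rho>) (a - size \<mu>) * (\<Prod>v\<in>set_mset \<rho>. mfac t (count \<rho> v) (count \<mu> v))"
    (is "?L = _")
proof -
  have "?L = (\<Prod>v\<in>insert (Suc 0) (Suc ` set_mset \<rho>). mfac t (count (ext l \<rho>) v) (count (ext a \<mu>) v))"
  proof (rule prod.mono_neutral_left)
    show "\<forall>v\<in>insert (Suc 0) (Suc ` set_mset \<rho>) - set_mset (ext l \<rho>).
        mfac t (count (ext l \<rho>) v) (count (ext a \<mu>) v) = 1"
      by (metis DiffD2 mfac_0 not_in_iff)
  qed (auto simp: ext_def split: if_splits)
  also have "\<dots> = mfac t (l - size \<rho>) (a - size \<mu>) *
      (\<Prod>v\<in>Suc ` set_mset \<rho>. mfac t (count (ext l \<rho>) v) (count (ext a \<mu>) v))"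
    using assms(1)
    by (subst prod.insert) (auto simp: count_ext_Suc[OF assms(1)] count_ext_Suc[OF assms(2)] partitions_def)
  also have "(\<Prod>v\<in>Suc ` set_mset \<rho>. mfac t (count (ext l \<rho>) v) (count (ext a \<mu>) v)) =
      (\<Prod>v\<in>set_mset \<rho>. mfac t (count \<rho> v) (count \<mu> v))"
    using assms(1)
    by (subst prod.reindex)
       (auto simp: count_ext_Suc[OF assms(1)] count_ext_Suc[OF assms(2)] partitions_def intro!: prod.cong)
  finally show ?thesis .
qed

lemma phi_ext:
  assumes "\<rho> \<in> partitions" "\<mu> \<in> partitions" "size \<rho> \<le> l" "size \<mu> \<le> a"
  shows "phi t (ext l \<rho>) (ext a \<mu>) =
    (if a \<le> l \<and> l \<le> Suc a then mfac t (l - size \<rho>) (a - size \<mu>) * phi t \<rho> \<mu> else 0)"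
  using prod_mfac_ext[OF assms(1,2)] by (simp add: phi_def hstrip_ext assms)

lemma psi_ext:
  assumes "\<rho> \<in> partitions" "\<mu> \<in> partitions" "size \<rho> \<le> l" "size \<mu> \<le> a"
  shows "psi t (ext l \<rho>) (ext a \<mu>) =
    (if a \<le> l \<and> l \<le> Suc a then mfac t (a - size \<mu>) (l - size \<rho>) * psi t \<rho> \<mu> else 0)"
  using prod_mfac_ext[OF assms(2,1)] by (simp add: psi_def hstrip_ext assms)

lemma sum_peel: "\<mu> \<in> partitions \<Longrightarrow> sum_mset (peel \<mu>) + size \<mu> = sum_mset \<mu>"
  using sum_ext[OF size_peel_le[of \<mu>]] ext_peel[of \<mu>] by simp

text \<open>Replaces a sum over partitions with exactly \<open>l\<close> rows by one over what is
  left after deleting the first column, where any number of rows up to \<open>l\<close> may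
  occur.\<close>

lemma partitions_by_columns:
  "bij_betw (ext l) {\<mu> \<in> partitions. size \<mu> \<le> l \<and> sum_mset \<mu> + l = n}
     {\<mu> \<in> partitions. size \<mu> = l \<and> sum_mset \<mu> = n}" (is "bij_betw _ ?S ?T")
proof (rule bij_betw_byWitness[where f' = peel])
  show "\<forall>\<mu>\<in>?S. peel (ext l \<mu>) = \<mu>"
    using peel_ext by blast
  show "\<forall>\<mu>\<in>?T. ext l (peel \<mu>) = \<mu>"
    using ext_peel by blast
  show "ext l ` ?S \<subseteq> ?T"
  proof (rule image_subsetI)
    fix \<mu> assume "\<mu> \<in> ?S"
    then show "ext l \<mu> \<in> ?T" using ext_partition[of l \<mu>] size_ext[of \<mu> l] sum_ext[of \<mu> l] by simp
  qed
  show "peel ` ?T \<subseteq> ?S"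
  proof (rule image_subsetI)
    fix \<mu> assume "\<mu> \<in> ?T"
    then show "peel \<mu> \<in> ?S"
      using peel_partition[of \<mu>] size_peel_le[of \<mu>] sum_peel[of \<mu>] by simp
  qed
qed

section \<open>The skew Cauchy identity\<close>

text \<open>The exponent records the size of the intermediate partition; \<open>l\<close>, its
  number of rows, is the state that connects it to a column prepended later.\<close>

definition upper :: "real \<Rightarrow> nat multiset \<Rightarrow> nat multiset \<Rightarrow> nat \<Rightarrow> real fps" where
  "upper t \<mu> \<nu> l =
    Abs_fps (\<lambda>n. \<Sum>\<rho> | \<rho> \<in> partitions \<and> size \<rho> = l \<and> sum_mset \<rho> = n. phi t \<rho> \<mu> * psi t \<rho> \<nu>)"

text \<open>The exponent is |\<mu>| + |\<nu>| - |\<kappa>|. In two variables the terms above carry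
  x^(|\<rho>|-|\<mu>|) y^(|\<rho>|-|\<nu>|) and those below x^(|\<nu>|-|\<kappa>|)
  y^(|\<mu>|-|\<kappa>|); up to the common factor x^(-|\<mu>|) y^(-|\<nu>|) these are powers of x y
  with exponents |\<rho>| and |\<mu>| + |\<nu>| - |\<kappa>|, so one series variable
  suffices.\<close>

definition lower :: "real \<Rightarrow> nat multiset \<Rightarrow> nat multiset \<Rightarrow> nat \<Rightarrow> real fps" where
  "lower t \<mu> \<nu> l =
    Abs_fps (\<lambda>m. \<Sum>\<kappa> | \<kappa> \<in> partitions \<and> size \<kappa> = l \<and> sum_mset \<kappa> + m = sum_mset \<mu> + sum_mset \<nu>.
      psi t \<mu> \<kappa> * phi t \<nu> \<kappa>)"

lemma finite_sized_partitions [simp]: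
  "finite {\<kappa> \<in> partitions. size \<kappa> = l \<and> sum_mset \<kappa> + m = n}"
  "finite {\<kappa> \<in> partitions. size \<kappa> \<le> l \<and> sum_mset \<kappa> + m = n}"
  "finite {\<kappa> \<in> partitions. size \<kappa> = l \<and> sum_mset \<kappa> = n}"
  by (rule finite_subset[OF _ finite_partitions_le[of n]]; auto)+

lemma sum_by_size:
  fixes g :: "nat multiset \<Rightarrow> 'a :: comm_monoid_add"
  shows "(\<Sum>\<kappa> | \<kappa> \<in> partitions \<and> size \<kappa> \<le> l \<and> sum_mset \<kappa> + m = n. g \<kappa>) =
    (\<Sum>k\<le>l. \<Sum>\<kappa> | \<kappa> \<in> partitions \<and> size \<kappa> = k \<and> sum_mset \<kappa> + m = n. g \<kappa>)"
    (is "sum g ?S = _")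
proof -
  have "sum g ?S = (\<Sum>k\<le>l. sum g {\<kappa> \<in> ?S. size \<kappa> = k})"
    by (rule sum.group[symmetric]) auto
  also have "\<dots> = (\<Sum>k\<le>l. \<Sum>\<kappa> | \<kappa> \<in> partitions \<and> size \<kappa> = k \<and> sum_mset \<kappa> + m = n. g \<kappa>)"
    by (intro sum.cong) auto
  finally show ?thesis .
qed

lemma sum_ext_partitions:
  fixes g :: "nat multiset \<Rightarrow> 'a :: comm_monoid_add"
  shows "(\<Sum>\<rho> | \<rho> \<in> partitions \<and> size \<rho> = l \<and> sum_mset \<rho> = n. g \<rho>) =
    (\<Sum>k\<le>l. \<Sum>\<kappa> | \<kappa> \<in> partitions \<and> size \<kappa> = k \<and> sum_mset \<kappa> + l = n. g (ext l \<kappa>))"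
  unfolding sum_by_size[symmetric]
  by (rule sum.reindex_bij_betw[OF partitions_by_columns, symmetric])

text \<open>One step of the transfer matrix: with first columns of lengths \<open>a\<close>,
  \<open>b\<close>, \<open>l\<close>, the sum runs over the row number \<open>k\<close> of the rest,
  and the only new weights are those of the parts 1.\<close>

lemma upper_ext:
  assumes "\<mu> \<in> partitions" "\<nu> \<in> partitions" "size \<mu> \<le> a" "size \<nu> \<le> b"
  shows "upper t (ext a \<mu>) (ext b \<nu>) l =
    (if a \<le> l \<and> l \<le> Suc a \<and> b \<le> l \<and> l \<le> Suc b
     then fps_X ^ l * (\<Sum>k\<le>l. fps_const (mfac t (l - k) (a - size \<mu>) * mfac t (b - size \<nu>) (l - k)) * upper t \<mu> \<nu> k)
     else 0)"
proof (rule fps_ext)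
  fix n
  have "fps_nth (upper t (ext a \<mu>) (ext b \<nu>) l) n =
    (\<Sum>k\<le>l. \<Sum>\<kappa> | \<kappa> \<in> partitions \<and> size \<kappa> = k \<and> sum_mset \<kappa> + l = n.
      phi t (ext l \<kappa>) (ext a \<mu>) * psi t (ext l \<kappa>) (ext b \<nu>))"
    by (simp add: upper_def sum_ext_partitions)
  also have "\<dots> = (\<Sum>k\<le>l. \<Sum>\<kappa> | \<kappa> \<in> partitions \<and> size \<kappa> = k \<and> sum_mset \<kappa> + l = n.
      (if a \<le> l \<and> l \<le> Suc a \<and> b \<le> l \<and> l \<le> Suc b then
      (mfac t (l - k) (a - size \<mu>) * mfac t (b - size \<nu>) (l - k)) * (phi t \<kappa> \<mu> * psi t \<kappa> \<nu>) else 0))"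
    using assms by (intro sum.cong refl) (auto simp: phi_ext psi_ext)
  also have "\<dots> = fps_nth (if a \<le> l \<and> l \<le> Suc a \<and> b \<le> l \<and> l \<le> Suc b
     then fps_X ^ l * (\<Sum>k\<le>l. fps_const (mfac t (l - k) (a - size \<mu>) * mfac t (b - size \<nu>) (l - k)) * upper t \<mu> \<nu> k)
     else 0) n"
  proof (cases "n < l")
    case True
    then show ?thesis by (auto simp: fps_X_power_mult_nth intro!: sum.neutral)
  next
    case False
    then have "sum_mset \<kappa> + l = n \<longleftrightarrow> sum_mset \<kappa> = n - l" for \<kappa> :: "nat multiset" by auto
    then show ?thesis using False
      by (auto simp: fps_X_power_mult_nth fps_sum_nth upper_def sum_distrib_left)
  qed
  finally show "fps_nth (upper t (ext a \<mu>) (ext b \<nu>) l) n = \<dots>" .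
qed

text \<open>As for \<open>upper\<close>, except that the new columns raise the complementary
  exponent by \<open>a + b - l\<close>.\<close>

lemma lower_ext:
  assumes "\<mu> \<in> partitions" "\<nu> \<in> partitions" "size \<mu> \<le> a" "size \<nu> \<le> b"
  shows "lower t (ext a \<mu>) (ext b \<nu>) l =
    (if l \<le> a \<and> a \<le> Suc l \<and> l \<le> b \<and> b \<le> Suc l
     then fps_X ^ (a + b - l) * (\<Sum>k\<le>l. fps_const (mfac t (l - k) (a - size \<mu>) * mfac t (b - size \<nu>) (l - k)) * lower t \<mu> \<nu> k)
     else 0)"
proof (rule fps_ext)
  fix m
  let ?s = "sum_mset \<mu> + sum_mset \<nu>"
  let ?c = "l \<le> a \<and> a \<le> Suc l \<and> l \<le> b \<and> b \<le> Suc l"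
  have S: "(\<Sum>\<kappa> | \<kappa> \<in> partitions \<and> size \<kappa> = l \<and> sum_mset \<kappa> + m = N. g \<kappa>) =
    (\<Sum>k\<le>l. \<Sum>\<kappa> | \<kappa> \<in> partitions \<and> size \<kappa> = k \<and> sum_mset \<kappa> + l + m = N. g (ext l \<kappa>))"
    for g :: "nat multiset \<Rightarrow> real" and N
  proof (cases "m \<le> N")
    case True
    then have "sum_mset \<kappa> + m = N \<longleftrightarrow> sum_mset \<kappa> = N - m"
      "sum_mset \<kappa> + l + m = N \<longleftrightarrow> sum_mset \<kappa> + l = N - m" for \<kappa> :: "nat multiset" by auto
    then show ?thesis by (simp add: sum_ext_partitions)
  next
    case False
    then have "sum_mset \<kappa> + m \<noteq> N" "sum_mset \<kappa> + l + m \<noteq> N" for \<kappa> :: "nat multiset" by auto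
    then show ?thesis by simp
  qed
  have "fps_nth (lower t (ext a \<mu>) (ext b \<nu>) l) m =
    (\<Sum>k\<le>l. \<Sum>\<kappa> | \<kappa> \<in> partitions \<and> size \<kappa> = k \<and> sum_mset \<kappa> + l + m = ?s + a + b.
      psi t (ext a \<mu>) (ext l \<kappa>) * phi t (ext b \<nu>) (ext l \<kappa>))"
  proof -
    have "sum_mset (ext a \<mu>) + sum_mset (ext b \<nu>) = ?s + a + b"
      by (simp add: sum_ext assms)
    then show ?thesis unfolding lower_def fps_nth_Abs_fps by (simp only: S)
  qed
  also have "\<dots> = (\<Sum>k\<le>l. \<Sum>\<kappa> | \<kappa> \<in> partitions \<and> size \<kappa> = k \<and> sum_mset \<kappa> + l + m = ?s + a + b.
      (if ?c then
      (mfac t (l - k) (a - size \<mu>) * mfac t (b - size \<nu>) (l - k)) * (psi t \<mu> \<kappa> * phi t \<nu> \<kappa>) else 0))"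
    using assms by (intro sum.cong refl) (auto simp: phi_ext psi_ext)
  also have "\<dots> = fps_nth (if ?c
     then fps_X ^ (a + b - l) * (\<Sum>k\<le>l. fps_const (mfac t (l - k) (a - size \<mu>) * mfac t (b - size \<nu>) (l - k)) * lower t \<mu> \<nu> k)
     else 0) m"
  proof (cases ?c)
    case c: True
    show ?thesis
    proof (cases "m < a + b - l")
      case True
      \<comment> \<open>Here \<open>\<kappa>\<close> would be larger than \<open>\<mu>\<close> and
        \<open>\<nu>\<close> together, so no strip exists.\<close>
      have "psi t \<mu> \<kappa> = 0" if "sum_mset \<kappa> + l + m = ?s + a + b" for \<kappa>
        using hstrip_sum_le[of \<mu> \<kappa>] that True c by (auto simp: psi_def)
      then show ?thesis using True by (auto simp: fps_X_power_mult_nth intro!: sum.neutral)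
    next
      case False
      then have "sum_mset \<kappa> + l + m = ?s + a + b \<longleftrightarrow> sum_mset \<kappa> + (m - (a + b - l)) = ?s" for \<kappa> :: "nat multiset"
        using c by auto
      then show ?thesis using False c
        by (simp add: fps_X_power_mult_nth fps_sum_nth lower_def sum_distrib_left)
    qed
  qed (auto intro!: sum.neutral)
  finally show "fps_nth (lower t (ext a \<mu>) (ext b \<nu>) l) m = \<dots>" .
qed

lemma hstrip_size: 
  assumes "hstrip \<rho> \<mu>" "\<rho> \<in> partitions" "\<mu> \<in> partitions"
  shows "size \<mu> \<le> size \<rho>" "size \<rho> \<le> Suc (size \<mu>)"
  using assms cols_1[of \<rho>] cols_1[of \<mu>] by (auto simp: hstrip_def dest!: spec[of _ 1])

text \<open>A strip changes the number of rows by at most one. Hence at most two states are nonzero,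
  and likewise for \<open>lower\<close>.\<close>

lemma upper_eq_0:
  assumes "\<mu> \<in> partitions" "\<nu> \<in> partitions"
    and "\<not> (size \<mu> \<le> l \<and> l \<le> Suc (size \<mu>) \<and> size \<nu> \<le> l \<and> l \<le> Suc (size \<nu>))"
  shows "upper t \<mu> \<nu> l = 0"
  by (rule fps_ext) (use assms hstrip_size in \<open>fastforce simp: upper_def phi_def psi_def intro!: sum.neutral\<close>)

lemma lower_eq_0:
  assumes "\<mu> \<in> partitions" "\<nu> \<in> partitions"
    and "\<not> (l \<le> size \<mu> \<and> size \<mu> \<le> Suc l \<and> l \<le> size \<nu> \<and> size \<nu> \<le> Suc l)"
  shows "lower t \<mu> \<nu> l = 0"
  by (rule fps_ext) (use assms hstrip_size in \<open>fastforce simp: lower_def phi_def psi_def intro!: sum.neutral\<close>)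

text \<open>The number of rows of the intermediate partition is the state of a transfer matrix over the
  columns; the relation between the two state vectors is the Yang--Baxter relation of the
  underlying six-vertex model.\<close>

definition column_relation :: "real \<Rightarrow> nat multiset \<Rightarrow> nat multiset \<Rightarrow> bool" where
  "column_relation t \<mu> \<nu> \<longleftrightarrow>
    (let a = size \<mu>; b = size \<nu>; A = upper t \<mu> \<nu>; B = lower t \<mu> \<nu>; c = fps_const t;
         B' = (if a = 0 then 0 else B (a - 1))
     in (a = b \<longrightarrow> (1 - fps_X) * A a = (1 - fps_X) * B a + (1 - c) * B' \<and>
           (1 - fps_X) * A (Suc a) = (1 - c) * fps_X * B a + c * (1 - fps_X) * B') \<and>
        (a = Suc b \<longrightarrow> (1 - fps_X) * A a = (1 - c * fps_X) * B b) \<and>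
        (b = Suc a \<longrightarrow> (1 - fps_X) * A b = (1 - c * fps_X) * B a))"

lemma sum_atMost_single:
  fixes g :: "nat \<Rightarrow> 'a :: comm_monoid_add"
  assumes "\<And>k. k \<noteq> x \<Longrightarrow> g k = 0"
  shows "(\<Sum>k\<le>l. g k) = (if x \<le> l then g x else 0)"
proof -
  have "(\<Sum>k\<le>l. g k) = (\<Sum>k\<in>(if x \<le> l then {x} else {}). g k)"
    by (rule sum.mono_neutral_right) (use assms in \<open>auto split: if_splits\<close>)
  then show ?thesis by simp
qed

lemma sum_atMost_two:
  fixes g :: "nat \<Rightarrow> 'a :: comm_monoid_add"
  assumes "\<And>k. k \<noteq> x \<Longrightarrow> k \<noteq> Suc x \<Longrightarrow> g k = 0"
  shows "(\<Sum>k\<le>l. g k) = (if x \<le> l then g x else 0) + (if Suc x \<le> l then g (Suc x) else 0)"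
proof -
  have "(\<Sum>k\<le>l. g k) = (\<Sum>k\<in>(if x \<le> l then {x} else {}) \<union> (if Suc x \<le> l then {Suc x} else {}). g k)"
    by (rule sum.mono_neutral_right) (use assms in \<open>auto split: if_splits\<close>)
  also have "\<dots> = (if x \<le> l then g x else 0) + (if Suc x \<le> l then g (Suc x) else 0)"
    by (subst sum.union_disjoint) auto
  finally show ?thesis .
qed

text \<open>The algebra of adding a column when the row numbers agree. \<open>A0\<close>,
  \<open>A1\<close> are the upper states, \<open>B0\<close>, \<open>B1\<close> the lower ones,
  \<open>P\<close> a power of the series variable. The first two identities, with
  \<open>T = t ^ p\<close>, serve new columns of equal length; the third, with \<open>T\<close> a
  common \<open>mfac\<close> factor, serves lengths differing by one.\<close>

lemma transfer_identities:
  fixes A0 A1 B0 B1 X c T P :: "'a :: comm_ring_1"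
  assumes r1: "(1 - X) * A0 = (1 - X) * B0 + (1 - c) * B1"
    and r2: "(1 - X) * A1 = (1 - c) * X * B0 + c * (1 - X) * B1"
  shows "(1 - X) * (P * (A0 + (1 - T) * A1)) =
      (1 - X) * (P * (B0 + (1 - c * T) * B1)) + (1 - c) * (X * P * ((1 - T) * B0 + B1))"
    and "(1 - X) * (X * P * ((1 - c * T) * A0 + A1)) =
      (1 - c) * X * (P * (B0 + (1 - c * T) * B1)) + c * (1 - X) * (X * P * ((1 - T) * B0 + B1))"
    and "(1 - X) * (P * (T * A0 + T * A1)) = (1 - c * X) * (P * (T * B0 + T * B1))"
proof -
  have "(1 - X) * (P * (A0 + (1 - T) * A1)) = P * ((1 - X) * A0) + P * (1 - T) * ((1 - X) * A1)"
    by (simp add: algebra_simps)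
  then show "(1 - X) * (P * (A0 + (1 - T) * A1)) =
      (1 - X) * (P * (B0 + (1 - c * T) * B1)) + (1 - c) * (X * P * ((1 - T) * B0 + B1))"
    unfolding r1 r2 by (simp add: algebra_simps)
  have "(1 - X) * (X * P * ((1 - c * T) * A0 + A1)) =
      X * P * (1 - c * T) * ((1 - X) * A0) + X * P * ((1 - X) * A1)"
    by (simp add: algebra_simps)
  then show "(1 - X) * (X * P * ((1 - c * T) * A0 + A1)) =
      (1 - c) * X * (P * (B0 + (1 - c * T) * B1)) + c * (1 - X) * (X * P * ((1 - T) * B0 + B1))"
    unfolding r1 r2 by (simp add: algebra_simps)
  have "(1 - X) * (P * (T * A0 + T * A1)) = P * T * ((1 - X) * A0) + P * T * ((1 - X) * A1)"
    by (simp add: algebra_simps)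
  then show "(1 - X) * (P * (T * A0 + T * A1)) = (1 - c * X) * (P * (T * B0 + T * B1))"
    unfolding r1 r2 by (simp add: algebra_simps)
qed

text \<open>The same for row numbers differing by one, where each side has a single state and
  \<open>T\<close> is always a common factor.\<close>

lemma transfer_identities_single:
  fixes A0 B0 X c T P :: "'a :: comm_ring_1"
  assumes r: "(1 - X) * A0 = (1 - c * X) * B0"
  shows "(1 - X) * (P * (T * A0)) = (1 - X) * (P * (T * B0)) + (1 - c) * (X * P * (T * B0))"
    and "(1 - X) * (X * P * (T * A0)) = (1 - c) * X * (P * (T * B0)) + c * (1 - X) * (X * P * (T * B0))"
    and "(1 - X) * (P * (T * A0)) = (1 - c * X) * (P * (T * B0))"
proof -
  have *: "(1 - X) * (P * (T * A0)) = P * T * ((1 - X) * A0)" for P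
    by (simp add: algebra_simps)
  show "(1 - X) * (P * (T * A0)) = (1 - X) * (P * (T * B0)) + (1 - c) * (X * P * (T * B0))"
    "(1 - X) * (X * P * (T * A0)) = (1 - c) * X * (P * (T * B0)) + c * (1 - X) * (X * P * (T * B0))"
    "(1 - X) * (P * (T * A0)) = (1 - c * X) * (P * (T * B0))"
    unfolding * r by (simp_all add: algebra_simps)
qed

text \<open>The cases combine the row numbers before the new column with the column lengths after
  it. \<open>p\<close> and \<open>q\<close> count the parts 1 created in the two outer partitions;
  once the \<open>mfac\<close> factors are expressed by them, each case is one of the ring
  identities.\<close>

lemma column_relation_ext:
  assumes \<mu>: "\<mu> \<in> partitions" and \<nu>: "\<nu> \<in> partitions" and a: "size \<mu> \<le> a" and b: "size \<nu> \<le> b"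
    and rel: "column_relation t \<mu> \<nu>"
  shows "column_relation t (ext a \<mu>) (ext b \<nu>)"
proof -
  let ?X = "fps_X :: real fps" and ?c = "fps_const t"
  define A where "A = upper t \<mu> \<nu>"
  define B where "B = lower t \<mu> \<nu>"
  define k where "k l i = fps_const (mfac t (l - i) (a - size \<mu>) * mfac t (b - size \<nu>) (l - i))" for l i
  note UL = upper_ext[OF \<mu> \<nu> a b, of t] lower_ext[OF \<mu> \<nu> a b, of t]
  note UL' = UL[folded A_def B_def k_def]
  have A0: "A l = 0" if "\<not> (size \<mu> \<le> l \<and> l \<le> Suc (size \<mu>) \<and> size \<nu> \<le> l \<and> l \<le> Suc (size \<nu>))" for l
    using upper_eq_0[OF \<mu> \<nu> that] by (simp add: A_def)
  have B0: "B l = 0" if "\<not> (l \<le> size \<mu> \<and> size \<mu> \<le> Suc l \<and> l \<le> size \<nu> \<and> size \<nu> \<le> Suc l)" for l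
    using lower_eq_0[OF \<mu> \<nu> that] by (simp add: B_def)
  have sz: "size (ext a \<mu>) = a" "size (ext b \<nu>) = b"
    using a b by (simp_all add: size_ext)
  consider (eq) "size \<mu> = size \<nu>" | (gt) "size \<mu> = Suc (size \<nu>)" | (lt) "size \<nu> = Suc (size \<mu>)"
    | (far) "\<not> (size \<mu> \<le> Suc (size \<nu>) \<and> size \<nu> \<le> Suc (size \<mu>))" by linarith
  then show ?thesis
  proof cases
    case far
    then have "A l = 0" "B l = 0" for l using A0[of l] B0[of l] by force+
    then show ?thesis unfolding column_relation_def UL' Let_def sz by simp
  next
    case gt
    \<comment> \<open>\<open>s\<close> is the smaller row number. Only the upper state
      \<open>Suc s\<close> and the lower state \<open>s\<close> are compatible with both
      partitions.\<close>
    define s where "s = size \<nu>"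
    have sums: "(\<Sum>i\<le>l. k l i * A i) = (if Suc s \<le> l then k l (Suc s) * A (Suc s) else 0)"
      "(\<Sum>i\<le>l. k l i * B i) = (if s \<le> l then k l s * B s else 0)" for l
      by (rule sum_atMost_single[of "Suc s"]; use gt A0 in \<open>auto simp: s_def\<close>)
        (rule sum_atMost_single[of s]; use gt B0 in \<open>auto simp: s_def\<close>)
    have r: "(1 - ?X) * A (Suc s) = (1 - ?c * ?X) * B s"
      using rel gt by (simp add: column_relation_def A_def B_def s_def Let_def)
    obtain q where q: "b = s + q" using b le_Suc_ex s_def by blast
    obtain p where p: "a = Suc s + p" using a le_Suc_ex s_def gt by metis
    note R = transfer_identities_single[OF r]
    have pq: "a = b \<Longrightarrow> q = Suc p" "a = Suc b \<Longrightarrow> p = q" "b = Suc a \<Longrightarrow> q = Suc (Suc p)" using p q by auto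
    have kk: "k l i = fps_const (mfac t (l - i) p * mfac t q (l - i))" for l i
      by (simp add: k_def p q gt flip: s_def)
    have "column_relation t (ext a \<mu>) (ext b \<nu>)" if ab: "a = b"
    proof -
      have U1: "upper t (ext a \<mu>) (ext b \<nu>) a = ?X ^ a * (fps_const (1 - t ^ q) * A (Suc s))"
        unfolding UL' sums unfolding kk using ab pq(1)[OF ab] by (auto simp: p q mfac_def Suc_diff_le)
      have U2: "upper t (ext a \<mu>) (ext b \<nu>) (Suc a) = ?X * ?X ^ a * (fps_const (1 - t ^ q) * A (Suc s))"
        unfolding UL' sums unfolding kk using ab pq(1)[OF ab] by (auto simp: p q mfac_def Suc_diff_le)
      have L1: "lower t (ext a \<mu>) (ext b \<nu>) a = ?X ^ a * (fps_const (1 - t ^ q) * B s)"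
        unfolding UL' sums unfolding kk using ab pq(1)[OF ab] by (auto simp: p q mfac_def Suc_diff_le)
      have "a \<noteq> 0" "a + a - (a - 1) = Suc a" using p q ab by auto
      then have L2: "(if a = 0 then 0 else lower t (ext a \<mu>) (ext b \<nu>) (a - 1)) = ?X * ?X ^ a * (fps_const (1 - t ^ q) * B s)"
        unfolding UL' sums unfolding kk using ab pq(1)[OF ab] by (auto simp: p q mfac_def Suc_diff_le)
      show ?thesis
        unfolding column_relation_def Let_def sz U1 U2 L1 L2
        using R(1,2)[of "?X ^ a" "fps_const (1 - t ^ q)"] ab by (simp add: U1 U2 L1)
    qed
    moreover have "column_relation t (ext a \<mu>) (ext b \<nu>)" if ab: "a = Suc b"
    proof -
      have U1: "upper t (ext a \<mu>) (ext b \<nu>) a = ?X ^ a * (1 * A (Suc s))"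
        unfolding UL' sums unfolding kk using ab pq(2)[OF ab] by (auto simp: p q mfac_def Suc_diff_le)
      have L1: "lower t (ext a \<mu>) (ext b \<nu>) b = ?X ^ a * (1 * B s)"
        unfolding UL' sums unfolding kk using ab pq(2)[OF ab] by (auto simp: p q mfac_def Suc_diff_le)
      show ?thesis
        unfolding column_relation_def Let_def sz U1 L1
        using R(3)[of "?X ^ a" 1] ab by simp
    qed
    moreover have "column_relation t (ext a \<mu>) (ext b \<nu>)" if ab: "b = Suc a"
    proof -
      have U1: "upper t (ext a \<mu>) (ext b \<nu>) b = ?X ^ b * (fps_const ((1 - t ^ Suc p) * (1 - t ^ q)) * A (Suc s))"
        unfolding UL' sums unfolding kk using ab pq(3)[OF ab] by (auto simp: p q mfac_def Suc_diff_le)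
      have L1: "lower t (ext a \<mu>) (ext b \<nu>) a = ?X ^ b * (fps_const ((1 - t ^ Suc p) * (1 - t ^ q)) * B s)"
        unfolding UL' sums unfolding kk using ab pq(3)[OF ab] by (auto simp: p q mfac_def Suc_diff_le)
      show ?thesis
        unfolding column_relation_def Let_def sz U1 L1
        using R(3)[of "?X ^ b" "fps_const ((1 - t ^ Suc p) * (1 - t ^ q))"] ab by simp
    qed
    ultimately show ?thesis
      unfolding column_relation_def[of t "ext a \<mu>" "ext b \<nu>"] Let_def sz by auto
  next
    case lt
    define s where "s = size \<mu>"
    have sums: "(\<Sum>i\<le>l. k l i * A i) = (if Suc s \<le> l then k l (Suc s) * A (Suc s) else 0)"
      "(\<Sum>i\<le>l. k l i * B i) = (if s \<le> l then k l s * B s else 0)" for l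
      by (rule sum_atMost_single[of "Suc s"]; use lt A0 in \<open>auto simp: s_def\<close>)
        (rule sum_atMost_single[of s]; use lt B0 in \<open>auto simp: s_def\<close>)
    have r: "(1 - ?X) * A (Suc s) = (1 - ?c * ?X) * B s"
      using rel lt by (simp add: column_relation_def A_def B_def s_def Let_def)
    obtain q where q: "b = Suc s + q" using b le_Suc_ex s_def lt by metis
    obtain p where p: "a = s + p" using a le_Suc_ex s_def by metis
    note R = transfer_identities_single[OF r]
    have pq: "a = b \<Longrightarrow> p = Suc q" "a = Suc b \<Longrightarrow> p = Suc (Suc q)" "b = Suc a \<Longrightarrow> q = p" using p q by auto
    have kk: "k l i = fps_const (mfac t (l - i) p * mfac t q (l - i))" for l i
      by (simp add: k_def p q lt flip: s_def)
    have "column_relation t (ext a \<mu>) (ext b \<nu>)" if ab: "a = b"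
    proof -
      have U1: "upper t (ext a \<mu>) (ext b \<nu>) a = ?X ^ a * (1 * A (Suc s))"
        unfolding UL' sums unfolding kk using ab pq(1)[OF ab] by (auto simp: p q mfac_def Suc_diff_le)
      have U2: "upper t (ext a \<mu>) (ext b \<nu>) (Suc a) = ?X * ?X ^ a * (1 * A (Suc s))"
        unfolding UL' sums unfolding kk using ab pq(1)[OF ab] by (auto simp: p q mfac_def Suc_diff_le)
      have L1: "lower t (ext a \<mu>) (ext b \<nu>) a = ?X ^ a * (1 * B s)"
        unfolding UL' sums unfolding kk using ab pq(1)[OF ab] by (auto simp: p q mfac_def Suc_diff_le)
      have "a \<noteq> 0" "a + a - (a - 1) = Suc a" using p q ab by auto
      then have L2: "(if a = 0 then 0 else lower t (ext a \<mu>) (ext b \<nu>) (a - 1)) = ?X * ?X ^ a * (1 * B s)"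
        unfolding UL' sums unfolding kk using ab pq(1)[OF ab] by (auto simp: p q mfac_def Suc_diff_le)
      show ?thesis
        unfolding column_relation_def Let_def sz U1 U2 L1 L2
        using R(1,2)[of "?X ^ a" "1"] ab by (simp add: U1 U2 L1)
    qed
    moreover have "column_relation t (ext a \<mu>) (ext b \<nu>)" if ab: "a = Suc b"
    proof -
      have U1: "upper t (ext a \<mu>) (ext b \<nu>) a = ?X ^ a * (1 * A (Suc s))"
        unfolding UL' sums unfolding kk using ab pq(2)[OF ab] by (auto simp: p q mfac_def Suc_diff_le)
      have L1: "lower t (ext a \<mu>) (ext b \<nu>) b = ?X ^ a * (1 * B s)"
        unfolding UL' sums unfolding kk using ab pq(2)[OF ab] by (auto simp: p q mfac_def Suc_diff_le)
      show ?thesis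
        unfolding column_relation_def Let_def sz U1 L1
        using R(3)[of "?X ^ a" 1] ab by simp
    qed
    moreover have "column_relation t (ext a \<mu>) (ext b \<nu>)" if ab: "b = Suc a"
    proof -
      have U1: "upper t (ext a \<mu>) (ext b \<nu>) b = ?X ^ b * (1 * A (Suc s))"
        unfolding UL' sums unfolding kk using ab pq(3)[OF ab] by (auto simp: p q mfac_def Suc_diff_le)
      have L1: "lower t (ext a \<mu>) (ext b \<nu>) a = ?X ^ b * (1 * B s)"
        unfolding UL' sums unfolding kk using ab pq(3)[OF ab] by (auto simp: p q mfac_def Suc_diff_le)
      show ?thesis
        unfolding column_relation_def Let_def sz U1 L1
        using R(3)[of "?X ^ b" "1"] ab by simp
    qed
    ultimately show ?thesis
      unfolding column_relation_def[of t "ext a \<mu>" "ext b \<nu>"] Let_def sz by auto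
  next
    case eq
    define s where "s = size \<mu>"
    define B1 where "B1 = (if s = 0 then 0 else B (s - 1))"
    have sums: "(\<Sum>i\<le>l. k l i * A i) = (if s \<le> l then k l s * A s else 0) + (if Suc s \<le> l then k l (Suc s) * A (Suc s) else 0)"
       for l
      using eq A0 by (intro sum_atMost_two) (auto simp: s_def)
    \<comment> \<open>\<open>B1\<close> is the state \<open>s - 1\<close>, and 0 for
      \<open>s = 0\<close>, so the truncated index is harmless; the condition
      \<open>s \<le> Suc l\<close> means \<open>s - 1 \<le> l\<close>.\<close>
    have sums': "(\<Sum>i\<le>l. k l i * B i) = (if s \<le> l then k l s * B s else 0) + (if s \<le> Suc l then k l (s - 1) * B1 else 0)"
       for l
    proof (cases s)
      case 0
      then show ?thesis using eq B0 by (subst sum_atMost_single[of 0]) (auto simp: s_def B1_def)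
    next
      case (Suc s')
      then show ?thesis using eq B0 by (subst sum_atMost_two[of s']) (auto simp: s_def B1_def add.commute)
    qed
    have r1: "(1 - ?X) * A s = (1 - ?X) * B s + (1 - ?c) * B1"
     and r2: "(1 - ?X) * A (Suc s) = (1 - ?c) * ?X * B s + ?c * (1 - ?X) * B1"
      using rel eq by (simp_all add: column_relation_def A_def B_def s_def B1_def Let_def)
    obtain q where q: "b = s + q" using b le_Suc_ex s_def eq by metis
    obtain p where p: "a = s + p" using a le_Suc_ex s_def by metis
    note R = transfer_identities[OF r1 r2]
    note S = eq[symmetric, folded s_def] s_def[symmetric]
    have pq: "a = b \<longleftrightarrow> q = p" "a = Suc b \<longleftrightarrow> p = Suc q" "b = Suc a \<longleftrightarrow> q = Suc p" using p q by auto
    have c1: "fps_const (1 - t ^ p) = 1 - fps_const (t ^ p)" "fps_const (1 - t * t ^ p) = 1 - ?c * fps_const (t ^ p)" for p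
      by (simp_all flip: fps_const_mult fps_const_sub)
    have B1_0: "s = 0 \<Longrightarrow> B1 = 0" by (simp add: B1_def)
    have k1: "k l (s - Suc 0) * B1 = fps_const (mfac t (Suc (l - s)) p * mfac t q (Suc (l - s))) * B1"
       if "s \<le> l" for l
      using B1_0 that by (cases s) (auto simp: k_def S p q Suc_diff_Suc)
    have k2: "k l (s - Suc 0) * B1 = fps_const (mfac t 0 p * mfac t q 0) * B1"
       if "s = Suc l" for l
      using that by (auto simp: k_def S p q)
    have k0: "k l s = fps_const (mfac t (l - s) p * mfac t q (l - s))"
      "k l (Suc s) = fps_const (mfac t (l - Suc s) p * mfac t q (l - Suc s))" for l
      by (simp_all add: k_def S p q)
    have E: "column_relation t (ext a \<mu>) (ext b \<nu>)" if "q = p"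
    proof -
      have ab: "a = b" using pq that by simp
      have U1: "upper t (ext a \<mu>) (ext b \<nu>) a = ?X ^ a * (A s + (1 - fps_const (t ^ p)) * A (Suc s))"
        unfolding UL' sums k0 using ab that by (cases p) (auto simp: p c1 mfac_def)
      have U2: "upper t (ext a \<mu>) (ext b \<nu>) (Suc a) = ?X * ?X ^ a * ((1 - ?c * fps_const (t ^ p)) * A s + A (Suc s))"
        unfolding UL' sums k0 using ab that by (auto simp: p c1 mfac_def Suc_diff_le)
      have L1: "lower t (ext a \<mu>) (ext b \<nu>) a = ?X ^ a * (B s + (1 - ?c * fps_const (t ^ p)) * B1)"
        unfolding UL' sums' k0 using ab that k1[of a] by (auto simp: p c1 mfac_def Suc_diff_le)
      have L2: "(if a = 0 then 0 else lower t (ext a \<mu>) (ext b \<nu>) (a - 1)) =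
         ?X * ?X ^ a * ((1 - fps_const (t ^ p)) * B s + B1)"
      proof (cases "a = 0")
        case True
        then show ?thesis using p B1_0 by simp
      next
        case False
        have "a + a - (a - Suc 0) = Suc a" using False by simp
        show ?thesis
        proof (cases p)
          case 0
          then show ?thesis
            unfolding UL' sums' k0 using False ab that k2[of "a - 1"] p \<open>_ = Suc a\<close> by (auto simp: mfac_def)
        next
          case (Suc p')
          then show ?thesis
            unfolding UL' sums' k0 using False ab that k1[of "a - 1"] p \<open>_ = Suc a\<close>
            by (auto simp: mfac_def c1)
        qed
      qed
      show ?thesis
        unfolding column_relation_def Let_def sz U1 U2 L1 L2
        using R(1,2)[of "?X ^ a" "fps_const (t ^ p)"] ab by (simp add: U1 U2 L1)
    qed
    moreover have "column_relation t (ext a \<mu>) (ext b \<nu>)" if "p = Suc q"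
    proof -
      have ab: "a = Suc b" using pq that by simp
      have U1: "upper t (ext a \<mu>) (ext b \<nu>) a = ?X ^ a * (1 * A s + 1 * A (Suc s))"
        unfolding UL' sums k0 using that by (auto simp: p q mfac_def)
      have L1: "lower t (ext a \<mu>) (ext b \<nu>) b = ?X ^ a * (1 * B s + 1 * B1)"
        unfolding UL' sums' k0 using that k1[of b] by (auto simp: p q mfac_def)
      show ?thesis
        unfolding column_relation_def Let_def sz U1 L1
        using R(3)[of "?X ^ a" 1] ab by simp
    qed
    moreover have "column_relation t (ext a \<mu>) (ext b \<nu>)" if "q = Suc p"
    proof -
      have ab: "b = Suc a" using pq that by simp
      have U1: "upper t (ext a \<mu>) (ext b \<nu>) b = ?X ^ b * (fps_const (1 - t ^ q) * A s + fps_const (1 - t ^ q) * A (Suc s))"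
        unfolding UL' sums k0 using that by (auto simp: p q mfac_def Suc_diff_le)
      have L1: "lower t (ext a \<mu>) (ext b \<nu>) a = ?X ^ b * (fps_const (1 - t ^ q) * B s + fps_const (1 - t ^ q) * B1)"
        unfolding UL' sums' k0 using that k1[of a] by (auto simp: p q mfac_def)
      show ?thesis
        unfolding column_relation_def Let_def sz U1 L1
        using R(3)[of "?X ^ b" "fps_const (1 - t ^ q)"] ab by simp
    qed
    ultimately show ?thesis
      unfolding pq column_relation_def[of t "ext a \<mu>" "ext b \<nu>"] Let_def sz
      by (auto simp: pq)
  qed
qed

lemma column_relation_empty: "column_relation t {#} {#}"
proof -
  have e: "ext 0 {#} = {#}" by (simp add: ext_def)
  have U0: "upper t {#} {#} 0 = 1" and L0: "lower t {#} {#} 0 = 1"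
  proof -
    have "{\<rho> \<in> partitions. size \<rho> = 0 \<and> sum_mset \<rho> = n} = (if n = 0 then {{#}} else {})" for n
      by auto
    moreover have "{\<rho> \<in> partitions. size \<rho> = 0 \<and> sum_mset \<rho> + n = 0} = (if n = 0 then {{#}} else {})" for n
      by auto
    ultimately show "upper t {#} {#} 0 = 1" "lower t {#} {#} 0 = 1"
      by (auto intro!: fps_ext simp: upper_def lower_def phi_self psi_self simp del: size_eq_0_iff_empty)
  qed
  \<comment> \<open>The empty partition is its own extension by a column of length 0, so
    \<open>upper_ext\<close> gives an equation for the one-row series in terms of itself.\<close>
  have "upper t {#} {#} 1 = fps_X * (fps_const (1 - t) + upper t {#} {#} 1)"
    using upper_ext[of "{#}" "{#}" 0 0 t 1] by (simp add: e U0 mfac_def)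
  then have "(1 - fps_X) * upper t {#} {#} 1 = fps_X * fps_const (1 - t)"
    by (simp add: algebra_simps)
  moreover have "fps_const (1 - t) = 1 - fps_const t" by simp
  ultimately have "(1 - fps_X) * upper t {#} {#} (Suc 0) = (1 - fps_const t) * fps_X"
    by (simp only: One_nat_def mult.commute)
  then show ?thesis
    by (simp add: column_relation_def U0 L0 Let_def)
qed

text \<open>Deleting both first columns lowers the total size unless both partitions are empty,
  which gives the induction.\<close>

lemma column_relation:
  assumes "\<mu> \<in> partitions" "\<nu> \<in> partitions"
  shows "column_relation t \<mu> \<nu>"
  using assms
proof (induction "sum_mset \<mu> + sum_mset \<nu>" arbitrary: \<mu> \<nu> rule: less_induct)
  case less
  show ?case
  proof (cases "\<mu> = {#} \<and> \<nu> = {#}")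
    case True
    then show ?thesis using column_relation_empty by simp
  next
    case False
    have *: "sum_mset \<mu> = sum_mset (peel \<mu>) + size \<mu>" if "\<mu> \<in> partitions" for \<mu>
      using sum_ext[OF size_peel_le[of \<mu>]] ext_peel[OF that] by simp
    have "column_relation t (peel \<mu>) (peel \<nu>)"
      using False less.prems *[of \<mu>] *[of \<nu>] nonempty_has_size[of \<mu>] nonempty_has_size[of \<nu>]
      by (intro less.hyps) (auto simp: peel_partition)
    then show ?thesis
      using column_relation_ext[OF peel_partition peel_partition size_peel_le size_peel_le, of t \<mu> \<nu>]
      by (simp add: ext_peel less.prems)
  qed
qed

text \<open>Sums the column relation over the row number. For equal row numbers the two relations
  are added, and the coefficients of both lower states become 1 - t X.\<close>

theorem skew_cauchy:
  assumes "\<mu> \<in> partitions" "\<nu> \<in> partitions"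
  shows "(1 - fps_X) * Abs_fps (\<lambda>n. \<Sum>\<rho>\<in>Par n. phi t \<rho> \<mu> * psi t \<rho> \<nu>) =
    (1 - fps_const t * fps_X) *
      Abs_fps (\<lambda>m. \<Sum>\<kappa> | \<kappa> \<in> partitions \<and> sum_mset \<kappa> + m = sum_mset \<mu> + sum_mset \<nu>. psi t \<mu> \<kappa> * phi t \<nu> \<kappa>)"
proof -
  let ?X = "fps_X :: real fps" and ?c = "fps_const t"
  define A where "A = upper t \<mu> \<nu>"
  define B where "B = lower t \<mu> \<nu>"
  have A0: "A l = 0" if "\<not> (size \<mu> \<le> l \<and> l \<le> Suc (size \<mu>) \<and> size \<nu> \<le> l \<and> l \<le> Suc (size \<nu>))" for l
    using upper_eq_0[OF assms that] by (simp add: A_def)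
  have B0: "B l = 0" if "\<not> (l \<le> size \<mu> \<and> size \<mu> \<le> Suc l \<and> l \<le> size \<nu> \<and> size \<nu> \<le> Suc l)" for l
    using lower_eq_0[OF assms that] by (simp add: B_def)
  \<comment> \<open>No partition with a nonzero term has more rows than this, so the sum over row
    numbers can stop here.\<close>
  define s where "s = Suc (size \<mu> + size \<nu>)"
  have SA: "Abs_fps (\<lambda>n. \<Sum>\<rho>\<in>Par n. phi t \<rho> \<mu> * psi t \<rho> \<nu>) = (\<Sum>l\<le>s. A l)"
  proof (rule fps_ext)
    fix n
    have "(\<Sum>\<rho>\<in>Par n. phi t \<rho> \<mu> * psi t \<rho> \<nu>) =
      (\<Sum>\<rho> | \<rho> \<in> partitions \<and> size \<rho> \<le> s \<and> sum_mset \<rho> + 0 = n. phi t \<rho> \<mu> * psi t \<rho> \<nu>)"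
    proof (rule sum.mono_neutral_right)
      show "\<forall>\<rho>\<in>Par n - {\<rho> \<in> partitions. size \<rho> \<le> s \<and> sum_mset \<rho> + 0 = n}. phi t \<rho> \<mu> * psi t \<rho> \<nu> = 0"
      proof
        fix \<rho> assume *: "\<rho> \<in> Par n - {\<rho> \<in> partitions. size \<rho> \<le> s \<and> sum_mset \<rho> + 0 = n}"
        then have "\<not> hstrip \<rho> \<mu>" using hstrip_size(2)[of \<rho> \<mu>] assms(1) by (auto simp: Par_def s_def)
        then show "phi t \<rho> \<mu> * psi t \<rho> \<nu> = 0" by (simp add: phi_def)
      qed
    qed (simp, auto simp: Par_def)
    then show "fps_nth (Abs_fps (\<lambda>n. \<Sum>\<rho>\<in>Par n. phi t \<rho> \<mu> * psi t \<rho> \<nu>)) n = fps_nth (\<Sum>l\<le>s. A l) n"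
      unfolding sum_by_size by (simp add: A_def upper_def fps_sum_nth)
  qed
  have SB: "Abs_fps (\<lambda>m. \<Sum>\<kappa> | \<kappa> \<in> partitions \<and> sum_mset \<kappa> + m = sum_mset \<mu> + sum_mset \<nu>. psi t \<mu> \<kappa> * phi t \<nu> \<kappa>) = (\<Sum>l\<le>s. B l)"
    (is "Abs_fps ?f = _")
  proof (rule fps_ext)
    fix n
    have "?f n =
      (\<Sum>\<rho> | \<rho> \<in> partitions \<and> size \<rho> \<le> s \<and> sum_mset \<rho> + n = sum_mset \<mu> + sum_mset \<nu>. psi t \<mu> \<rho> * phi t \<nu> \<rho>)"
    proof (rule sum.mono_neutral_right)
      show "finite {\<kappa> \<in> partitions. sum_mset \<kappa> + n = sum_mset \<mu> + sum_mset \<nu>}"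
        by (rule finite_subset[OF _ finite_partitions_le[of "sum_mset \<mu> + sum_mset \<nu>"]]) auto
      show "\<forall>\<kappa>\<in>{\<kappa> \<in> partitions. sum_mset \<kappa> + n = sum_mset \<mu> + sum_mset \<nu>} -
          {\<kappa> \<in> partitions. size \<kappa> \<le> s \<and> sum_mset \<kappa> + n = sum_mset \<mu> + sum_mset \<nu>}.
          psi t \<mu> \<kappa> * phi t \<nu> \<kappa> = 0"
      proof
        fix \<kappa> assume *: "\<kappa> \<in> {\<kappa> \<in> partitions. sum_mset \<kappa> + n = sum_mset \<mu> + sum_mset \<nu>} -
          {\<kappa> \<in> partitions. size \<kappa> \<le> s \<and> sum_mset \<kappa> + n = sum_mset \<mu> + sum_mset \<nu>}"
        then have "\<not> hstrip \<mu> \<kappa>" using hstrip_size(1)[of \<mu> \<kappa>] assms(1) by (auto simp: s_def)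
        then show "psi t \<mu> \<kappa> * phi t \<nu> \<kappa> = 0" by (simp add: psi_def)
      qed
    qed auto
    then show "fps_nth (Abs_fps ?f) n = fps_nth (\<Sum>l\<le>s. B l) n"
      unfolding sum_by_size by (simp add: B_def lower_def fps_sum_nth)
  qed
  note rel = column_relation[OF assms, of t, unfolded column_relation_def Let_def, folded A_def B_def]
  consider (eq) "size \<mu> = size \<nu>" | (gt) "size \<mu> = Suc (size \<nu>)" | (lt) "size \<nu> = Suc (size \<mu>)"
    | (far) "\<not> (size \<mu> \<le> Suc (size \<nu>) \<and> size \<nu> \<le> Suc (size \<mu>))" by linarith
  then have "(1 - ?X) * (\<Sum>l\<le>s. A l) = (1 - ?c * ?X) * (\<Sum>l\<le>s. B l)"
  proof cases
    case far
    then have "A l = 0" "B l = 0" for l using A0[of l] B0[of l] by force+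
    then show ?thesis by simp
  next
    case gt
    have "(\<Sum>l\<le>s. A l) = A (Suc (size \<nu>))" "(\<Sum>l\<le>s. B l) = B (size \<nu>)"
      using A0 B0 gt by (subst sum_atMost_single; auto simp: s_def)+
    then show ?thesis using rel gt by simp
  next
    case lt
    have "(\<Sum>l\<le>s. A l) = A (Suc (size \<mu>))" "(\<Sum>l\<le>s. B l) = B (size \<mu>)"
      using A0 B0 lt by (subst sum_atMost_single; auto simp: s_def)+
    then show ?thesis using rel lt by simp
  next
    case eq
    have 1: "(\<Sum>l\<le>s. A l) = A (size \<mu>) + A (Suc (size \<mu>))"
      using A0 eq by (subst sum_atMost_two[of "size \<mu>"]) (auto simp: s_def)
    have 2: "(\<Sum>l\<le>s. B l) = B (size \<mu>) + (if size \<mu> = 0 then 0 else B (size \<mu> - 1))"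
    proof (cases "size \<mu>")
      case 0
      then show ?thesis using B0 eq by (subst sum_atMost_single[of 0]) (auto simp: s_def)
    next
      case (Suc k)
      then show ?thesis using B0 eq by (subst sum_atMost_two[of k]) (auto simp: s_def add.commute)
    qed
    show ?thesis unfolding 1 2 using rel eq by (simp add: distrib_left) (simp add: algebra_simps)
  qed
  then show ?thesis unfolding SA SB .
qed

section \<open>The Cauchy identity\<close>

text \<open>\<open>hlF\<close> will be Q and \<open>hlG\<close> will be P. The head of the list
  belongs to the outermost strip, so the order of the variables matters until symmetry is proved.
  The bound on the size of \<open>\<mu>\<close> keeps the sum finite; larger \<open>\<mu>\<close>
  admit no strip.\<close>

primrec hlF :: "real \<Rightarrow> nat multiset \<Rightarrow> real list \<Rightarrow> real" where
  "hlF t \<rho> [] = (if \<rho> = {#} then 1 else 0)"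
| "hlF t \<rho> (x # xs) = (\<Sum>\<mu> | \<mu> \<in> partitions \<and> sum_mset \<mu> \<le> sum_mset \<rho>.
     phi t \<rho> \<mu> * x ^ (sum_mset \<rho> - sum_mset \<mu>) * hlF t \<mu> xs)"

primrec hlG :: "real \<Rightarrow> nat multiset \<Rightarrow> real list \<Rightarrow> real" where
  "hlG t \<rho> [] = (if \<rho> = {#} then 1 else 0)"
| "hlG t \<rho> (x # xs) = (\<Sum>\<mu> | \<mu> \<in> partitions \<and> sum_mset \<mu> \<le> sum_mset \<rho>.
     psi t \<rho> \<mu> * x ^ (sum_mset \<rho> - sum_mset \<mu>) * hlG t \<mu> xs)"

text \<open>Macdonald's b_\<rho>(t), the ratio of Q to P.\<close>

definition hlb :: "real \<Rightarrow> nat multiset \<Rightarrow> real" where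
  "hlb t \<rho> = (\<Prod>v\<in>set_mset \<rho>. \<Prod>k=1..count \<rho> v. 1 - t ^ k)"

lemma partitions_le_0: "{\<mu> \<in> partitions. sum_mset \<mu> \<le> 0} = {{#}}"
  using Par_0 by (auto simp: Par_def)

lemma hlG_empty: "hlG t {#} xs = 1"
  using partitions_le_0 by (induction xs) (simp_all add: psi_self)

lemma hlF_empty: "hlF t {#} xs = 1"
  using partitions_le_0 by (induction xs) (simp_all add: phi_self)

lemma hstrip_count:
  assumes "hstrip \<rho> \<mu>" "\<rho> \<in> partitions" "\<mu> \<in> partitions"
  shows "count \<rho> v \<le> Suc (count \<mu> v)" "count \<mu> v \<le> Suc (count \<rho> v)"
proof -
  have "count \<rho> v \<le> Suc (count \<mu> v) \<and> count \<mu> v \<le> Suc (count \<rho> v)"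
  proof (cases "v = 0")
    case True
    then show ?thesis using assms(2,3) by (simp add: partitions_def not_in_iff)
  next
    case False
    then have "cols \<mu> v \<le> cols \<rho> v" "cols \<rho> v \<le> Suc (cols \<mu> v)"
      "cols \<mu> (Suc v) \<le> cols \<rho> (Suc v)" "cols \<rho> (Suc v) \<le> Suc (cols \<mu> (Suc v))"
      using assms(1) by (auto simp: hstrip_def)
    then show ?thesis using cols_Suc[of \<rho> v] cols_Suc[of \<mu> v] by linarith
  qed
  then show "count \<rho> v \<le> Suc (count \<mu> v)" "count \<mu> v \<le> Suc (count \<rho> v)" by auto
qed

lemma hlb_superset:
  assumes "finite S" "set_mset \<rho> \<subseteq> S"
  shows "hlb t \<rho> = (\<Prod>v\<in>S. \<Prod>k=1..count \<rho> v. 1 - t ^ k)"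
  unfolding hlb_def by (rule prod.mono_neutral_left) (use assms in \<open>auto simp: not_in_iff\<close>)

text \<open>Multiplicities along a strip differ by at most one, so for each part value the quotient
  of the two \<open>mfac\<close> factors is the quotient of the corresponding products in
  \<open>hlb\<close>.\<close>

lemma phi_psi:
  assumes "\<rho> \<in> partitions" "\<mu> \<in> partitions"
  shows "phi t \<rho> \<mu> * hlb t \<mu> = psi t \<rho> \<mu> * hlb t \<rho>"
proof (cases "hstrip \<rho> \<mu>")
  case False
  then show ?thesis by (simp add: phi_def psi_def)
next
  case True
  define S where "S = set_mset \<rho> \<union> set_mset \<mu>"
  have S: "finite S" "set_mset \<rho> \<subseteq> S" "set_mset \<mu> \<subseteq> S" by (auto simp: S_def)
  have "(\<Prod>v\<in>S. mfac t (count \<rho> v) (count \<mu> v) * (\<Prod>k=1..count \<mu> v. 1 - t ^ k)) =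
    (\<Prod>v\<in>S. mfac t (count \<mu> v) (count \<rho> v) * (\<Prod>k=1..count \<rho> v. 1 - t ^ k))"
  proof (rule prod.cong[OF refl])
    fix v
    have *: "mfac t a b * (\<Prod>k=1..b. 1 - t ^ k) = mfac t b a * (\<Prod>k=1..a. 1 - t ^ k)"
      if "a \<le> Suc b" "b \<le> Suc a" for a b
    proof -
      have "a = b \<or> a = Suc b \<or> b = Suc a" using that by linarith
      then show ?thesis by (elim disjE) (simp_all add: mult.commute)
    qed
    show "mfac t (count \<rho> v) (count \<mu> v) * (\<Prod>k=1..count \<mu> v. 1 - t ^ k) =
        mfac t (count \<mu> v) (count \<rho> v) * (\<Prod>k=1..count \<rho> v. 1 - t ^ k)"
      by (rule *) (use hstrip_count[OF True assms] in auto)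
  qed
  then show ?thesis
    using True by (simp add: phi_superset[OF S(1,2)] psi_superset[OF S(1,3)] hlb_superset[OF S(1,2)]
        hlb_superset[OF S(1,3)] prod.distrib)
qed

text \<open>The expansion of (1 - t c X) / (1 - c X), the Cauchy factor of two variables with
  product \<open>c\<close>.\<close>

definition gen :: "real \<Rightarrow> real \<Rightarrow> real fps" where
  "gen t c = Abs_fps (\<lambda>k. if k = 0 then 1 else (1 - t) * c ^ k)"

definition genl :: "real \<Rightarrow> real \<Rightarrow> real list \<Rightarrow> real fps" where
  "genl t a ys = prod_list (map (\<lambda>y. gen t (a * y)) ys)"

lemma gen_mult: "(1 - fps_const c * fps_X) * gen t c = 1 - fps_const (t * c) * fps_X"
proof (rule fps_ext)
  fix n
  have *: "fps_nth ((1 - fps_const c * fps_X) * gen t c) n = fps_nth (gen t c) n - (if n = 0 then 0 else c * fps_nth (gen t c) (n - 1))"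
    by (simp add: left_diff_distrib mult.assoc)
  show "fps_nth ((1 - fps_const c * fps_X) * gen t c) n = fps_nth (1 - fps_const (t * c) * fps_X) n"
  proof (cases n)
    case 0
    then show ?thesis unfolding * by (simp add: gen_def)
  next
    case (Suc k)
    then show ?thesis unfolding * by (cases k) (simp_all add: gen_def algebra_simps)
  qed
qed

text \<open>Power series form an integral domain, so 1 - X can be cancelled; what remains of the
  quotient is \<open>gen t 1\<close>.\<close>

lemma skew_cauchy_coeff:
  assumes "\<mu> \<in> partitions" "\<nu> \<in> partitions"
  shows "(\<Sum>\<rho>\<in>Par n. phi t \<rho> \<mu> * psi t \<rho> \<nu>) =
    (\<Sum>i\<le>n. fps_nth (gen t 1) i * (\<Sum>\<kappa> | \<kappa> \<in> partitions \<and> sum_mset \<kappa> + (n - i) = sum_mset \<mu> + sum_mset \<nu>. psi t \<mu> \<kappa> * phi t \<nu> \<kappa>))"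
proof -
  define A where "A = Abs_fps (\<lambda>n. \<Sum>\<rho>\<in>Par n. phi t \<rho> \<mu> * psi t \<rho> \<nu>)"
  define B where "B = Abs_fps (\<lambda>m. \<Sum>\<kappa> | \<kappa> \<in> partitions \<and> sum_mset \<kappa> + m = sum_mset \<mu> + sum_mset \<nu>. psi t \<mu> \<kappa> * phi t \<nu> \<kappa>)"
  have "(1 - fps_X) * A = (1 - fps_const t * fps_X) * B"
    unfolding A_def B_def by (rule skew_cauchy[OF assms])
  also have "1 - fps_const t * fps_X = (1 - fps_X) * gen t 1"
    using gen_mult[of 1 t] by simp
  finally have "(1 - fps_X) * (A - gen t 1 * B) = 0"
    by (simp add: algebra_simps)
  moreover have "(1 - fps_X :: real fps) \<noteq> 0"
  proof
    assume "(1 - fps_X :: real fps) = 0"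
    then have "fps_nth (1 - fps_X :: real fps) 0 = 0" by simp
    then show False by simp
  qed
  ultimately have "A = gen t 1 * B" by simp
  then have "fps_nth A n = fps_nth (gen t 1 * B) n" by simp
  then show ?thesis by (simp add: A_def B_def fps_mult_nth atMost_atLeast0)
qed

lemma finite_partitions_sum [simp]:
  "finite {\<kappa> \<in> partitions. sum_mset \<kappa> + m = n}" "finite {\<kappa> \<in> partitions. sum_mset \<kappa> \<le> n}"
  "finite {\<kappa> \<in> partitions. sum_mset \<kappa> = n}"
  by (rule finite_subset[OF _ finite_partitions_le[of n]]; auto)+

text \<open>Adding a \<open>phi\<close> strip in the variable \<open>a\<close> acts on the functions
  P in \<open>ys\<close> as multiplication by the Cauchy factors. A further variable
  \<open>y\<close> branches each \<open>hlG\<close>; the skew identity exchanges its strip with the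
  \<open>phi\<close> strip, and the induction hypothesis applies above the smaller
  partition.\<close>

lemma cauchy_step:
  assumes "\<mu> \<in> partitions"
  shows "Abs_fps (\<lambda>n. \<Sum>\<rho>\<in>Par n. phi t \<rho> \<mu> * a ^ (n - sum_mset \<mu>) * hlG t \<rho> ys) =
    genl t a ys * (fps_X ^ sum_mset \<mu> * fps_const (hlG t \<mu> ys))"
  using assms
proof (induction ys arbitrary: \<mu>)
  case Nil
  show ?case
  proof (rule fps_ext)
    fix n
    have "(\<Sum>\<rho>\<in>Par n. phi t \<rho> \<mu> * a ^ (n - sum_mset \<mu>) * hlG t \<rho> []) =
      (\<Sum>\<rho>\<in>Par n. if \<rho> = {#} then phi t {#} \<mu> * a ^ (n - sum_mset \<mu>) else 0)"
      by (intro sum.cong) auto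
    also have "\<dots> = (if n = 0 then phi t {#} \<mu> * a ^ (n - sum_mset \<mu>) else 0)"
      by (auto simp: Par_def)
    also have "\<dots> = (if n = sum_mset \<mu> \<and> \<mu> = {#} then 1 else 0)"
    proof -
      have "phi t {#} \<mu> = (if \<mu> = {#} then 1 else 0)"
      proof (cases "hstrip {#} \<mu>")
        case True
        then have "{#} = \<mu>" using hstrip_sum_le[OF True] Nil by (intro hstrip_eqI) auto
        then show ?thesis by (simp add: phi_self)
      next
        case False
        then have "\<mu> \<noteq> {#}" by auto
        then show ?thesis using False by (simp add: phi_def)
      qed
      then show ?thesis by auto
    qed
    finally show "fps_nth (Abs_fps (\<lambda>n. \<Sum>\<rho>\<in>Par n. phi t \<rho> \<mu> * a ^ (n - sum_mset \<mu>) * hlG t \<rho> [])) n =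
      fps_nth (genl t a [] * (fps_X ^ sum_mset \<mu> * fps_const (hlG t \<mu> []))) n"
      by (auto simp: genl_def)
  qed
next
  case (Cons y ys)
  define \<beta> where "\<beta> \<nu> m = (\<Sum>\<kappa> | \<kappa> \<in> partitions \<and> sum_mset \<kappa> + m = sum_mset \<mu> + sum_mset \<nu>. psi t \<mu> \<kappa> * phi t \<nu> \<kappa>)" for \<nu> m
  \<comment> \<open>Outside the natural range the truncated exponents of \<open>a\<close> and
    \<open>y\<close> cannot be split; there \<open>\<beta>\<close> vanishes anyway.\<close>
  have \<beta>0: "\<beta> \<nu> m = 0" if "m < sum_mset \<mu> \<or> m < sum_mset \<nu>" for \<nu> m
    unfolding \<beta>_def
  proof (rule sum.neutral, safe)
    fix \<kappa> assume \<kappa>: "sum_mset \<kappa> + m = sum_mset \<mu> + sum_mset \<nu>"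
    show "psi t \<mu> \<kappa> * phi t \<nu> \<kappa> = 0"
      using hstrip_sum_le[of \<mu> \<kappa>] hstrip_sum_le[of \<nu> \<kappa>] \<kappa> that by (auto simp: psi_def phi_def)
  qed
  define T where "T m = (\<Sum>\<nu> | \<nu> \<in> partitions \<and> sum_mset \<nu> \<le> m. a ^ (m - sum_mset \<mu>) * y ^ (m - sum_mset \<nu>) * \<beta> \<nu> m * hlG t \<nu> ys)" for m
  define S where "S \<kappa> = Abs_fps (\<lambda>n. \<Sum>\<rho>\<in>Par n. phi t \<rho> \<kappa> * a ^ (n - sum_mset \<kappa>) * hlG t \<rho> ys)" for \<kappa>
  have 1: "Abs_fps (\<lambda>n. \<Sum>\<rho>\<in>Par n. phi t \<rho> \<mu> * a ^ (n - sum_mset \<mu>) * hlG t \<rho> (y # ys)) = gen t (a * y) * Abs_fps T"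
  proof (rule fps_ext)
    fix n
    have "(\<Sum>\<rho>\<in>Par n. phi t \<rho> \<mu> * a ^ (n - sum_mset \<mu>) * hlG t \<rho> (y # ys)) =
      (\<Sum>\<rho>\<in>Par n. \<Sum>\<nu> | \<nu> \<in> partitions \<and> sum_mset \<nu> \<le> n.
        phi t \<rho> \<mu> * a ^ (n - sum_mset \<mu>) * (psi t \<rho> \<nu> * y ^ (n - sum_mset \<nu>) * hlG t \<nu> ys))"
      by (intro sum.cong) (auto simp: Par_def sum_distrib_left)
    also have "\<dots> = (\<Sum>\<nu> | \<nu> \<in> partitions \<and> sum_mset \<nu> \<le> n.
        a ^ (n - sum_mset \<mu>) * y ^ (n - sum_mset \<nu>) * hlG t \<nu> ys * (\<Sum>\<rho>\<in>Par n. phi t \<rho> \<mu> * psi t \<rho> \<nu>))"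
      by (subst sum.swap) (simp add: sum_distrib_left mult_ac)
    also have "\<dots> = (\<Sum>\<nu> | \<nu> \<in> partitions \<and> sum_mset \<nu> \<le> n. \<Sum>i\<le>n.
        a ^ (n - sum_mset \<mu>) * y ^ (n - sum_mset \<nu>) * hlG t \<nu> ys * (fps_nth (gen t 1) i * \<beta> \<nu> (n - i)))"
      by (intro sum.cong) (auto simp: skew_cauchy_coeff[OF Cons.prems] \<beta>_def sum_distrib_left)
    also have "\<dots> = (\<Sum>\<nu> | \<nu> \<in> partitions \<and> sum_mset \<nu> \<le> n. \<Sum>i\<le>n.
        fps_nth (gen t (a * y)) i * (a ^ (n - i - sum_mset \<mu>) * y ^ (n - i - sum_mset \<nu>) * \<beta> \<nu> (n - i) * hlG t \<nu> ys))"
    proof (intro sum.cong refl)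
      fix \<nu> i assume i: "i \<in> {..n}"
      show "a ^ (n - sum_mset \<mu>) * y ^ (n - sum_mset \<nu>) * hlG t \<nu> ys * (fps_nth (gen t 1) i * \<beta> \<nu> (n - i)) =
        fps_nth (gen t (a * y)) i * (a ^ (n - i - sum_mset \<mu>) * y ^ (n - i - sum_mset \<nu>) * \<beta> \<nu> (n - i) * hlG t \<nu> ys)"
      proof (cases "n - i < sum_mset \<mu> \<or> n - i < sum_mset \<nu>")
        case True
        then show ?thesis using \<beta>0 by simp
      next
        case False
        then have "n - sum_mset \<mu> = i + (n - i - sum_mset \<mu>)" "n - sum_mset \<nu> = i + (n - i - sum_mset \<nu>)"
          using i by auto
        then have "a ^ (n - sum_mset \<mu>) = a ^ i * a ^ (n - i - sum_mset \<mu>)"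
          "y ^ (n - sum_mset \<nu>) = y ^ i * y ^ (n - i - sum_mset \<nu>)" by (metis power_add)+
        then show ?thesis by (simp add: gen_def power_mult_distrib)
      qed
    qed
    also have "\<dots> = (\<Sum>i\<le>n. fps_nth (gen t (a * y)) i * (\<Sum>\<nu> | \<nu> \<in> partitions \<and> sum_mset \<nu> \<le> n.
        a ^ (n - i - sum_mset \<mu>) * y ^ (n - i - sum_mset \<nu>) * \<beta> \<nu> (n - i) * hlG t \<nu> ys))"
      by (subst sum.swap) (simp add: sum_distrib_left)
    also have "\<dots> = (\<Sum>i\<le>n. fps_nth (gen t (a * y)) i * T (n - i))"
    proof (intro sum.cong refl arg_cong2[where f = "(*)"])
      fix i
      show "(\<Sum>\<nu> | \<nu> \<in> partitions \<and> sum_mset \<nu> \<le> n.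
        a ^ (n - i - sum_mset \<mu>) * y ^ (n - i - sum_mset \<nu>) * \<beta> \<nu> (n - i) * hlG t \<nu> ys) = T (n - i)"
        unfolding T_def by (rule sum.mono_neutral_right) (auto simp: \<beta>0 not_le)
    qed
    finally show "fps_nth (Abs_fps (\<lambda>n. \<Sum>\<rho>\<in>Par n. phi t \<rho> \<mu> * a ^ (n - sum_mset \<mu>) * hlG t \<rho> (y # ys))) n =
      fps_nth (gen t (a * y) * Abs_fps T) n"
      by (simp add: fps_mult_nth atMost_atLeast0 del: hlG.simps)
  qed
  \<comment> \<open>After exchanging the sums, the inner sum over \<open>\<nu>\<close> for fixed
    \<open>\<kappa>\<close> is the series \<open>S \<kappa>\<close> shifted by the size of
    \<mu>/\<kappa>.\<close>
  have 2: "Abs_fps T = (\<Sum>\<kappa> | \<kappa> \<in> partitions \<and> sum_mset \<kappa> \<le> sum_mset \<mu>.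
      fps_const (psi t \<mu> \<kappa> * y ^ (sum_mset \<mu> - sum_mset \<kappa>)) * (fps_X ^ (sum_mset \<mu> - sum_mset \<kappa>) * S \<kappa>))"
  proof (rule fps_ext)
    fix m
    define h where "h \<nu> \<kappa> = a ^ (m - sum_mset \<mu>) * y ^ (m - sum_mset \<nu>) * (psi t \<mu> \<kappa> * phi t \<nu> \<kappa>) * hlG t \<nu> ys" for \<nu> \<kappa>
    have h0: "h \<nu> \<kappa> = 0" if "sum_mset \<mu> < sum_mset \<kappa>" for \<nu> \<kappa>
      using hstrip_sum_le[of \<mu> \<kappa>] that by (auto simp: psi_def h_def)
    have "T m = (\<Sum>\<nu> | \<nu> \<in> partitions \<and> sum_mset \<nu> \<le> m. \<Sum>\<kappa> | \<kappa> \<in> partitions \<and> sum_mset \<kappa> + m = sum_mset \<mu> + sum_mset \<nu>. h \<nu> \<kappa>)"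
      by (simp add: T_def \<beta>_def h_def sum_distrib_left sum_distrib_right)
    also have "\<dots> = (\<Sum>\<nu> | \<nu> \<in> partitions \<and> sum_mset \<nu> \<le> m. \<Sum>\<kappa> | \<kappa> \<in> {\<kappa> \<in> partitions. sum_mset \<kappa> \<le> sum_mset \<mu>} \<and> sum_mset \<kappa> + m = sum_mset \<mu> + sum_mset \<nu>. h \<nu> \<kappa>)"
      by (intro sum.cong refl sum.mono_neutral_right) (auto simp: h0 not_le)
    also have "\<dots> = (\<Sum>\<kappa> | \<kappa> \<in> partitions \<and> sum_mset \<kappa> \<le> sum_mset \<mu>. \<Sum>\<nu> | \<nu> \<in> {\<nu> \<in> partitions. sum_mset \<nu> \<le> m} \<and> sum_mset \<kappa> + m = sum_mset \<mu> + sum_mset \<nu>. h \<nu> \<kappa>)"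
      by (subst sum.swap_restrict) simp_all
    also have "\<dots> = (\<Sum>\<kappa> | \<kappa> \<in> partitions \<and> sum_mset \<kappa> \<le> sum_mset \<mu>.
      psi t \<mu> \<kappa> * y ^ (sum_mset \<mu> - sum_mset \<kappa>) * fps_nth (fps_X ^ (sum_mset \<mu> - sum_mset \<kappa>) * S \<kappa>) m)"
    proof (intro sum.cong refl)
      fix \<kappa> assume "\<kappa> \<in> {\<kappa> \<in> partitions. sum_mset \<kappa> \<le> sum_mset \<mu>}"
      then have le: "sum_mset \<kappa> \<le> sum_mset \<mu>" by simp
      show "(\<Sum>\<nu> | \<nu> \<in> {\<nu> \<in> partitions. sum_mset \<nu> \<le> m} \<and> sum_mset \<kappa> + m = sum_mset \<mu> + sum_mset \<nu>. h \<nu> \<kappa>) =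
        psi t \<mu> \<kappa> * y ^ (sum_mset \<mu> - sum_mset \<kappa>) * fps_nth (fps_X ^ (sum_mset \<mu> - sum_mset \<kappa>) * S \<kappa>) m"
      proof (cases "m < sum_mset \<mu> - sum_mset \<kappa>")
        case True
        then have "{\<nu> \<in> {\<nu> \<in> partitions. sum_mset \<nu> \<le> m}. sum_mset \<kappa> + m = sum_mset \<mu> + sum_mset \<nu>} = {}"
          using le by auto
        then have "(\<Sum>\<nu> | \<nu> \<in> {\<nu> \<in> partitions. sum_mset \<nu> \<le> m} \<and> sum_mset \<kappa> + m = sum_mset \<mu> + sum_mset \<nu>. h \<nu> \<kappa>) = 0"
          by (simp only: sum.empty)
        then show ?thesis using True by (simp add: fps_X_power_mult_nth)
      next
        case False
        define n where "n = m - (sum_mset \<mu> - sum_mset \<kappa>)"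
        have "{\<nu> \<in> {\<nu> \<in> partitions. sum_mset \<nu> \<le> m}. sum_mset \<kappa> + m = sum_mset \<mu> + sum_mset \<nu>} = Par n"
          using False le by (auto simp: Par_def n_def)
        moreover have "h \<nu> \<kappa> = psi t \<mu> \<kappa> * y ^ (sum_mset \<mu> - sum_mset \<kappa>) * (phi t \<nu> \<kappa> * a ^ (n - sum_mset \<kappa>) * hlG t \<nu> ys)"
          if "\<nu> \<in> Par n" for \<nu>
        proof (cases "phi t \<nu> \<kappa> = 0")
          case True
          then show ?thesis by (simp add: h_def)
        next
          case nz: False
          then have "m - sum_mset \<nu> = sum_mset \<mu> - sum_mset \<kappa>" "m - sum_mset \<mu> = n - sum_mset \<kappa>"
            using that False le by (auto simp: Par_def n_def)
          then show ?thesis by (simp add: h_def)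
        qed
        ultimately show ?thesis using False
          by (simp add: fps_X_power_mult_nth S_def n_def sum_distrib_left)
      qed
    qed
    finally show "fps_nth (Abs_fps T) m = fps_nth (\<Sum>\<kappa> | \<kappa> \<in> partitions \<and> sum_mset \<kappa> \<le> sum_mset \<mu>.
      fps_const (psi t \<mu> \<kappa> * y ^ (sum_mset \<mu> - sum_mset \<kappa>)) * (fps_X ^ (sum_mset \<mu> - sum_mset \<kappa>) * S \<kappa>)) m"
      by (simp add: fps_sum_nth)
  qed
  have 3: "Abs_fps T = (\<Sum>\<kappa> | \<kappa> \<in> partitions \<and> sum_mset \<kappa> \<le> sum_mset \<mu>.
      genl t a ys * (fps_X ^ sum_mset \<mu> * fps_const (psi t \<mu> \<kappa> * y ^ (sum_mset \<mu> - sum_mset \<kappa>) * hlG t \<kappa> ys)))"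
    unfolding 2
  proof (intro sum.cong refl)
    fix \<kappa> assume \<kappa>: "\<kappa> \<in> {\<kappa> \<in> partitions. sum_mset \<kappa> \<le> sum_mset \<mu>}"
    have S: "S \<kappa> = genl t a ys * (fps_X ^ sum_mset \<kappa> * fps_const (hlG t \<kappa> ys))"
      unfolding S_def by (rule Cons.IH) (use \<kappa> in simp)
    have X: "fps_X ^ (sum_mset \<mu> - sum_mset \<kappa>) * fps_X ^ sum_mset \<kappa> = (fps_X ^ sum_mset \<mu> :: real fps)"
      using \<kappa> by (simp flip: power_add)
    have ac: "c1 * (p * (E * (q * c2))) = E * ((p * q) * (c1 * c2))" for c1 p E q c2 :: "real fps"
      by (simp only: mult_ac)
    show "fps_const (psi t \<mu> \<kappa> * y ^ (sum_mset \<mu> - sum_mset \<kappa>)) * (fps_X ^ (sum_mset \<mu> - sum_mset \<kappa>) * S \<kappa>) =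
      genl t a ys * (fps_X ^ sum_mset \<mu> * fps_const (psi t \<mu> \<kappa> * y ^ (sum_mset \<mu> - sum_mset \<kappa>) * hlG t \<kappa> ys))"
      unfolding S ac X fps_const_mult ..
  qed
  have "(\<Sum>\<kappa> | \<kappa> \<in> partitions \<and> sum_mset \<kappa> \<le> sum_mset \<mu>. fps_const (psi t \<mu> \<kappa> * y ^ (sum_mset \<mu> - sum_mset \<kappa>) * hlG t \<kappa> ys)) =
     fps_const (hlG t \<mu> (y # ys))"
    by (rule fps_ext) (simp add: fps_sum_nth)
  then have "Abs_fps T = genl t a ys * (fps_X ^ sum_mset \<mu> * fps_const (hlG t \<mu> (y # ys)))"
    unfolding 3 by (simp only: sum_distrib_left[symmetric])
  then show ?case unfolding 1 by (simp add: genl_def mult.assoc)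
qed

text \<open>Each variable of \<open>xs\<close> is one \<open>phi\<close> strip and contributes one
  factor through \<open>cauchy_step\<close>; the series variable records the degree.\<close>

lemma cauchy_product:
  "Abs_fps (\<lambda>n. \<Sum>\<rho>\<in>Par n. hlF t \<rho> xs * hlG t \<rho> ys) = prod_list (map (\<lambda>x. genl t x ys) xs)"
proof (induction xs)
  case Nil
  show ?case
  proof (rule fps_ext)
    fix n
    have "(\<Sum>\<rho>\<in>Par n. hlF t \<rho> [] * hlG t \<rho> ys) = (\<Sum>\<rho>\<in>Par n. if \<rho> = {#} then 1 else 0)"
      by (intro sum.cong) (auto simp: hlG_empty)
    also have "\<dots> = (if n = 0 then 1 else 0)"
      by (auto simp: Par_def)
    finally show "fps_nth (Abs_fps (\<lambda>n. \<Sum>\<rho>\<in>Par n. hlF t \<rho> [] * hlG t \<rho> ys)) n =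
      fps_nth (prod_list (map (\<lambda>x. genl t x ys) [])) n" by simp
  qed
next
  case (Cons x xs)
  show ?case
  proof (rule fps_ext)
    fix n
    have "(\<Sum>\<rho>\<in>Par n. hlF t \<rho> (x # xs) * hlG t \<rho> ys) =
      (\<Sum>\<rho>\<in>Par n. \<Sum>\<mu> | \<mu> \<in> partitions \<and> sum_mset \<mu> \<le> n. phi t \<rho> \<mu> * x ^ (n - sum_mset \<mu>) * hlF t \<mu> xs * hlG t \<rho> ys)"
      by (intro sum.cong) (auto simp: Par_def sum_distrib_right)
    also have "\<dots> = (\<Sum>\<mu> | \<mu> \<in> partitions \<and> sum_mset \<mu> \<le> n. hlF t \<mu> xs *
        fps_nth (Abs_fps (\<lambda>n. \<Sum>\<rho>\<in>Par n. phi t \<rho> \<mu> * x ^ (n - sum_mset \<mu>) * hlG t \<rho> ys)) n)"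
      by (subst sum.swap) (simp add: sum_distrib_left mult_ac)
    also have "\<dots> = (\<Sum>\<mu> | \<mu> \<in> partitions \<and> sum_mset \<mu> \<le> n. hlF t \<mu> xs * hlG t \<mu> ys * fps_nth (genl t x ys) (n - sum_mset \<mu>))"
    proof (intro sum.cong refl)
      fix \<mu> assume \<mu>: "\<mu> \<in> {\<mu> \<in> partitions. sum_mset \<mu> \<le> n}"
      then have *: "\<mu> \<in> partitions" by simp
      have eq: "genl t x ys * (fps_X ^ sum_mset \<mu> * fps_const (hlG t \<mu> ys)) =
         fps_const (hlG t \<mu> ys) * (fps_X ^ sum_mset \<mu> * genl t x ys)" by (simp add: mult_ac)
      show "hlF t \<mu> xs *
        fps_nth (Abs_fps (\<lambda>n. \<Sum>\<rho>\<in>Par n. phi t \<rho> \<mu> * x ^ (n - sum_mset \<mu>) * hlG t \<rho> ys)) n =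
        hlF t \<mu> xs * hlG t \<mu> ys * fps_nth (genl t x ys) (n - sum_mset \<mu>)"
        unfolding cauchy_step[OF *] eq using \<mu> by (simp add: fps_X_power_mult_nth)
    qed
    also have "\<dots> = (\<Sum>m\<le>n. \<Sum>\<mu> | \<mu> \<in> {\<mu> \<in> partitions. sum_mset \<mu> \<le> n} \<and> sum_mset \<mu> = m. hlF t \<mu> xs * hlG t \<mu> ys * fps_nth (genl t x ys) (n - sum_mset \<mu>))"
      by (rule sum.group[symmetric]) auto
    also have "\<dots> = (\<Sum>m\<le>n. \<Sum>\<mu>\<in>Par m. hlF t \<mu> xs * hlG t \<mu> ys * fps_nth (genl t x ys) (n - m))"
      by (intro sum.cong) (auto simp: Par_def)
    also have "\<dots> = fps_nth (Abs_fps (\<lambda>n. \<Sum>\<rho>\<in>Par n. hlF t \<rho> xs * hlG t \<rho> ys) * genl t x ys) n"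
      by (simp add: fps_mult_nth atMost_atLeast0 sum_distrib_right)
    finally show "fps_nth (Abs_fps (\<lambda>n. \<Sum>\<rho>\<in>Par n. hlF t \<rho> (x # xs) * hlG t \<rho> ys)) n =
      fps_nth (prod_list (map (\<lambda>x. genl t x ys) (x # xs))) n"
      unfolding Cons.IH by (simp add: mult.commute)
  qed
qed

section \<open>The Cauchy kernel in terms of power sums\<close>

text \<open>Comparing coefficients gives Newton's recursion: n times the n-th coefficient is a
  combination of earlier ones. So the logarithmic derivative and the constant term determine a
  series.\<close>

lemma newton_unique:
  fixes P Q L :: "real fps"
  assumes "fps_X * fps_deriv P = L * P" "fps_X * fps_deriv Q = L * Q" "fps_nth L 0 = 0" "fps_nth P 0 = fps_nth Q 0"
  shows "P = Q"
proof (rule fps_ext)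
  fix n
  have R: "real n * fps_nth R n = (\<Sum>i=1..n. fps_nth L i * fps_nth R (n - i))" if "fps_X * fps_deriv R = L * R" for R n
  proof -
    have "real n * fps_nth R n = fps_nth (fps_X * fps_deriv R) n"
      by (cases n) auto
    also have "\<dots> = (\<Sum>i=0..n. fps_nth L i * fps_nth R (n - i))"
      unfolding that fps_mult_nth ..
    also have "\<dots> = (\<Sum>i=1..n. fps_nth L i * fps_nth R (n - i))"
      using assms(3) by (simp add: sum.atLeast_Suc_atMost)
    finally show ?thesis .
  qed
  show "fps_nth P n = fps_nth Q n"
  proof (induction n rule: less_induct)
    case (less n)
    show ?case
    proof (cases "n = 0")
      case False
      have "(\<Sum>i=1..n. fps_nth L i * fps_nth P (n - i)) = (\<Sum>i=1..n. fps_nth L i * fps_nth Q (n - i))"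
        using less.IH False by (intro sum.cong) auto
      moreover have "real n * fps_nth P n = (\<Sum>i=1..n. fps_nth L i * fps_nth P (n - i))"
        "real n * fps_nth Q n = (\<Sum>i=1..n. fps_nth L i * fps_nth Q (n - i))" for n
        by (rule R[OF assms(1)], rule R[OF assms(2)])
      ultimately have "real n * fps_nth P n = real n * fps_nth Q n" by simp
      then show ?thesis using False by simp
    qed (use assms(4) in simp)
  qed
qed

text \<open>The logarithmic derivative of (1 - t c X) / (1 - c X), times X. Its k-th coefficient is
  a power of \<open>c\<close> deformed by \<open>1 - t ^ k\<close>, which is where the weights of
  \<open>hl_norm\<close> come from.\<close>

lemma gen_log_deriv:
  "fps_X * fps_deriv (gen t c) = Abs_fps (\<lambda>k. (1 - t ^ k) * c ^ k) * gen t c"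
proof (rule fps_ext)
  fix n
  show "fps_nth (fps_X * fps_deriv (gen t c)) n = fps_nth (Abs_fps (\<lambda>k. (1 - t ^ k) * c ^ k) * gen t c) n"
  proof (cases n)
    case 0
    then show ?thesis by simp
  next
    case (Suc m)
    have s: "(\<Sum>k\<le>m. (1 - t ^ k) * (1 - t)) = real (Suc m) * (1 - t) - 1 + t ^ Suc m"
      by (induction m) (simp_all add: algebra_simps)
    have "fps_nth (Abs_fps (\<lambda>k. (1 - t ^ k) * c ^ k) * gen t c) n =
       (\<Sum>k\<le>Suc m. (1 - t ^ k) * c ^ k * fps_nth (gen t c) (Suc m - k))"
      by (simp add: fps_mult_nth Suc atMost_atLeast0)
    also have "\<dots> = (1 - t ^ Suc m) * c ^ Suc m + (\<Sum>k\<le>m. (1 - t ^ k) * c ^ k * fps_nth (gen t c) (Suc m - k))"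
      by (subst sum.atMost_Suc) (simp add: gen_def)
    also have "(\<Sum>k\<le>m. (1 - t ^ k) * c ^ k * fps_nth (gen t c) (Suc m - k)) =
      (\<Sum>k\<le>m. (1 - t ^ k) * (1 - t) * c ^ Suc m)"
    proof (intro sum.cong refl)
      fix k assume "k \<in> {..m}"
      then have "c ^ Suc m = c ^ k * c ^ (Suc m - k)" "Suc m - k \<noteq> 0" by (simp_all flip: power_add)
      then show "(1 - t ^ k) * c ^ k * fps_nth (gen t c) (Suc m - k) = (1 - t ^ k) * (1 - t) * c ^ Suc m"
        by (simp add: gen_def)
    qed
    also have "\<dots> = (real (Suc m) * (1 - t) - 1 + t ^ Suc m) * c ^ Suc m"
      unfolding s[symmetric] by (rule sum_distrib_right[symmetric])
    finally show ?thesis using Suc by (simp add: gen_def algebra_simps)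
  qed
qed

lemma gen_list_log_deriv:
  "fps_X * fps_deriv (prod_list (map (gen t) cs)) =
    Abs_fps (\<lambda>k. (1 - t ^ k) * (\<Sum>c\<leftarrow>cs. c ^ k)) * prod_list (map (gen t) cs)"
proof (induction cs)
  case Nil
  show ?case by (simp add: fps_ext)
next
  case (Cons c cs)
  have "Abs_fps (\<lambda>k. (1 - t ^ k) * (\<Sum>c\<leftarrow>c # cs. c ^ k)) =
    Abs_fps (\<lambda>k. (1 - t ^ k) * c ^ k) + Abs_fps (\<lambda>k. (1 - t ^ k) * (\<Sum>c\<leftarrow>cs. c ^ k))"
    by (rule fps_ext) (simp add: distrib_left)
  moreover have "fps_X * fps_deriv (gen t c * prod_list (map (gen t) cs)) =
    (fps_X * fps_deriv (gen t c)) * prod_list (map (gen t) cs) +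
      gen t c * (fps_X * fps_deriv (prod_list (map (gen t) cs)))"
    by (simp add: algebra_simps)
  ultimately show ?case
    unfolding list.map prod_list.Cons Cons.IH gen_log_deriv by (simp add: algebra_simps)
qed

lemma hl_norm_add_mset:
  "hl_norm t (add_mset k \<nu>) = hl_norm t \<nu> * (real k * real (Suc (count \<nu> k)) * inverse (1 - t ^ k))"
proof -
  define g :: "nat \<Rightarrow> nat \<Rightarrow> real" where "g i m = real i ^ m * fact m" for i m
  have S: "(\<Prod>i\<in>set_mset \<mu>. g i (count \<mu> i)) = (\<Prod>i\<in>insert k (set_mset \<nu>). g i (count \<mu> i))"
    if "set_mset \<mu> \<subseteq> insert k (set_mset \<nu>)" for \<mu>
    by (rule prod.mono_neutral_left) (use that in \<open>auto simp: g_def not_in_iff\<close>)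
  have "(\<Prod>i\<in>set_mset (add_mset k \<nu>). g i (count (add_mset k \<nu>) i)) =
      (\<Prod>i\<in>insert k (set_mset \<nu>). g i (count \<nu> i) * (if i = k then real k * real (Suc (count \<nu> k)) else 1))"
    by (intro prod.cong) (auto simp: g_def)
  also have "\<dots> = (\<Prod>i\<in>set_mset \<nu>. g i (count \<nu> i)) * (real k * real (Suc (count \<nu> k)))"
    by (subst S[of \<nu>]) (auto simp: prod.distrib)
  finally show ?thesis by (simp add: hl_norm_def g_def)
qed

text \<open>The degree is the sum of all k times their multiplicities. By
  \<open>hl_norm_add_mset\<close>, taking away a part \<open>k\<close> turns \<open>k\<close> times
  its multiplicity times the weight of \<open>\<mu>\<close> into \<open>(1 - t ^ k) * s k\<close>
  times the weight of the rest.\<close>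

lemma power_sum_series:
  assumes t: "0 \<le> t" "t < 1"
  shows "fps_X * fps_deriv (Abs_fps (\<lambda>n. \<Sum>\<mu>\<in>Par n. (\<Prod>k\<in>#\<mu>. s k) / hl_norm t \<mu>)) =
    Abs_fps (\<lambda>k. (1 - t ^ k) * s k) * Abs_fps (\<lambda>n. \<Sum>\<mu>\<in>Par n. (\<Prod>k\<in>#\<mu>. s k) / hl_norm t \<mu>)"
proof (rule fps_ext)
  fix n
  define w where "w \<mu> = (\<Prod>k\<in>#\<mu>. s k) / hl_norm t \<mu>" for \<mu>
  have w: "real k * real (count (add_mset k \<nu>) k) * w (add_mset k \<nu>) = (1 - t ^ k) * s k * w \<nu>" if "k \<noteq> 0" for k \<nu>
  proof -
    have A: "1 - t ^ k \<noteq> 0" using t that by (simp add: power_less_one_iff less_imp_neq)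
    have "a * c * (s' * P / (N * (a * c * inverse A))) = A * s' * (P / N)"
      if "a \<noteq> 0" "c \<noteq> 0" "A \<noteq> 0" for a c s' P N A :: real
      using that by (simp add: field_simps)
    from this[of "real k" "real (Suc (count \<nu> k))" "1 - t ^ k" "s k"] show ?thesis
      using that A by (simp add: w_def hl_norm_add_mset)
  qed
  have "fps_nth (fps_X * fps_deriv (Abs_fps (\<lambda>n. \<Sum>\<mu>\<in>Par n. w \<mu>))) n = real n * (\<Sum>\<mu>\<in>Par n. w \<mu>)"
    by (cases n) auto
  also have "\<dots> = (\<Sum>\<mu>\<in>Par n. \<Sum>k=1..n. real k * real (count \<mu> k) * w \<mu>)"
    unfolding sum_distrib_left
  proof (intro sum.cong refl)
    fix \<mu> assume \<mu>: "\<mu> \<in> Par n"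
    have "set_mset \<mu> \<subseteq> {1..n}"
    proof
      fix k assume k: "k \<in># \<mu>"
      then have "k \<le> n" using \<mu> sum_mset.remove[OF k] by (simp add: Par_def)
      moreover have "k \<noteq> 0" using k \<mu> by (auto simp: Par_def partitions_def intro!: Nat.gr0I)
      ultimately show "k \<in> {1..n}" by simp
    qed
    then have "sum_mset \<mu> = (\<Sum>k=1..n. count \<mu> k * k)"
    proof (induction \<mu>)
      case (add x \<mu>)
      have "(\<Sum>k=1..n. count (add_mset x \<mu>) k * k) = (\<Sum>k=1..n. count \<mu> k * k + (if k = x then x else 0))"
        by (intro sum.cong) auto
      then show ?case using add by (simp add: sum.distrib)
    qed simp
    then have "real n = (\<Sum>k=1..n. real (count \<mu> k) * real k)"
      using \<mu> by (simp add: Par_def flip: of_nat_mult of_nat_sum)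
    then have "real n * w \<mu> = (\<Sum>k=1..n. real (count \<mu> k) * real k) * w \<mu>"
      by (rule arg_cong)
    also have "\<dots> = (\<Sum>k=1..n. real (count \<mu> k) * real k * w \<mu>)"
      by (rule sum_distrib_right)
    finally show "real n * w \<mu> = (\<Sum>k=1..n. real k * real (count \<mu> k) * w \<mu>)"
      by (simp only: mult.commute[of "real _" "real _"] mult.assoc mult.left_commute)
  qed
  also have "\<dots> = (\<Sum>k=1..n. \<Sum>\<mu>\<in>Par n. real k * real (count \<mu> k) * w \<mu>)"
    by (rule sum.swap)
  also have "\<dots> = (\<Sum>k=1..n. (1 - t ^ k) * s k * (\<Sum>\<nu>\<in>Par (n - k). w \<nu>))"
  proof (intro sum.cong refl)
    fix k assume k: "k \<in> {1..n}"
    have "(\<Sum>\<mu>\<in>Par n. real k * real (count \<mu> k) * w \<mu>) = (\<Sum>\<mu>\<in>add_mset k ` Par (n - k). real k * real (count \<mu> k) * w \<mu>)"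
    proof (rule sum.mono_neutral_right)
      show "\<forall>\<mu>\<in>Par n - add_mset k ` Par (n - k). real k * real (count \<mu> k) * w \<mu> = 0"
      proof
        fix \<mu> assume *: "\<mu> \<in> Par n - add_mset k ` Par (n - k)"
        have "k \<notin># \<mu>"
        proof
          assume "k \<in># \<mu>"
          then obtain \<nu> where "\<mu> = add_mset k \<nu>" by (metis insert_DiffM)
          then show False using * by (auto simp: Par_def partitions_def)
        qed
        then show "real k * real (count \<mu> k) * w \<mu> = 0" by (simp add: not_in_iff)
      qed
      show "add_mset k ` Par (n - k) \<subseteq> Par n"
        using k by (auto simp: Par_def partitions_def)
    qed simp
    also have "\<dots> = (\<Sum>\<nu>\<in>Par (n - k). (1 - t ^ k) * s k * w \<nu>)"
      using k w by (subst sum.reindex) (auto simp: inj_on_def simp del: count_add_mset intro!: sum.cong)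
    finally show "(\<Sum>\<mu>\<in>Par n. real k * real (count \<mu> k) * w \<mu>) = (1 - t ^ k) * s k * (\<Sum>\<nu>\<in>Par (n - k). w \<nu>)"
      by (simp add: sum_distrib_left)
  qed
  also have "\<dots> = fps_nth (Abs_fps (\<lambda>k. (1 - t ^ k) * s k) * Abs_fps (\<lambda>n. \<Sum>\<mu>\<in>Par n. w \<mu>)) n"
    by (simp add: fps_mult_nth sum.atLeast_Suc_atMost)
  finally show "fps_nth (fps_X * fps_deriv (Abs_fps (\<lambda>n. \<Sum>\<mu>\<in>Par n. (\<Prod>k\<in>#\<mu>. s k) / hl_norm t \<mu>))) n =
    fps_nth (Abs_fps (\<lambda>k. (1 - t ^ k) * s k) * Abs_fps (\<lambda>n. \<Sum>\<mu>\<in>Par n. (\<Prod>k\<in>#\<mu>. s k) / hl_norm t \<mu>)) n"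
    by (simp only: w_def)
qed

definition psum :: "nat multiset \<Rightarrow> real list \<Rightarrow> real" where
  "psum \<mu> xs = (\<Prod>k\<in>#\<mu>. \<Sum>x\<leftarrow>xs. x ^ k)"

text \<open>Both sides are coefficients of series with the same logarithmic derivative, because the
  power sums of all products x y factor into those of \<open>xs\<close> and
  \<open>ys\<close>.\<close>

theorem cauchy_identity:
  assumes t: "0 \<le> t" "t < 1"
  shows "(\<Sum>\<rho>\<in>Par n. hlF t \<rho> xs * hlG t \<rho> ys) = (\<Sum>\<mu>\<in>Par n. psum \<mu> xs * psum \<mu> ys / hl_norm t \<mu>)"
proof -
  define cs where "cs = concat (map (\<lambda>x. map (\<lambda>y. x * y) ys) xs)"
  define s where "s k = (\<Sum>x\<leftarrow>xs. x ^ k) * (\<Sum>y\<leftarrow>ys. y ^ k)" for k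
  have "(\<Sum>y\<leftarrow>ys. (x * y) ^ k) = x ^ k * (\<Sum>y\<leftarrow>ys. y ^ k)" for x k
    by (simp add: power_mult_distrib sum_list_const_mult)
  then have s: "(\<Sum>c\<leftarrow>cs. c ^ k) = s k" for k
    unfolding cs_def s_def by (induction xs) (simp_all add: o_def distrib_right)
  have K: "prod_list (map (\<lambda>x. genl t x ys) xs) = prod_list (map (gen t) cs)"
    unfolding cs_def genl_def by (induction xs) (simp_all add: o_def)
  define Z where "Z = Abs_fps (\<lambda>n. \<Sum>\<mu>\<in>Par n. (\<Prod>k\<in>#\<mu>. s k) / hl_norm t \<mu>)"
  have "Z = prod_list (map (gen t) cs)"
  proof (rule newton_unique)
    show "fps_X * fps_deriv Z = Abs_fps (\<lambda>k. (1 - t ^ k) * s k) * Z"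
      unfolding Z_def by (rule power_sum_series[OF t])
    show "fps_X * fps_deriv (prod_list (map (gen t) cs)) = Abs_fps (\<lambda>k. (1 - t ^ k) * s k) * prod_list (map (gen t) cs)"
      using gen_list_log_deriv[of t cs] by (simp add: s)
    have "fps_nth (prod_list (map (gen t) cs)) 0 = 1"
      by (induction cs) (simp_all add: gen_def)
    then show "fps_nth Z 0 = fps_nth (prod_list (map (gen t) cs)) 0"
      by (simp add: Z_def hl_norm_def)
  qed simp
  then have "fps_nth (Abs_fps (\<lambda>n. \<Sum>\<rho>\<in>Par n. hlF t \<rho> xs * hlG t \<rho> ys)) n = fps_nth Z n"
    unfolding cauchy_product K by simp
  moreover have "(\<Prod>k\<in>#\<mu>. s k) = psum \<mu> xs * psum \<mu> ys" for \<mu>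
    by (simp add: psum_def s_def prod_mset.distrib)
  ultimately show ?thesis by (simp add: Z_def)
qed

section \<open>Linear independence and the power sum expansion\<close>

lemma sum_partitions_le:
  fixes g :: "nat multiset \<Rightarrow> 'a :: comm_monoid_add"
  shows "(\<Sum>\<mu> | \<mu> \<in> partitions \<and> sum_mset \<mu> \<le> n. g \<mu>) = (\<Sum>r\<le>n. \<Sum>\<mu>\<in>Par (n - r). g \<mu>)"
proof -
  have "(\<Sum>\<mu> | \<mu> \<in> partitions \<and> sum_mset \<mu> \<le> n. g \<mu>) =
    (\<Sum>r\<le>n. \<Sum>\<mu> | \<mu> \<in> {\<mu> \<in> partitions. sum_mset \<mu> \<le> n} \<and> n - sum_mset \<mu> = r. g \<mu>)"
    by (rule sum.group[symmetric]) auto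
  also have "\<dots> = (\<Sum>r\<le>n. \<Sum>\<mu>\<in>Par (n - r). g \<mu>)"
    by (intro sum.cong) (auto simp: Par_def)
  finally show ?thesis .
qed

text \<open>Displays the function as a polynomial in its first variable, so that coefficients can be
  compared.\<close>

lemma hlF_Cons:
  "hlF t \<rho> (x # xs) = (\<Sum>r\<le>sum_mset \<rho>. (\<Sum>\<mu>\<in>Par (sum_mset \<rho> - r). phi t \<rho> \<mu> * hlF t \<mu> xs) * x ^ r)"
  by (simp add: sum_partitions_le sum_distrib_right) (intro sum.cong refl, auto simp: Par_def)

lemma hlG_Cons:
  "hlG t \<rho> (x # xs) = (\<Sum>r\<le>sum_mset \<rho>. (\<Sum>\<mu>\<in>Par (sum_mset \<rho> - r). psi t \<rho> \<mu> * hlG t \<mu> xs) * x ^ r)"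
  by (simp add: sum_partitions_le sum_distrib_right) (intro sum.cong refl, auto simp: Par_def)

declare hlF.simps(2) [simp del] hlG.simps(2) [simp del]

lemma cols_add_mset: "cols (add_mset r \<mu>) v = cols \<mu> v + (if v \<le> r then 1 else 0)"
  by (simp add: cols_def)

lemma hstrip_add_mset: "hstrip (add_mset r \<mu>) \<mu>"
  by (simp add: hstrip_def cols_add_mset)

lemma psi_add_mset: "psi t (add_mset r \<mu>) \<mu> = 1"
  by (auto simp: psi_def hstrip_add_mset mfac_def intro!: prod.neutral)

text \<open>A strip has at most one box in each of the \<open>r\<close> columns; having
  \<open>r\<close> boxes it meets all of them, so that removing it is the same as removing one
  longest row.\<close>

lemma hstrip_remove_row:
  assumes h: "hstrip \<rho> \<mu>" and p: "\<rho> \<in> partitions" "\<mu> \<in> partitions"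
    and r: "r \<noteq> 0" "\<And>k. k \<in># \<rho> \<Longrightarrow> k \<le> r" and s: "sum_mset \<rho> = sum_mset \<mu> + r"
  shows "\<rho> = add_mset r \<mu>"
proof -
  have c0: "cols \<rho> v = 0" "cols \<mu> v = 0" if "r < v" for v
  proof -
    show "cols \<rho> v = 0" using r(2) that by (fastforce simp: cols_eq_0)
    then show "cols \<mu> v = 0" using h that by (metis hstrip_def le_zero_eq less_one not_le not_less_zero)
  qed
  have r': "k \<le> r" if "k \<in># \<mu>" for k
    using c0(2)[of "Suc r"] that by (auto simp: cols_eq_0)
  have "(\<Sum>v=1..r. Suc (cols \<mu> v) - cols \<rho> v) = (\<Sum>v=1..r. Suc (cols \<mu> v)) - (\<Sum>v=1..r. cols \<rho> v)"
    by (rule sum_subtractf_nat) (use h in \<open>auto simp: hstrip_def\<close>)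
  also have "(\<Sum>v=1..r. Suc (cols \<mu> v)) = (\<Sum>v=1..r. cols \<mu> v) + r"
    using sum.distrib[of "cols \<mu>" "\<lambda>_. 1" "{1..r}"] by simp
  also have "(\<Sum>v=1..r. cols \<mu> v) + r - (\<Sum>v=1..r. cols \<rho> v) = 0"
    using s sum_mset_cols[OF r'] sum_mset_cols[OF r(2)] by simp
  finally have eq: "Suc (cols \<mu> v) \<le> cols \<rho> v" if "v \<in> {1..r}" for v
    using that by simp
  show ?thesis
  proof (rule partitions_eqI[OF p(1)])
    show "add_mset r \<mu> \<in> partitions" using p(2) r(1) by (simp add: partitions_def)
    fix v :: nat assume v: "1 \<le> v"
    show "cols \<rho> v = cols (add_mset r \<mu>) v"
    proof (cases "v \<le> r")
      case True
      then show ?thesis using eq[of v] v h by (auto simp: cols_add_mset hstrip_def intro!: antisym)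
    next
      case False
      then show ?thesis using c0[of v] by (simp add: cols_add_mset)
    qed
  qed
qed

lemma power_sub_ne_0: "0 < t \<Longrightarrow> t < 1 \<Longrightarrow> k \<noteq> 0 \<Longrightarrow> 1 - t ^ k \<noteq> (0 :: real)"
  by (metis less_irrefl power_less_one_iff zero_le_one eq_iff_diff_eq_0 less_le gr0I not_less_iff_gr_or_eq)

lemma hlb_pos: "0 < t \<Longrightarrow> t < 1 \<Longrightarrow> 0 < hlb t \<rho>"
  unfolding hlb_def by (intro prod_pos) (auto simp: power_less_one_iff)

lemma hl_norm_pos: "0 < t \<Longrightarrow> t < 1 \<Longrightarrow> \<mu> \<in> partitions \<Longrightarrow> 0 < hl_norm t \<mu>"
proof (induction \<mu>)
  case empty
  then show ?case by (simp add: hl_norm_def)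
next
  case (add k \<mu>)
  then have "\<mu> \<in> partitions" "0 < k" by (auto simp: partitions_def)
  moreover have "0 < 1 - t ^ k" using add.prems \<open>0 < k\<close> by (simp add: power_less_one_iff)
  ultimately show ?case using add by (simp add: hl_norm_add_mset)
qed

lemma phi_ne_0:
  assumes "0 < t" "t < 1" "hstrip \<rho> \<mu>" shows "phi t \<rho> \<mu> \<noteq> 0"
proof -
  have "mfac t a b \<noteq> 0" for a b
    using power_sub_ne_0[OF assms(1,2), of a] by (cases a) (auto simp: mfac_def)
  then show ?thesis using assms(3) by (simp add: phi_def)
qed

lemma polynomial_coeffs_0:
  fixes c :: "nat \<Rightarrow> real"
  assumes "\<And>x. (\<Sum>r\<le>n. c r * x ^ r) = 0" "r \<le> n"
  shows "c r = 0"
  using assms polyfun_eq_0[of c n] by auto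

lemma hlF_independent:
  assumes t: "0 < t" "t < 1"
    and "\<And>xs. (\<Sum>\<rho>\<in>Par n. c \<rho> * hlF t \<rho> xs) = 0" "\<rho> \<in> Par n"
  shows "c \<rho> = 0"
  using assms(3,4)
proof (induction n arbitrary: c \<rho> rule: less_induct)
  case (less n)
  show ?case
  proof (cases "n = 0")
    case True
    then show ?thesis using less.prems(1)[of "[]"] less.prems(2) by simp
  next
    case False
    \<comment> \<open>The coefficient of \<open>x ^ r\<close> in the relation for
      \<open>x # xs\<close>. Since \<open>r \<ge> 1\<close> lowers the degree, the induction
      hypothesis separates the different \<open>\<mu>\<close>.\<close>
    have c': "(\<Sum>\<rho>\<in>Par n. c \<rho> * phi t \<rho> \<mu>) = 0" if r: "1 \<le> r" "r \<le> n" and \<mu>: "\<mu> \<in> Par (n - r)" for r \<mu>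
    proof (rule less.IH[OF _ _ \<mu>])
      show "n - r < n" using r by simp
      fix xs
      have *: "(\<Sum>r\<le>n. (\<Sum>\<rho>\<in>Par n. \<Sum>\<mu>\<in>Par (n - r). c \<rho> * phi t \<rho> \<mu> * hlF t \<mu> xs) * x ^ r) = 0" for x
      proof -
        have "(\<Sum>r\<le>n. (\<Sum>\<rho>\<in>Par n. \<Sum>\<mu>\<in>Par (n - r). c \<rho> * phi t \<rho> \<mu> * hlF t \<mu> xs) * x ^ r) =
          (\<Sum>r\<le>n. \<Sum>\<rho>\<in>Par n. c \<rho> * ((\<Sum>\<mu>\<in>Par (n - r). phi t \<rho> \<mu> * hlF t \<mu> xs) * x ^ r))"
          by (simp add: sum_distrib_left sum_distrib_right mult_ac)
        also have "\<dots> = (\<Sum>\<rho>\<in>Par n. c \<rho> * hlF t \<rho> (x # xs))"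
          by (subst sum.swap) (auto simp: hlF_Cons Par_def sum_distrib_left intro!: sum.cong)
        finally show ?thesis using less.prems(1) by simp
      qed
      have "(\<Sum>\<rho>\<in>Par n. \<Sum>\<mu>\<in>Par (n - r). c \<rho> * phi t \<rho> \<mu> * hlF t \<mu> xs) = 0"
        using polynomial_coeffs_0[OF *] r by blast
      then show "(\<Sum>\<mu>\<in>Par (n - r). (\<Sum>\<rho>\<in>Par n. c \<rho> * phi t \<rho> \<mu>) * hlF t \<mu> xs) = 0"
        by (subst (asm) sum.swap) (simp add: sum_distrib_right)
    qed
    show ?thesis
    proof (rule ccontr)
      assume "c \<rho> \<noteq> 0"
      \<comment> \<open>Among the partitions with nonzero coefficient let \<open>\<tau>\<close> have
        the longest first row \<open>r\<close>, and remove this row. By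
        \<open>hstrip_remove_row\<close> no other one has a strip of size \<open>r\<close> over the
        rest.\<close>
      define S where "S = {\<rho> \<in> Par n. c \<rho> \<noteq> 0}"
      have S: "finite S" "S \<noteq> {}" using \<open>c \<rho> \<noteq> 0\<close> less.prems(2) by (auto simp: S_def)
      define M where "M \<rho> = Max (set_mset \<rho>)" for \<rho> :: "nat multiset"
      define r where "r = Max (M ` S)"
      have "r \<in> M ` S" unfolding r_def using S by (intro Max_in) auto
      then obtain \<tau> where \<tau>: "\<tau> \<in> S" "M \<tau> = r" by auto
      have ne: "\<tau>' \<noteq> {#}" if "\<tau>' \<in> S" for \<tau>' using that False by (auto simp: S_def Par_def)
      have le: "k \<le> r" if "\<tau>' \<in> S" "k \<in># \<tau>'" for \<tau>' k
      proof -
        have "k \<le> M \<tau>'" using that by (auto simp: M_def)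
        also have "\<dots> \<le> r" unfolding r_def using S that by (intro Max_ge) auto
        finally show ?thesis .
      qed
      have "M \<tau> \<in># \<tau>" unfolding M_def by (rule Max_in) (use ne[OF \<tau>(1)] in auto)
      then have "r \<in># \<tau>" using \<tau>(2) by simp
      then obtain \<mu> where \<mu>: "\<tau> = add_mset r \<mu>" by (metis insert_DiffM)
      have r: "r \<noteq> 0" "\<mu> \<in> Par (n - r)" "r \<le> n" using \<tau>(1) \<mu> by (auto simp: S_def Par_def partitions_def)
      have "(\<Sum>\<rho>\<in>Par n. c \<rho> * phi t \<rho> \<mu>) = (\<Sum>\<rho>\<in>{\<tau>}. c \<rho> * phi t \<rho> \<mu>)"
      proof (rule sum.mono_neutral_right)
        show "{\<tau>} \<subseteq> Par n" using \<tau> by (simp add: S_def)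
        show "\<forall>\<rho>\<in>Par n - {\<tau>}. c \<rho> * phi t \<rho> \<mu> = 0"
        proof
          fix \<rho> assume \<rho>: "\<rho> \<in> Par n - {\<tau>}"
          show "c \<rho> * phi t \<rho> \<mu> = 0"
          proof (rule ccontr)
            assume nz: "c \<rho> * phi t \<rho> \<mu> \<noteq> 0"
            then have "\<rho> \<in> S" "hstrip \<rho> \<mu>" using \<rho> by (auto simp: S_def phi_def split: if_splits)
            then have "\<rho> = add_mset r \<mu>"
              using le \<rho> r by (intro hstrip_remove_row) (auto simp: Par_def)
            then show False using \<mu> \<rho> by simp
          qed
        qed
      qed simp
      moreover have "(\<Sum>\<rho>\<in>Par n. c \<rho> * phi t \<rho> \<mu>) = 0"
        using c'[of r \<mu>] r by simp
      moreover have "phi t \<tau> \<mu> \<noteq> 0" using phi_ne_0[OF t] hstrip_add_mset \<mu> by simp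
      ultimately show False using \<tau> by (simp add: S_def)
    qed
  qed
qed

text \<open>The functional given by finitely many weighted points. It makes sense for all functions,
  hence can be applied to both sides of the Cauchy identity before anything is known about
  \<open>hlF\<close>.\<close>

definition point_comb :: "(real \<times> 'x) list \<Rightarrow> ('x \<Rightarrow> real) \<Rightarrow> real" where
  "point_comb w f = (\<Sum>(c, x)\<leftarrow>w. c * f x)"

lemma point_comb_sum: "finite A \<Longrightarrow> point_comb w (\<lambda>x. \<Sum>i\<in>A. a i * f i x) = (\<Sum>i\<in>A. a i * point_comb w (f i))"
  by (induction w) (auto simp: point_comb_def sum.distrib sum_distrib_left algebra_simps)

lemma point_comb_append: "point_comb (w @ w') f = point_comb w f + point_comb w' f"
  by (simp add: point_comb_def)

lemma point_comb_scale: "point_comb (map (\<lambda>(c, x). (a * c, x)) w) f = a * point_comb w f"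
  by (induction w) (auto simp: point_comb_def algebra_simps)

lemma point_comb_concat:
  "point_comb (concat (map (\<lambda>i. map (\<lambda>(c, x). (a i * c, x)) (w i)) js)) f = (\<Sum>i\<leftarrow>js. a i * point_comb (w i) f)"
  by (induction js) (simp_all add: point_comb_append point_comb_scale, simp add: point_comb_def)

text \<open>A new function has a nonzero residual with respect to the dual system built so far; a
  point where the residual survives yields the new functional, and the old ones are corrected by
  multiples of it.\<close>

lemma dual_functionals:
  assumes "finite I"
    and "\<And>c. (\<And>x. (\<Sum>i\<in>I. c i * f i x) = 0) \<Longrightarrow> (\<And>i. i \<in> I \<Longrightarrow> c i = 0)"
  shows "\<exists>w. \<forall>i\<in>I. \<forall>j\<in>I. point_comb (w i) (f j) = (if i = j then 1 else 0)"
  using assms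
proof (induction I)
  case empty
  then show ?case by simp
next
  case (insert k I)
  have "\<exists>w. \<forall>i\<in>I. \<forall>j\<in>I. point_comb (w i) (f j) = (if i = j then 1 else 0)"
  proof (rule insert.IH)
    fix c i assume *: "\<And>x. (\<Sum>i\<in>I. c i * f i x) = 0" "i \<in> I"
    have "(\<Sum>i\<in>insert k I. (c(k := 0)) i * f i x) = 0" for x
    proof -
      have "(\<Sum>i\<in>I. (c(k := 0)) i * f i x) = (\<Sum>i\<in>I. c i * f i x)"
        using insert.hyps by (intro sum.cong) auto
      then show ?thesis using insert.hyps * by simp
    qed
    then have "(c(k := 0)) i = 0" using insert.prems[of "c(k := 0)" i] * by blast
    then show "c i = 0" using * insert.hyps by (auto split: if_splits)
  qed
  then obtain w where w: "\<And>i j. i \<in> I \<Longrightarrow> j \<in> I \<Longrightarrow> point_comb (w i) (f j) = (if i = j then 1 else 0)"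
    by blast
  define a where "a i = point_comb (w i) (f k)" for i
  have "\<exists>x. f k x - (\<Sum>i\<in>I. a i * f i x) \<noteq> 0"
  proof (rule ccontr)
    assume "\<not> ?thesis"
    then have *: "f k x = (\<Sum>i\<in>I. a i * f i x)" for x by simp
    define c where "c i = (if i = k then 1 else - a i)" for i
    have "(\<Sum>i\<in>insert k I. c i * f i x) = 0" for x
    proof -
      have "(\<Sum>i\<in>I. c i * f i x) = (\<Sum>i\<in>I. - (a i * f i x))"
        using insert.hyps by (intro sum.cong) (auto simp: c_def)
      then show ?thesis using insert.hyps *[of x] by (simp add: c_def sum_negf)
    qed
    then have "c k = 0" by (rule insert.prems) simp
    then show False by (simp add: c_def)
  qed
  then obtain x where x: "f k x - (\<Sum>i\<in>I. a i * f i x) \<noteq> 0" by blast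
  define d where "d = f k x - (\<Sum>i\<in>I. a i * f i x)"
  obtain js where js: "set js = I" "distinct js" using finite_distinct_list[OF insert.hyps(1)] by blast
  \<comment> \<open>\<open>u\<close> subtracts from a function its components along the old
    \<open>f i\<close>, evaluates at \<open>x\<close> and divides by \<open>d\<close>; so it kills
    the old functions and is 1 on \<open>f k\<close>.\<close>
  define u where "u = map (\<lambda>(c, y). (inverse d * c, y)) ((1, x) # concat (map (\<lambda>i. map (\<lambda>(c, y). ((- f i x) * c, y)) (w i)) js))"
  have u: "point_comb u g = inverse d * (g x - (\<Sum>i\<in>I. f i x * point_comb (w i) g))" for g
  proof -
    have C: "point_comb ((1, x) # ws) g = g x + point_comb ws g" for ws
      by (simp add: point_comb_def)
    show ?thesis unfolding u_def point_comb_scale C point_comb_concat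
      using js by (simp add: sum_list_distinct_conv_sum_set sum_negf)
  qed
  have uk: "point_comb u (f k) = 1"
  proof -
    have "(\<Sum>i\<in>I. f i x * point_comb (w i) (f k)) = (\<Sum>i\<in>I. a i * f i x)" by (simp add: a_def mult.commute)
    then show ?thesis unfolding u using x by (simp add: d_def)
  qed
  have uj: "point_comb u (f j) = 0" if "j \<in> I" for j
  proof -
    have "(\<Sum>i\<in>I. f i x * point_comb (w i) (f j)) = (\<Sum>i\<in>I. if i = j then f i x else 0)"
      using w that by (intro sum.cong) auto
    then show ?thesis unfolding u using that insert.hyps by simp
  qed
  define w' where "w' i = (if i = k then u else w i @ map (\<lambda>(c, y). (- a i * c, y)) u)" for i
  have "point_comb (w' i) (f j) = (if i = j then 1 else 0)" if "i \<in> insert k I" "j \<in> insert k I" for i j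
  proof -
    have pw: "point_comb (w' i) g = (if i = k then point_comb u g else point_comb (w i) g - a i * point_comb u g)" for g
      unfolding w'_def using point_comb_scale[of "- a i" u g] by (simp add: point_comb_append)
    show ?thesis unfolding pw using that insert.hyps uk uj w by (auto simp: a_def)
  qed
  then show ?case by blast
qed

text \<open>The squared Frobenius norm of \<open>M\<^sup>T M - 1\<close> is the number of columns minus the number of rows.\<close>

lemma orthogonal_transpose:
  fixes M :: "'a \<Rightarrow> 'a \<Rightarrow> real"
  assumes A: "finite A" and o: "\<And>i j. i \<in> A \<Longrightarrow> j \<in> A \<Longrightarrow> (\<Sum>k\<in>A. M i k * M j k) = (if i = j then 1 else 0)"
    and kl: "k \<in> A" "l \<in> A"
  shows "(\<Sum>i\<in>A. M i k * M i l) = (if k = l then 1 else 0)"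
proof -
  define D where "D k l = (\<Sum>i\<in>A. M i k * M i l)" for k l
  have diag: "(\<Sum>k\<in>A. D k k) = real (card A)"
  proof -
    have "(\<Sum>k\<in>A. D k k) = (\<Sum>i\<in>A. \<Sum>k\<in>A. M i k * M i k)"
      unfolding D_def by (rule sum.swap)
    also have "\<dots> = (\<Sum>i\<in>A. 1)" using o by (intro sum.cong) auto
    finally show ?thesis by simp
  qed
  have "(\<Sum>k\<in>A. \<Sum>l\<in>A. (D k l)\<^sup>2) = (\<Sum>k\<in>A. \<Sum>l\<in>A. \<Sum>i\<in>A. \<Sum>j\<in>A. (M i k * M j k) * (M i l * M j l))"
    by (simp add: D_def power2_eq_square sum_product mult_ac)
  also have "\<dots> = (\<Sum>k\<in>A. \<Sum>i\<in>A. \<Sum>l\<in>A. \<Sum>j\<in>A. (M i k * M j k) * (M i l * M j l))"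
    by (intro sum.cong refl sum.swap)
  also have "\<dots> = (\<Sum>k\<in>A. \<Sum>i\<in>A. \<Sum>j\<in>A. \<Sum>l\<in>A. (M i k * M j k) * (M i l * M j l))"
    by (intro sum.cong refl sum.swap)
  also have "\<dots> = (\<Sum>k\<in>A. \<Sum>i\<in>A. \<Sum>j\<in>A. (M i k * M j k) * (if i = j then 1 else 0))"
    by (intro sum.cong refl) (simp add: sum_distrib_left[symmetric] o)
  also have "\<dots> = (\<Sum>k\<in>A. D k k)"
    using A by (simp add: D_def if_distrib[of "\<lambda>x. _ * x"] sum.delta' cong: if_cong)
  finally have sq: "(\<Sum>k\<in>A. \<Sum>l\<in>A. (D k l)\<^sup>2) = real (card A)" using diag by simp
  have "(\<Sum>k\<in>A. \<Sum>l\<in>A. (D k l - (if k = l then 1 else 0))\<^sup>2) =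
    (\<Sum>k\<in>A. \<Sum>l\<in>A. (D k l)\<^sup>2 - 2 * (if k = l then D k l else 0) + (if k = l then 1 else 0))"
    by (intro sum.cong refl) (auto simp: power2_eq_square algebra_simps)
  also have "\<dots> = (\<Sum>k\<in>A. \<Sum>l\<in>A. (D k l)\<^sup>2) - 2 * (\<Sum>k\<in>A. D k k) + real (card A)"
    using A by (simp add: sum.distrib sum_subtractf sum.delta sum_distrib_left[symmetric])
  also have "\<dots> = 0" using sq diag by simp
  finally have "(\<Sum>k\<in>A. \<Sum>l\<in>A. (D k l - (if k = l then 1 else 0))\<^sup>2) = 0" .
  then have "\<forall>k\<in>A. (\<Sum>l\<in>A. (D k l - (if k = l then 1 else 0))\<^sup>2) = 0"
    using A by (subst (asm) sum_nonneg_eq_0_iff) (auto intro!: sum_nonneg)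
  then have "\<forall>l\<in>A. (D k l - (if k = l then 1 else 0))\<^sup>2 = 0"
    using kl A by (subst (asm) sum_nonneg_eq_0_iff) auto
  then show ?thesis using kl by (auto simp: D_def)
qed

text \<open>\<open>phi_psi\<close> telescopes along the chain of strips.\<close>

lemma hlF_hlG:
  assumes "\<rho> \<in> partitions"
  shows "hlF t \<rho> xs = hlb t \<rho> * hlG t \<rho> xs"
  using assms
proof (induction xs arbitrary: \<rho>)
  case Nil
  then show ?case by (simp add: hlb_def)
next
  case (Cons x xs)
  have "phi t \<rho> \<mu> * hlF t \<mu> xs = hlb t \<rho> * (psi t \<rho> \<mu> * hlG t \<mu> xs)" if "\<mu> \<in> Par k" for \<mu> k
  proof -
    have \<mu>: "\<mu> \<in> partitions" using that by (simp add: Par_def)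
    have "phi t \<rho> \<mu> * hlF t \<mu> xs = (phi t \<rho> \<mu> * hlb t \<mu>) * hlG t \<mu> xs"
      unfolding Cons.IH[OF \<mu>] by (simp only: mult.assoc)
    also have "\<dots> = (psi t \<rho> \<mu> * hlb t \<rho>) * hlG t \<mu> xs"
      by (simp only: phi_psi[OF Cons.prems \<mu>])
    finally show ?thesis by (simp only: mult_ac)
  qed
  then show ?case
    by (simp add: hlF_Cons hlG_Cons sum_distrib_left sum_distrib_right mult.assoc cong: sum.cong)
qed

text \<open>\<open>H\<close> holds the power sum coefficients of the functions Q of degree
  \<open>n\<close>; the second clause says that these are orthogonal with squared norm
  \<open>hlb\<close>.\<close>

definition power_sum_expansion :: "real \<Rightarrow> nat \<Rightarrow> (nat multiset \<Rightarrow> nat multiset \<Rightarrow> real) \<Rightarrow> bool" where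
  "power_sum_expansion t n H \<longleftrightarrow>
    (\<forall>\<rho>\<in>Par n. \<forall>xs. hlF t \<rho> xs = (\<Sum>\<mu>\<in>Par n. H \<rho> \<mu> * psum \<mu> xs)) \<and>
    (\<forall>\<rho>\<in>Par n. \<forall>\<kappa>\<in>Par n. (\<Sum>\<mu>\<in>Par n. H \<rho> \<mu> * H \<kappa> \<mu> * hl_norm t \<mu>) = (if \<rho> = \<kappa> then hlb t \<rho> else 0))"

text \<open>Two kernels \<open>\<Sum>\<^sub>i f\<^sub>i(x) f\<^sub>i(y) = \<Sum>\<^sub>j e\<^sub>j(x) e\<^sub>j(y)\<close> with independent \<open>f\<^sub>i\<close> are related by a matrix with
  orthonormal rows; here this is applied to the Cauchy kernel, with weights.\<close>

lemma power_sum_expansion_exists: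
  assumes t: "0 < t" "t < 1"
  shows "\<exists>H. power_sum_expansion t n H"
proof -
  obtain w where w: "\<And>\<rho> \<kappa>. \<rho> \<in> Par n \<Longrightarrow> \<kappa> \<in> Par n \<Longrightarrow> point_comb (w \<rho>) (hlF t \<kappa>) = (if \<rho> = \<kappa> then 1 else 0)"
  proof -
    have "\<exists>w. \<forall>i\<in>Par n. \<forall>j\<in>Par n. point_comb (w i) (hlF t j) = (if i = j then 1 else 0)"
      by (rule dual_functionals[OF finite_Par]) (rule hlF_independent[OF t])
    then show ?thesis using that by blast
  qed
  define H where "H \<rho> \<mu> = hlb t \<rho> * point_comb (w \<rho>) (psum \<mu>) / hl_norm t \<mu>" for \<rho> \<mu>
  have b: "hlb t \<rho> \<noteq> 0" for \<rho> using hlb_pos[OF t] by (simp add: less_imp_neq[symmetric])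
  have z: "hl_norm t \<mu> \<noteq> 0" if "\<mu> \<in> Par n" for \<mu> using hl_norm_pos[OF t, of \<mu>] that by (auto simp: Par_def)
  \<comment> \<open>The dual functional acts on the first set of variables of the Cauchy identity:
    one side leaves only \<open>hlG t \<rho> ys\<close>, the other a combination of power sums of
    \<open>ys\<close>.\<close>
  have G: "hlG t \<rho> ys = (\<Sum>\<mu>\<in>Par n. psum \<mu> ys / hl_norm t \<mu> * point_comb (w \<rho>) (psum \<mu>))" if \<rho>: "\<rho> \<in> Par n" for \<rho> ys
  proof -
    have "(\<lambda>xs. \<Sum>\<kappa>\<in>Par n. hlG t \<kappa> ys * hlF t \<kappa> xs) = (\<lambda>xs. \<Sum>\<mu>\<in>Par n. (psum \<mu> ys / hl_norm t \<mu>) * psum \<mu> xs)"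
      using cauchy_identity[where n = n and ys = ys] t by (simp add: mult_ac)
    then have "point_comb (w \<rho>) (\<lambda>xs. \<Sum>\<kappa>\<in>Par n. hlG t \<kappa> ys * hlF t \<kappa> xs) =
      point_comb (w \<rho>) (\<lambda>xs. \<Sum>\<mu>\<in>Par n. (psum \<mu> ys / hl_norm t \<mu>) * psum \<mu> xs)" by (rule arg_cong)
    then have "(\<Sum>\<kappa>\<in>Par n. hlG t \<kappa> ys * point_comb (w \<rho>) (hlF t \<kappa>)) =
      (\<Sum>\<mu>\<in>Par n. (psum \<mu> ys / hl_norm t \<mu>) * point_comb (w \<rho>) (psum \<mu>))"
      by (simp only: point_comb_sum[OF finite_Par])
    moreover have "(\<Sum>\<kappa>\<in>Par n. hlG t \<kappa> ys * point_comb (w \<rho>) (hlF t \<kappa>)) = (\<Sum>\<kappa>\<in>Par n. if \<rho> = \<kappa> then hlG t \<kappa> ys else 0)"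
      using w \<rho> by (intro sum.cong) auto
    ultimately show ?thesis using \<rho> by simp
  qed
  have "hlF t \<rho> xs = (\<Sum>\<mu>\<in>Par n. H \<rho> \<mu> * psum \<mu> xs)" if "\<rho> \<in> Par n" for \<rho> xs
  proof -
    have "\<rho> \<in> partitions" using that by (simp add: Par_def)
    then show ?thesis unfolding hlF_hlG[OF \<open>\<rho> \<in> partitions\<close>] G[OF that]
      by (simp add: H_def sum_distrib_left mult_ac)
  qed
  moreover have "(\<Sum>\<mu>\<in>Par n. H \<rho> \<mu> * H \<kappa> \<mu> * hl_norm t \<mu>) = (if \<rho> = \<kappa> then hlb t \<rho> else 0)"
    if \<rho>: "\<rho> \<in> Par n" and \<kappa>: "\<kappa> \<in> Par n" for \<rho> \<kappa>
  proof -
    have "(\<Sum>\<mu>\<in>Par n. H \<rho> \<mu> * H \<kappa> \<mu> * hl_norm t \<mu>) =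
      hlb t \<rho> * hlb t \<kappa> * (\<Sum>\<mu>\<in>Par n. point_comb (w \<rho>) (psum \<mu>) / hl_norm t \<mu> * point_comb (w \<kappa>) (psum \<mu>))"
      unfolding sum_distrib_left using z by (intro sum.cong) (auto simp: H_def)
    also have "(\<Sum>\<mu>\<in>Par n. point_comb (w \<rho>) (psum \<mu>) / hl_norm t \<mu> * point_comb (w \<kappa>) (psum \<mu>)) =
      point_comb (w \<kappa>) (hlG t \<rho>)"
    proof -
      have "hlG t \<rho> = (\<lambda>ys. \<Sum>\<mu>\<in>Par n. (point_comb (w \<rho>) (psum \<mu>) / hl_norm t \<mu>) * psum \<mu> ys)"
        using G[OF \<rho>] by (auto simp: mult_ac)
      then show ?thesis by (simp only: point_comb_sum[OF finite_Par])
    qed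
    also have "hlG t \<rho> = (\<lambda>ys. \<Sum>i\<in>{\<rho>}. inverse (hlb t \<rho>) * hlF t i ys)"
      using hlF_hlG[of \<rho> t] \<rho> b by (auto simp: Par_def)
    also have "point_comb (w \<kappa>) \<dots> = inverse (hlb t \<rho>) * (if \<kappa> = \<rho> then 1 else 0)"
      by (subst point_comb_sum) (use w[OF \<kappa> \<rho>] in simp_all)
    finally show ?thesis using b by auto
  qed
  ultimately show ?thesis unfolding power_sum_expansion_def by blast
qed

text \<open>Rescaling by square roots of the positive numbers \<open>hl_norm\<close> and
  \<open>hlb\<close> turns \<open>H\<close> into a square matrix with orthonormal rows, whose
  columns are then orthonormal too.\<close>

lemma power_sum_expansion_transpose:
  assumes t: "0 < t" "t < 1" and H: "power_sum_expansion t n H" and \<mu>: "\<mu> \<in> Par n" and \<nu>: "\<nu> \<in> Par n"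
  shows "(\<Sum>\<rho>\<in>Par n. H \<rho> \<mu> * H \<rho> \<nu> / hlb t \<rho>) = (if \<mu> = \<nu> then 1 / hl_norm t \<mu> else 0)"
proof -
  have b: "0 < hlb t \<rho>" for \<rho> using hlb_pos[OF t] .
  have z: "0 < hl_norm t \<mu>" if "\<mu> \<in> Par n" for \<mu> using hl_norm_pos[OF t, of \<mu>] that by (auto simp: Par_def)
  define M where "M \<rho> \<mu> = H \<rho> \<mu> * (sqrt (hl_norm t \<mu>) / sqrt (hlb t \<rho>))" for \<rho> \<mu>
  have "(\<Sum>\<rho>\<in>Par n. M \<rho> \<mu> * M \<rho> \<nu>) = (if \<mu> = \<nu> then 1 else 0)"
  proof (rule orthogonal_transpose[OF finite_Par _ \<mu> \<nu>])
    fix \<rho> \<kappa> assume *: "\<rho> \<in> Par n" "\<kappa> \<in> Par n"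
    have "(\<Sum>\<mu>\<in>Par n. M \<rho> \<mu> * M \<kappa> \<mu>) = (\<Sum>\<mu>\<in>Par n. H \<rho> \<mu> * H \<kappa> \<mu> * hl_norm t \<mu>) / (sqrt (hlb t \<rho>) * sqrt (hlb t \<kappa>))"
      unfolding sum_divide_distrib
    proof (intro sum.cong refl)
      fix \<mu> assume "\<mu> \<in> Par n"
      then have "sqrt (hl_norm t \<mu>) * sqrt (hl_norm t \<mu>) = hl_norm t \<mu>" using z by (simp add: less_imp_le)
      then show "M \<rho> \<mu> * M \<kappa> \<mu> = H \<rho> \<mu> * H \<kappa> \<mu> * hl_norm t \<mu> / (sqrt (hlb t \<rho>) * sqrt (hlb t \<kappa>))"
        by (simp add: M_def) 
    qed
    also have "\<dots> = (if \<rho> = \<kappa> then 1 else 0)"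
      using H * b[of \<rho>] by (auto simp: power_sum_expansion_def less_imp_le)
    finally show "(\<Sum>\<mu>\<in>Par n. M \<rho> \<mu> * M \<kappa> \<mu>) = (if \<rho> = \<kappa> then 1 else 0)" .
  qed
  moreover have "(\<Sum>\<rho>\<in>Par n. M \<rho> \<mu> * M \<rho> \<nu>) = sqrt (hl_norm t \<mu>) * sqrt (hl_norm t \<nu>) * (\<Sum>\<rho>\<in>Par n. H \<rho> \<mu> * H \<rho> \<nu> / hlb t \<rho>)"
    unfolding sum_distrib_left
  proof (intro sum.cong refl)
    fix \<rho>
    have "sqrt (hlb t \<rho>) * sqrt (hlb t \<rho>) = hlb t \<rho>" using b[of \<rho>] by (simp add: less_imp_le)
    then show "M \<rho> \<mu> * M \<rho> \<nu> = sqrt (hl_norm t \<mu>) * sqrt (hl_norm t \<nu>) * (H \<rho> \<mu> * H \<rho> \<nu> / hlb t \<rho>)"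
      by (simp add: M_def)
  qed
  ultimately have *: "sqrt (hl_norm t \<mu>) * sqrt (hl_norm t \<nu>) * (\<Sum>\<rho>\<in>Par n. H \<rho> \<mu> * H \<rho> \<nu> / hlb t \<rho>) = (if \<mu> = \<nu> then 1 else 0)"
    by simp
  show ?thesis
  proof (cases "\<mu> = \<nu>")
    case True
    then have "hl_norm t \<mu> * (\<Sum>\<rho>\<in>Par n. H \<rho> \<mu> * H \<rho> \<nu> / hlb t \<rho>) = 1"
      using * z[OF \<mu>] by (simp add: less_imp_le)
    then show ?thesis using True z[OF \<mu>] by (simp add: field_simps)
  next
    case False
    then show ?thesis using * z[OF \<mu>] z[OF \<nu>] by simp
  qed
qed

text \<open>Column orthogonality inverts the expansion matrix. A relation between power sums becomes
  one between the independent \<open>hlF\<close>, and its coefficients can be recovered.\<close>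

lemma psum_independent_Par:
  fixes t :: real
  assumes t: "0 < t" "t < 1"
    and 0: "\<And>xs. (\<Sum>\<mu>\<in>Par n. c \<mu> * psum \<mu> xs) = 0" and \<mu>: "\<mu> \<in> Par n"
  shows "c \<mu> = 0"
proof -
  obtain H where H: "power_sum_expansion t n H" using power_sum_expansion_exists[OF t] by blast
  have z: "hl_norm t \<mu> \<noteq> 0" if "\<mu> \<in> Par n" for \<mu> using hl_norm_pos[OF t, of \<mu>] that by (auto simp: Par_def)
  define d where "d \<rho> = (\<Sum>\<mu>\<in>Par n. c \<mu> * hl_norm t \<mu> * H \<rho> \<mu> / hlb t \<rho>)" for \<rho>
  have p: "psum \<mu> xs = (\<Sum>\<rho>\<in>Par n. hl_norm t \<mu> * H \<rho> \<mu> / hlb t \<rho> * hlF t \<rho> xs)" if \<mu>: "\<mu> \<in> Par n" for \<mu> xs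
  proof -
    have "(\<Sum>\<rho>\<in>Par n. hl_norm t \<mu> * H \<rho> \<mu> / hlb t \<rho> * hlF t \<rho> xs) =
      (\<Sum>\<rho>\<in>Par n. \<Sum>\<nu>\<in>Par n. hl_norm t \<mu> * psum \<nu> xs * (H \<rho> \<mu> * H \<rho> \<nu> / hlb t \<rho>))"
      using H by (intro sum.cong) (auto simp: power_sum_expansion_def sum_distrib_left sum_divide_distrib mult_ac)
    also have "\<dots> = (\<Sum>\<nu>\<in>Par n. hl_norm t \<mu> * psum \<nu> xs * (\<Sum>\<rho>\<in>Par n. H \<rho> \<mu> * H \<rho> \<nu> / hlb t \<rho>))"
      by (subst sum.swap) (simp add: sum_distrib_left)
    also have "\<dots> = (\<Sum>\<nu>\<in>Par n. if \<mu> = \<nu> then psum \<nu> xs else 0)"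
      using power_sum_expansion_transpose[OF t H \<mu>] z[OF \<mu>] by (intro sum.cong) auto
    finally show ?thesis using \<mu> by simp
  qed
  have "d \<rho> = 0" if "\<rho> \<in> Par n" for \<rho>
  proof (rule hlF_independent[OF t _ that])
    fix xs
    have "(\<Sum>\<rho>\<in>Par n. d \<rho> * hlF t \<rho> xs) = (\<Sum>\<rho>\<in>Par n. \<Sum>\<mu>\<in>Par n. c \<mu> * (hl_norm t \<mu> * H \<rho> \<mu> / hlb t \<rho> * hlF t \<rho> xs))"
      unfolding d_def sum_distrib_right by (intro sum.cong refl) simp
    also have "\<dots> = (\<Sum>\<mu>\<in>Par n. c \<mu> * psum \<mu> xs)"
      by (subst sum.swap) (simp add: p sum_distrib_left)
    finally show "(\<Sum>\<rho>\<in>Par n. d \<rho> * hlF t \<rho> xs) = 0" using 0 by simp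
  qed
  then have "0 = (\<Sum>\<rho>\<in>Par n. d \<rho> * H \<rho> \<mu>)" by simp
  also have "\<dots> = (\<Sum>\<rho>\<in>Par n. \<Sum>\<nu>\<in>Par n. c \<nu> * hl_norm t \<nu> * (H \<rho> \<nu> * H \<rho> \<mu> / hlb t \<rho>))"
    unfolding d_def sum_distrib_right by (intro sum.cong refl) simp
  also have "\<dots> = (\<Sum>\<nu>\<in>Par n. c \<nu> * hl_norm t \<nu> * (\<Sum>\<rho>\<in>Par n. H \<rho> \<nu> * H \<rho> \<mu> / hlb t \<rho>))"
    by (subst sum.swap) (simp add: sum_distrib_left)
  also have "\<dots> = (\<Sum>\<nu>\<in>Par n. if \<nu> = \<mu> then c \<nu> else 0)"
    using power_sum_expansion_transpose[OF t H _ \<mu>] z by (intro sum.cong) auto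
  also have "\<dots> = c \<mu>" using \<mu> by simp
  finally show ?thesis by simp
qed

lemma psum_scale: "psum \<mu> (map ((*) a) xs) = a ^ sum_mset \<mu> * psum \<mu> xs"
proof (induction \<mu>)
  case (add k \<mu>)
  have "(\<Sum>x\<leftarrow>map ((*) a) xs. x ^ k) = a ^ k * (\<Sum>x\<leftarrow>xs. x ^ k)"
    by (simp add: o_def power_mult_distrib sum_list_const_mult)
  then show ?case using add by (simp add: psum_def power_add)
qed (simp add: psum_def)

text \<open>Scaling all variables by \<open>a\<close> multiplies p_\<mu> by
  \<open>a ^ sum_mset \<mu>\<close>, so a relation splits into homogeneous ones.\<close>

lemma psum_independent:
  assumes S: "finite S" "S \<subseteq> partitions"
    and 0: "\<And>xs. (\<Sum>\<mu>\<in>S. c \<mu> * psum \<mu> xs) = 0" and \<mu>: "\<mu> \<in> S"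
  shows "c \<mu> = 0"
proof -
  define n where "n = sum_mset \<mu>"
  define B where "B = Max (sum_mset ` S)"
  have B: "sum_mset \<nu> \<le> B" if "\<nu> \<in> S" for \<nu>
    unfolding B_def using S that by (intro Max_ge) auto
  define c' where "c' \<nu> = (if \<nu> \<in> S then c \<nu> else 0)" for \<nu>
  have "c' \<mu> = 0"
  \<comment> \<open>Power sums do not involve \<open>t\<close>; any value strictly between 0 and 1
    would serve.\<close>
  proof (rule psum_independent_Par[where t = "1/2" and n = n])
    fix xs
    have "(\<Sum>r\<le>B. (\<Sum>\<nu> | \<nu> \<in> S \<and> sum_mset \<nu> = r. c \<nu> * psum \<nu> xs) * a ^ r) = 0" for a
    proof -
      have "(\<Sum>r\<le>B. (\<Sum>\<nu> | \<nu> \<in> S \<and> sum_mset \<nu> = r. c \<nu> * psum \<nu> xs) * a ^ r) =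
        (\<Sum>r\<le>B. \<Sum>\<nu> | \<nu> \<in> S \<and> sum_mset \<nu> = r. c \<nu> * psum \<nu> (map ((*) a) xs))"
        unfolding psum_scale sum_distrib_right by (intro sum.cong) (auto simp: mult_ac)
      also have "\<dots> = (\<Sum>\<nu>\<in>S. c \<nu> * psum \<nu> (map ((*) a) xs))"
        by (rule sum.group) (use S B in auto)
      finally show ?thesis using 0 by simp
    qed
    then have "(\<Sum>\<nu> | \<nu> \<in> S \<and> sum_mset \<nu> = n. c \<nu> * psum \<nu> xs) = 0"
      by (rule polynomial_coeffs_0) (use B \<mu> n_def in auto)
    also have "(\<Sum>\<nu> | \<nu> \<in> S \<and> sum_mset \<nu> = n. c \<nu> * psum \<nu> xs) = (\<Sum>\<nu>\<in>Par n. c' \<nu> * psum \<nu> xs)"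
      by (rule sum.mono_neutral_cong_left) (use S in \<open>auto simp: c'_def Par_def\<close>)
    finally show "(\<Sum>\<nu>\<in>Par n. c' \<nu> * psum \<nu> xs) = 0" .
  qed (use \<mu> S in \<open>auto simp: n_def Par_def\<close>)
  then show ?thesis using \<mu> by (simp add: c'_def)
qed

section \<open>Monomial expansions\<close>

definition mon :: "real list \<Rightarrow> nat list \<Rightarrow> real" where
  "mon xs a = (\<Prod>i<length xs. (xs ! i) ^ (a ! i))"

definition comps :: "nat \<Rightarrow> nat \<Rightarrow> nat list set" where
  "comps k n = {a. length a = k \<and> sum_list a = n}"

text \<open>The coefficient in P_\<rho> of the monomial with exponents \<open>a\<close>: a sum over
  chains of strips of prescribed sizes.\<close>

primrec hlc :: "real \<Rightarrow> nat multiset \<Rightarrow> nat list \<Rightarrow> real" where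
  "hlc t \<rho> [] = (if \<rho> = {#} then 1 else 0)"
| "hlc t \<rho> (r # a) = (if r \<le> sum_mset \<rho> then \<Sum>\<mu>\<in>Par (sum_mset \<rho> - r). psi t \<rho> \<mu> * hlc t \<mu> a else 0)"

lemma mon_Cons: "mon (x # xs) (r # a) = x ^ r * mon xs a"
  unfolding mon_def length_Cons by (subst prod.lessThan_Suc_shift) simp

lemma finite_comps [simp]: "finite (comps k n)"
proof (rule finite_subset)
  show "comps k n \<subseteq> {a. set a \<subseteq> {..n} \<and> length a = k}"
    using member_le_sum_list by (fastforce simp: comps_def)
qed (rule finite_lists_length_eq, simp)

lemma comps_0: "comps 0 n = (if n = 0 then {[]} else {})"
  by (auto simp: comps_def)

lemma sum_comps_Suc:
  fixes g :: "nat list \<Rightarrow> 'a :: comm_monoid_add"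
  shows "(\<Sum>a\<in>comps (Suc k) n. g a) = (\<Sum>r\<le>n. \<Sum>a\<in>comps k (n - r). g (r # a))"
proof -
  have "(\<Sum>r\<le>n. \<Sum>a\<in>comps k (n - r). g (r # a)) = (\<Sum>(r, a)\<in>Sigma {..n} (\<lambda>r. comps k (n - r)). g (r # a))"
    by (rule sum.Sigma) auto
  also have "\<dots> = (\<Sum>a\<in>comps (Suc k) n. g a)"
    by (rule sum.reindex_bij_witness[of _ "\<lambda>a. (hd a, tl a)" "\<lambda>(r, a). r # a"])
       (auto simp: comps_def length_Suc_conv)
  finally show ?thesis ..
qed

lemma hlG_mon: "\<rho> \<in> partitions \<Longrightarrow> hlG t \<rho> xs = (\<Sum>a\<in>comps (length xs) (sum_mset \<rho>). hlc t \<rho> a * mon xs a)"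
proof (induction xs arbitrary: \<rho>)
  case Nil
  have "\<rho> = {#}" if "sum_mset \<rho> = 0" using Par_0 that Nil by (auto simp: Par_def)
  then show ?case by (auto simp: comps_0 mon_def)
next
  case (Cons x xs)
  define n where "n = sum_mset \<rho>"
  have IH: "hlG t \<mu> xs = (\<Sum>a\<in>comps (length xs) k. hlc t \<mu> a * mon xs a)" if "\<mu> \<in> Par k" for \<mu> k
    using Cons.IH[of \<mu>] that by (simp add: Par_def)
  have "hlG t \<rho> (x # xs) = (\<Sum>r\<le>n. \<Sum>\<mu>\<in>Par (n - r). \<Sum>a\<in>comps (length xs) (n - r). psi t \<rho> \<mu> * (hlc t \<mu> a * mon xs a) * x ^ r)"
    unfolding hlG_Cons n_def[symmetric] sum_distrib_right
    by (intro sum.cong refl) (simp add: IH sum_distrib_left sum_distrib_right)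
  also have "\<dots> = (\<Sum>r\<le>n. \<Sum>a\<in>comps (length xs) (n - r). \<Sum>\<mu>\<in>Par (n - r). psi t \<rho> \<mu> * (hlc t \<mu> a * mon xs a) * x ^ r)"
    by (intro sum.cong refl sum.swap)
  also have "\<dots> = (\<Sum>r\<le>n. \<Sum>a\<in>comps (length xs) (n - r). hlc t \<rho> (r # a) * mon (x # xs) (r # a))"
    by (intro sum.cong refl) (simp add: n_def mon_Cons sum_distrib_right sum_distrib_left mult_ac)
  also have "\<dots> = (\<Sum>a\<in>comps (length (x # xs)) n. hlc t \<rho> a * mon (x # xs) a)"
    by (simp add: sum_comps_Suc)
  finally show ?case by (simp add: n_def)
qed

text \<open>Induction on the number of variables, reading off the coefficients of the powers of the
  first one.\<close>

lemma mon_independent: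
  assumes "finite A" "\<And>a. a \<in> A \<Longrightarrow> length a = k"
    and "\<And>xs. length xs = k \<Longrightarrow> (\<Sum>a\<in>A. c a * mon xs a) = 0" and "a \<in> A"
  shows "c a = 0"
  using assms
proof (induction k arbitrary: A c a)
  case 0
  then have "A = {[]}" by auto
  then show ?case using "0.prems"(3)[of "[]"] "0.prems"(4) by (simp add: mon_def)
next
  case (Suc k)
  obtain r a' where a: "a = r # a'" "length a' = k" using Suc.prems(2,4) by (metis length_Suc_conv)
  define R where "R = Max (hd ` A)"
  have R: "hd b \<le> R" if "b \<in> A" for b unfolding R_def using Suc.prems(1) that by (intro Max_ge) auto
  define B where "B r = {b. r # b \<in> A}" for r
  have fB: "finite (B r)" for r
    by (rule finite_subset[of _ "tl ` A"]) (use Suc.prems(1) in \<open>force simp: B_def image_iff\<close>)+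
  show ?case unfolding a(1)
  proof (rule Suc.IH[of "B r" "\<lambda>b. c (r # b)" a'])
    show "finite (B r)" by (rule fB)
    show "length b = k" if "b \<in> B r" for b using Suc.prems(2)[of "r # b"] that by (simp add: B_def)
    show "a' \<in> B r" using Suc.prems(4) a by (simp add: B_def)
    fix xs :: "real list" assume xs: "length xs = k"
    have "(\<Sum>r\<le>R. (\<Sum>b\<in>B r. c (r # b) * mon xs b) * x ^ r) = 0" for x
    proof -
      have "(\<Sum>r\<le>R. (\<Sum>b\<in>B r. c (r # b) * mon xs b) * x ^ r) = (\<Sum>r\<le>R. \<Sum>b | b \<in> A \<and> hd b = r. c b * mon (x # xs) b)"
      proof (intro sum.cong refl)
        fix r
        have "(\<Sum>b | b \<in> A \<and> hd b = r. c b * mon (x # xs) b) = (\<Sum>b\<in>B r. c (r # b) * mon (x # xs) (r # b))"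
        proof (rule sum.reindex_bij_witness[of _ "\<lambda>b. r # b" tl])
          show "r # tl b = b" if "b \<in> {b \<in> A. hd b = r}" for b
            using that Suc.prems(2)[of b] by (cases b) auto
          then show "tl b \<in> B r" if "b \<in> {b \<in> A. hd b = r}" for b
            using that by (simp add: B_def)
          then show "c (r # tl b) * mon (x # xs) (r # tl b) = c b * mon (x # xs) b" if "b \<in> {b \<in> A. hd b = r}" for b
            using that Suc.prems(2)[of b] by (cases b) auto
        qed (auto simp: B_def)
        then show "(\<Sum>b\<in>B r. c (r # b) * mon xs b) * x ^ r = (\<Sum>b | b \<in> A \<and> hd b = r. c b * mon (x # xs) b)"
          by (simp add: mon_Cons sum_distrib_right sum_distrib_left mult_ac)
      qed
      also have "\<dots> = (\<Sum>b\<in>A. c b * mon (x # xs) b)"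
        by (rule sum.group) (use Suc.prems(1) R in auto)
      also have "\<dots> = 0" using Suc.prems(3)[of "x # xs"] xs by simp
      finally show ?thesis .
    qed
    then show "(\<Sum>b\<in>B r. c (r # b) * mon xs b) = 0"
      by (rule polynomial_coeffs_0) (use R[OF Suc.prems(4)] a in simp)
  qed
qed

lemma psum_mset_cong: assumes "mset xs = mset ys" shows "psum \<mu> xs = psum \<mu> ys"
proof -
  have "(\<Sum>x\<leftarrow>xs. x ^ k) = (\<Sum>x\<leftarrow>ys. x ^ k)" for k
    using assms by (metis mset_map sum_mset_sum_list)
  then show ?thesis by (simp add: psum_def)
qed

section \<open>Partitions as decreasing lists, and their partial sums\<close>

lemma mset_parts: "mset (parts \<mu>) = \<mu>"
  by (simp add: parts_def)

lemma sum_partition_of_tuple: "sum_mset (partition_of_tuple a) = sum_list a"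
  by (induction a) (auto simp: partition_of_tuple_def)

lemma partition_of_tuple_partition: "partition_of_tuple a \<in> partitions"
  by (auto simp: partition_of_tuple_def partitions_def)

text \<open>The first \<open>k\<close> rows of a diagram contain the smaller of \<open>k\<close> and
  its length from each column. This brings the dominance order into column form.\<close>

lemma sum_list_take_sorted:
  assumes "sorted_wrt (\<ge>) l" "\<And>x. x \<in> set l \<Longrightarrow> x \<le> B"
  shows "sum_list (take k l) = (\<Sum>v=1..B. min k (length (filter (\<lambda>x. v \<le> x) l)))"
  using assms
proof (induction l arbitrary: k)
  case (Cons x l)
  show ?case
  proof (cases k)
    case (Suc j)
    have "(\<Sum>v=1..B. min (Suc j) (length (filter (\<lambda>y. v \<le> y) (x # l)))) =
      (\<Sum>v=1..B. (if v \<le> x then 1 else 0) + min j (length (filter (\<lambda>y. v \<le> y) l)))"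
    proof (intro sum.cong refl)
      fix v assume "v \<in> {1..B}"
      show "min (Suc j) (length (filter (\<lambda>y. v \<le> y) (x # l))) = (if v \<le> x then 1 else 0) + min j (length (filter (\<lambda>y. v \<le> y) l))"
      proof (cases "v \<le> x")
        case False
        then have "filter (\<lambda>y. v \<le> y) l = []" using Cons.prems(1) by (fastforce simp: filter_empty_conv)
        then show ?thesis using False by simp
      qed simp
    qed
    also have "\<dots> = (\<Sum>v=1..B. if v \<le> x then 1 else 0) + sum_list (take j l)"
      using Cons by (simp add: sum.distrib)
    also have "(\<Sum>v=1..B. if v \<le> x then 1 else 0) = (\<Sum>v=1..x. 1::nat)"
      by (rule sum.mono_neutral_cong_right) (use Cons.prems(2) in auto)
    finally show ?thesis using Suc by simp
  qed simp
qed simp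

lemma sorted_parts: "sorted_wrt (\<ge>) (parts \<mu>)"
  by (simp add: parts_def sorted_wrt_rev)

lemma sum_take_parts:
  assumes "\<And>x. x \<in># \<mu> \<Longrightarrow> x \<le> B"
  shows "sum_list (take k (parts \<mu>)) = (\<Sum>v=1..B. min k (cols \<mu> v))"
proof -
  have "cols \<mu> v = length (filter (\<lambda>x. v \<le> x) (parts \<mu>))" for v
    unfolding cols_def by (subst mset_parts[symmetric]) (simp flip: mset_filter)
  then show ?thesis
    using assms sum_list_take_sorted[OF sorted_parts, of \<mu> B k] by (simp flip: set_mset_mset add: mset_parts)
qed

text \<open>Gives antisymmetry of dominance. Zeros are excluded because trailing zeros do not show
  in partial sums.\<close>

lemma parts_eqI:
  assumes "\<And>k. sum_list (take k a) = sum_list (take k b)" "0 \<notin> set a" "0 \<notin> set b"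
  shows "a = (b :: nat list)"
  using assms
proof (induction a arbitrary: b)
  case Nil
  then show ?case using Nil(1)[of 1] by (cases b) auto
next
  case (Cons x a)
  obtain y b' where b: "b = y # b'" using Cons.prems(1)[of 1] Cons.prems(2) by (cases b) auto
  have xy: "x = y" using Cons.prems(1)[of 1] b by simp
  have "a = b'"
  proof (rule Cons.IH)
    fix k show "sum_list (take k a) = sum_list (take k b')" using Cons.prems(1)[of "Suc k"] b xy by simp
  qed (use Cons.prems b in auto)
  then show ?case using b xy by simp
qed

context
  fixes t :: real
  assumes t: "0 < t" "t < 1"
begin

text \<open>The chosen matrix depends on \<open>\<rho>\<close> only through its degree, so all rows
  of one degree come from the same matrix and its orthogonality relations apply.\<close>

definition hl_coef :: "nat multiset \<Rightarrow> nat multiset \<Rightarrow> real" where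
  "hl_coef \<rho> \<mu> = (SOME H. power_sum_expansion t (sum_mset \<rho>) H) \<rho> \<mu>"

lemma hl_coef: "power_sum_expansion t n hl_coef"
proof -
  define H where "H = (SOME H. power_sum_expansion t n H)"
  have "power_sum_expansion t n H"
    unfolding H_def by (rule someI_ex[OF power_sum_expansion_exists[OF t]])
  moreover have "hl_coef \<rho> = H \<rho>" if "\<rho> \<in> Par n" for \<rho>
    using that by (auto simp: hl_coef_def H_def Par_def)
  ultimately show ?thesis by (simp add: power_sum_expansion_def)
qed

lemma hlF_psum: "\<rho> \<in> Par n \<Longrightarrow> hlF t \<rho> xs = (\<Sum>\<mu>\<in>Par n. hl_coef \<rho> \<mu> * psum \<mu> xs)"
  using hl_coef[of n] by (simp add: power_sum_expansion_def)

lemma hl_coef_orthogonal: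
  "\<rho> \<in> Par n \<Longrightarrow> \<kappa> \<in> Par n \<Longrightarrow>
    (\<Sum>\<mu>\<in>Par n. hl_coef \<rho> \<mu> * hl_coef \<kappa> \<mu> * hl_norm t \<mu>) = (if \<rho> = \<kappa> then hlb t \<rho> else 0)"
  using hl_coef[of n] by (simp add: power_sum_expansion_def)

text \<open>Symmetry, hidden by the recursion, is evident in power sums.\<close>

lemma hlF_mset_cong: "\<rho> \<in> partitions \<Longrightarrow> mset xs = mset ys \<Longrightarrow> hlF t \<rho> xs = hlF t \<rho> ys"
  using hlF_psum[of \<rho> "sum_mset \<rho>"] psum_mset_cong[of xs ys] by (simp add: Par_def)

lemma hlG_mset_cong: "\<rho> \<in> partitions \<Longrightarrow> mset xs = mset ys \<Longrightarrow> hlG t \<rho> xs = hlG t \<rho> ys"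
  using hlF_mset_cong[of \<rho> xs ys] hlF_hlG[of \<rho> t] hlb_pos[OF t, of \<rho>] by simp

text \<open>Permuting exponents amounts to permuting variables; symmetry of \<open>hlG\<close> and
  independence of the monomials give equal coefficients.\<close>

lemma hlc_mset_cong:
  assumes \<rho>: "\<rho> \<in> partitions" and ab: "mset a = mset b" and s: "sum_list a = sum_mset \<rho>"
  shows "hlc t \<rho> a = hlc t \<rho> b"
proof -
  obtain p where p: "p permutes {..<length a}" "permute_list p a = b"
    using mset_eq_permutation[of b a] ab by metis
  define k where "k = length a"
  define n where "n = sum_mset \<rho>"
  note p' = p(1)[folded k_def]
  have pl: "length (permute_list p ys) = length ys" "mset (permute_list p ys) = mset ys" if "length ys = k" for ys :: "'b list"
    using p' that by auto
  have bij: "bij_betw (permute_list p) (comps k n) (comps k n)"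
  proof (rule bij_betw_byWitness[where f' = "permute_list (inv p)"])
    have pi: "inv p permutes {..<k}" using p' by (rule permutes_inv)
    have *: "sum_list (permute_list q a) = sum_list a" if "q permutes {..<k}" "length a = k" for q and a :: "nat list"
      using that by (metis mset_permute_list sum_mset_sum_list)
    show "permute_list p ` comps k n \<subseteq> comps k n" "permute_list (inv p) ` comps k n \<subseteq> comps k n"
      using *[OF p'] *[OF pi] by (auto simp: comps_def)
    show "\<forall>a\<in>comps k n. permute_list (inv p) (permute_list p a) = a"
      "\<forall>a\<in>comps k n. permute_list p (permute_list (inv p) a) = a"
      using p' pi permutes_inv_o[OF p']
      by (auto simp: comps_def simp flip: permute_list_compose)
  qed
  have mon: "mon (permute_list p xs) (permute_list p a) = mon xs a" if "length xs = k" "length a = k" for xs a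
  proof -
    have "mon (permute_list p xs) (permute_list p a) = (\<Prod>i<k. (xs ! p i) ^ (a ! p i))"
      unfolding mon_def using that p' by (intro prod.cong) (auto simp: permute_list_nth)
    also have "\<dots> = (\<Prod>i<k. (xs ! i) ^ (a ! i))"
      using prod.permute[OF p', of "\<lambda>i. (xs ! i) ^ (a ! i)"] by (simp add: o_def)
    finally show ?thesis using that by (simp add: mon_def)
  qed
  have "hlc t \<rho> (permute_list p a) - hlc t \<rho> a = 0"
  proof (rule mon_independent[of "comps k n" k "\<lambda>a. hlc t \<rho> (permute_list p a) - hlc t \<rho> a"])
    show "a \<in> comps k n" using s by (simp add: comps_def k_def n_def)
    fix xs :: "real list" assume xs: "length xs = k"
    have "(\<Sum>a\<in>comps k n. hlc t \<rho> (permute_list p a) * mon xs a) =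
      (\<Sum>a\<in>comps k n. hlc t \<rho> (permute_list p a) * mon (permute_list p xs) (permute_list p a))"
      using xs by (intro sum.cong) (auto simp: mon comps_def)
    also have "\<dots> = (\<Sum>a\<in>comps k n. hlc t \<rho> a * mon (permute_list p xs) a)"
      by (rule sum.reindex_bij_betw[OF bij])
    also have "\<dots> = hlG t \<rho> (permute_list p xs)"
      using xs by (simp add: hlG_mon[OF \<rho>] n_def)
    also have "\<dots> = hlG t \<rho> xs" by (rule hlG_mset_cong[OF \<rho>]) (use p' xs in auto)
    also have "\<dots> = (\<Sum>a\<in>comps k n. hlc t \<rho> a * mon xs a)"
      using xs by (simp add: hlG_mon[OF \<rho>] n_def)
    finally show "(\<Sum>a\<in>comps k n. (hlc t \<rho> (permute_list p a) - hlc t \<rho> a) * mon xs a) = 0"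
      by (simp add: left_diff_distrib sum_subtractf)
  qed (simp, auto simp: comps_def)
  then show ?thesis using p(2) by simp
qed

lemma psi_same_size:
  assumes "\<rho> \<in> partitions" "\<mu> \<in> Par (sum_mset \<rho>)" "\<mu> \<noteq> \<rho>"
  shows "psi t \<rho> \<mu> = 0"
  using assms hstrip_eqI[of \<rho> \<mu>] by (auto simp: psi_def Par_def)

lemma hlc_Cons_0: assumes \<rho>: "\<rho> \<in> partitions" shows "hlc t \<rho> (0 # a) = hlc t \<rho> a"
proof -
  have "hlc t \<rho> (0 # a) = (\<Sum>\<mu>\<in>Par (sum_mset \<rho>). psi t \<rho> \<mu> * hlc t \<mu> a)"
    by simp
  also have "\<dots> = (\<Sum>\<mu>\<in>Par (sum_mset \<rho>). if \<mu> = \<rho> then hlc t \<rho> a else 0)"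
    by (intro sum.cong refl) (auto simp: psi_self psi_same_size[OF \<rho>])
  also have "\<dots> = hlc t \<rho> a" using \<rho> by (simp add: Par_def)
  finally show ?thesis .
qed

lemma hlc_partition_of_tuple:
  assumes \<rho>: "\<rho> \<in> partitions" and s: "sum_list a = sum_mset \<rho>"
  shows "hlc t \<rho> a = hlc t \<rho> (parts (partition_of_tuple a))"
proof -
  have z: "hlc t \<rho> (replicate k 0 @ b) = hlc t \<rho> b" for k b
    by (induction k) (simp_all add: hlc_Cons_0[OF \<rho>] del: hlc.simps(2))
  \<comment> \<open>The zeros go to the front, where \<open>hlc_Cons_0\<close> removes them.\<close>
  define b where "b = replicate (count (mset a) 0) 0 @ parts (partition_of_tuple a)"
  have "mset a = mset b"
  proof (rule multiset_eqI)
    fix v show "count (mset a) v = count (mset b) v"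
      by (auto simp: b_def mset_parts partition_of_tuple_def)
  qed
  then have "hlc t \<rho> a = hlc t \<rho> b" by (rule hlc_mset_cong[OF \<rho> _ s])
  then show ?thesis by (simp add: b_def z)
qed

lemma hlG_monomial_sym:
  assumes \<rho>: "\<rho> \<in> partitions"
  shows "hlG t \<rho> xs = (\<Sum>\<mu>\<in>Par (sum_mset \<rho>). hlc t \<rho> (parts \<mu>) * monomial_sym \<mu> xs)"
proof -
  define n where "n = sum_mset \<rho>"
  have "hlG t \<rho> xs = (\<Sum>a\<in>comps (length xs) n. hlc t \<rho> (parts (partition_of_tuple a)) * mon xs a)"
    unfolding hlG_mon[OF \<rho>] n_def
    using hlc_partition_of_tuple[OF \<rho>] by (intro sum.cong) (auto simp: comps_def)
  also have "\<dots> = (\<Sum>\<mu>\<in>Par n. \<Sum>a | a \<in> comps (length xs) n \<and> partition_of_tuple a = \<mu>. hlc t \<rho> (parts (partition_of_tuple a)) * mon xs a)"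
    by (rule sum.group[symmetric, OF finite_comps finite_Par])
       (auto simp: Par_def comps_def sum_partition_of_tuple partition_of_tuple_partition)
  also have "\<dots> = (\<Sum>\<mu>\<in>Par n. hlc t \<rho> (parts \<mu>) * monomial_sym \<mu> xs)"
  proof (intro sum.cong refl)
    fix \<mu> assume "\<mu> \<in> Par n"
    then have "{a \<in> comps (length xs) n. partition_of_tuple a = \<mu>} = {a. length a = length xs \<and> partition_of_tuple a = \<mu>}"
      using sum_partition_of_tuple by (auto simp: comps_def Par_def)
    then show "(\<Sum>a | a \<in> comps (length xs) n \<and> partition_of_tuple a = \<mu>. hlc t \<rho> (parts (partition_of_tuple a)) * mon xs a) =
      hlc t \<rho> (parts \<mu>) * monomial_sym \<mu> xs"
      by (simp add: monomial_sym_def mon_def sum_distrib_left)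
  qed
  finally show ?thesis by (simp add: n_def)
qed

subsection \<open>Dominance\<close>

text \<open>\<open>a\<close> lists the sizes of successive strips. Each takes at most one box from a
  column, so the first \<open>k\<close> take at most \<open>min k (cols \<rho> v)\<close> from
  column \<open>v\<close>.\<close>

lemma hlc_dominance:
  assumes "hlc t \<rho> a \<noteq> 0" "\<And>x. x \<in># \<rho> \<Longrightarrow> x \<le> B" "\<rho> \<in> partitions"
  shows "sum_list (take k a) \<le> (\<Sum>v=1..B. min k (cols \<rho> v))"
  using assms
proof (induction a arbitrary: \<rho> k)
  case (Cons r a)
  show ?case
  proof (cases k)
    case (Suc j)
    have r: "r \<le> sum_mset \<rho>" and "(\<Sum>\<mu>\<in>Par (sum_mset \<rho> - r). psi t \<rho> \<mu> * hlc t \<mu> a) \<noteq> 0"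
      using Cons.prems(1) by (auto split: if_splits)
    then obtain \<mu> where \<mu>: "\<mu> \<in> Par (sum_mset \<rho> - r)" "psi t \<rho> \<mu> \<noteq> 0" "hlc t \<mu> a \<noteq> 0"
      by (metis (no_types, lifting) mult_eq_0_iff sum.neutral)
    have h: "hstrip \<rho> \<mu>" using \<mu>(2) by (auto simp: psi_def split: if_splits)
    have "cols \<rho> (Suc B) = 0" using Cons.prems(2) by (auto simp: cols_eq_0 less_Suc_eq_le)
    then have "cols \<mu> (Suc B) = 0" using h by (metis hstrip_def le_add1 le_zero_eq plus_1_eq_Suc)
    then have B: "x \<le> B" if "x \<in># \<mu>" for x using that by (auto simp: cols_eq_0 less_Suc_eq_le)
    have "r + sum_mset \<mu> = sum_mset \<rho>" using r \<mu>(1) by (simp add: Par_def)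
    then have "r + (\<Sum>v=1..B. cols \<mu> v) = (\<Sum>v=1..B. cols \<rho> v)"
      using sum_mset_cols[of \<mu> B] sum_mset_cols[of \<rho> B] B Cons.prems(2) by simp
    moreover have "(\<Sum>v=1..B. cols \<rho> v - cols \<mu> v) = (\<Sum>v=1..B. cols \<rho> v) - (\<Sum>v=1..B. cols \<mu> v)"
      by (rule sum_subtractf_nat) (use h in \<open>auto simp: hstrip_def\<close>)
    ultimately have "r = (\<Sum>v=1..B. cols \<rho> v - cols \<mu> v)" by linarith
    moreover have "sum_list (take j a) \<le> (\<Sum>v=1..B. min j (cols \<mu> v))"
      by (rule Cons.IH[OF \<mu>(3) B]) (use \<mu>(1) in \<open>auto simp: Par_def\<close>)
    ultimately have "r + sum_list (take j a) \<le> (\<Sum>v=1..B. (cols \<rho> v - cols \<mu> v) + min j (cols \<mu> v))"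
      by (simp add: sum.distrib)
    also have "\<dots> \<le> (\<Sum>v=1..B. min (Suc j) (cols \<rho> v))"
    proof (rule sum_mono)
      fix v assume "v \<in> {1..B}"
      then have "cols \<mu> v \<le> cols \<rho> v" "cols \<rho> v \<le> Suc (cols \<mu> v)" using h by (auto simp: hstrip_def)
      then show "(cols \<rho> v - cols \<mu> v) + min j (cols \<mu> v) \<le> min (Suc j) (cols \<rho> v)" by linarith
    qed
    finally show ?thesis using Suc by simp
  qed simp
qed simp

lemma hlc_triangular:
  assumes "\<rho> \<in> partitions" "\<mu> \<in> Par (sum_mset \<rho>)" "\<mu> \<noteq> \<rho>" "hlc t \<rho> (parts \<mu>) \<noteq> 0"
  shows "strictly_dominated \<mu> \<rho>"
proof -
  obtain B where B: "\<And>k. k \<in># \<rho> \<Longrightarrow> k \<le> B" using mset_bound[of \<rho> \<rho>] by blast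
  show ?thesis
    using assms hlc_dominance[OF assms(4) B assms(1)] sum_take_parts[OF B]
    by (simp add: strictly_dominated_def Par_def)
qed

text \<open>If the exponents are the rows in decreasing order, each strip must amount to removing a
  longest row, and the \<open>psi\<close> of such a strip is 1.\<close>

lemma hlc_diagonal:
  assumes "sorted_wrt (\<ge>) l" "0 \<notin> set l"
  shows "hlc t (mset l) l = 1"
  using assms
proof (induction l)
  case (Cons r l)
  have p: "mset (r # l) \<in> partitions" "mset l \<in> partitions" "r \<noteq> 0"
    using Cons.prems by (auto simp: partitions_def)
  have "hlc t (mset (r # l)) (r # l) = (\<Sum>\<mu>\<in>Par (sum_list l). psi t (mset (r # l)) \<mu> * hlc t \<mu> l)"
    by (simp add: sum_mset_sum_list)
  also have "\<dots> = (\<Sum>\<mu>\<in>Par (sum_list l). if \<mu> = mset l then 1 else 0)"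
  proof (intro sum.cong refl)
    fix \<mu> assume \<mu>: "\<mu> \<in> Par (sum_list l)"
    show "psi t (mset (r # l)) \<mu> * hlc t \<mu> l = (if \<mu> = mset l then 1 else 0)"
    proof (cases "hstrip (mset (r # l)) \<mu>")
      case True
      have "mset (r # l) = add_mset r \<mu>"
        by (rule hstrip_remove_row[OF True p(1)])
           (use \<mu> p(3) Cons.prems(1) in \<open>auto simp: Par_def sum_mset_sum_list\<close>)
      then have "\<mu> = mset l" by simp
      then show ?thesis using Cons by (simp add: psi_add_mset)
    next
      case False
      then have "\<mu> \<noteq> mset l" using hstrip_add_mset[of r "mset l"] by auto
      then show ?thesis using False by (simp add: psi_def)
    qed
  qed
  also have "\<dots> = 1" using p by (simp add: Par_def sum_mset_sum_list)
  finally show ?case .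
qed simp

lemma hlc_parts: assumes "\<rho> \<in> partitions" shows "hlc t \<rho> (parts \<rho>) = 1"
proof -
  have "0 \<notin> set (parts \<rho>)" using assms by (metis mset_parts partitions_def mem_Collect_eq set_mset_mset)
  then show ?thesis using hlc_diagonal[OF sorted_parts] by (simp add: mset_parts)
qed

section \<open>Unitriangular passage between monomial and Hall--Littlewood functions\<close>

abbreviation dominated :: "nat multiset \<Rightarrow> nat multiset set" where
  "dominated \<nu> \<equiv> {\<mu> \<in> partitions. strictly_dominated \<mu> \<nu>}"

lemma dominated_Par: "\<nu> \<in> Par n \<Longrightarrow> dominated \<nu> \<subseteq> Par n"
  by (auto simp: strictly_dominated_def Par_def)

lemma finite_dominated [simp]: "finite (dominated \<nu>)"
  by (rule finite_subset[OF _ finite_Par[of "sum_mset \<nu>"]]) (auto simp: strictly_dominated_def Par_def)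

lemma hlG_expansion:
  assumes \<rho>: "\<rho> \<in> partitions"
  shows "hlG t \<rho> xs = monomial_sym \<rho> xs + (\<Sum>\<mu>\<in>dominated \<rho>. hlc t \<rho> (parts \<mu>) * monomial_sym \<mu> xs)"
proof -
  have \<rho>': "\<rho> \<in> Par (sum_mset \<rho>)" using \<rho> by (simp add: Par_def)
  have n: "\<rho> \<notin> dominated \<rho>" by (simp add: strictly_dominated_def)
  have "hlG t \<rho> xs = (\<Sum>\<mu>\<in>insert \<rho> (dominated \<rho>). hlc t \<rho> (parts \<mu>) * monomial_sym \<mu> xs)"
    unfolding hlG_monomial_sym[OF \<rho>]
  proof (rule sum.mono_neutral_right)
    show "insert \<rho> (dominated \<rho>) \<subseteq> Par (sum_mset \<rho>)" using \<rho>' dominated_Par[OF \<rho>'] by blast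
    show "\<forall>\<mu>\<in>Par (sum_mset \<rho>) - insert \<rho> (dominated \<rho>). hlc t \<rho> (parts \<mu>) * monomial_sym \<mu> xs = 0"
      using hlc_triangular[OF \<rho>] by (auto simp: Par_def)
  qed simp
  also have "\<dots> = monomial_sym \<rho> xs + (\<Sum>\<mu>\<in>dominated \<rho>. hlc t \<rho> (parts \<mu>) * monomial_sym \<mu> xs)"
    using n by (subst sum.insert) (simp_all add: hlc_parts[OF \<rho>])
  finally show ?thesis .
qed

text \<open>Only \<open>\<kappa> \<noteq> \<nu>\<close> needs an argument: equality would squeeze
  the partial sums of \<open>\<mu>\<close> between equal bounds.\<close>

lemma strictly_dominated_trans:
  assumes "\<kappa> \<in> dominated \<mu>" "\<mu> \<in> dominated \<nu>" "\<nu> \<in> partitions"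
  shows "\<kappa> \<in> dominated \<nu>"
proof -
  have "\<kappa> \<noteq> \<nu>"
  proof
    assume "\<kappa> = \<nu>"
    then have "sum_list (take k (parts \<mu>)) = sum_list (take k (parts \<nu>))" for k
      using assms by (auto simp: strictly_dominated_def intro: antisym)
    then have "parts \<mu> = parts \<nu>"
    proof (rule parts_eqI)
      show "0 \<notin> set (parts \<mu>)" "0 \<notin> set (parts \<nu>)"
        using assms by (auto simp flip: set_mset_mset simp: mset_parts partitions_def)
    qed
    then have "\<mu> = \<nu>" by (metis mset_parts)
    then show False using assms(2) by (simp add: strictly_dominated_def)
  qed
  then show ?thesis using assms by (auto simp: strictly_dominated_def) (meson le_trans)
qed

text \<open>Well-founded because the finite set of dominated partitions shrinks strictly when
  passing to one of its elements.\<close>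

lemma dominated_induct [consumes 1, case_names less]:
  assumes "\<nu> \<in> partitions" "\<And>\<nu>. \<nu> \<in> partitions \<Longrightarrow> (\<And>\<mu>. \<mu> \<in> dominated \<nu> \<Longrightarrow> R \<mu>) \<Longrightarrow> R \<nu>"
  shows "R \<nu>"
  using assms(1)
proof (induction "card (dominated \<nu>)" arbitrary: \<nu> rule: less_induct)
  case less
  show ?case
  proof (rule assms(2)[OF less.prems])
    fix \<mu> assume \<mu>: "\<mu> \<in> dominated \<nu>"
    have "dominated \<mu> \<subset> dominated \<nu>"
      using strictly_dominated_trans[OF _ \<mu> less.prems] \<mu> by (auto simp: strictly_dominated_def)
    then have "card (dominated \<mu>) < card (dominated \<nu>)" by (intro psubset_card_mono) auto
    then show "R \<mu>" using less.hyps \<mu> by blast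
  qed
qed

text \<open>Inverts the unitriangular system of \<open>hlG_expansion\<close>.\<close>

lemma monomial_sym_expansion:
  assumes "\<nu> \<in> partitions"
  shows "\<exists>d. \<forall>xs. monomial_sym \<nu> xs = hlG t \<nu> xs + (\<Sum>\<kappa>\<in>dominated \<nu>. d \<kappa> * hlG t \<kappa> xs)"
  using assms
proof (induction \<nu> rule: dominated_induct)
  case (less \<nu>)
  have "\<forall>\<mu>\<in>dominated \<nu>. \<exists>d. \<forall>xs. monomial_sym \<mu> xs = hlG t \<mu> xs + (\<Sum>\<kappa>\<in>dominated \<mu>. d \<kappa> * hlG t \<kappa> xs)"
    using less.IH by blast
  from bchoice[OF this] obtain d where d: "\<And>\<mu> xs. \<mu> \<in> dominated \<nu> \<Longrightarrow> monomial_sym \<mu> xs = hlG t \<mu> xs + (\<Sum>\<kappa>\<in>dominated \<mu>. d \<mu> \<kappa> * hlG t \<kappa> xs)"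
    by blast
  \<comment> \<open>Extending the coefficients by 1 on the diagonal and 0 elsewhere lets all sums
    run over one index set.\<close>
  define e where "e \<mu> \<kappa> = (if \<kappa> = \<mu> then 1 else if \<kappa> \<in> dominated \<mu> then d \<mu> \<kappa> else 0)" for \<mu> \<kappa>
  have e: "monomial_sym \<mu> xs = (\<Sum>\<kappa>\<in>dominated \<nu>. e \<mu> \<kappa> * hlG t \<kappa> xs)" if \<mu>: "\<mu> \<in> dominated \<nu>" for \<mu> xs
  proof -
    have "(\<Sum>\<kappa>\<in>dominated \<nu>. e \<mu> \<kappa> * hlG t \<kappa> xs) = (\<Sum>\<kappa>\<in>insert \<mu> (dominated \<mu>). e \<mu> \<kappa> * hlG t \<kappa> xs)"
    proof (rule sum.mono_neutral_right)
      show "insert \<mu> (dominated \<mu>) \<subseteq> dominated \<nu>"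
        using \<mu> strictly_dominated_trans[OF _ \<mu> less.hyps] by blast
    qed (auto simp: e_def)
    also have "\<dots> = hlG t \<mu> xs + (\<Sum>\<kappa>\<in>dominated \<mu>. d \<mu> \<kappa> * hlG t \<kappa> xs)"
    proof -
      have n: "\<mu> \<notin> dominated \<mu>" by (simp add: strictly_dominated_def)
      then have "(\<Sum>\<kappa>\<in>dominated \<mu>. e \<mu> \<kappa> * hlG t \<kappa> xs) = (\<Sum>\<kappa>\<in>dominated \<mu>. d \<mu> \<kappa> * hlG t \<kappa> xs)"
        by (intro sum.cong) (auto simp: e_def)
      then show ?thesis using n by (subst sum.insert) (simp_all add: e_def)
    qed
    finally show ?thesis using d[OF \<mu>] by simp
  qed
  define c where "c \<kappa> = - (\<Sum>\<mu>\<in>dominated \<nu>. hlc t \<nu> (parts \<mu>) * e \<mu> \<kappa>)" for \<kappa>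
  have "monomial_sym \<nu> xs = hlG t \<nu> xs + (\<Sum>\<kappa>\<in>dominated \<nu>. c \<kappa> * hlG t \<kappa> xs)" for xs
  proof -
    have "(\<Sum>\<mu>\<in>dominated \<nu>. hlc t \<nu> (parts \<mu>) * monomial_sym \<mu> xs) =
      (\<Sum>\<mu>\<in>dominated \<nu>. \<Sum>\<kappa>\<in>dominated \<nu>. hlc t \<nu> (parts \<mu>) * (e \<mu> \<kappa> * hlG t \<kappa> xs))"
      by (intro sum.cong refl) (simp add: e sum_distrib_left)
    also have "\<dots> = (\<Sum>\<kappa>\<in>dominated \<nu>. - (c \<kappa> * hlG t \<kappa> xs))"
      by (subst sum.swap) (simp add: c_def sum_distrib_right sum_distrib_left mult_ac)
    finally show ?thesis using hlG_expansion[OF less.hyps, of xs] by (simp add: sum_negf)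
  qed
  then show ?case by blast
qed

section \<open>Identification of the Hall--Littlewood functions\<close>

text \<open>P_\<rho> inside the algebra: the coefficients of Q_\<rho> divided by b_\<rho>.\<close>

definition hl_sym :: "nat multiset \<Rightarrow> symfun" where
  "hl_sym \<rho> = (if \<rho> \<in> partitions then \<Sum>\<mu>\<in>Par (sum_mset \<rho>). Poly_Mapping.single \<mu> (hl_coef \<rho> \<mu> / hlb t \<rho>) else 0)"

lemma lookup_hl_sym:
  "Poly_Mapping.lookup (hl_sym \<rho>) \<mu> = (if \<rho> \<in> partitions \<and> \<mu> \<in> Par (sum_mset \<rho>) then hl_coef \<rho> \<mu> / hlb t \<rho> else 0)"
  by (auto simp: hl_sym_def lookup_sum lookup_single when_def)

lemma keys_hl_sym: "Poly_Mapping.keys (hl_sym \<rho>) \<subseteq> Par (sum_mset \<rho>)"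
  by (auto simp: in_keys_iff lookup_hl_sym split: if_splits)

lemma eval_sym_superset:
  assumes "finite S" "Poly_Mapping.keys f \<subseteq> S"
  shows "eval_sym f xs = (\<Sum>\<mu>\<in>S. Poly_Mapping.lookup f \<mu> * psum \<mu> xs)"
  unfolding eval_sym_def specialize_superset[OF assms] psum_def ..

lemma hl_inner_superset:
  assumes "finite S" "Poly_Mapping.keys f \<subseteq> S"
  shows "hl_inner t f g = (\<Sum>\<mu>\<in>S. Poly_Mapping.lookup f \<mu> * Poly_Mapping.lookup g \<mu> * hl_norm t \<mu>)"
  unfolding hl_inner_def
  by (rule sum.mono_neutral_left) (use assms in \<open>auto simp: in_keys_iff\<close>)

lemma eval_hl_sym:
  assumes \<rho>: "\<rho> \<in> partitions" shows "eval_sym (hl_sym \<rho>) xs = hlG t \<rho> xs"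
proof -
  have "\<rho> \<in> Par (sum_mset \<rho>)" using \<rho> by (simp add: Par_def)
  note F = hlF_psum[OF this, of xs]
  have "eval_sym (hl_sym \<rho>) xs = hlF t \<rho> xs / hlb t \<rho>"
    unfolding eval_sym_superset[OF finite_Par keys_hl_sym] F sum_divide_distrib
    using \<rho> by (intro sum.cong) (auto simp: lookup_hl_sym)
  then show ?thesis using hlF_hlG[OF \<rho>, of t] hlb_pos[OF t, of \<rho>] by simp
qed

text \<open>The functions Q are orthogonal with squared norms \<open>hlb\<close>; dividing both
  arguments by b leaves \<open>1 / hlb\<close>, so that the normalization of \<open>hl_Q\<close>
  multiplies by \<open>hlb\<close>.\<close>

lemma hl_inner_hl_sym:
  assumes \<rho>: "\<rho> \<in> partitions" and \<kappa>: "\<kappa> \<in> partitions"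
  shows "hl_inner t (hl_sym \<rho>) (hl_sym \<kappa>) = (if \<rho> = \<kappa> then 1 / hlb t \<rho> else 0)"
proof (cases "sum_mset \<rho> = sum_mset \<kappa>")
  case True
  have "hl_inner t (hl_sym \<rho>) (hl_sym \<kappa>) =
    (\<Sum>\<mu>\<in>Par (sum_mset \<rho>). hl_coef \<rho> \<mu> * hl_coef \<kappa> \<mu> * hl_norm t \<mu>) / (hlb t \<rho> * hlb t \<kappa>)"
    unfolding hl_inner_superset[OF finite_Par keys_hl_sym] sum_divide_distrib
    using assms True by (intro sum.cong) (auto simp: lookup_hl_sym)
  then show ?thesis
    using hl_coef_orthogonal[of \<rho> "sum_mset \<rho>" \<kappa>] assms True hlb_pos[OF t, of \<rho>] by (simp add: Par_def)
next
  case False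
  then show ?thesis
    unfolding hl_inner_superset[OF finite_Par keys_hl_sym]
    by (auto simp: lookup_hl_sym Par_def intro!: sum.neutral)
qed

lemma hl_family_hl_sym: "hl_family t hl_sym"
  unfolding hl_family_def
proof (intro conjI ballI allI impI)
  fix \<nu> assume \<nu>: "\<nu> \<in> partitions"
  show "hl_sym \<nu> \<in> symmetric_functions"
    using keys_hl_sym[of \<nu>] by (auto simp: symmetric_functions_def Par_def)
  show "\<exists>u. \<forall>xs. eval_sym (hl_sym \<nu>) xs = monomial_sym \<nu> xs + (\<Sum>\<mu>\<in>dominated \<nu>. u \<mu> * monomial_sym \<mu> xs)"
    by (rule exI[of _ "\<lambda>\<mu>. hlc t \<nu> (parts \<mu>)"]) (simp add: eval_hl_sym[OF \<nu>] hlG_expansion[OF \<nu>])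
next
  fix \<nu> \<mu> assume "\<nu> \<in> partitions" "\<mu> \<in> partitions" "\<nu> \<noteq> \<mu>"
  then show "hl_inner t (hl_sym \<nu>) (hl_sym \<mu>) = 0" by (simp add: hl_inner_hl_sym)
next
  fix \<nu> assume "\<nu> \<notin> partitions" then show "hl_sym \<nu> = 0" by (simp add: hl_sym_def)
qed

text \<open>Gram--Schmidt: by triangularity a competitor is \<open>hl_sym \<nu>\<close> plus a
  combination of dominated \<open>hl_sym \<kappa>\<close>, and by induction it is orthogonal to each
  of these.\<close>

lemma hl_family_unique:
  assumes P: "hl_family t P"
  shows "P = hl_sym"
proof
  fix \<nu>
  show "P \<nu> = hl_sym \<nu>"
  proof (cases "\<nu> \<in> partitions")
    case False
    then show ?thesis using P by (auto simp: hl_family_def hl_sym_def)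
  next
    case True
    then show ?thesis
    proof (induction \<nu> rule: dominated_induct)
      case (less \<nu>)
      have keys: "Poly_Mapping.keys (P \<nu>) \<subseteq> partitions"
        using P less.hyps by (auto simp: hl_family_def symmetric_functions_def)
      obtain u where u: "\<And>xs. eval_sym (P \<nu>) xs = monomial_sym \<nu> xs + (\<Sum>\<mu>\<in>dominated \<nu>. u \<mu> * monomial_sym \<mu> xs)"
        using P less.hyps unfolding hl_family_def by meson
      obtain u' where u': "\<And>xs. monomial_sym \<nu> xs = hlG t \<nu> xs + (\<Sum>\<kappa>\<in>dominated \<nu>. u' \<kappa> * hlG t \<kappa> xs)"
        using monomial_sym_expansion[OF less.hyps] by blast
      have "\<forall>\<mu>\<in>dominated \<nu>. \<exists>d. \<forall>xs. monomial_sym \<mu> xs = hlG t \<mu> xs + (\<Sum>\<kappa>\<in>dominated \<mu>. d \<kappa> * hlG t \<kappa> xs)"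
        using monomial_sym_expansion by blast
      from bchoice[OF this] obtain v where v: "\<And>\<mu> xs. \<mu> \<in> dominated \<nu> \<Longrightarrow> monomial_sym \<mu> xs = hlG t \<mu> xs + (\<Sum>\<kappa>\<in>dominated \<mu>. v \<mu> \<kappa> * hlG t \<kappa> xs)"
        by blast
      have v': "(\<Sum>\<kappa>\<in>dominated \<mu>. v \<mu> \<kappa> * hlG t \<kappa> xs) = (\<Sum>\<kappa>\<in>dominated \<nu>. (if \<kappa> \<in> dominated \<mu> then v \<mu> \<kappa> else 0) * hlG t \<kappa> xs)"
        if \<mu>: "\<mu> \<in> dominated \<nu>" for \<mu> xs
        by (rule sum.mono_neutral_cong_left) (use strictly_dominated_trans[OF _ \<mu> less.hyps] in auto)
      define d where "d \<kappa> = u' \<kappa> + u \<kappa> + (\<Sum>\<mu>\<in>dominated \<nu>. u \<mu> * (if \<kappa> \<in> dominated \<mu> then v \<mu> \<kappa> else 0))" for \<kappa>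
      have ev: "eval_sym (P \<nu>) xs = hlG t \<nu> xs + (\<Sum>\<kappa>\<in>dominated \<nu>. d \<kappa> * hlG t \<kappa> xs)" for xs
      proof -
        have "(\<Sum>\<mu>\<in>dominated \<nu>. u \<mu> * monomial_sym \<mu> xs) =
          (\<Sum>\<mu>\<in>dominated \<nu>. u \<mu> * hlG t \<mu> xs) + (\<Sum>\<mu>\<in>dominated \<nu>. \<Sum>\<kappa>\<in>dominated \<nu>. u \<mu> * (if \<kappa> \<in> dominated \<mu> then v \<mu> \<kappa> else 0) * hlG t \<kappa> xs)"
          unfolding sum.distrib[symmetric]
          by (intro sum.cong refl) (simp add: v v' distrib_left sum_distrib_left mult.assoc)
        also have "(\<Sum>\<mu>\<in>dominated \<nu>. \<Sum>\<kappa>\<in>dominated \<nu>. u \<mu> * (if \<kappa> \<in> dominated \<mu> then v \<mu> \<kappa> else 0) * hlG t \<kappa> xs) =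
          (\<Sum>\<kappa>\<in>dominated \<nu>. (\<Sum>\<mu>\<in>dominated \<nu>. u \<mu> * (if \<kappa> \<in> dominated \<mu> then v \<mu> \<kappa> else 0)) * hlG t \<kappa> xs)"
          unfolding sum_distrib_right by (rule sum.swap)
        finally show ?thesis
          unfolding u u' d_def by (simp only: distrib_right sum.distrib add.assoc)
      qed
      \<comment> \<open>The competitor is not known to be homogeneous, so its keys are joined to the
        partitions of the expected degree.\<close>
      define S where "S = Poly_Mapping.keys (P \<nu>) \<union> Par (sum_mset \<nu>)"
      have S: "finite S" "S \<subseteq> partitions" "Poly_Mapping.keys (P \<nu>) \<subseteq> S" "Par (sum_mset \<nu>) \<subseteq> S"
        using keys by (auto simp: S_def Par_def)
      have evS: "hlG t \<kappa> xs = (\<Sum>\<mu>\<in>S. Poly_Mapping.lookup (hl_sym \<kappa>) \<mu> * psum \<mu> xs)"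
        if "\<kappa> \<in> Par (sum_mset \<nu>)" for \<kappa> xs
      proof -
        have "\<kappa> \<in> partitions" "Poly_Mapping.keys (hl_sym \<kappa>) \<subseteq> S"
          using that keys_hl_sym[of \<kappa>] S(4) by (auto simp: Par_def)
        then show ?thesis using eval_hl_sym eval_sym_superset[OF S(1)] by metis
      qed
      have \<nu>: "\<nu> \<in> Par (sum_mset \<nu>)" using less.hyps by (simp add: Par_def)
      \<comment> \<open>Independence of the power sums lifts the identity of values to one of
        coefficients, on which the form is defined.\<close>
      have look: "Poly_Mapping.lookup (P \<nu>) \<mu> = Poly_Mapping.lookup (hl_sym \<nu>) \<mu> + (\<Sum>\<kappa>\<in>dominated \<nu>. d \<kappa> * Poly_Mapping.lookup (hl_sym \<kappa>) \<mu>)"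
        if "\<mu> \<in> S" for \<mu>
      proof -
        have "Poly_Mapping.lookup (P \<nu>) \<mu> - (Poly_Mapping.lookup (hl_sym \<nu>) \<mu> + (\<Sum>\<kappa>\<in>dominated \<nu>. d \<kappa> * Poly_Mapping.lookup (hl_sym \<kappa>) \<mu>)) = 0"
        proof (rule psum_independent[OF S(1,2) _ that])
          fix xs
          have "(\<Sum>\<kappa>\<in>dominated \<nu>. d \<kappa> * hlG t \<kappa> xs) = (\<Sum>\<kappa>\<in>dominated \<nu>. \<Sum>\<mu>\<in>S. d \<kappa> * Poly_Mapping.lookup (hl_sym \<kappa>) \<mu> * psum \<mu> xs)"
            using dominated_Par[OF \<nu>] by (intro sum.cong refl) (auto simp: evS sum_distrib_left mult.assoc)
          also have "\<dots> = (\<Sum>\<mu>\<in>S. (\<Sum>\<kappa>\<in>dominated \<nu>. d \<kappa> * Poly_Mapping.lookup (hl_sym \<kappa>) \<mu>) * psum \<mu> xs)"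
            unfolding sum_distrib_right by (rule sum.swap)
          finally have "(\<Sum>\<mu>\<in>S. Poly_Mapping.lookup (P \<nu>) \<mu> * psum \<mu> xs) =
            (\<Sum>\<mu>\<in>S. Poly_Mapping.lookup (hl_sym \<nu>) \<mu> * psum \<mu> xs) + (\<Sum>\<mu>\<in>S. (\<Sum>\<kappa>\<in>dominated \<nu>. d \<kappa> * Poly_Mapping.lookup (hl_sym \<kappa>) \<mu>) * psum \<mu> xs)"
            using ev[of xs] eval_sym_superset[OF S(1,3), of xs] evS[OF \<nu>, of xs] by simp
          then show "(\<Sum>\<mu>\<in>S. (Poly_Mapping.lookup (P \<nu>) \<mu> - (Poly_Mapping.lookup (hl_sym \<nu>) \<mu> + (\<Sum>\<kappa>\<in>dominated \<nu>. d \<kappa> * Poly_Mapping.lookup (hl_sym \<kappa>) \<mu>))) * psum \<mu> xs) = 0"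
            by (simp add: left_diff_distrib distrib_right sum_subtractf sum.distrib)
        qed
        then show ?thesis by simp
      qed
      have inner: "hl_inner t (hl_sym \<kappa>) g = (\<Sum>\<mu>\<in>S. Poly_Mapping.lookup (hl_sym \<kappa>) \<mu> * Poly_Mapping.lookup g \<mu> * hl_norm t \<mu>)"
        if "\<kappa> \<in> Par (sum_mset \<nu>)" for \<kappa> g
        by (rule hl_inner_superset[OF S(1)]) (use that keys_hl_sym[of \<kappa>] S(4) in \<open>auto simp: Par_def\<close>)
      \<comment> \<open>Pairing with \<open>hl_sym \<tau>\<close>, which is \<open>P \<tau>\<close>
        by induction, isolates \<open>d \<tau>\<close>.\<close>
      have d0: "d \<tau> = 0" if \<tau>: "\<tau> \<in> dominated \<nu>" for \<tau>
      proof -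
        have \<tau>': "\<tau> \<in> Par (sum_mset \<nu>)" "\<tau> \<in> partitions" "\<tau> \<noteq> \<nu>" using dominated_Par[OF \<nu>] \<tau> by (auto simp: strictly_dominated_def)
        have "0 = hl_inner t (P \<nu>) (hl_sym \<tau>)"
          using P less.hyps less.IH[OF \<tau>] \<tau>' by (metis hl_family_def)
        also have "\<dots> = (\<Sum>\<mu>\<in>S. (Poly_Mapping.lookup (hl_sym \<nu>) \<mu> + (\<Sum>\<kappa>\<in>dominated \<nu>. d \<kappa> * Poly_Mapping.lookup (hl_sym \<kappa>) \<mu>)) *
            Poly_Mapping.lookup (hl_sym \<tau>) \<mu> * hl_norm t \<mu>)"
          unfolding hl_inner_superset[OF S(1,3)] by (intro sum.cong refl) (simp add: look)
        also have "\<dots> = hl_inner t (hl_sym \<nu>) (hl_sym \<tau>) +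
            (\<Sum>\<mu>\<in>S. \<Sum>\<kappa>\<in>dominated \<nu>. d \<kappa> * (Poly_Mapping.lookup (hl_sym \<kappa>) \<mu> * Poly_Mapping.lookup (hl_sym \<tau>) \<mu> * hl_norm t \<mu>))"
          unfolding inner[OF \<nu>] by (simp add: distrib_right sum.distrib sum_distrib_right mult.assoc)
        also have "(\<Sum>\<mu>\<in>S. \<Sum>\<kappa>\<in>dominated \<nu>. d \<kappa> * (Poly_Mapping.lookup (hl_sym \<kappa>) \<mu> * Poly_Mapping.lookup (hl_sym \<tau>) \<mu> * hl_norm t \<mu>)) =
            (\<Sum>\<kappa>\<in>dominated \<nu>. d \<kappa> * hl_inner t (hl_sym \<kappa>) (hl_sym \<tau>))"
          by (subst sum.swap) (use dominated_Par[OF \<nu>] in \<open>auto simp: inner sum_distrib_left intro!: sum.cong\<close>)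
        also have "\<dots> = (\<Sum>\<kappa>\<in>dominated \<nu>. if \<kappa> = \<tau> then d \<kappa> / hlb t \<tau> else 0)"
          using \<tau>' by (intro sum.cong refl) (auto simp: hl_inner_hl_sym)
        also have "hl_inner t (hl_sym \<nu>) (hl_sym \<tau>) = 0" using \<tau>' less.hyps by (simp add: hl_inner_hl_sym)
        finally show ?thesis using \<tau> hlb_pos[OF t, of \<tau>] by simp
      qed
      show ?case
      proof (rule poly_mapping_eqI)
        fix \<mu>
        show "Poly_Mapping.lookup (P \<nu>) \<mu> = Poly_Mapping.lookup (hl_sym \<nu>) \<mu>"
        proof (cases "\<mu> \<in> S")
          case True
          then show ?thesis using look d0 by simp
        next
          case False
          then show ?thesis using S(3,4) keys_hl_sym[of \<nu>] by (metis in_keys_iff subsetD)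
        qed
      qed
    qed
  qed
qed

lemma hl_P_eq: "hl_P t = hl_sym"
  unfolding hl_P_def by (rule the_equality) (rule hl_family_hl_sym, erule hl_family_unique)

lemma eval_hl_Q:
  assumes \<rho>: "\<rho> \<in> partitions" shows "eval_sym (hl_Q t \<rho>) xs = hlF t \<rho> xs"
proof -
  define c where "c = hl_inner t (hl_sym \<rho>) (hl_sym \<rho>)"
  have c: "c = 1 / hlb t \<rho>" using \<rho> by (simp add: c_def hl_inner_hl_sym)
  have l: "Poly_Mapping.lookup (hl_Q t \<rho>) \<mu> = Poly_Mapping.lookup (hl_sym \<rho>) \<mu> / c" for \<mu>
    by (simp add: hl_Q_def hl_P_eq c_def map.rep_eq when_def)
  have "Poly_Mapping.keys (hl_Q t \<rho>) \<subseteq> Par (sum_mset \<rho>)"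
    using keys_hl_sym[of \<rho>] by (auto simp: in_keys_iff l)
  then have "eval_sym (hl_Q t \<rho>) xs = eval_sym (hl_sym \<rho>) xs / c"
    using keys_hl_sym[of \<rho>] by (simp add: eval_sym_superset[OF finite_Par] l sum_divide_distrib)
  then show ?thesis using hlF_hlG[OF \<rho>, of t] c by (simp add: eval_hl_sym[OF \<rho>])
qed

section \<open>The Plancherel specialization\<close>

text \<open>At \<open>x = 0\<close> only factors p_1 have a nonzero derivative in the new variable,
  so this is differentiation with respect to p_1.\<close>

lemma psum_deriv:
  assumes "\<mu> \<in> partitions"
  shows "((\<lambda>x. psum \<mu> (x # xs)) has_real_derivative (real (count \<mu> 1) * psum (\<mu> - {#1#}) xs)) (at 0)"
  using assms
proof (induction \<mu>)
  case empty
  then show ?case by (simp add: psum_def)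
next
  case (add k \<mu>)
  define p where "p = (\<Sum>x\<leftarrow>xs. x ^ k)"
  have k: "k \<noteq> 0" "\<mu> \<in> partitions" using add.prems by (auto simp: partitions_def)
  have p0: "psum \<mu> (0 # xs) = psum \<mu> xs"
    using k(2) by (induction \<mu>) (auto simp: psum_def partitions_def power_0_left)
  have "((\<lambda>x. x ^ k) has_real_derivative (if k = 1 then 1 else 0)) (at 0)"
    using k(1) by (auto intro!: derivative_eq_intros simp: power_0_left)
  then have "((\<lambda>x. (x ^ k + p) * psum \<mu> (x # xs)) has_real_derivative
     ((if k = 1 then 1 else 0) * psum \<mu> (0 # xs) + (0 ^ k + p) * (real (count \<mu> 1) * psum (\<mu> - {#1#}) xs))) (at 0)"
    using add.IH[OF k(2)] by (auto intro!: derivative_eq_intros)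
  moreover have "(\<lambda>x. (x ^ k + p) * psum \<mu> (x # xs)) = (\<lambda>x. psum (add_mset k \<mu>) (x # xs))"
    by (simp add: psum_def p_def)
  moreover have "(if k = 1 then 1 else 0) * psum \<mu> (0 # xs) + (0 ^ k + p) * (real (count \<mu> 1) * psum (\<mu> - {#1#}) xs) =
     real (count (add_mset k \<mu>) 1) * psum (add_mset k \<mu> - {#1#}) xs"
  proof -
    have P: "p * psum \<nu> xs = psum (add_mset k \<nu>) xs" for \<nu> by (simp add: psum_def p_def)
    show ?thesis
    proof (cases "k = 1")
      case True
      show ?thesis
      proof (cases "1 \<in># \<mu>")
        case True
        then obtain \<nu> where "\<mu> = add_mset 1 \<nu>" by (metis insert_DiffM)
        then show ?thesis using \<open>k = 1\<close> P[of \<nu>] p0 by (simp add: algebra_simps)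
      next
        case False
        then show ?thesis using \<open>k = 1\<close> p0 by (simp add: not_in_iff)
      qed
    next
      case False
      show ?thesis
      proof (cases "1 \<in># \<mu>")
        case True
        then obtain \<nu> where "\<mu> = add_mset 1 \<nu>" by (metis insert_DiffM)
        then show ?thesis using False k(1) P[of \<nu>] by (simp add: add_mset_commute power_0_left)
      next
        case 1: False
        then show ?thesis using False by (simp add: not_in_iff)
      qed
    qed
  qed
  ultimately show ?case by metis
qed

text \<open>The linear coefficient of a new variable is computed twice: branching gives the sum over
  partitions one box smaller, the power sum expansion gives the derivative in p_1.\<close>

lemma hl_coef_ones:
  assumes \<rho>: "\<rho> \<in> Par (Suc n)"
  shows "real (Suc n) * hl_coef \<rho> (replicate_mset (Suc n) 1) =
    (\<Sum>\<kappa>\<in>Par n. phi t \<rho> \<kappa> * hl_coef \<kappa> (replicate_mset n 1))"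
proof -
  \<comment> \<open>The difference of the two coefficients of p_\<tau>. All of them vanish by
    independence; the one for p_1^n is wanted.\<close>
  define c where "c \<tau> = real (Suc (count \<tau> 1)) * hl_coef \<rho> (add_mset 1 \<tau>) - (\<Sum>\<kappa>\<in>Par n. phi t \<rho> \<kappa> * hl_coef \<kappa> \<tau>)" for \<tau>
  have s: "sum_mset \<rho> = Suc n" "\<rho> \<in> partitions" using \<rho> by (auto simp: Par_def)
  have "c (replicate_mset n 1) = 0"
  proof (rule psum_independent[of "Par n"])
    show "Par n \<subseteq> partitions" by (auto simp: Par_def)
    show "replicate_mset n 1 \<in> Par n" by (auto simp: Par_def partitions_def in_replicate_mset sum_mset_replicate_mset)
    fix xs
    have "((\<lambda>x. \<Sum>r\<le>Suc n. (\<Sum>\<mu>\<in>Par (Suc n - r). phi t \<rho> \<mu> * hlF t \<mu> xs) * x ^ r) has_real_derivative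
       (\<Sum>r\<le>Suc n. (\<Sum>\<mu>\<in>Par (Suc n - r). phi t \<rho> \<mu> * hlF t \<mu> xs) * (real r * 0 ^ (r - Suc 0)))) (at 0)"
      by (intro DERIV_sum DERIV_cmult DERIV_pow)
    moreover have "(\<Sum>r\<le>Suc n. (\<Sum>\<mu>\<in>Par (Suc n - r). phi t \<rho> \<mu> * hlF t \<mu> xs) * (real r * 0 ^ (r - Suc 0))) =
      (\<Sum>r\<le>Suc n. if r = 1 then \<Sum>\<mu>\<in>Par n. phi t \<rho> \<mu> * hlF t \<mu> xs else 0)"
      by (intro sum.cong refl) (auto simp: power_0_left)
    moreover have "(\<lambda>x. \<Sum>r\<le>Suc n. (\<Sum>\<mu>\<in>Par (Suc n - r). phi t \<rho> \<mu> * hlF t \<mu> xs) * x ^ r) = (\<lambda>x. hlF t \<rho> (x # xs))"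
      by (simp only: hlF_Cons s)
    moreover have "(\<Sum>r\<le>Suc n. if r = 1 then \<Sum>\<mu>\<in>Par n. phi t \<rho> \<mu> * hlF t \<mu> xs else 0) = (\<Sum>\<mu>\<in>Par n. phi t \<rho> \<mu> * hlF t \<mu> xs)"
      by (subst sum.delta) auto
    ultimately have 1: "((\<lambda>x. hlF t \<rho> (x # xs)) has_real_derivative (\<Sum>\<mu>\<in>Par n. phi t \<rho> \<mu> * hlF t \<mu> xs)) (at 0)"
      by (simp only:)
    have "((\<lambda>x. \<Sum>\<mu>\<in>Par (Suc n). hl_coef \<rho> \<mu> * psum \<mu> (x # xs)) has_real_derivative
      (\<Sum>\<mu>\<in>Par (Suc n). hl_coef \<rho> \<mu> * (real (count \<mu> 1) * psum (\<mu> - {#1#}) xs))) (at 0)"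
      by (intro DERIV_sum DERIV_cmult psum_deriv) (auto simp: Par_def)
    then have 2: "((\<lambda>x. hlF t \<rho> (x # xs)) has_real_derivative
      (\<Sum>\<mu>\<in>Par (Suc n). hl_coef \<rho> \<mu> * (real (count \<mu> 1) * psum (\<mu> - {#1#}) xs))) (at 0)"
      by (simp only: hlF_psum[OF \<rho>])
    have "(\<Sum>\<mu>\<in>Par n. phi t \<rho> \<mu> * hlF t \<mu> xs) = (\<Sum>\<mu>\<in>Par (Suc n). hl_coef \<rho> \<mu> * (real (count \<mu> 1) * psum (\<mu> - {#1#}) xs))"
      by (rule DERIV_unique[OF 1 2])
    also have "\<dots> = (\<Sum>\<mu>\<in>add_mset 1 ` Par n. hl_coef \<rho> \<mu> * (real (count \<mu> 1) * psum (\<mu> - {#1#}) xs))"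
    proof (rule sum.mono_neutral_right)
      show "add_mset 1 ` Par n \<subseteq> Par (Suc n)" by (auto simp: Par_def partitions_def)
      show "\<forall>\<mu>\<in>Par (Suc n) - add_mset 1 ` Par n. hl_coef \<rho> \<mu> * (real (count \<mu> 1) * psum (\<mu> - {#1#}) xs) = 0"
      proof
        fix \<mu> assume \<mu>: "\<mu> \<in> Par (Suc n) - add_mset 1 ` Par n"
        have "1 \<notin># \<mu>"
        proof
          assume "1 \<in># \<mu>"
          then obtain \<nu> where "\<mu> = add_mset 1 \<nu>" by (metis insert_DiffM)
          then show False using \<mu> by (auto simp: Par_def partitions_def)
        qed
        then show "hl_coef \<rho> \<mu> * (real (count \<mu> 1) * psum (\<mu> - {#1#}) xs) = 0" by (simp add: not_in_iff)
      qed
    qed simp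
    also have "\<dots> = (\<Sum>\<tau>\<in>Par n. hl_coef \<rho> (add_mset 1 \<tau>) * (real (Suc (count \<tau> 1)) * psum \<tau> xs))"
      by (subst sum.reindex) (auto simp: inj_on_def)
    finally have 3: "(\<Sum>\<mu>\<in>Par n. phi t \<rho> \<mu> * hlF t \<mu> xs) = (\<Sum>\<tau>\<in>Par n. hl_coef \<rho> (add_mset 1 \<tau>) * (real (Suc (count \<tau> 1)) * psum \<tau> xs))" .
    have "(\<Sum>\<mu>\<in>Par n. phi t \<rho> \<mu> * hlF t \<mu> xs) = (\<Sum>\<mu>\<in>Par n. \<Sum>\<tau>\<in>Par n. phi t \<rho> \<mu> * hl_coef \<mu> \<tau> * psum \<tau> xs)"
      by (intro sum.cong refl) (simp add: hlF_psum sum_distrib_left mult.assoc)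
    also have "\<dots> = (\<Sum>\<tau>\<in>Par n. (\<Sum>\<mu>\<in>Par n. phi t \<rho> \<mu> * hl_coef \<mu> \<tau>) * psum \<tau> xs)"
      unfolding sum_distrib_right by (rule sum.swap)
    finally show "(\<Sum>\<tau>\<in>Par n. c \<tau> * psum \<tau> xs) = 0"
      using 3 by (simp add: c_def left_diff_distrib right_diff_distrib sum_subtractf mult_ac)
  qed simp
  then show ?thesis by (simp add: c_def)
qed

text \<open>By \<open>hl_paths_rec\<close> this is the total weight of the ways to build
  \<open>\<rho>\<close> box by box from the empty partition, each box weighing
  \<open>psi / (1 - t)\<close>.\<close>

definition hl_paths :: "nat multiset \<Rightarrow> real" where
  "hl_paths \<rho> = fact (sum_mset \<rho>) * plancherel t (hl_P t \<rho>)"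

text \<open>Of all products of power sums of degree \<open>n\<close> only the power of p_1 survives
  the specialization.\<close>

lemma plancherel_hl_P:
  assumes \<rho>: "\<rho> \<in> Par n"
  shows "plancherel t (hl_P t \<rho>) = hl_coef \<rho> (replicate_mset n 1) / hlb t \<rho> * (1 / (1 - t)) ^ n"
proof -
  have s: "sum_mset \<rho> = n" "\<rho> \<in> partitions" using \<rho> by (auto simp: Par_def)
  have one: "replicate_mset n 1 \<in> Par n" by (auto simp: Par_def partitions_def in_replicate_mset sum_mset_replicate_mset)
  have "plancherel t (hl_P t \<rho>) = (\<Sum>\<mu>\<in>Par n. hl_coef \<rho> \<mu> / hlb t \<rho> * (\<Prod>k\<in>#\<mu>. if k = 1 then 1 / (1 - t) else 0))"
    unfolding plancherel_def hl_P_eq using keys_hl_sym[of \<rho>] s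
    by (subst specialize_superset[OF finite_Par[of n]]) (auto simp: lookup_hl_sym)
  also have "\<dots> = (\<Sum>\<mu>\<in>Par n. if \<mu> = replicate_mset n 1 then hl_coef \<rho> \<mu> / hlb t \<rho> * (1 / (1 - t)) ^ n else 0)"
  proof (intro sum.cong refl)
    fix \<mu> assume \<mu>: "\<mu> \<in> Par n"
    show "hl_coef \<rho> \<mu> / hlb t \<rho> * (\<Prod>k\<in>#\<mu>. if k = 1 then 1 / (1 - t) else 0) =
      (if \<mu> = replicate_mset n 1 then hl_coef \<rho> \<mu> / hlb t \<rho> * (1 / (1 - t)) ^ n else 0)"
    proof (cases "\<forall>k\<in>#\<mu>. k = 1")
      case True
      then have "set_mset \<mu> \<subseteq> {1}" by blast
      then obtain m where m: "\<mu> = replicate_mset m 1" by (metis set_mset_subset_singletonD)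
      moreover have "m = n" using \<mu> m by (simp add: Par_def)
      ultimately have "\<mu> = replicate_mset n 1" by simp
      then show ?thesis by (simp add: prod_mset_constant)
    next
      case False
      then obtain k where k: "k \<in># \<mu>" "k \<noteq> 1" by blast
      then have "\<mu> \<noteq> replicate_mset n 1" by (auto split: if_splits)
      moreover have "(\<Prod>k\<in>#\<mu>. if k = 1 then 1 / (1 - t) else 0) = 0"
        using k by (subst prod_mset_zero_iff) (auto simp: image_iff)
      ultimately show ?thesis by simp
    qed
  qed
  also have "\<dots> = hl_coef \<rho> (replicate_mset n 1) / hlb t \<rho> * (1 / (1 - t)) ^ n"
    using one by simp
  finally show ?thesis .
qed

lemma hl_paths_empty: "hl_paths {#} = 1"
proof -
  have e: "{#} \<in> Par 0" by simp
  have "hl_coef {#} {#} = 1" using hlF_psum[OF e, of "[]"] by (simp add: psum_def hlF_empty del: hlF.simps)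
  then show ?thesis using plancherel_hl_P[OF e] by (simp add: hl_paths_def hlb_def)
qed

text \<open>Divides \<open>hl_coef_ones\<close> by \<open>hlb\<close>: \<open>phi_psi\<close> turns
  \<open>phi / hlb t \<rho>\<close> into \<open>psi / hlb t \<kappa>\<close>, and the factor
  \<open>Suc n\<close> is absorbed by the factorial.\<close>

lemma hl_paths_rec:
  assumes \<rho>: "\<rho> \<in> Par (Suc n)"
  shows "hl_paths \<rho> = (\<Sum>\<kappa>\<in>Par n. psi t \<rho> \<kappa> / (1 - t) * hl_paths \<kappa>)"
proof -
  have s: "sum_mset \<rho> = Suc n" "\<rho> \<in> partitions" using \<rho> by (auto simp: Par_def)
  have b: "hlb t \<kappa> \<noteq> 0" for \<kappa> using hlb_pos[OF t, of \<kappa>] by simp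
  have "hl_paths \<rho> = fact n * (real (Suc n) * hl_coef \<rho> (replicate_mset (Suc n) 1)) / hlb t \<rho> * (1 / (1 - t)) ^ Suc n"
    using plancherel_hl_P[OF \<rho>] s by (simp add: hl_paths_def mult_ac)
  also have "\<dots> = (\<Sum>\<kappa>\<in>Par n. fact n * (phi t \<rho> \<kappa> * hl_coef \<kappa> (replicate_mset n 1)) / hlb t \<rho> * (1 / (1 - t)) ^ Suc n)"
    unfolding hl_coef_ones[OF \<rho>] by (simp add: sum_distrib_left sum_distrib_right sum_divide_distrib)
  also have "\<dots> = (\<Sum>\<kappa>\<in>Par n. psi t \<rho> \<kappa> / (1 - t) * hl_paths \<kappa>)"
  proof (intro sum.cong refl)
    fix \<kappa> assume \<kappa>: "\<kappa> \<in> Par n"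
    then have "\<kappa> \<in> partitions" "sum_mset \<kappa> = n" by (auto simp: Par_def)
    then have "phi t \<rho> \<kappa> = psi t \<rho> \<kappa> * hlb t \<rho> / hlb t \<kappa>"
      using phi_psi[OF s(2), of \<kappa> t] b by (simp add: field_simps)
    then show "fact n * (phi t \<rho> \<kappa> * hl_coef \<kappa> (replicate_mset n 1)) / hlb t \<rho> * (1 / (1 - t)) ^ Suc n =
      psi t \<rho> \<kappa> / (1 - t) * hl_paths \<kappa>"
      using plancherel_hl_P[OF \<kappa>] \<open>sum_mset \<kappa> = n\<close> b by (simp add: hl_paths_def mult_ac)
  qed
  finally show ?thesis .
qed

end

section \<open>Adding and removing boxes\<close>

text \<open>A particle moving from \<open>y\<close> to \<open>y + 1\<close> adds a box in column
  \<open>y + 1\<close>. For \<open>y = 0\<close> a new row appears, and no multiplicity drops, as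
  zeros are not parts.\<close>

definition add_box :: "nat multiset \<Rightarrow> nat multiset \<Rightarrow> nat \<Rightarrow> bool" where
  "add_box \<rho> \<mu> y \<longleftrightarrow> \<rho> \<in> partitions \<and> \<mu> \<in> partitions \<and>
    (\<forall>v\<ge>1. cols \<rho> v = cols \<mu> v + (if v = Suc y then 1 else 0))"

lemma box_count:
  assumes "add_box \<rho> \<mu> y" "1 \<le> v"
  shows "count \<mu> v + (if v = Suc y then 1 else 0) = count \<rho> v + (if v = y then 1 else 0)"
proof -
  have "cols \<rho> v = cols \<mu> v + (if v = Suc y then 1 else 0)"
    "cols \<rho> (Suc v) = cols \<mu> (Suc v) + (if v = y then 1 else 0)"
    using assms by (auto simp: add_box_def)
  then show ?thesis using cols_Suc[of \<rho> v] cols_Suc[of \<mu> v] by simp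
qed

lemma box_count_same: "add_box \<rho> \<mu> y \<Longrightarrow> v \<noteq> y \<Longrightarrow> v \<noteq> Suc y \<Longrightarrow> count \<mu> v = count \<rho> v"
  using box_count[of \<rho> \<mu> y v] by (cases "v = 0") (auto simp: add_box_def partitions_def not_in_iff)

lemma box_count_y: "add_box \<rho> \<mu> y \<Longrightarrow> 1 \<le> y \<Longrightarrow> count \<mu> y = Suc (count \<rho> y)"
  using box_count[of \<rho> \<mu> y y] by simp

lemma box_count_Suc: "add_box \<rho> \<mu> y \<Longrightarrow> count \<rho> (Suc y) = Suc (count \<mu> (Suc y))"
  using box_count[of \<rho> \<mu> y "Suc y"] by simp

lemma box_hstrip: "add_box \<rho> \<mu> y \<Longrightarrow> hstrip \<rho> \<mu>"
  by (auto simp: add_box_def hstrip_def)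

lemma box_sum: assumes "add_box \<rho> \<mu> y" shows "sum_mset \<rho> = Suc (sum_mset \<mu>)"
proof -
  obtain B where B: "\<And>k. k \<in># \<rho> \<Longrightarrow> k \<le> B" "\<And>k. k \<in># \<mu> \<Longrightarrow> k \<le> B"
    "sum_mset \<rho> = (\<Sum>v=1..B. cols \<rho> v)" "sum_mset \<mu> = (\<Sum>v=1..B. cols \<mu> v)"
    by (rule sum_mset_bound[of \<rho> \<mu>]) (rule that)
  have "Suc y \<in># \<rho>" using box_count_Suc[OF assms] by (metis count_inI nat.distinct(1))
  then have y: "Suc y \<le> B" using B(1) by simp
  have "(\<Sum>v=1..B. cols \<rho> v) = (\<Sum>v=1..B. cols \<mu> v + (if v = Suc y then 1 else 0))"
    using assms by (intro sum.cong) (auto simp: add_box_def)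
  then show ?thesis using B y by (simp add: sum.distrib)
qed

text \<open>\<open>psi\<close> has a factor only where the smaller partition has the larger
  multiplicity, and this happens at \<open>y\<close> alone.\<close>

lemma psi_box:
  assumes "add_box \<rho> \<mu> y"
  shows "psi t \<rho> \<mu> = (if y = 0 then 1 else 1 - t ^ Suc (count \<rho> y))"
proof -
  have "psi t \<rho> \<mu> = (\<Prod>v\<in>insert y (set_mset \<mu>). mfac t (count \<mu> v) (count \<rho> v))"
    using box_hstrip[OF assms] by (subst psi_superset[of "insert y (set_mset \<mu>)"]) auto
  also have "\<dots> = (\<Prod>v\<in>insert y (set_mset \<mu>). if v = y then (if y = 0 then 1 else 1 - t ^ Suc (count \<rho> y)) else 1)"
  proof (intro prod.cong refl)
    fix v assume "v \<in> insert y (set_mset \<mu>)"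
    show "mfac t (count \<mu> v) (count \<rho> v) = (if v = y then (if y = 0 then 1 else 1 - t ^ Suc (count \<rho> y)) else 1)"
    proof (cases "v = y")
      case True
      then show ?thesis using assms box_count_y[OF assms]
        by (cases "y = 0") (auto simp: add_box_def partitions_def not_in_iff mfac_def)
    next
      case False
      then show ?thesis using box_count_same[OF assms, of v] box_count_Suc[OF assms]
        by (cases "v = Suc y") (auto simp: mfac_def)
    qed
  qed
  finally show ?thesis by (simp add: prod.delta)
qed

section \<open>Effect of moved boxes on the coefficient of a strip\<close>

lemma hstrip_count_cols:
  assumes "1 \<le> v"
  shows "count \<rho> v + cols \<mu> v + cols \<rho> (Suc v) = count \<mu> v + cols \<rho> v + cols \<mu> (Suc v)"
  using cols_Suc[of \<rho> v] cols_Suc[of \<mu> v] by simp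

lemma hstripD: "hstrip \<rho> \<mu> \<Longrightarrow> cols \<mu> (Suc v) \<le> cols \<rho> (Suc v)" "hstrip \<rho> \<mu> \<Longrightarrow> cols \<rho> (Suc v) \<le> Suc (cols \<mu> (Suc v))"
  by (auto simp: hstrip_def)

text \<open>\<open>K\<close> and \<open>K'\<close> record how the factor of each part value changes
  between two strips, trivially off \<open>S\<close>. The cross-multiplied form avoids dividing by
  factors that vanish for some \<open>t\<close>.\<close>

lemma phi_compare:
  assumes h: "hstrip \<rho> \<mu>" "hstrip \<rho>' \<mu>'"
    and p: "\<And>v. 1 \<le> v \<Longrightarrow> mfac t (count \<rho>' v) (count \<mu>' v) * K v = mfac t (count \<rho> v) (count \<mu> v) * K' v"
    and 1: "\<And>v. v \<noteq> 0 \<Longrightarrow> v \<notin> S \<Longrightarrow> K v = 1" "\<And>v. v \<noteq> 0 \<Longrightarrow> v \<notin> S \<Longrightarrow> K' v = 1" and S: "finite S" "0 \<notin> S"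
    and q: "\<rho> \<in> partitions" "\<rho>' \<in> partitions"
  shows "phi t \<rho>' \<mu>' * (\<Prod>v\<in>S. K v) = phi t \<rho> \<mu> * (\<Prod>v\<in>S. K' v)"
proof -
  define T where "T = set_mset \<rho> \<union> set_mset \<rho>' \<union> S"
  have T: "finite T" "set_mset \<rho> \<subseteq> T" "set_mset \<rho>' \<subseteq> T" "S \<subseteq> T" "0 \<notin> T"
    using S q by (auto simp: T_def partitions_def)
  have "\<forall>v\<in>T - S. K v = 1" "\<forall>v\<in>T - S. K' v = 1"
    using 1 T(5) by (metis DiffE)+
  then have K: "(\<Prod>v\<in>S. K v) = (\<Prod>v\<in>T. K v)" "(\<Prod>v\<in>S. K' v) = (\<Prod>v\<in>T. K' v)"
    using prod.mono_neutral_left[OF T(1,4)] by blast+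
  have "(\<Prod>v\<in>T. mfac t (count \<rho>' v) (count \<mu>' v) * K v) = (\<Prod>v\<in>T. mfac t (count \<rho> v) (count \<mu> v) * K' v)"
    by (intro prod.cong refl p) (use T(5) in \<open>metis One_nat_def Suc_leI gr0I\<close>)
  then show ?thesis
    unfolding K phi_superset[OF T(1,2)] phi_superset[OF T(1,3)] using h by (simp add: prod.distrib)
qed

lemma prod_two:
  fixes y :: nat and g :: "nat \<Rightarrow> real"
  assumes "x < Suc y"
  shows "(\<Prod>v\<in>{x, Suc y} - {0}. g v) = (if x = 0 then 1 else g x) * g (Suc y)"
proof (cases "x = 0")
  case True
  then have "{x, Suc y} - {0} = {Suc y}" by auto
  then show ?thesis using True by simp
next
  case False
  then have "{x, Suc y} - {0} = {x, Suc y}" by auto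
  then show ?thesis using False assms by simp
qed

text \<open>Primes denote rows before the moves. After them the strip has a box in each of the
  columns \<open>x + 2\<close> to \<open>y + 1\<close> and none in column \<open>x + 1\<close>.
  Going back, the factors at \<open>x\<close> and \<open>y + 1\<close> become 1 and one factor,
  \<open>psi t P P'\<close>, appears at \<open>y\<close>.\<close>

lemma phi_boxes_apart:
  assumes P: "add_box P P' y" and V: "add_box V V' x" and xy: "x < y" and h: "hstrip P V"
    and run: "\<And>v. x + 2 \<le> v \<Longrightarrow> v \<le> Suc y \<Longrightarrow> cols P v = Suc (cols V v)"
    and x: "cols P (Suc x) = cols V (Suc x)"
  shows "phi t P' V' * ((if x = 0 then 1 else mfac t (count P x) (count V x)) * mfac t (count P (Suc y)) (count V (Suc y))) =
     phi t P V * psi t P P'" "hstrip P' V'"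
proof -
  show h': "hstrip P' V'"
    unfolding hstrip_def
  proof (intro allI impI)
    fix v :: nat assume v: "1 \<le> v"
    have "cols P v = cols P' v + (if v = Suc y then 1 else 0)" "cols V v = cols V' v + (if v = Suc x then 1 else 0)"
      "cols V v \<le> cols P v" "cols P v \<le> Suc (cols V v)"
      using P V h v by (auto simp: add_box_def hstrip_def)
    moreover have "cols P (Suc y) = Suc (cols V (Suc y))" using run[of "Suc y"] xy by simp
    ultimately show "cols V' v \<le> cols P' v \<and> cols P' v \<le> Suc (cols V' v)"
      using x xy by (auto split: if_splits)
  qed
  define K where "K v = (if v = x \<or> v = Suc y then mfac t (count P v) (count V v) else 1)" for v
  define K' where "K' v = (if v = y then 1 - t ^ Suc (count P y) else 1)" for v
  have "phi t P' V' * (\<Prod>v\<in>{x, Suc y, y} - {0}. K v) = phi t P V * (\<Prod>v\<in>{x, Suc y, y} - {0}. K' v)"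
  proof (rule phi_compare[OF h h'])
    fix v :: nat assume v: "1 \<le> v"
    have c: "count P v + cols V v + cols P (Suc v) = count V v + cols P v + cols V (Suc v)"
      by (rule hstrip_count_cols[OF v])
    have hv: "cols V v \<le> cols P v" "cols P v \<le> Suc (cols V v)" "cols V (Suc v) \<le> cols P (Suc v)" "cols P (Suc v) \<le> Suc (cols V (Suc v))"
      using h v by (auto simp: hstrip_def)
    consider "v = Suc y" | "v = y" "y \<noteq> Suc x" | "v = y" "y = Suc x" | "v = Suc x" "Suc x \<noteq> y" | "v = x" | "v \<noteq> x" "v \<noteq> Suc x" "v \<noteq> y" "v \<noteq> Suc y"
      by blast
    then show "mfac t (count P' v) (count V' v) * K v = mfac t (count P v) (count V v) * K' v"
    proof cases
      case 1
      then have "count V' v = count V v" "count P v = Suc (count P' v)"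
        using box_count_same[OF V, of v] box_count_Suc[OF P] xy by auto
      moreover have "count P v \<le> Suc (count V v)" using c hv by linarith
      ultimately show ?thesis using 1 by (auto simp: K_def K'_def mfac_def)
    next
      case 2
      then have "count V' v = count V v" "count P' v = Suc (count P v)"
        using box_count_same[OF V, of v] box_count_y[OF P] xy v by auto
      moreover have "count P v = count V v" using c run[of v] run[of "Suc v"] 2 xy by simp
      ultimately show ?thesis using 2 xy by (auto simp: K_def K'_def mfac_def)
    next
      case 3
      then have "count V v = Suc (count V' v)" "count P' v = Suc (count P v)"
        using box_count_Suc[OF V] box_count_y[OF P] xy v by auto
      moreover have "count V v = Suc (count P v)" using c x run[of "Suc v"] 3 xy by simp
      ultimately show ?thesis using 3 xy by (auto simp: K_def K'_def mfac_def)
    next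
      case 4
      then have "count V v = Suc (count V' v)" "count P' v = count P v"
        using box_count_Suc[OF V] box_count_same[OF P, of v] xy by auto
      moreover have "count V v = Suc (count P v)" using c x run[of "Suc v"] 4 xy by simp
      ultimately show ?thesis using 4 xy by (auto simp: K_def K'_def mfac_def)
    next
      case 5
      then have "count V' v = Suc (count V v)" "count P' v = count P v"
        using box_count_y[OF V] box_count_same[OF P, of v] xy v by auto
      moreover have "count P v \<le> Suc (count V v)" using c hv by linarith
      ultimately show ?thesis using 5 xy by (auto simp: K_def K'_def mfac_def)
    next
      case 6
      then show ?thesis using box_count_same[OF P, of v] box_count_same[OF V, of v] by (simp add: K_def K'_def)
    qed
  qed (use P in \<open>auto simp: K_def K'_def add_box_def\<close>)
  moreover have "(\<Prod>v\<in>{x, Suc y, y} - {0}. K v) = (\<Prod>v\<in>{x, Suc y} - {0}. K v)"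
    by (rule prod.mono_neutral_right) (use xy in \<open>auto simp: K_def\<close>)
  moreover have "(\<Prod>v\<in>{x, Suc y, y} - {0}. K' v) = (\<Prod>v\<in>{y}. K' v)"
    by (rule prod.mono_neutral_right) (use xy in \<open>auto simp: K'_def\<close>)
  moreover have "K' y = psi t P P'" using psi_box[OF P] xy by (simp add: K'_def)
  moreover have "(\<Prod>v\<in>{x, Suc y} - {0}. K v) = (if x = 0 then 1 else mfac t (count P x) (count V x)) * mfac t (count P (Suc y)) (count V (Suc y))"
    using xy by (subst prod_two) (auto simp: K_def)
  ultimately show "phi t P' V' * ((if x = 0 then 1 else mfac t (count P x) (count V x)) * mfac t (count P (Suc y)) (count V (Suc y))) =
     phi t P V * psi t P P'" by simp
qed

text \<open>The variant with an unchanged lower row: all columns up to \<open>y + 1\<close> of the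
  strip are occupied. It describes a letter starting at the upper level.\<close>

lemma phi_box_insert:
  assumes P: "add_box P P' y" and V: "V \<in> partitions" and h: "hstrip P V"
    and run: "\<And>v. 1 \<le> v \<Longrightarrow> v \<le> Suc y \<Longrightarrow> cols P v = Suc (cols V v)"
  shows "phi t P' V * mfac t (count P (Suc y)) (count V (Suc y)) = phi t P V * psi t P P'" "hstrip P' V"
proof -
  show h': "hstrip P' V"
    unfolding hstrip_def
  proof (intro allI impI)
    fix v :: nat assume v: "1 \<le> v"
    have "cols P v = cols P' v + (if v = Suc y then 1 else 0)" "cols V v \<le> cols P v" "cols P v \<le> Suc (cols V v)"
      using P h v by (auto simp: add_box_def hstrip_def)
    then show "cols V v \<le> cols P' v \<and> cols P' v \<le> Suc (cols V v)"
      using run[of "Suc y"] by (auto split: if_splits)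
  qed
  define K where "K v = (if v = Suc y then mfac t (count P v) (count V v) else 1)" for v
  define K' where "K' v = (if v = y then 1 - t ^ Suc (count P y) else 1)" for v
  have "phi t P' V * (\<Prod>v\<in>{y, Suc y} - {0}. K v) = phi t P V * (\<Prod>v\<in>{y, Suc y} - {0}. K' v)"
  proof (rule phi_compare[OF h h'])
    fix v :: nat assume v: "1 \<le> v"
    have c: "count P v + cols V v + cols P (Suc v) = count V v + cols P v + cols V (Suc v)"
      by (rule hstrip_count_cols[OF v])
    have hv: "cols V v \<le> cols P v" "cols P v \<le> Suc (cols V v)" "cols V (Suc v) \<le> cols P (Suc v)" "cols P (Suc v) \<le> Suc (cols V (Suc v))"
      using h v by (auto simp: hstrip_def)
    consider "v = Suc y" | "v = y" | "v \<noteq> y" "v \<noteq> Suc y" by blast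
    then show "mfac t (count P' v) (count V v) * K v = mfac t (count P v) (count V v) * K' v"
    proof cases
      case 1
      then have "count P v = Suc (count P' v)" using box_count_Suc[OF P] by auto
      moreover have "count P v \<le> Suc (count V v)" using c hv by linarith
      ultimately show ?thesis using 1 by (auto simp: K_def K'_def mfac_def)
    next
      case 2
      then have "count P' v = Suc (count P v)" using box_count_y[OF P] v by auto
      moreover have "count P v = count V v" using c run[of v] run[of "Suc v"] 2 v by simp
      ultimately show ?thesis using 2 by (auto simp: K_def K'_def mfac_def)
    next
      case 3
      then show ?thesis using box_count_same[OF P, of v] by (simp add: K_def K'_def)
    qed
  qed (use P in \<open>auto simp: K_def K'_def add_box_def\<close>)
  then show "phi t P' V * mfac t (count P (Suc y)) (count V (Suc y)) = phi t P V * psi t P P'"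
    using psi_box[OF P, of t] by (simp add: prod_two K_def K'_def split: if_splits)
qed

text \<open>Both rows grow in the same column, so the strip occupies the same columns before and
  after; the multiplicities at \<open>y\<close> and at \<open>y + 1\<close> shift in parallel. This
  serves both pushing and a refused jump.\<close>

lemma phi_boxes_same:
  assumes P: "add_box P P' y" and V: "add_box V V' y" and h: "hstrip P V"
  shows "phi t P' V' * ((if y = 0 then 1 else mfac t (count P y) (count V y)) * mfac t (count P (Suc y)) (count V (Suc y))) =
     phi t P V * ((if y = 0 then 1 else mfac t (Suc (count P y)) (Suc (count V y))) * mfac t (count P (Suc y) - 1) (count V (Suc y) - 1))"
    "hstrip P' V'"
proof -
  show h': "hstrip P' V'"
    unfolding hstrip_def
  proof (intro allI impI)
    fix v :: nat assume v: "1 \<le> v"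
    have "cols P v = cols P' v + (if v = Suc y then 1 else 0)" "cols V v = cols V' v + (if v = Suc y then 1 else 0)"
      "cols V v \<le> cols P v" "cols P v \<le> Suc (cols V v)"
      using P V h v by (auto simp: add_box_def hstrip_def)
    then show "cols V' v \<le> cols P' v \<and> cols P' v \<le> Suc (cols V' v)"
      by (auto split: if_splits)
  qed
  define K where "K v = (if v = y \<or> v = Suc y then mfac t (count P v) (count V v) else 1)" for v
  define K' where "K' v = (if v = y then mfac t (Suc (count P y)) (Suc (count V y)) else
    if v = Suc y then mfac t (count P (Suc y) - 1) (count V (Suc y) - 1) else 1)" for v
  have "phi t P' V' * (\<Prod>v\<in>{y, Suc y} - {0}. K v) = phi t P V * (\<Prod>v\<in>{y, Suc y} - {0}. K' v)"
  proof (rule phi_compare[OF h h'])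
    fix v :: nat assume v: "1 \<le> v"
    consider "v = Suc y" | "v = y" | "v \<noteq> y" "v \<noteq> Suc y" by blast
    then show "mfac t (count P' v) (count V' v) * K v = mfac t (count P v) (count V v) * K' v"
    proof cases
      case 1
      then show ?thesis using box_count_Suc[OF P] box_count_Suc[OF V] by (simp add: K_def K'_def)
    next
      case 2
      then show ?thesis using box_count_y[OF P] box_count_y[OF V] v by (simp add: K_def K'_def)
    next
      case 3
      then show ?thesis using box_count_same[OF P, of v] box_count_same[OF V, of v] by (simp add: K_def K'_def)
    qed
  qed (use P in \<open>auto simp: K_def K'_def add_box_def\<close>)
  then show "phi t P' V' * ((if y = 0 then 1 else mfac t (count P y) (count V y)) * mfac t (count P (Suc y)) (count V (Suc y))) =
     phi t P V * ((if y = 0 then 1 else mfac t (Suc (count P y)) (Suc (count V y))) * mfac t (count P (Suc y) - 1) (count V (Suc y) - 1))"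
    by (simp add: prod_two K_def K'_def)
qed

text \<open>The jump probability of the insertion, with \<open>D\<close> particles below and \<open>U\<close> above at the vacated
  position.\<close>

definition jump_prob :: "real \<Rightarrow> nat \<Rightarrow> nat \<Rightarrow> real" where
  "jump_prob t D U = (if U = D then (1 - t) / (1 - t ^ (D + 1)) else 1 - t)"

text \<open>This explains the rates. For \<open>x > 0\<close> the lower box has
  \<open>psi = 1 - t ^ (D + 1)\<close>. If \<open>U = D\<close>, the rate cancels it down to
  \<open>1 - t\<close>; if \<open>U = D + 1\<close>, the rate \<open>1 - t\<close> leaves it to be
  the new \<open>mfac\<close> factor at \<open>x\<close>. For \<open>x = 0\<close>,
  \<open>psi\<close> is 1 and \<open>U \<noteq> D\<close> selects the rate
  \<open>1 - t\<close>.\<close>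

lemma weight_jump:
  assumes t: "0 < t" "t < 1"
    and P: "add_box P P' y" and V: "add_box V V' x" and xy: "x < y" and h: "hstrip P V"
    and run: "\<And>v. x + 2 \<le> v \<Longrightarrow> v \<le> Suc y \<Longrightarrow> cols P v = Suc (cols V v)"
    and x: "cols P (Suc x) = cols V (Suc x)"
    and DU: "if x = 0 then U \<noteq> D else D = count V x \<and> U = count P' x"
  shows "psi t V V' * phi t P' V' * jump_prob t D U * mfac t (count P (Suc y)) (count V (Suc y)) = (1 - t) * (phi t P V * psi t P P')"
proof -
  have E: "psi t V V' * jump_prob t D U = (1 - t) * (if x = 0 then 1 else mfac t (count P x) (count V x))"
  proof (cases "x = 0")
    case True
    then show ?thesis using psi_box[OF V] DU by (simp add: jump_prob_def)
  next
    case False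
    have "count P x + cols V x + cols P (Suc x) = count V x + cols P x + cols V (Suc x)"
      by (rule hstrip_count_cols) (use False in simp)
    moreover have "cols V x \<le> cols P x" "cols P x \<le> Suc (cols V x)" using h False by (auto simp: hstrip_def)
    ultimately have c: "count P x = count V x \<or> count P x = Suc (count V x)" using x by linarith
    have "count P' x = count P x" using box_count_same[OF P, of x] xy by simp
    then show ?thesis
      using c psi_box[OF V, of t] DU False power_sub_ne_0[OF t, of "Suc (count V x)"]
      by (auto simp: jump_prob_def mfac_def)
  qed
  have "psi t V V' * phi t P' V' * jump_prob t D U * mfac t (count P (Suc y)) (count V (Suc y)) =
    (1 - t) * (phi t P' V' * ((if x = 0 then 1 else mfac t (count P x) (count V x)) * mfac t (count P (Suc y)) (count V (Suc y))))"
    using arg_cong[OF E, of "\<lambda>c. c * (phi t P' V' * mfac t (count P (Suc y)) (count V (Suc y)))"]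
    by (simp only: mult_ac)
  then show ?thesis using phi_boxes_apart(1)[OF P V xy h run x, of t] by simp
qed

text \<open>For \<open>y > 0\<close> the complementary rate is \<open>t\<close> if
  \<open>U = D + 1\<close> and \<open>t * (1 - t ^ D) / (1 - t ^ (D + 1))\<close> if
  \<open>U = D\<close>; either way it turns \<open>psi\<close> of the lower box into
  \<open>t\<close> times \<open>psi\<close> of the upper one. At \<open>y + 1\<close> a factor with
  both multiplicities lowered by one remains.\<close>

lemma weight_stay:
  assumes t: "0 < t" "t < 1"
    and P: "add_box P P' y" and V: "add_box V V' y" and h: "hstrip P V"
    and y: "cols P (Suc y) = Suc (cols V (Suc y))"
    and DU: "if y = 0 then U \<noteq> D else D = count V y \<and> U = count P' y"
  shows "psi t V V' * phi t P' V' * (1 - jump_prob t D U) * mfac t (count P (Suc y)) (count V (Suc y)) =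
    t * (phi t P V * psi t P P') * mfac t (count P (Suc y) - 1) (count V (Suc y) - 1)"
proof -
  define my where "my = (if y = 0 then 1 else mfac t (count P y) (count V y))"
  have m: "my = 1 \<and> (if y = 0 then 1 else mfac t (Suc (count P y)) (Suc (count V y))) = 1 \<and>
     psi t V V' * (1 - jump_prob t D U) = t * psi t P P'"
  proof (cases "y = 0")
    case True
    then show ?thesis using psi_box[OF V] psi_box[OF P] DU by (simp add: jump_prob_def my_def)
  next
    case False
    have "count P y + cols V y + cols P (Suc y) = count V y + cols P y + cols V (Suc y)"
      by (rule hstrip_count_cols) (use False in simp)
    moreover have "cols V y \<le> cols P y" "cols P y \<le> Suc (cols V y)" using h False by (auto simp: hstrip_def)
    ultimately have c: "count P y = count V y \<or> count V y = Suc (count P y)" using y by linarith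
    have P'y: "count P' y = Suc (count P y)" using box_count_y[OF P] False by simp
    from c show ?thesis
    proof
      assume eq: "count P y = count V y"
      have "jump_prob t D U = 1 - t" using DU False P'y eq by (simp add: jump_prob_def)
      then show ?thesis using psi_box[OF V, of t] psi_box[OF P, of t] False eq by (simp add: my_def)
    next
      assume eq: "count V y = Suc (count P y)"
      define z where "z = 1 - t ^ Suc (Suc (count P y))"
      have z: "z \<noteq> 0" unfolding z_def by (rule power_sub_ne_0[OF t]) simp
      have "jump_prob t D U = (1 - t) / z" using DU False P'y eq by (simp add: jump_prob_def z_def)
      then have "z * jump_prob t D U = 1 - t" using z by simp
      then have "z * (1 - jump_prob t D U) = z - (1 - t)" by (simp add: right_diff_distrib)
      also have "\<dots> = t * (1 - t ^ Suc (count P y))" by (simp add: z_def algebra_simps)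
      finally show ?thesis
        using psi_box[OF V, of t] psi_box[OF P, of t] False eq by (simp add: my_def z_def)
    qed
  qed
  have "phi t P' V' * mfac t (count P (Suc y)) (count V (Suc y)) = phi t P V * mfac t (count P (Suc y) - 1) (count V (Suc y) - 1)"
    using phi_boxes_same(1)[OF P V h, of t] m by (simp add: my_def)
  moreover have "psi t V V' * phi t P' V' * (1 - jump_prob t D U) * mfac t (count P (Suc y)) (count V (Suc y)) =
    (psi t V V' * (1 - jump_prob t D U)) * (phi t P' V' * mfac t (count P (Suc y)) (count V (Suc y)))"
    by (simp only: mult_ac)
  ultimately show ?thesis using m by (simp only: mult_ac)
qed

text \<open>The strip has no box in column \<open>y + 1\<close>, so the factors there are trivial,
  and the factor at \<open>y\<close> exchanges \<open>psi\<close> of the lower box for that of the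
  upper: a forced push preserves the weight.\<close>

lemma weight_push:
  assumes P: "add_box P P' y" and V: "add_box V V' y" and h: "hstrip P V"
    and y: "cols P (Suc y) = cols V (Suc y)"
  shows "psi t V V' * phi t P' V' = phi t P V * psi t P P'"
proof -
  define a where "a = count P y"
  define b where "b = count V y"
  have "count P (Suc y) + cols V (Suc y) + cols P (Suc (Suc y)) = count V (Suc y) + cols P (Suc y) + cols V (Suc (Suc y))"
    by (rule hstrip_count_cols) simp
  then have "count P (Suc y) \<le> count V (Suc y)" using hstripD(1)[OF h, of "Suc y"] y by linarith
  then have m: "mfac t (count P (Suc y)) (count V (Suc y)) = 1" "mfac t (count P (Suc y) - 1) (count V (Suc y) - 1) = 1"
    using box_count_Suc[OF V] by (auto simp: mfac_def)
  have *: "phi t P' V' * (if y = 0 then 1 else mfac t a b) = phi t P V * (if y = 0 then 1 else mfac t (Suc a) (Suc b))"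
    using phi_boxes_same(1)[OF P V h, of t] by (simp only: a_def b_def m mult_1_right)
  show ?thesis
  proof (cases "y = 0")
    case True
    then show ?thesis using * psi_box[OF V, of t] psi_box[OF P, of t] by simp
  next
    case False
    have "count P y + cols V y + cols P (Suc y) = count V y + cols P y + cols V (Suc y)"
      by (rule hstrip_count_cols) (use False in simp)
    moreover have "cols V y \<le> cols P y" "cols P y \<le> Suc (cols V y)" using h False by (auto simp: hstrip_def)
    ultimately have "a = b \<or> a = Suc b" using y by (auto simp: a_def b_def)
    then show ?thesis
      using * False psi_box[OF V, of t] psi_box[OF P, of t] by (auto simp: mfac_def a_def[symmetric] b_def[symmetric] mult.commute)
  qed
qed

section \<open>Rows of particles\<close>

definition decreasing :: "nat \<Rightarrow> (nat \<Rightarrow> nat) \<Rightarrow> bool" where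
  "decreasing m f \<longleftrightarrow> (\<forall>i j. 1 \<le> i \<longrightarrow> i \<le> j \<longrightarrow> j \<le> m \<longrightarrow> f j \<le> f i)"

definition row_part :: "nat \<Rightarrow> (nat \<Rightarrow> nat) \<Rightarrow> nat multiset" where
  "row_part m f = partition_of_tuple (map f [1..<Suc m])"

lemma decreasingD: "decreasing m f \<Longrightarrow> 1 \<le> i \<Longrightarrow> i \<le> j \<Longrightarrow> j \<le> m \<Longrightarrow> f j \<le> f i"
  by (simp add: decreasing_def)

lemma row_partition [simp]: "row_part m f \<in> partitions"
  unfolding row_part_def by (rule partition_of_tuple_partition)

lemma size_filter_row:
  assumes "\<And>v. Q v \<Longrightarrow> 0 < v"
  shows "size (filter_mset Q (row_part m f)) = card {i \<in> {1..m}. Q (f i)}"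
proof (induction m)
  case 0
  then show ?case by (simp add: row_part_def partition_of_tuple_def)
next
  case (Suc m)
  have "row_part (Suc m) f = (if 0 < f (Suc m) then add_mset (f (Suc m)) (row_part m f) else row_part m f)"
    by (simp add: row_part_def partition_of_tuple_def)
  moreover have "{i \<in> {1..Suc m}. Q (f i)} = (if Q (f (Suc m)) then insert (Suc m) {i \<in> {1..m}. Q (f i)} else {i \<in> {1..m}. Q (f i)})"
    by (auto simp: le_Suc_eq)
  ultimately show ?case using Suc assms[of "f (Suc m)"] by auto
qed

lemma cols_row: "1 \<le> v \<Longrightarrow> cols (row_part m f) v = card {i \<in> {1..m}. v \<le> f i}"
  unfolding cols_def by (rule size_filter_row) simp

lemma count_row: "1 \<le> v \<Longrightarrow> count (row_part m f) v = card {i \<in> {1..m}. f i = v}"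
  using size_filter_row[of "\<lambda>k. k = v" m f] by (simp add: filter_eq_replicate_mset)

lemma sum_row: "sum_mset (row_part m f) = (\<Sum>i=1..m. f i)"
  unfolding row_part_def sum_partition_of_tuple by (induction m) simp_all

lemma cols_row_le: "1 \<le> v \<Longrightarrow> cols (row_part m f) v \<le> m"
  unfolding cols_row by (rule order_trans[OF card_mono[of "{1..m}"]]) auto

text \<open>Conjugation of the diagram; the dictionary between particle indices and column
  lengths.\<close>

lemma le_cols_row:
  assumes d: "decreasing m f" and i: "1 \<le> i" "i \<le> m" and v: "1 \<le> v"
  shows "v \<le> f i \<longleftrightarrow> i \<le> cols (row_part m f) v"
proof
  assume vi: "v \<le> f i"
  have "{1..i} \<subseteq> {k \<in> {1..m}. v \<le> f k}" using decreasingD[OF d] i vi le_trans by fastforce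
  then show "i \<le> cols (row_part m f) v" unfolding cols_row[OF v] using card_mono[of "{k \<in> {1..m}. v \<le> f k}" "{1..i}"] by simp
next
  assume *: "i \<le> cols (row_part m f) v"
  show "v \<le> f i"
  proof (rule ccontr)
    assume "\<not> v \<le> f i"
    then have "{k \<in> {1..m}. v \<le> f k} \<subseteq> {1..<i}"
      using decreasingD[OF d i(1)] by (auto simp: not_le) (metis le_less_trans not_le)
    then have "card {k \<in> {1..m}. v \<le> f k} \<le> i - 1" using card_mono[of "{1..<i}"] by simp
    then show False using * i unfolding cols_row[OF v] by simp
  qed
qed

lemma row_box:
  assumes "1 \<le> i" "i \<le> m"
  shows "add_box (row_part m (f(i := Suc (f i)))) (row_part m f) (f i)"
  unfolding add_box_def
proof (intro conjI allI impI)
  fix v :: nat assume v: "1 \<le> v"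
  let ?g = "f(i := Suc (f i))"
  have "{k \<in> {1..m}. v \<le> ?g k} = {k \<in> {1..m}. v \<le> f k} \<union> (if v = Suc (f i) then {i} else {})"
    using assms by auto
  moreover have "card ({k \<in> {1..m}. v \<le> f k} \<union> (if v = Suc (f i) then {i} else {})) = card {k \<in> {1..m}. v \<le> f k} + (if v = Suc (f i) then 1 else 0)"
    by (subst card_Un_disjoint) auto
  ultimately show "cols (row_part m ?g) v = cols (row_part m f) v + (if v = Suc (f i) then 1 else 0)"
    by (simp only: cols_row[OF v])
qed simp_all

lemma row_box_down:
  assumes "1 \<le> i" "i \<le> m" "f i = Suc x"
  shows "add_box (row_part m f) (row_part m (f(i := x))) x"
proof -
  have "(f(i := x))(i := Suc x) = f" using assms(3) by auto
  then show ?thesis using row_box[OF assms(1,2), of "f(i := x)"] by simp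
qed

text \<open>Translates the column condition back into interlacing of positions.\<close>

lemma hstrip_interlace:
  assumes h: "hstrip (row_part (Suc m) g) (row_part m f)" and d: "decreasing (Suc m) g" "decreasing m f"
    and k: "1 \<le> k" "k \<le> m"
  shows "f k \<le> g k" "g (Suc k) \<le> f k"
proof -
  show "f k \<le> g k"
  proof (cases "f k = 0")
    case False
    then have "k \<le> cols (row_part m f) (f k)" using le_cols_row[OF d(2) k, of "f k"] by simp
    also have "\<dots> \<le> cols (row_part (Suc m) g) (f k)" using h False by (simp add: hstrip_def)
    finally show ?thesis using le_cols_row[OF d(1), of k "f k"] k False by simp
  qed simp
  show "g (Suc k) \<le> f k"
  proof (cases "g (Suc k) = 0")
    case False
    then have "Suc k \<le> cols (row_part (Suc m) g) (g (Suc k))" using le_cols_row[OF d(1), of "Suc k" "g (Suc k)"] k by simp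
    also have "\<dots> \<le> Suc (cols (row_part m f) (g (Suc k)))" using h False by (simp add: hstrip_def)
    finally show ?thesis using le_cols_row[OF d(2) k, of "g (Suc k)"] False by simp
  qed simp
qed

section \<open>The local identity\<close>

definition free :: "(nat \<Rightarrow> nat) \<Rightarrow> (nat \<Rightarrow> nat) \<Rightarrow> nat \<Rightarrow> bool" where
  "free f g k \<longleftrightarrow> \<not> (2 \<le> k \<and> g k = f (k - 1))"

text \<open>Covers both rules: \<open>i = Suc m\<close> gives the particle moved by a letter
  starting at level \<open>Suc m\<close>, and \<open>i \<le> m\<close> the jump caused by particle
  \<open>i\<close> below.\<close>

definition mover :: "(nat \<Rightarrow> nat) \<Rightarrow> (nat \<Rightarrow> nat) \<Rightarrow> nat \<Rightarrow> nat" where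
  "mover f g i = Max {k \<in> {1..i}. free f g k}"

text \<open>\<open>f\<close> is a row after a move: particle \<open>i\<close> can be the one that
  moved if undoing its step leaves a decreasing row.\<close>

definition removable :: "nat \<Rightarrow> (nat \<Rightarrow> nat) \<Rightarrow> nat \<Rightarrow> bool" where
  "removable m f i \<longleftrightarrow> 1 \<le> i \<and> i \<le> m \<and> 1 \<le> f i \<and> decreasing m (f(i := f i - 1))"

text \<open>\<open>f\<close> is the lower row after its move, \<open>g\<close> the upper row before;
  hence the vacated position \<open>f i - 1\<close>.\<close>

definition move_prob :: "real \<Rightarrow> nat \<Rightarrow> (nat \<Rightarrow> nat) \<Rightarrow> (nat \<Rightarrow> nat) \<Rightarrow> nat \<Rightarrow> nat \<Rightarrow> real" where
  "move_prob t m f g i j =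
    (let x = f i - 1;
         r = jump_prob t (card {k \<in> {1..m}. f k = x}) (card {k \<in> {1..Suc m}. g k = x})
     in if g i = x then (if j = i then 1 else 0)
        else r * (if j = mover f g i then 1 else 0) + (1 - r) * (if j = Suc i then 1 else 0))"

lemma mover:
  assumes "1 \<le> i"
  shows "1 \<le> mover f g i" "mover f g i \<le> i" "free f g (mover f g i)"
    "\<And>k. mover f g i < k \<Longrightarrow> k \<le> i \<Longrightarrow> g k = f (k - 1)"
proof -
  let ?S = "{k \<in> {1..i}. free f g k}"
  have S: "finite ?S" "1 \<in> ?S" using assms by (auto simp: free_def)
  then have "mover f g i \<in> ?S" unfolding mover_def by (intro Max_in) auto
  then show *: "1 \<le> mover f g i" "mover f g i \<le> i" "free f g (mover f g i)" by auto
  fix k assume k: "mover f g i < k" "k \<le> i"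
  have "k \<notin> ?S"
  proof
    assume "k \<in> ?S"
    then have "k \<le> mover f g i" unfolding mover_def by (rule Max_ge[OF S(1)])
    then show False using k by simp
  qed
  then show "g k = f (k - 1)" using k * by (auto simp: free_def)
qed

lemma mover_eqI:
  assumes "1 \<le> j" "j \<le> i" "free f g j" "\<And>k. j < k \<Longrightarrow> k \<le> i \<Longrightarrow> g k = f (k - 1)"
  shows "mover f g i = j"
  unfolding mover_def
proof (rule Max_eqI)
  fix k assume k: "k \<in> {k \<in> {1..i}. free f g k}"
  show "k \<le> j"
  proof (rule ccontr)
    assume "\<not> k \<le> j"
    then have "g k = f (k - 1)" "2 \<le> k" using assms(1,4) k by auto
    then show False using k by (simp add: free_def)
  qed
qed (use assms in auto)

lemma decreasing_up:
  assumes d: "decreasing n g" and j: "1 \<le> j" "j \<le> n" and "2 \<le> j \<Longrightarrow> g j < g (j - 1)"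
  shows "decreasing n (g(j := Suc (g j)))"
  unfolding decreasing_def
proof (intro allI impI)
  fix a b assume ab: "1 \<le> a" "a \<le> b" "b \<le> n"
  have "g b \<le> g a" using decreasingD[OF d ab] .
  moreover have "Suc (g b) \<le> g a" if "b = j" "a < j"
  proof -
    have "g (j - 1) \<le> g a" using decreasingD[OF d, of a "j - 1"] ab that by simp
    moreover have "g j < g (j - 1)" using assms(4) ab that by simp
    ultimately show ?thesis using that by simp
  qed
  ultimately show "(g(j := Suc (g j))) b \<le> (g(j := Suc (g j))) a" using ab by auto
qed

lemma decreasing_down:
  assumes d: "decreasing n f" and i: "1 \<le> i" "i \<le> n" and "i < n \<Longrightarrow> f (Suc i) \<le> x" and x: "x \<le> f i"
  shows "decreasing n (f(i := x))"
  unfolding decreasing_def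
proof (intro allI impI)
  fix a b assume ab: "1 \<le> a" "a \<le> b" "b \<le> n"
  have "f b \<le> f a" using decreasingD[OF d ab] .
  moreover have "f b \<le> x" if "a = i" "i < b"
  proof -
    have "f b \<le> f (Suc i)" using decreasingD[OF d, of "Suc i" b] ab that by simp
    then show ?thesis using assms(4) ab that by simp
  qed
  ultimately show "(f(i := x)) b \<le> (f(i := x)) a" using ab x by auto
qed

lemma hstrip_add_boxes:
  assumes P: "add_box P P' y" and V: "add_box V V' y" and h: "hstrip P' V'"
  shows "hstrip P V"
  using assms by (auto simp: hstrip_def add_box_def)

lemma hstrip_add_upper:
  assumes P: "add_box P P' y" and h: "hstrip P' V" and y: "cols P' (Suc y) \<le> cols V (Suc y)"
  shows "hstrip P V"
  unfolding hstrip_def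
proof (intro allI impI)
  fix v :: nat assume v: "1 \<le> v"
  have "cols P v = cols P' v + (if v = Suc y then 1 else 0)" "cols V v \<le> cols P' v" "cols P' v \<le> Suc (cols V v)"
    using P h v by (auto simp: add_box_def hstrip_def)
  then show "cols V v \<le> cols P v \<and> cols P v \<le> Suc (cols V v)" using y by (cases "v = Suc y") auto
qed

lemma hstrip_add_lower:
  assumes V: "add_box V V' x" and h: "hstrip P V'" and x: "cols V (Suc x) \<le> cols P (Suc x)"
  shows "hstrip P V"
  unfolding hstrip_def
proof (intro allI impI)
  fix v :: nat assume v: "1 \<le> v"
  have "cols V v = cols V' v + (if v = Suc x then 1 else 0)" "cols V' v \<le> cols P v" "cols P v \<le> Suc (cols V' v)"
    using V h v by (auto simp: add_box_def hstrip_def)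
  then show "cols V v \<le> cols P v \<and> cols P v \<le> Suc (cols V v)" using x by (cases "v = Suc x") auto
qed

text \<open>The insertion stays within interlacing arrays, and a possible upper mover arises in one
  of three ways: pushed, reached by a jump, or as the neighbour \<open>Suc i\<close> after a refused
  jump.\<close>

lemma contribution:
  fixes g j
  defines "g' \<equiv> g(j := Suc (g j))"
  assumes t: "0 < t" "t < 1"
    and g: "decreasing (Suc m) g" and f: "decreasing m f" and j: "1 \<le> j" "j \<le> Suc m"
    and i: "removable m f i" and h: "hstrip (row_part (Suc m) g) (row_part m (f(i := f i - 1)))"
    and pr: "move_prob t m f g i j \<noteq> 0"
  shows "decreasing (Suc m) g'" "hstrip (row_part (Suc m) g') (row_part m f)"
    "j = i \<and> f i = Suc (g j) \<or> j \<le> i \<and> mover f g i = j \<and> g i \<noteq> f i - 1 \<or> j = Suc i \<and> f i = Suc (g j)"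
proof -
  define x where "x = f i - 1"
  define y where "y = g j"
  define fi where "fi = f(i := x)"
  have i': "1 \<le> i" "i \<le> m" "f i = Suc x" "decreasing m fi" using i by (auto simp: removable_def x_def fi_def)
  have P: "add_box (row_part (Suc m) g') (row_part (Suc m) g) y"
    using row_box[OF j, of g] by (simp add: g'_def y_def)
  have V: "add_box (row_part m f) (row_part m fi) x"
    unfolding fi_def by (rule row_box_down) (use i' in auto)
  have h': "hstrip (row_part (Suc m) g) (row_part m fi)" using h by (simp add: fi_def x_def)
  note I = hstrip_interlace[OF h' g i'(4)]
  have fi: "fi k = f k" if "k \<noteq> i" for k using that by (simp add: fi_def)
  have fii: "fi i = x" by (simp add: fi_def)
  have fSuc: "f (Suc i) \<le> x" if "i < m" using decreasingD[OF i'(4), of i "Suc i"] i' that by (simp add: fi_def)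
  consider (a) "g i = x" "j = i" | (b1) "g i \<noteq> x" "mover f g i = j" | (b2) "g i \<noteq> x" "j = Suc i"
      "jump_prob t (card {k \<in> {1..m}. f k = x}) (card {k \<in> {1..Suc m}. g k = x}) \<noteq> 1"
    using pr by (auto simp: move_prob_def Let_def x_def split: if_splits)
  then have "decreasing (Suc m) g' \<and> hstrip (row_part (Suc m) g') (row_part m f) \<and>
    (j = i \<and> f i = Suc (g j) \<or> j \<le> i \<and> mover f g i = j \<and> g i \<noteq> x \<or> j = Suc i \<and> f i = Suc (g j))"
  proof cases
    case a
    have "decreasing (Suc m) g'" unfolding g'_def
    proof (rule decreasing_up[OF g j])
      assume "2 \<le> j"
      then have j1: "1 \<le> j - 1" "j - 1 \<le> m" "j - 1 \<noteq> i" "j - 1 \<le> j" using a i' by auto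
      have "f j \<le> f (j - 1)" by (rule decreasingD[OF f j1(1,4)]) (use a i' in simp)
      then show "g j < g (j - 1)" using I(1)[OF j1(1,2)] a i' unfolding fi[OF j1(3)] by simp
    qed
    moreover have "hstrip (row_part (Suc m) g') (row_part m f)"
      by (rule hstrip_add_boxes[OF P _ h']) (use V a in \<open>simp add: y_def\<close>)
    ultimately show ?thesis using a i' by simp
  next
    case b1
    note M = mover[OF i'(1), of f g, unfolded b1(2)]
    have gi: "x < g i" using I(1)[of i] i' b1 fii by simp
    have xy: "x < y" using decreasingD[OF g, of j i] M i' gi by (simp add: y_def)
    have fj: "g j < f (j - 1) \<and> f (j - 1) \<le> g (j - 1)" if "2 \<le> j"
    proof -
      have j1: "1 \<le> j - 1" "j - 1 \<le> m" "Suc (j - 1) = j" "j - 1 \<noteq> i" using that M(1,2) i' by auto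
      show ?thesis
        using I(1)[OF j1(1,2)] I(2)[OF j1(1,2)] M(3) that unfolding j1(3) fi[OF j1(4)] by (simp add: free_def)
    qed
    have "decreasing (Suc m) g'" unfolding g'_def
      by (rule decreasing_up[OF g j]) (use fj in auto)
    moreover have "hstrip (row_part (Suc m) g') (row_part m f)"
    proof (rule hstrip_add_lower[OF V])
      show "hstrip (row_part (Suc m) g') (row_part m fi)"
      proof (rule hstrip_add_upper[OF P h'])
        have "cols (row_part (Suc m) g) (Suc y) \<le> j - 1"
          using le_cols_row[OF g j, of "Suc y"] by (simp add: y_def)
        also have "\<dots> \<le> cols (row_part m fi) (Suc y)"
        proof (cases "2 \<le> j")
          case True
          then have j1: "1 \<le> j - 1" "j - 1 \<le> m" "j - 1 \<noteq> i" using M(1,2) i' by auto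
          then show ?thesis using le_cols_row[OF i'(4) j1(1,2), of "Suc y"] fj True fi[OF j1(3)] by (simp add: y_def)
        qed simp
        finally show "cols (row_part (Suc m) g) (Suc y) \<le> cols (row_part m fi) (Suc y)" .
      qed
      have "cols (row_part m f) (Suc x) \<le> i"
      proof (rule ccontr)
        assume "\<not> ?thesis"
        then have "Suc i \<le> cols (row_part m f) (Suc x)" "Suc i \<le> m" using cols_row_le[of "Suc x" m f] by auto
        then show False using le_cols_row[OF f, of "Suc i" "Suc x"] fSuc by simp
      qed
      also have "i \<le> cols (row_part (Suc m) g) (Suc x)"
        using le_cols_row[OF g, of i "Suc x"] gi i' by simp
      also have "\<dots> = cols (row_part (Suc m) g') (Suc x)" using P xy by (simp add: add_box_def)
      finally show "cols (row_part m f) (Suc x) \<le> cols (row_part (Suc m) g') (Suc x)" .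
    qed
    ultimately show ?thesis using b1 M by simp
  next
    case b2
    have gi: "x < g i" using I(1)[of i] i' b2 fii by simp
    have "g j \<le> x" using I(2)[of i] i' b2 fii by simp
    \<comment> \<open>Otherwise position \<open>x\<close> is empty on both levels,
      \<open>D = U = 0\<close>, the jump has probability 1, and index \<open>Suc i\<close> cannot
      move.\<close>
    moreover have "\<not> g j < x"
    proof
      assume lt: "g j < x"
      have "g k \<noteq> x" if "k \<in> {1..Suc m}" for k
      proof (cases "k \<le> i")
        case True
        then show ?thesis using decreasingD[OF g, of k i] gi that i' by simp
      next
        case False
        then show ?thesis using decreasingD[OF g, of j k] lt b2 that j by simp
      qed
      then have "{k \<in> {1..Suc m}. g k = x} = {}" by blast
      moreover have "f k \<noteq> x" if "k \<in> {1..m}" for k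
      proof (cases "k \<le> i")
        case True
        then show ?thesis using decreasingD[OF f, of k i] that i' by simp
      next
        case False
        then show ?thesis using I(1)[of k] fi[of k] decreasingD[OF g, of j k] lt b2 that j by simp
      qed
      then have "{k \<in> {1..m}. f k = x} = {}" by blast
      ultimately show False using b2(3) t by (simp only: card.empty jump_prob_def) simp
    qed
    ultimately have y: "g j = x" by simp
    have "decreasing (Suc m) g'" unfolding g'_def
      by (rule decreasing_up[OF g j]) (use gi y b2 in auto)
    moreover have "hstrip (row_part (Suc m) g') (row_part m f)"
      by (rule hstrip_add_boxes[OF P _ h']) (use V y in \<open>simp add: y_def\<close>)
    ultimately show ?thesis using b2 y i' by simp
  qed
  then show "decreasing (Suc m) g'" "hstrip (row_part (Suc m) g') (row_part m f)"
    "j = i \<and> f i = Suc (g j) \<or> j \<le> i \<and> mover f g i = j \<and> g i \<noteq> f i - 1 \<or> j = Suc i \<and> f i = Suc (g j)"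
    unfolding x_def by blast+
qed

lemma insertion_contribution:
  fixes g j
  defines "g' \<equiv> g(j := Suc (g j))"
  assumes g: "decreasing (Suc m) g" and f: "decreasing m f"
    and h: "hstrip (row_part (Suc m) g) (row_part m f)" and mv: "mover f g (Suc m) = j"
  shows "decreasing (Suc m) g'" "hstrip (row_part (Suc m) g') (row_part m f)"
proof -
  note M = mover[of "Suc m" f g, unfolded mv]
  note I = hstrip_interlace[OF h g f]
  have fj: "g j < f (j - 1) \<and> f (j - 1) \<le> g (j - 1)" if "2 \<le> j"
  proof -
    have j1: "1 \<le> j - 1" "j - 1 \<le> m" "Suc (j - 1) = j" using that M(2) by auto
    show ?thesis using I(1)[OF j1(1,2)] I(2)[OF j1(1,2)] M(3) that unfolding j1(3) by (simp add: free_def)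
  qed
  show "decreasing (Suc m) g'" unfolding g'_def
    by (rule decreasing_up[OF g]) (use fj M(1,2) in auto)
  have P: "add_box (row_part (Suc m) g') (row_part (Suc m) g) (g j)"
    using row_box[of j "Suc m" g] M(1,2) by (simp add: g'_def)
  show "hstrip (row_part (Suc m) g') (row_part m f)"
  proof (rule hstrip_add_upper[OF P h])
    have "cols (row_part (Suc m) g) (Suc (g j)) \<le> j - 1"
      using le_cols_row[OF g, of j "Suc (g j)"] M(1,2) by simp
    also have "\<dots> \<le> cols (row_part m f) (Suc (g j))"
    proof (cases "2 \<le> j")
      case True
      then have j1: "1 \<le> j - 1" "j - 1 \<le> m" using M(2) by auto
      then show ?thesis using le_cols_row[OF f j1, of "Suc (g j)"] fj True by simp
    qed simp
    finally show "cols (row_part (Suc m) g) (Suc (g j)) \<le> cols (row_part m f) (Suc (g j))" .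
  qed
qed

text \<open>Particles at 0 are not parts, yet they are counted in \<open>D\<close> and
  \<open>U\<close>; the first column gives their number.\<close>

lemma card_zero_row:
  assumes "decreasing m f"
  shows "card {k \<in> {1..m}. f k = 0} + cols (row_part m f) 1 = m"
proof -
  have "card {1..m} = card ({k \<in> {1..m}. f k = 0} \<union> {k \<in> {1..m}. 1 \<le> f k})"
    by (rule arg_cong[of _ _ card]) auto
  also have "card ({k \<in> {1..m}. f k = 0} \<union> {k \<in> {1..m}. 1 \<le> f k}) = card {k \<in> {1..m}. f k = 0} + card {k \<in> {1..m}. 1 \<le> f k}"
    by (rule card_Un_disjoint) auto
  finally show ?thesis by (simp add: cols_row)
qed

text \<open>With the rows after the update fixed, which lower movers can have caused the move of
  \<open>j\<close> away from \<open>y\<close>? If the strip has no box in column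
  \<open>y + 1\<close>, only \<open>i = j\<close>, by pushing. Otherwise \<open>i = j - 1\<close>
  may have been refused a jump, and exactly one of a jump from some \<open>i \<ge> j\<close> and a
  letter starting here occurs. After multiplication by \<open>M\<close> these contribute
  \<open>t\<close> times a shifted factor and \<open>1 - t\<close>, which add up to
  \<open>M\<close>.\<close>

lemma local_identity:
  fixes g j
  defines "g' \<equiv> g(j := Suc (g j))"
  assumes t: "0 < t" "t < 1"
    and g: "decreasing (Suc m) g" and f: "decreasing m f" and j: "1 \<le> j" "j \<le> Suc m"
  shows "(\<Sum>i=1..m. if removable m f i then psi t (row_part m f) (row_part m (f(i := f i - 1))) *
        phi t (row_part (Suc m) g) (row_part m (f(i := f i - 1))) * move_prob t m f g i j else 0) +
      (if mover f g (Suc m) = j then (1 - t) * phi t (row_part (Suc m) g) (row_part m f) else 0) =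
    (if decreasing (Suc m) g' then phi t (row_part (Suc m) g') (row_part m f) * psi t (row_part (Suc m) g') (row_part (Suc m) g) else 0)"
proof -
  define y where "y = g j"
  define P where "P = row_part (Suc m) g'"
  define P' where "P' = row_part (Suc m) g"
  define V where "V = row_part m f"
  define W where "W i = row_part m (f(i := f i - 1))" for i
  define T where "T i = (if removable m f i then psi t V (W i) * phi t P' (W i) * move_prob t m f g i j else 0)" for i
  define I where "I = (if mover f g (Suc m) = j then (1 - t) * phi t P' V else 0)"
  have T0: "removable m f i \<and> hstrip P' (W i) \<and> move_prob t m f g i j \<noteq> 0" if "T i \<noteq> 0" for i
    using that by (auto simp: T_def phi_def split: if_splits)
  have I0: "mover f g (Suc m) = j \<and> hstrip P' V" if "I \<noteq> 0"
    using that by (auto simp: I_def phi_def split: if_splits)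
  have C: "decreasing (Suc m) g'" "hstrip P V"
    "j = i \<and> f i = Suc y \<or> j \<le> i \<and> mover f g i = j \<and> g i \<noteq> f i - 1 \<or> j = Suc i \<and> f i = Suc y"
    if "T i \<noteq> 0" for i
    using contribution[OF t g f j, of i] T0[OF that] by (simp_all add: P_def P'_def V_def W_def g'_def y_def)
  have CI: "decreasing (Suc m) g'" "hstrip P V" if "I \<noteq> 0"
    using insertion_contribution[OF g f, of j] I0[OF that] by (simp_all add: P_def P'_def V_def g'_def)
  have "(\<Sum>i=1..m. T i) + I = (if decreasing (Suc m) g' then phi t P V * psi t P P' else 0)"
  proof (cases "decreasing (Suc m) g' \<and> hstrip P V")
    case False
    then have "T i = 0" "I = 0" for i using C(1,2) CI by blast+
    then show ?thesis using False by (auto simp: phi_def)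
  next
    case True
    then have dg': "decreasing (Suc m) g'" and h: "hstrip P V" by auto
    have PP: "add_box P P' y" using row_box[OF j, of g] by (simp add: P_def P'_def g'_def y_def)
    have g'j: "g' j = Suc y" "\<And>k. k \<noteq> j \<Longrightarrow> g' k = g k" by (simp_all add: g'_def y_def)
    note IL = hstrip_interlace[OF h[unfolded P_def V_def] dg' f]
    have colP: "cols P (Suc y) = j"
    proof -
      have "j \<le> cols P (Suc y)" using le_cols_row[OF dg' j, of "Suc y"] g'j by (simp add: P_def)
      moreover have "\<not> Suc j \<le> cols P (Suc y)"
      proof
        assume *: "Suc j \<le> cols P (Suc y)"
        then have "Suc j \<le> Suc m" using cols_row_le[of "Suc y" "Suc m" g'] by (simp add: P_def)
        moreover from this have "Suc y \<le> g' (Suc j)" using le_cols_row[OF dg', of "Suc j" "Suc y"] * by (simp add: P_def)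
        ultimately show False using decreasingD[OF g, of j "Suc j"] g'j j by (simp add: y_def)
      qed
      ultimately show ?thesis by simp
    qed
    have WW: "add_box V (W i) x" if "1 \<le> i" "i \<le> m" "f i = Suc x" for i x
      using row_box_down[where m = m and f = f and i = i and x = x] that by (simp add: V_def W_def)
    have fle: "f k < v" if "cols V v < k" "1 \<le> k" "k \<le> m" "1 \<le> v" for k v
      using le_cols_row[OF f, of k v] that by (simp add: V_def)
    have fge: "v \<le> f k" if "k \<le> cols V v" "1 \<le> k" "1 \<le> v" for k v
      using le_cols_row[OF f, of k v] that cols_row_le[of v m f] by (simp add: V_def)
    have g'ge: "v \<le> g' k" if "k \<le> cols P v" "1 \<le> k" "1 \<le> v" for k v
      using le_cols_row[OF dg', of k v] that cols_row_le[of v "Suc m" g'] by (simp add: P_def)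
    have rem: "removable m f i" if "1 \<le> i" "i \<le> m" "f i = Suc x" "i = cols V (Suc x)" for i x
      unfolding removable_def using that fle[of "Suc x" "Suc i"]
      by (auto intro!: decreasing_down[OF f])
    \<comment> \<open>Interlacing of the rows before the moves, expressed by the lower row after its
      move.\<close>
    have iw: "g (Suc i) < f i" "\<And>k. k \<noteq> i \<Longrightarrow> 1 \<le> k \<Longrightarrow> k \<le> m \<Longrightarrow> f k \<le> g k" if "removable m f i" "hstrip P' (W i)" for i
    proof -
      have "decreasing m (f(i := f i - 1))" "1 \<le> i" "i \<le> m" using that(1) by (auto simp: removable_def)
      note * = hstrip_interlace[OF that(2)[unfolded P'_def W_def] g this(1)]
      have "g (Suc i) \<le> f i - 1" using *(2)[of i] \<open>1 \<le> i\<close> \<open>i \<le> m\<close> by simp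
      moreover have "1 \<le> f i" using that(1) by (simp add: removable_def)
      ultimately show "g (Suc i) < f i" by linarith
      show "f k \<le> g k" if "k \<noteq> i" "1 \<le> k" "k \<le> m" for k using *(1)[of k] that by simp
    qed
    \<comment> \<open>Column \<open>y + 1\<close> has length \<open>j\<close> in the upper row, so
      (A) means that the strip has no box there and (B) that it has one.\<close>
    consider (A) "cols V (Suc y) = j" | (B) "cols V (Suc y) = j - 1"
      using hstripD[OF h, of y] colP by linarith
    then show ?thesis
    proof cases
      case A
      have jm: "j \<le> m" using A cols_row_le[of "Suc y" m f] by (simp add: V_def)
      have fj: "f j = Suc y" using fge[of j "Suc y"] IL(1)[OF j(1) jm] A j g'j by simp
      have "T i = 0" if "i \<noteq> j" for i
      proof (rule ccontr)
        assume "T i \<noteq> 0"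
        then have "f j \<le> g j" using iw(2)[of i j] T0 that j jm by auto
        then show False using fj by (simp add: y_def)
      qed
      moreover have "I = 0"
      proof (rule ccontr)
        assume "I \<noteq> 0"
        then have "hstrip (row_part (Suc m) g) (row_part m f)" using I0 by (simp add: P'_def V_def)
        then have "f j \<le> g j" using hstrip_interlace(1)[OF _ g f j(1) jm] by blast
        then show False using fj by (simp add: y_def)
      qed
      moreover have "T j = phi t P V * psi t P P'"
      proof -
        have "move_prob t m f g j j = 1" using fj by (simp add: move_prob_def y_def)
        moreover have "removable m f j" by (rule rem[OF j(1) jm fj]) (use A in simp)
        ultimately show ?thesis
          using weight_push[OF PP WW[OF j(1) jm fj] h, of t] colP A by (simp add: T_def)
      qed
      moreover have "(\<Sum>i=1..m. T i) = T j"
      proof -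
        have "(\<Sum>i=1..m. T i) = (\<Sum>i\<in>{j}. T i)"
          by (rule sum.mono_neutral_right) (use calculation j jm in auto)
        then show ?thesis by simp
      qed
      ultimately show ?thesis using dg' by simp
    next
      case B
      define E where "E = phi t P V * psi t P P'"
      define a where "a = count P (Suc y)"
      define b where "b = count V (Suc y)"
      define M where "M = mfac t a b"
      have colPV: "cols P (Suc y) = Suc (cols V (Suc y))" using colP B j by simp
      have ab: "a = Suc b \<or> a = b" "1 \<le> a"
      proof -
        have "a + cols V (Suc y) + cols P (Suc (Suc y)) = b + cols P (Suc y) + cols V (Suc (Suc y))"
          unfolding a_def b_def by (rule hstrip_count_cols) simp
        then show "a = Suc b \<or> a = b" using colPV hstripD[OF h, of "Suc y"] by linarith
        show "1 \<le> a" using box_count_Suc[OF PP] by (simp add: a_def)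
      qed
      have M0: "M \<noteq> 0" using power_sub_ne_0[OF t, of a] ab by (auto simp: M_def mfac_def)
      have fj: "f j \<le> y" if "j \<le> m" using fle[of "Suc y" j] B j that by simp
      have free_j: "free f g j"
      proof -
        have "g j \<noteq> f (j - 1)" if "2 \<le> j"
        proof -
          have j1: "1 \<le> j - 1" "j - 1 \<le> m" "Suc (j - 1) = j" using that j by auto
          show ?thesis using IL(2)[OF j1(1,2)] g'j(1) unfolding j1(3) by (simp add: y_def)
        qed
        then show ?thesis by (auto simp: free_def)
      qed
      have Tcases: "j \<le> i \<and> mover f g i = j \<or> j = Suc i \<and> f i = Suc y" if "T i \<noteq> 0" for i
      proof -
        have "i \<le> m" using T0[OF that] by (simp add: removable_def)
        then show ?thesis using C(3)[OF that] fj by auto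
      qed
      \<comment> \<open>Where the columns from \<open>w + 1\<close> to \<open>y\<close> of the strip
        are full, a gap between upper particle \<open>k\<close> and lower particle
        \<open>k - 1\<close> would need an empty column; hence \<open>k\<close> is blocked.\<close>
      have chain: "g k = f (k - 1)"
        if k: "j < k" "k \<le> Suc m" and run: "\<And>v. w < v \<Longrightarrow> v \<le> y \<Longrightarrow> cols P v = Suc (cols V v)"
          and low: "w \<le> g' k" for k w
      proof -
        have k1: "1 \<le> k - 1" "k - 1 \<le> m" "Suc (k - 1) = k" using k j by auto
        have le: "g' k \<le> f (k - 1)" using IL(2)[OF k1(1,2)] unfolding k1(3) .
        have "\<not> g' k < f (k - 1)"
        proof
          assume lt: "g' k < f (k - 1)"
          have "f (k - 1) \<le> f j" by (rule decreasingD[OF f]) (use k j in auto)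
          then have v: "w < f (k - 1)" "f (k - 1) \<le> y" using fj low lt k by auto
          have "k - 1 \<le> cols V (f (k - 1))" using le_cols_row[OF f k1(1,2), of "f (k - 1)"] lt by (simp add: V_def)
          then have "k \<le> cols P (f (k - 1))" using run[OF v] by simp
          then show False using g'ge[of k "f (k - 1)"] lt k by simp
        qed
        then show ?thesis using le g'j(2)[of k] k by simp
      qed
      \<comment> \<open>\<open>b = 0\<close> means that no lower particle is at
        \<open>y + 1\<close>, so \<open>j - 1\<close> cannot have just arrived there.\<close>
      have stay: "(if 2 \<le> j then T (j - 1) else 0) * M = (if b = 0 then 0 else t * E * mfac t (a - 1) (b - 1))"
      proof (cases "b = 0")
        case True
        have "T (j - 1) = 0" if "2 \<le> j"
        proof (rule ccontr)
          assume nz: "T (j - 1) \<noteq> 0"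
          then have "f (j - 1) = Suc y" "j - 1 \<le> m" using Tcases[OF nz] that j by auto
          then have "j - 1 \<in> {k \<in> {1..m}. f k = Suc y}" using that by simp
          then have "0 < card {k \<in> {1..m}. f k = Suc y}" by (subst card_gt_0_iff) auto
          moreover have "count V (Suc y) = card {k \<in> {1..m}. f k = Suc y}"
            unfolding V_def by (rule count_row) simp
          ultimately show False using True unfolding b_def by linarith
        qed
        then show ?thesis using True by simp
      next
        case False
        have "cols V (Suc (Suc y)) < j - 1" using cols_Suc[of V "Suc y"] B False by (simp add: b_def)
        then have j2: "2 \<le> j" and jm: "1 \<le> j - 1" "j - 1 \<le> m" and c2: "cols V (Suc (Suc y)) < j - 1"
          using j by auto
        have "Suc y \<le> f (j - 1)" by (rule fge) (use B jm in auto)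
        moreover have "f (j - 1) < Suc (Suc y)" by (rule fle[OF c2 jm]) simp
        ultimately have f1: "f (j - 1) = Suc y" "j - 1 \<le> m" using jm by auto
        define i where "i = j - 1"
        have i: "1 \<le> i" "i \<le> m" "f i = Suc y" "j = Suc i" using j2 f1 by (auto simp: i_def)
        have "removable m f i" by (rule rem[OF i(1,2,3)]) (use B i in simp)
        moreover have "g i \<noteq> y" using IL(1)[OF i(1,2)] g'j(2)[of i] i by simp
        moreover have "mover f g i \<noteq> j" using mover(2)[OF i(1), of f g] i by simp
        moreover define D where "D = card {k \<in> {1..m}. f k = y}"
        moreover define U where "U = card {k \<in> {1..Suc m}. g k = y}"
        ultimately have Ti: "T i = psi t V (W i) * phi t P' (W i) * (1 - jump_prob t D U)"
          using i by (simp add: T_def move_prob_def Let_def)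
        have DU: "if y = 0 then U \<noteq> D else D = count V y \<and> U = count P' y"
        proof (cases "y = 0")
          case True
          have "D + cols V 1 = m" "U + cols P' 1 = Suc m"
            using card_zero_row[OF f] card_zero_row[OF g] True by (simp_all add: D_def U_def V_def P'_def)
          moreover have "cols P 1 = Suc (cols P' 1)" using PP True by (simp add: add_box_def)
          ultimately show ?thesis using True colPV by simp
        next
          case False
          then show ?thesis by (simp add: D_def U_def V_def P'_def count_row)
        qed
        have "(if 2 \<le> j then T (j - 1) else 0) = T i" using j2 by (simp add: i_def)
        moreover have "T i * M = t * E * mfac t (a - 1) (b - 1)"
          unfolding Ti M_def a_def b_def E_def by (rule weight_stay[OF t PP WW[OF i(1,2,3)] h colPV DU])
        ultimately show ?thesis using False by (simp only: if_False)
      qed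
      have rest: "((\<Sum>i\<in>{j..m}. T i) + I) * M = (1 - t) * E"
      proof -
        \<comment> \<open>Columns up to \<open>y\<close> where the strip has no box. The largest
          one, \<open>x + 1\<close>, tells where the lower box was added; if there is none, the move
          began with a letter at this level.\<close>
        define Z where "Z = {v \<in> {1..y}. cols P v = cols V v}"
        have nZ: "cols P v = Suc (cols V v)" if "v \<notin> Z" "1 \<le> v" "v \<le> Suc y" for v
        proof (cases "v = Suc y")
          case True
          then show ?thesis using colPV by simp
        next
          case False
          then show ?thesis using that hstripD[OF h, of "v - 1"] by (auto simp: Z_def)
        qed
        have I_zero: "I = 0" if "removable m f i" "hstrip P' (W i)" "j \<le> i" for i
        proof (rule ccontr)
          assume "I \<noteq> 0"
          then have "mover f g (Suc m) = j" using I0 by blast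
          then have "g (Suc i) = f i" using mover(4)[of "Suc m" f g "Suc i"] that by (simp add: removable_def)
          then show False using iw(1)[OF that(1,2)] that(1) by (simp add: removable_def)
        qed
        \<comment> \<open>Of two such indices the smaller one, \<open>k\<close>, would satisfy
          \<open>g (Suc k) = f k\<close>, which \<open>iw\<close> forbids.\<close>
        have T_unique: "i = i'" if "T i \<noteq> 0" "j \<le> i" "removable m f i'" "hstrip P' (W i')" "mover f g i' = j" "j \<le> i'" for i i'
        proof -
          have Ti: "removable m f i" "hstrip P' (W i)" "mover f g i = j"
            using T0[OF that(1)] Tcases[OF that(1)] that(2) by auto
          have *: False if "removable m f k" "hstrip P' (W k)" "j \<le> k" "k < k'" "mover f g k' = j" for k k'
          proof -
            have "g (Suc k) = f k" using mover(4)[of k' f g "Suc k"] that by simp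
            then show False using iw(1)[OF that(1,2)] that(1) by (simp add: removable_def)
          qed
          show ?thesis using *[of i i'] *[of i' i] Ti that by (metis linorder_neqE_nat)
        qed
        show ?thesis
        proof (cases "Z = {}")
          case True
          have mv: "mover f g (Suc m) = j"
            by (rule mover_eqI[OF j free_j], rule chain[where w = 0]) (use True nZ in auto)
          have "T i = 0" if "i \<in> {j..m}" for i
          proof (rule ccontr)
            assume nz: "T i \<noteq> 0"
            have "removable m f i" "hstrip P' (W i)" using T0[OF nz] by auto
            moreover have "g (Suc i) = f i" using mover(4)[of "Suc m" f g "Suc i"] mv that by simp
            ultimately show False using iw(1)[of i] by (simp add: removable_def)
          qed
          then have "(\<Sum>i\<in>{j..m}. T i) = 0" by simp
          moreover have "phi t P' V * M = E"
            unfolding M_def a_def b_def E_def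
            by (rule phi_box_insert(1)[OF PP _ h]) (use True nZ in \<open>auto simp: V_def\<close>)
          ultimately show ?thesis using mv by (simp add: I_def)
        next
          case False
          have finZ: "finite Z" by (simp add: Z_def)
          define x where "x = Max Z - 1"
          have MZ: "Max Z \<in> Z" using finZ False by (rule Max_in)
          have x: "Suc x \<in> Z" "x < y" "cols P (Suc x) = cols V (Suc x)" using MZ by (auto simp: x_def Z_def)
          have sx: "Suc x = Max Z" using MZ by (auto simp: x_def Z_def)
          have run: "cols P v = Suc (cols V v)" if "x + 2 \<le> v" "v \<le> Suc y" for v
          proof (rule nZ)
            show "v \<notin> Z"
            proof
              assume "v \<in> Z"
              then have "v \<le> Max Z" using finZ by simp
              then show False using that sx by simp
            qed
          qed (use that in auto)
          \<comment> \<open>The last lower particle at position at least \<open>x + 1\<close>. Since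
            the next column is shorter, it sits exactly at \<open>x + 1\<close>.\<close>
          define i where "i = cols V (Suc x)"
          have ij: "j \<le> i" using cols_antimono[of "Suc x" "Suc y" P] colP x by (simp add: i_def)
          have im: "i \<le> m" unfolding i_def V_def by (rule cols_row_le) simp
          have i1: "1 \<le> i" using ij j by simp
          have fi: "f i = Suc x"
          proof -
            have "Suc x \<le> f i" by (rule fge) (use i1 in \<open>auto simp: i_def\<close>)
            moreover have "cols V (Suc (Suc x)) < i"
              using run[of "Suc (Suc x)"] x cols_antimono[of "Suc x" "Suc (Suc x)" P] by (simp add: i_def)
            then have "f i < Suc (Suc x)" using fle i1 im by simp
            ultimately show ?thesis by simp
          qed
          have ri: "removable m f i" by (rule rem[OF i1 im fi]) (simp add: i_def)
          note Wi = WW[OF i1 im fi]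
          have hi: "hstrip P' (W i)" by (rule phi_boxes_apart(2)[OF PP Wi x(2) h run x(3)])
          have g'x: "Suc x \<le> g' k" if "1 \<le> k" "k \<le> i" for k
            by (rule g'ge) (use that x in \<open>auto simp: i_def\<close>)
          have gi: "g i \<noteq> x"
          proof (cases "i = j")
            case True
            then show ?thesis using x by (simp add: y_def)
          next
            case False
            then show ?thesis using g'x[of i] g'j(2)[of i] i1 by simp
          qed
          have mv: "mover f g i = j"
          proof (rule mover_eqI[OF j(1) ij free_j])
            fix k assume k: "j < k" "k \<le> i"
            show "g k = f (k - 1)"
              by (rule chain[where w = "Suc x"]) (use k im run g'x[of k] in auto)
          qed
          define D where "D = card {k \<in> {1..m}. f k = x}"
          define U where "U = card {k \<in> {1..Suc m}. g k = x}"
          have Ti: "T i = psi t V (W i) * phi t P' (W i) * jump_prob t D U"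
            using ri gi mv fi ij by (simp add: T_def move_prob_def Let_def D_def U_def)
          have DU: "if x = 0 then U \<noteq> D else D = count V x \<and> U = count P' x"
          proof (cases "x = 0")
            case True
            have "D + cols V 1 = m" "U + cols P' 1 = Suc m"
              using card_zero_row[OF f] card_zero_row[OF g] True by (simp_all add: D_def U_def V_def P'_def)
            moreover have "cols P 1 = cols P' 1" using PP x by (simp add: add_box_def)
            ultimately show ?thesis using True x by simp
          next
            case False
            then show ?thesis by (simp add: D_def U_def V_def P'_def count_row)
          qed
          have "T i * M = (1 - t) * E"
            unfolding Ti M_def a_def b_def E_def
            by (rule weight_jump[OF t PP Wi x(2) h run x(3) DU])
          moreover have "(\<Sum>i\<in>{j..m}. T i) = T i"
          proof -
            have "(\<Sum>i\<in>{j..m}. T i) = (\<Sum>i\<in>{i}. T i)"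
            proof (rule sum.mono_neutral_right)
              show "\<forall>k\<in>{j..m} - {i}. T k = 0" using T_unique[of _ i] ri hi mv ij by auto
            qed (use ij im in auto)
            then show ?thesis by simp
          qed
          moreover have "I = 0" by (rule I_zero[OF ri hi ij])
          ultimately show ?thesis by simp
        qed
      qed
      have split: "(\<Sum>i=1..m. T i) = (if 2 \<le> j then T (j - 1) else 0) + (\<Sum>i\<in>{j..m}. T i)"
      proof -
        have "(\<Sum>i=1..m. T i) = (\<Sum>i\<in>(if 2 \<le> j then {j - 1} else {}) \<union> {j..m}. T i)"
        proof (rule sum.mono_neutral_right)
          show "(if 2 \<le> j then {j - 1} else {}) \<union> {j..m} \<subseteq> {1..m}" using j by auto
          show "\<forall>i\<in>{1..m} - ((if 2 \<le> j then {j - 1} else {}) \<union> {j..m}). T i = 0"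
          proof
            fix i assume i: "i \<in> {1..m} - ((if 2 \<le> j then {j - 1} else {}) \<union> {j..m})"
            show "T i = 0"
            proof (rule ccontr)
              assume "T i \<noteq> 0"
              from Tcases[OF this] show False using i by (auto split: if_splits)
            qed
          qed
        qed simp
        also have "\<dots> = (if 2 \<le> j then T (j - 1) else 0) + (\<Sum>i\<in>{j..m}. T i)"
          by (subst sum.union_disjoint) auto
        finally show ?thesis .
      qed
      have "((\<Sum>i=1..m. T i) + I) * M = (if 2 \<le> j then T (j - 1) else 0) * M + ((\<Sum>i\<in>{j..m}. T i) + I) * M"
        unfolding split by (simp add: algebra_simps)
      also have "\<dots> = (if b = 0 then 0 else t * E * mfac t (a - 1) (b - 1)) + (1 - t) * E"
        unfolding stay rest ..
      \<comment> \<open>That is \<open>M = (1 - t) + t * mfac t (a - 1) (b - 1)\<close>; for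
        \<open>b = 0\<close> the second term is absent, \<open>a = 1\<close> and
        \<open>M = 1 - t\<close>.\<close>
      also have "\<dots> = E * M"
      proof (cases "b = 0")
        case True
        then have "a = 1" using ab by auto
        then show ?thesis using True by (simp add: M_def mfac_def)
      next
        case False
        then obtain c where c: "b = Suc c" by (cases b) auto
        from ab(1) show ?thesis
        proof
          assume "a = Suc b"
          then show ?thesis using c by (simp add: M_def mfac_def algebra_simps)
        next
          assume "a = b"
          then show ?thesis using c by (simp add: M_def algebra_simps)
        qed
      qed
      finally show ?thesis using M0 dg' by (simp add: E_def)
    qed
  qed
  then show ?thesis by (simp only: T_def I_def P_def P'_def V_def W_def)
qed

section \<open>The law of the interlacing array\<close>

lemma pmf_bind_finite:
  assumes "finite A" "set_pmf M \<subseteq> A"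
  shows "pmf (bind_pmf M f) x = (\<Sum>a\<in>A. pmf M a * pmf (f a) x)"
  unfolding pmf_bind using assms
  by (subst integral_measure_pmf_real[of A]) (auto simp: mult.commute)

text \<open>\<open>bernoulli_pmf\<close> has the intended meaning only for parameters in this
  range.\<close>

lemma jump_prob_bounds:
  assumes "0 < t" "t < 1"
  shows "0 \<le> jump_prob t D U" "jump_prob t D U \<le> 1"
proof -
  have a: "t * t ^ D \<le> t" using assms by (intro mult_left_le power_le_one) auto
  moreover have "0 < 1 - t * t ^ D" using a assms by linarith
  ultimately show "0 \<le> jump_prob t D U" "jump_prob t D U \<le> 1"
    using assms by (auto simp: jump_prob_def divide_le_eq)
qed

lemma last_free_mover: "last_free \<Lambda> (Suc m) i = mover (\<Lambda> m) (\<Lambda> (Suc m)) i"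
  by (simp add: last_free_def mover_def blocked_def free_def)

lemma pmf_next_mover:
  assumes "0 < t" "t < 1"
  shows "pmf (next_mover t \<Lambda> m i) j = move_prob t m (\<Lambda> m) (\<Lambda> (Suc m)) i j"
proof -
  define x where "x = \<Lambda> m i - 1"
  define r where "r = jump_prob t (cluster_size \<Lambda> m x) (cluster_size \<Lambda> (Suc m) x)"
  have r: "0 \<le> r" "r \<le> 1" unfolding r_def by (rule jump_prob_bounds[OF assms])+
  have nm: "next_mover t \<Lambda> m i = (if \<Lambda> (Suc m) i = x then return_pmf i
      else map_pmf (\<lambda>b. if b then mover (\<Lambda> m) (\<Lambda> (Suc m)) i else Suc i) (bernoulli_pmf r))"
    unfolding next_mover_def Let_def Suc_eq_plus1[symmetric] last_free_mover x_def r_def jump_prob_def ..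
  have "pmf (map_pmf (\<lambda>b. if b then mover (\<Lambda> m) (\<Lambda> (Suc m)) i else Suc i) (bernoulli_pmf r)) j =
    r * (if j = mover (\<Lambda> m) (\<Lambda> (Suc m)) i then 1 else 0) + (1 - r) * (if j = Suc i then 1 else 0)"
    unfolding map_pmf_def pmf_bind using r by (simp add: indicator_def mult.commute)
  then show ?thesis
    unfolding nm by (auto simp: move_prob_def Let_def x_def r_def cluster_size_def indicator_def)
qed

lemma set_next_mover:
  assumes "0 < t" "t < 1" "1 \<le> i" "i \<le> m"
  shows "set_pmf (next_mover t \<Lambda> m i) \<subseteq> {1..Suc m}"
proof
  fix j assume "j \<in> set_pmf (next_mover t \<Lambda> m i)"
  then have "move_prob t m (\<Lambda> m) (\<Lambda> (Suc m)) i j \<noteq> 0"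
    using pmf_next_mover[OF assms(1,2)] by (simp add: set_pmf_iff)
  then have "j = i \<or> j = mover (\<Lambda> m) (\<Lambda> (Suc m)) i \<or> j = Suc i"
    by (auto simp: move_prob_def Let_def split: if_splits)
  then show "j \<in> {1..Suc m}" using assms mover(1,2)[of i "\<Lambda> m" "\<Lambda> (Suc m)"] by auto
qed

definition arrays :: "nat \<Rightarrow> nat \<Rightarrow> particles set" where
  "arrays N B = {\<Lambda>. \<forall>m i. if 1 \<le> i \<and> i \<le> m \<and> m \<le> N then \<Lambda> m i \<le> B else \<Lambda> m i = 0}"

text \<open>Interlacing is left to the weights, whose factors \<open>phi\<close> vanish unless
  consecutive rows form a horizontal strip.\<close>

definition valid :: "nat \<Rightarrow> particles \<Rightarrow> bool" where
  "valid N \<Lambda> \<longleftrightarrow> (\<forall>m i. \<not> (1 \<le> i \<and> i \<le> m \<and> m \<le> N) \<longrightarrow> \<Lambda> m i = 0) \<and> (\<forall>m\<le>N. decreasing m (\<Lambda> m))"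

lemma finite_arrays [simp]: "finite (arrays N B)"
proof -
  define R :: "(nat \<Rightarrow> nat) set" where "R = {f. \<forall>i. (i \<in> {1..N} \<longrightarrow> f i \<in> {..B}) \<and> (i \<notin> {1..N} \<longrightarrow> f i = 0)}"
  have "finite R" unfolding R_def by (rule finite_set_of_finite_funs) auto
  then have "finite {\<Lambda> :: particles. \<forall>m. (m \<in> {..N} \<longrightarrow> \<Lambda> m \<in> R) \<and> (m \<notin> {..N} \<longrightarrow> \<Lambda> m = (\<lambda>_. 0))}"
    by (intro finite_set_of_finite_funs) auto
  then show ?thesis
  proof (rule rev_finite_subset)
    show "arrays N B \<subseteq> {\<Lambda>. \<forall>m. (m \<in> {..N} \<longrightarrow> \<Lambda> m \<in> R) \<and> (m \<notin> {..N} \<longrightarrow> \<Lambda> m = (\<lambda>_. 0))}"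
    proof
      fix \<Lambda> assume \<Lambda>: "\<Lambda> \<in> arrays N B"
      have in0: "\<Lambda> m i = 0" if "\<not> (1 \<le> i \<and> i \<le> m \<and> m \<le> N)" for m i using \<Lambda> that by (auto simp: arrays_def)
      have le: "\<Lambda> m i \<le> B" for m i using \<Lambda> in0[of i m] by (cases "1 \<le> i \<and> i \<le> m \<and> m \<le> N") (auto simp: arrays_def)
      show "\<Lambda> \<in> {\<Lambda>. \<forall>m. (m \<in> {..N} \<longrightarrow> \<Lambda> m \<in> R) \<and> (m \<notin> {..N} \<longrightarrow> \<Lambda> m = (\<lambda>_. 0))}"
        using in0 le by (auto simp: R_def fun_eq_iff)
    qed
  qed
qed

lemma entry_le_sum_row: "1 \<le> i \<Longrightarrow> i \<le> m \<Longrightarrow> f i \<le> sum_mset (row_part m f)"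
  unfolding sum_row by (rule member_le_sum) auto

text \<open>Turns sums over the last mover into sums over partitions one box smaller. The single
  column \<open>v\<close> of the strip determines the particle as the last row reaching
  \<open>v\<close>.\<close>

lemma removable_row_bij:
  assumes f: "decreasing m f" and s: "row_part m f \<in> Par (Suc n)"
  shows "bij_betw (\<lambda>i. row_part m (f(i := f i - 1))) {i \<in> {1..m}. removable m f i} {\<kappa> \<in> Par n. hstrip (row_part m f) \<kappa>}"
proof -
  let ?\<rho> = "row_part m f" and ?r = "\<lambda>i. row_part m (f(i := f i - 1))"
  have bx: "add_box ?\<rho> (?r i) (f i - 1)" if "removable m f i" for i
    by (rule row_box_down) (use that in \<open>auto simp: removable_def\<close>)
  have nxt: "f k < f i" if "removable m f i" "i < k" "k \<le> m" for i k
  proof -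
    have "decreasing m (f(i := f i - 1))" "1 \<le> i" "1 \<le> f i" using that by (auto simp: removable_def)
    then show ?thesis using decreasingD[of m "f(i := f i - 1)" i k] that by simp
  qed
  have "inj_on ?r {i \<in> {1..m}. removable m f i}"
  proof (rule inj_onI)
    fix i k assume ik: "i \<in> {i \<in> {1..m}. removable m f i}" "k \<in> {i \<in> {1..m}. removable m f i}" and eq: "?r i = ?r k"
    have "f i - 1 = f k - 1"
    proof (rule ccontr)
      assume ne: "f i - 1 \<noteq> f k - 1"
      have "cols ?\<rho> (Suc (f i - 1)) = cols (?r i) (Suc (f i - 1)) + 1"
        using bx[of i] ik by (auto simp: add_box_def)
      moreover have "cols ?\<rho> (Suc (f i - 1)) = cols (?r k) (Suc (f i - 1))"
        using bx[of k] ik ne by (auto simp: add_box_def)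
      ultimately show False unfolding eq by linarith
    qed
    moreover have "1 \<le> f i" "1 \<le> f k" using ik by (auto simp: removable_def)
    ultimately have "f i = f k" by linarith
    then show "i = k" using nxt[of i k] nxt[of k i] ik by (cases i k rule: linorder_cases) auto
  qed
  moreover have "?r ` {i \<in> {1..m}. removable m f i} = {\<kappa> \<in> Par n. hstrip ?\<rho> \<kappa>}"
  proof
    show "?r ` {i \<in> {1..m}. removable m f i} \<subseteq> {\<kappa> \<in> Par n. hstrip ?\<rho> \<kappa>}"
      using box_sum[OF bx] box_hstrip[OF bx] s by (auto simp: Par_def)
    show "{\<kappa> \<in> Par n. hstrip ?\<rho> \<kappa>} \<subseteq> ?r ` {i \<in> {1..m}. removable m f i}"
    proof
      fix \<kappa> assume \<kappa>: "\<kappa> \<in> {\<kappa> \<in> Par n. hstrip ?\<rho> \<kappa>}"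
      then have h: "hstrip ?\<rho> \<kappa>" and p: "\<kappa> \<in> partitions" "sum_mset \<kappa> = n" by (auto simp: Par_def)
      obtain B where B: "\<And>k. k \<in># ?\<rho> \<Longrightarrow> k \<le> B" "\<And>k. k \<in># \<kappa> \<Longrightarrow> k \<le> B"
        "sum_mset ?\<rho> = (\<Sum>v=1..B. cols ?\<rho> v)" "sum_mset \<kappa> = (\<Sum>v=1..B. cols \<kappa> v)"
        by (rule sum_mset_bound[of ?\<rho> \<kappa>]) (rule that)
      have "(\<Sum>v=1..B. cols ?\<rho> v - cols \<kappa> v) = (\<Sum>v=1..B. cols ?\<rho> v) - (\<Sum>v=1..B. cols \<kappa> v)"
        by (rule sum_subtractf_nat) (use h in \<open>auto simp: hstrip_def\<close>)
      also have "\<dots> = 1" using B(3,4) s p by (simp add: Par_def)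
      finally obtain v where v: "v \<in> {1..B}" "cols ?\<rho> v - cols \<kappa> v = 1"
        "\<And>w. w \<in> {1..B} \<Longrightarrow> w \<noteq> v \<Longrightarrow> cols ?\<rho> w - cols \<kappa> w = 0"
        by (subst (asm) sum_eq_1_iff) auto
      have eq: "cols ?\<rho> w = cols \<kappa> w" if "1 \<le> w" "w \<noteq> v" for w
      proof (cases "w \<le> B")
        case True
        then show ?thesis using v(3)[of w] h that by (auto simp: hstrip_def intro: antisym)
      next
        case False
        then have "cols ?\<rho> w = 0" "cols \<kappa> w = 0" using B(1,2) by (force simp: cols_eq_0)+
        then show ?thesis by simp
      qed
      define i where "i = cols ?\<rho> v"
      have i: "1 \<le> i" "i \<le> m" using v cols_row_le[of v m f] by (auto simp: i_def)
      have lt: "cols ?\<rho> (Suc v) < i"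
        using eq[of "Suc v"] cols_antimono[of v "Suc v" \<kappa>] v by (simp add: i_def)
      have fi: "f i = v"
        using le_cols_row[OF f i, of v] le_cols_row[OF f i, of "Suc v"] v(1) lt by (simp add: i_def)
      have "removable m f i"
      proof -
        have "f (Suc i) \<le> v - 1" if "i < m"
          using le_cols_row[OF f, of "Suc i" v] that v(1) by (simp add: i_def)
        then have "decreasing m (f(i := v - 1))" using fi by (intro decreasing_down[OF f i]) auto
        then show ?thesis using i fi v(1) by (simp add: removable_def)
      qed
      moreover have "?r i = \<kappa>"
      proof (rule partitions_eqI[OF row_partition p(1)])
        fix w :: nat assume w: "1 \<le> w"
        have "cols ?\<rho> w = cols (?r i) w + (if w = v then 1 else 0)"
          using bx[OF calculation] w fi v(1) by (simp add: add_box_def)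
        then show "cols (?r i) w = cols \<kappa> w" using eq[OF w] v(2) by (cases "w = v") auto
      qed
      ultimately show "\<kappa> \<in> ?r ` {i \<in> {1..m}. removable m f i}" using i by force
    qed
  qed
  ultimately show ?thesis by (simp add: bij_betw_def)
qed

lemma row_part_0 [simp]: "row_part 0 f = {#}"
  by (simp add: row_part_def partition_of_tuple_def)

lemma removable_box: "removable m f i \<Longrightarrow> add_box (row_part m f) (row_part m (f(i := f i - 1))) (f i - 1)"
  by (rule row_box_down) (auto simp: removable_def)

section \<open>Weights of arrays and of partially updated arrays\<close>

context
  fixes t :: real and N :: nat and \<alpha> :: "nat \<Rightarrow> real"
begin

definition wk :: "nat \<Rightarrow> nat multiset \<Rightarrow> nat multiset \<Rightarrow> real" where
  "wk k \<rho> \<mu> = phi t \<rho> \<mu> * \<alpha> k ^ (sum_mset \<rho> - sum_mset \<mu>)"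

definition low :: "nat \<Rightarrow> particles \<Rightarrow> real" where
  "low m \<Lambda> = (\<Prod>k=1..m. wk k (row_part k (\<Lambda> k)) (row_part (k - 1) (\<Lambda> (k - 1))))"

text \<open>The weight of the top \<open>d\<close> levels over a row \<open>\<rho>\<close> of level
  \<open>N - d\<close>. This row is a separate argument because during an update the levels above
  still refer to the row before its move, whereas the array already holds the moved one.\<close>

primrec tail :: "nat \<Rightarrow> nat \<Rightarrow> particles \<Rightarrow> nat multiset \<Rightarrow> real" where
  "tail n 0 \<Lambda> \<rho> = (if sum_mset \<rho> = n then hl_paths t \<rho> else 0)"
| "tail n (Suc d) \<Lambda> \<rho> = wk (N - d) (row_part (N - d) (\<Lambda> (N - d))) \<rho> * tail n d \<Lambda> (row_part (N - d) (\<Lambda> (N - d)))"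

definition array_weight :: "nat \<Rightarrow> particles \<Rightarrow> real" where
  "array_weight n \<Lambda> = (if valid N \<Lambda> then tail n N \<Lambda> {#} else 0)"

text \<open>The joint weight of the array and the moved particle \<open>i\<close> of level \<open>m\<close>, when the levels up to
  \<open>m\<close> have already been updated and the levels above still have total size \<open>n\<close> on top.\<close>

definition stage :: "nat \<Rightarrow> nat \<Rightarrow> particles \<Rightarrow> nat \<Rightarrow> real" where
  "stage n m \<Lambda> i = (if valid N \<Lambda> \<and> removable m (\<Lambda> m) i
     then low m \<Lambda> * (psi t (row_part m (\<Lambda> m)) (row_part m ((\<Lambda> m)(i := \<Lambda> m i - 1))) / (1 - t)) *
       tail n (N - m) \<Lambda> (row_part m ((\<Lambda> m)(i := \<Lambda> m i - 1))) else 0)"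

lemma low_Suc: "low (Suc m) \<Lambda> = low m \<Lambda> * wk (Suc m) (row_part (Suc m) (\<Lambda> (Suc m))) (row_part m (\<Lambda> m))"
  by (simp add: low_def)

lemma low_cong: "(\<And>k. k \<le> m \<Longrightarrow> \<Lambda> k = \<Lambda>' k) \<Longrightarrow> low m \<Lambda> = low m \<Lambda>'"
  unfolding low_def by (intro prod.cong) auto

lemma tail_cong: "(\<And>k. N - d < k \<Longrightarrow> \<Lambda> k = \<Lambda>' k) \<Longrightarrow> d \<le> N \<Longrightarrow> tail n d \<Lambda> \<rho> = tail n d \<Lambda>' \<rho>"
proof (induction d arbitrary: \<rho>)
  case (Suc d)
  have "\<Lambda> (N - d) = \<Lambda>' (N - d)" using Suc.prems by simp
  moreover have "tail n d \<Lambda> \<rho> = tail n d \<Lambda>' \<rho>" for \<rho> by (rule Suc.IH) (use Suc.prems in auto)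
  ultimately show ?case by simp
qed simp

lemma tail_low: "m \<le> N \<Longrightarrow> tail n N \<Lambda> {#} = low m \<Lambda> * tail n (N - m) \<Lambda> (row_part m (\<Lambda> m))"
proof (induction m)
  case 0
  then show ?case by (simp add: low_def)
next
  case (Suc m)
  have "N - m = Suc (N - Suc m)" "N - (N - Suc m) = Suc m" using Suc.prems by auto
  then show ?case using Suc by (simp add: low_Suc mult.assoc)
qed

text \<open>Sizes do not increase downwards along strips; this confines the weights to finitely many
  arrays.\<close>

lemma tail_bound:
  "tail n d \<Lambda> \<rho> \<noteq> 0 \<Longrightarrow> d \<le> N \<Longrightarrow> sum_mset \<rho> \<le> n \<and> (\<forall>k. N - d < k \<and> k \<le> N \<longrightarrow> sum_mset (row_part k (\<Lambda> k)) \<le> n)"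
proof (induction d arbitrary: \<rho>)
  case 0
  then show ?case by (auto split: if_splits)
next
  case (Suc d)
  define \<sigma> where "\<sigma> = row_part (N - d) (\<Lambda> (N - d))"
  have nz: "wk (N - d) \<sigma> \<rho> \<noteq> 0" "tail n d \<Lambda> \<sigma> \<noteq> 0" using Suc.prems by (auto simp: \<sigma>_def)
  have IH: "sum_mset \<sigma> \<le> n" "\<And>k. N - d < k \<Longrightarrow> k \<le> N \<Longrightarrow> sum_mset (row_part k (\<Lambda> k)) \<le> n"
    using Suc.IH[OF nz(2)] Suc.prems by auto
  have "hstrip \<sigma> \<rho>" using nz(1) by (auto simp: wk_def phi_def split: if_splits)
  then have "sum_mset \<rho> \<le> n" using hstrip_sum_le IH(1) by fastforce
  moreover have "sum_mset (row_part k (\<Lambda> k)) \<le> n" if "N - Suc d < k" "k \<le> N" for k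
  proof (cases "k = N - d")
    case True
    then show ?thesis using IH(1) by (simp add: \<sigma>_def)
  next
    case False
    then show ?thesis using IH(2)[of k] that by simp
  qed
  ultimately show ?case by blast
qed

lemma low_bound:
  "low m \<Lambda> \<noteq> 0 \<Longrightarrow> k \<le> m \<Longrightarrow> sum_mset (row_part k (\<Lambda> k)) \<le> sum_mset (row_part m (\<Lambda> m))"
proof (induction m)
  case (Suc m)
  show ?case
  proof (cases "k = Suc m")
    case False
    have nz: "low m \<Lambda> \<noteq> 0" "wk (Suc m) (row_part (Suc m) (\<Lambda> (Suc m))) (row_part m (\<Lambda> m)) \<noteq> 0"
      using Suc.prems(1) by (auto simp: low_Suc)
    then have "hstrip (row_part (Suc m) (\<Lambda> (Suc m))) (row_part m (\<Lambda> m))"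
      by (auto simp: wk_def phi_def split: if_splits)
    then show ?thesis using hstrip_sum_le Suc.IH[OF nz(1)] Suc.prems(2) False by fastforce
  qed simp
qed simp

lemma arraysI:
  assumes "valid N \<Lambda>" "\<And>k. 1 \<le> k \<Longrightarrow> k \<le> N \<Longrightarrow> sum_mset (row_part k (\<Lambda> k)) \<le> B"
  shows "\<Lambda> \<in> arrays N B"
  unfolding arrays_def
proof (intro CollectI allI)
  fix m i
  show "if 1 \<le> i \<and> i \<le> m \<and> m \<le> N then \<Lambda> m i \<le> B else \<Lambda> m i = 0"
  proof (cases "1 \<le> i \<and> i \<le> m \<and> m \<le> N")
    case True
    then show ?thesis using entry_le_sum_row[of i m "\<Lambda> m"] assms(2)[of m] by simp
  next
    case False
    then show ?thesis using assms(1) unfolding valid_def by auto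
  qed
qed

lemma array_weight_arrays: assumes "array_weight n \<Lambda> \<noteq> 0" shows "\<Lambda> \<in> arrays N n"
proof (rule arraysI)
  show "valid N \<Lambda>" using assms by (auto simp: array_weight_def split: if_splits)
  have "tail n N \<Lambda> {#} \<noteq> 0" using assms by (auto simp: array_weight_def split: if_splits)
  then show "sum_mset (row_part k (\<Lambda> k)) \<le> n" if "1 \<le> k" "k \<le> N" for k
    using tail_bound[of n N \<Lambda> "{#}"] that by auto
qed

lemma stage_arrays: assumes "stage n m \<Lambda> i \<noteq> 0" "m \<le> N" shows "\<Lambda> \<in> arrays N (Suc n)"
proof (rule arraysI)
  have nz: "valid N \<Lambda>" "removable m (\<Lambda> m) i" "low m \<Lambda> \<noteq> 0"
    "tail n (N - m) \<Lambda> (row_part m ((\<Lambda> m)(i := \<Lambda> m i - 1))) \<noteq> 0"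
    using assms(1) by (auto simp: stage_def split: if_splits)
  show "valid N \<Lambda>" by (rule nz)
  note T = tail_bound[OF nz(4)]
  have m: "sum_mset (row_part m (\<Lambda> m)) \<le> Suc n" using box_sum[OF removable_box[OF nz(2)]] T by simp
  show "sum_mset (row_part k (\<Lambda> k)) \<le> Suc n" if "1 \<le> k" "k \<le> N" for k
  proof (cases "k \<le> m")
    case True
    then show ?thesis using low_bound[OF nz(3) True] m by simp
  next
    case False
    then show ?thesis using T that assms(2) by (simp add: le_SucI)
  qed
qed

context
  assumes t: "0 < t" "t < 1"
begin

text \<open>\<open>local_identity\<close> times the common factor \<open>c\<close> of the other
  levels. A starting letter has no lower box, hence no \<open>psi / (1 - t)\<close>; the denominator
  in \<open>c\<close> accounts for the \<open>1 - t\<close> in its term.\<close>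

lemma stage_step:
  assumes m: "Suc m \<le> N" and j: "1 \<le> j" "j \<le> Suc m"
  shows "(\<Sum>i=1..m. stage n m \<Lambda> i * move_prob t m (\<Lambda> m) (\<Lambda> (Suc m)) i j) +
      \<alpha> (Suc m) * array_weight n \<Lambda> * (if mover (\<Lambda> m) (\<Lambda> (Suc m)) (Suc m) = j then 1 else 0) =
    stage n (Suc m) (move \<Lambda> (Suc m) j) j"
proof -
  define f where "f = \<Lambda> m"
  define g where "g = \<Lambda> (Suc m)"
  define g' where "g' = g(j := Suc (g j))"
  define X where "X = move \<Lambda> (Suc m) j"
  have X: "X (Suc m) = g'" "\<And>k. k \<noteq> Suc m \<Longrightarrow> X k = \<Lambda> k" by (auto simp: X_def move_def g'_def g_def)
  have g'g: "g'(j := g' j - 1) = g" "g' j = Suc (g j)" by (auto simp: g'_def)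
  have zero: "(\<forall>k i. \<not> (1 \<le> i \<and> i \<le> k \<and> k \<le> N) \<longrightarrow> X k i = 0) \<longleftrightarrow> (\<forall>k i. \<not> (1 \<le> i \<and> i \<le> k \<and> k \<le> N) \<longrightarrow> \<Lambda> k i = 0)"
  proof -
    have "X k i = \<Lambda> k i" if "\<not> (1 \<le> i \<and> i \<le> k \<and> k \<le> N)" for k i
      using that m j by (auto simp: X_def move_def)
    then show ?thesis by metis
  qed
  show ?thesis
  proof (cases "valid N \<Lambda>")
    case False
    have "\<not> (valid N X \<and> removable (Suc m) (X (Suc m)) j)"
    proof
      assume *: "valid N X \<and> removable (Suc m) (X (Suc m)) j"
      then have "decreasing (Suc m) g" using g'g X(1) by (simp add: removable_def)
      moreover have "decreasing k (\<Lambda> k)" if "k \<le> N" "k \<noteq> Suc m" for k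
        using * X(2)[of k] that unfolding valid_def by auto
      ultimately have "decreasing k (\<Lambda> k)" if "k \<le> N" for k using that by (cases "k = Suc m") (auto simp: g_def)
      then have "valid N \<Lambda>" using * zero unfolding valid_def by blast
      then show False using False by simp
    qed
    then show ?thesis using False by (auto simp: stage_def array_weight_def X_def)
  next
    case True
    have dg: "decreasing (Suc m) g" and df: "decreasing m f" using True m by (auto simp: valid_def f_def g_def)
    have vX: "valid N X \<longleftrightarrow> decreasing (Suc m) g'"
    proof -
      have eq: "(\<forall>k\<le>N. decreasing k (X k)) \<longleftrightarrow> decreasing (Suc m) g'"
      proof
        assume "decreasing (Suc m) g'"
        then show "\<forall>k\<le>N. decreasing k (X k)" using True X unfolding valid_def by metis
      qed (use X m in metis)
      have zX: "\<forall>k i. \<not> (1 \<le> i \<and> i \<le> k \<and> k \<le> N) \<longrightarrow> X k i = 0"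
        by (rule iffD2[OF zero]) (rule conjunct1[OF True[unfolded valid_def]])
      show ?thesis
      proof
        assume "valid N X"
        then have "\<forall>k\<le>N. decreasing k (X k)" unfolding valid_def by (rule conjunct2)
        then show "decreasing (Suc m) g'" by (rule iffD1[OF eq])
      next
        assume "decreasing (Suc m) g'"
        then have "\<forall>k\<le>N. decreasing k (X k)" by (rule iffD2[OF eq])
        with zX show "valid N X" unfolding valid_def by (rule conjI)
      qed
    qed
    have rX: "removable (Suc m) g' j" using j dg g'g by (simp add: removable_def)
    define d where "d = N - Suc m"
    have d: "N - m = Suc d" "N - d = Suc m" "d \<le> N" using m by (auto simp: d_def)
    define V where "V = row_part m f"
    define P where "P = row_part (Suc m) g'"
    define P' where "P' = row_part (Suc m) g"
    define W where "W i = row_part m (f(i := f i - 1))" for i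
    \<comment> \<open>The size of the strip after both moves, and also before both. For a starting
      letter the old strip is one box smaller, and its probability supplies the missing
      factor.\<close>
    define e where "e = Suc (sum_mset P') - sum_mset V"
    define c where "c = low m \<Lambda> * tail n d \<Lambda> P' * \<alpha> (Suc m) ^ e / (1 - t)"
    have PP: "sum_mset P = Suc (sum_mset P')"
      unfolding P_def P'_def by (rule box_sum) (use row_box[OF j, of g] in \<open>simp add: g'_def\<close>)
    have S: "stage n m \<Lambda> i * move_prob t m f g i j = c * (if removable m f i then psi t V (W i) * phi t P' (W i) * move_prob t m f g i j else 0)"
      for i
    proof (cases "removable m f i")
      case r: True
      have "wk (Suc m) P' (W i) = phi t P' (W i) * \<alpha> (Suc m) ^ e"
      proof (cases "hstrip P' (W i)")
        case h: True
        have "sum_mset V = Suc (sum_mset (W i))" unfolding V_def W_def by (rule box_sum[OF removable_box[OF r]])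
        then have "sum_mset P' - sum_mset (W i) = e" using hstrip_sum_le[OF h] by (simp add: e_def)
        then show ?thesis by (simp add: wk_def)
      qed (simp add: wk_def phi_def)
      moreover have "stage n m \<Lambda> i = low m \<Lambda> * (psi t V (W i) / (1 - t)) * (wk (Suc m) P' (W i) * tail n d \<Lambda> P')"
        using r True by (simp add: stage_def f_def[symmetric] g_def[symmetric] V_def W_def P'_def d)
      ultimately show ?thesis using r by (simp add: c_def)
    next
      case False
      then show ?thesis by (simp add: stage_def f_def)
    qed
    have Mw: "\<alpha> (Suc m) * array_weight n \<Lambda> = c * ((1 - t) * phi t P' V)"
    proof -
      have aw: "\<alpha> (Suc m) * wk (Suc m) P' V = phi t P' V * \<alpha> (Suc m) ^ e"
      proof (cases "hstrip P' V")
        case True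
        then have "e = Suc (sum_mset P' - sum_mset V)" using hstrip_sum_le[OF True] by (simp add: e_def)
        then show ?thesis by (simp add: wk_def)
      qed (simp add: wk_def phi_def)
      have "array_weight n \<Lambda> = low m \<Lambda> * (wk (Suc m) P' V * tail n d \<Lambda> P')"
        using True m tail_low[of m n \<Lambda>] by (simp add: array_weight_def f_def[symmetric] g_def[symmetric] V_def P'_def d)
      then have "\<alpha> (Suc m) * array_weight n \<Lambda> = low m \<Lambda> * (\<alpha> (Suc m) * wk (Suc m) P' V) * tail n d \<Lambda> P'"
        by (simp only: mult_ac)
      then show ?thesis unfolding aw using t by (simp add: c_def)
    qed
    have "stage n (Suc m) X j = c * (if decreasing (Suc m) g' then phi t P V * psi t P P' else 0)"
    proof (cases "decreasing (Suc m) g'")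
      case dg': True
      have "low (Suc m) X = low m \<Lambda> * wk (Suc m) P V"
      proof -
        have "low m X = low m \<Lambda>" by (rule low_cong) (use X in auto)
        then show ?thesis using X by (simp add: low_Suc P_def V_def f_def)
      qed
      moreover have "wk (Suc m) P V = phi t P V * \<alpha> (Suc m) ^ e" by (simp add: wk_def PP e_def)
      moreover have "tail n d X P' = tail n d \<Lambda> P'" by (rule tail_cong) (use X d in auto)
      moreover have "stage n (Suc m) X j = low (Suc m) X * (psi t P P' / (1 - t)) * tail n d X P'"
        using dg' vX rX X(1) g'g by (simp add: stage_def P_def P'_def d_def)
      ultimately show ?thesis using dg' by (simp add: c_def)
    next
      case False
      then show ?thesis using vX by (simp add: stage_def)
    qed
    also have "\<dots> = c * ((\<Sum>i=1..m. if removable m f i then psi t V (W i) * phi t P' (W i) * move_prob t m f g i j else 0) +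
      (if mover f g (Suc m) = j then (1 - t) * phi t P' V else 0))"
      unfolding P_def P'_def V_def W_def g'_def by (simp only: local_identity[OF t dg df j])
    also have "\<dots> = (\<Sum>i=1..m. stage n m \<Lambda> i * move_prob t m f g i j) +
      \<alpha> (Suc m) * array_weight n \<Lambda> * (if mover f g (Suc m) = j then 1 else 0)"
      unfolding S Mw by (simp add: distrib_left sum_distrib_left)
    finally show ?thesis by (simp add: f_def g_def X_def)
  qed
qed

text \<open>Moves are injective, and an array of nonzero \<open>stage\<close> weight always arises
  from one; the bound \<open>Suc n\<close> leaves room for the new box.\<close>

lemma stage_sum_move:
  assumes m: "m \<le> N" and j: "1 \<le> j" "j \<le> m"
  shows "(\<Sum>\<Lambda>\<in>arrays N (Suc n). stage n m (move \<Lambda> m j) j * R (move \<Lambda> m j)) =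
    (\<Sum>\<Lambda>\<in>arrays N (Suc n). stage n m \<Lambda> j * R \<Lambda>)"
proof -
  define S where "S = {\<Lambda> \<in> arrays N (Suc n). stage n m \<Lambda> j \<noteq> 0}"
  define S' where "S' = {\<Lambda> \<in> arrays N (Suc n). stage n m (move \<Lambda> m j) j \<noteq> 0}"
  define unmove where "unmove \<Lambda> = \<Lambda>(m := (\<Lambda> m)(j := \<Lambda> m j - 1))" for \<Lambda> :: particles
  have "(\<Sum>\<Lambda>\<in>arrays N (Suc n). stage n m (move \<Lambda> m j) j * R (move \<Lambda> m j)) = (\<Sum>\<Lambda>\<in>S'. stage n m (move \<Lambda> m j) j * R (move \<Lambda> m j))"
    by (rule sum.mono_neutral_right) (auto simp: S'_def)
  also have "\<dots> = (\<Sum>\<Lambda>\<in>S. stage n m \<Lambda> j * R \<Lambda>)"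
  proof (rule sum.reindex_bij_witness[where i = unmove and j = "\<lambda>\<Lambda>. move \<Lambda> m j"])
    show "unmove (move \<Lambda> m j) = \<Lambda>" for \<Lambda> by (auto simp: unmove_def move_def)
    show "move \<Lambda> m j \<in> S" if "\<Lambda> \<in> S'" for \<Lambda>
      using that stage_arrays[OF _ m] by (auto simp: S_def S'_def)
    show mb: "move (unmove \<Lambda>) m j = \<Lambda>" if "\<Lambda> \<in> S" for \<Lambda>
    proof -
      have "1 \<le> \<Lambda> m j" using that by (auto simp: S_def stage_def removable_def split: if_splits)
      then show ?thesis by (auto simp: unmove_def move_def fun_eq_iff)
    qed
    show "unmove \<Lambda> \<in> S'" if "\<Lambda> \<in> S" for \<Lambda>
    proof -
      have "unmove \<Lambda> \<in> arrays N (Suc n)"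
        unfolding arrays_def
      proof (intro CollectI allI)
        fix k i
        have "if 1 \<le> i \<and> i \<le> k \<and> k \<le> N then \<Lambda> k i \<le> Suc n else \<Lambda> k i = 0"
          using that unfolding S_def arrays_def by blast
        moreover have "unmove \<Lambda> k i \<le> \<Lambda> k i" by (simp add: unmove_def)
        ultimately show "if 1 \<le> i \<and> i \<le> k \<and> k \<le> N then unmove \<Lambda> k i \<le> Suc n else unmove \<Lambda> k i = 0"
          by (auto split: if_splits)
      qed
      then show ?thesis using mb[OF that] that by (simp add: S'_def S_def)
    qed
  qed simp
  also have "\<dots> = (\<Sum>\<Lambda>\<in>arrays N (Suc n). stage n m \<Lambda> j * R \<Lambda>)"
    by (rule sum.mono_neutral_left) (auto simp: S_def)
  finally show ?thesis .
qed

text \<open>Passing from \<open>m\<close> to \<open>Suc m\<close> executes one step of the pending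
  propagations and admits the letter \<open>Suc m\<close>; these are the two sources balanced in
  \<open>stage_step\<close>.\<close>

lemma stage_propagate:
  assumes "m \<le> N"
  shows "(\<Sum>\<xi>=1..m. \<alpha> \<xi> * (\<Sum>\<Lambda>\<in>arrays N (Suc n). array_weight n \<Lambda> * pmf (insert_letter t N \<xi> \<Lambda>) \<Lambda>')) =
    (\<Sum>\<Lambda>\<in>arrays N (Suc n). \<Sum>i=1..m. stage n m \<Lambda> i * pmf (propagate t (N - m) m i \<Lambda>) \<Lambda>')"
  using assms
proof (induction m)
  case (Suc m)
  define d where "d = N - Suc m"
  have d: "N - m = Suc d" using Suc.prems by (simp add: d_def)
  define R where "R \<Lambda> j = pmf (propagate t d (Suc m) j \<Lambda>) \<Lambda>'" for \<Lambda> j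
  define A where "A = arrays N (Suc n)"
  have prp: "pmf (propagate t (Suc d) m i \<Lambda>) \<Lambda>' =
    (\<Sum>j=1..Suc m. move_prob t m (\<Lambda> m) (\<Lambda> (Suc m)) i j * R (move \<Lambda> (Suc m) j) j)" if "i \<in> {1..m}" for i \<Lambda>
    using that pmf_bind_finite[OF _ set_next_mover[OF t, of i m \<Lambda>]]
    by (simp add: pmf_next_mover[OF t] R_def)
  have ins: "pmf (insert_letter t N (Suc m) \<Lambda>) \<Lambda>' =
    (\<Sum>j=1..Suc m. (if mover (\<Lambda> m) (\<Lambda> (Suc m)) (Suc m) = j then 1 else 0) * R (move \<Lambda> (Suc m) j) j)" for \<Lambda>
  proof -
    define k where "k = mover (\<Lambda> m) (\<Lambda> (Suc m)) (Suc m)"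
    have k: "k \<in> {1..Suc m}" using mover(1,2)[of "Suc m" "\<Lambda> m" "\<Lambda> (Suc m)"] by (simp add: k_def)
    have "(\<Sum>j=1..Suc m. (if k = j then 1 else 0) * R (move \<Lambda> (Suc m) j) j) = (\<Sum>j=1..Suc m. if k = j then R (move \<Lambda> (Suc m) j) j else 0)"
      by (intro sum.cong) auto
    also have "\<dots> = R (move \<Lambda> (Suc m) k) k" using k by (simp only: sum.delta' finite_atLeastAtMost if_True)
    finally show ?thesis by (simp add: insert_letter_def Let_def last_free_mover R_def d_def k_def)
  qed
  have "(\<Sum>\<xi>=1..Suc m. \<alpha> \<xi> * (\<Sum>\<Lambda>\<in>A. array_weight n \<Lambda> * pmf (insert_letter t N \<xi> \<Lambda>) \<Lambda>')) =
    (\<Sum>\<Lambda>\<in>A. \<Sum>i=1..m. stage n m \<Lambda> i * pmf (propagate t (Suc d) m i \<Lambda>) \<Lambda>') +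
    \<alpha> (Suc m) * (\<Sum>\<Lambda>\<in>A. array_weight n \<Lambda> * pmf (insert_letter t N (Suc m) \<Lambda>) \<Lambda>')"
    using Suc d by (simp add: A_def)
  also have "(\<Sum>\<Lambda>\<in>A. \<Sum>i=1..m. stage n m \<Lambda> i * pmf (propagate t (Suc d) m i \<Lambda>) \<Lambda>') =
    (\<Sum>\<Lambda>\<in>A. \<Sum>j=1..Suc m. \<Sum>i=1..m. stage n m \<Lambda> i * move_prob t m (\<Lambda> m) (\<Lambda> (Suc m)) i j * R (move \<Lambda> (Suc m) j) j)"
  proof (rule sum.cong[OF refl])
    fix \<Lambda>
    have "(\<Sum>i=1..m. stage n m \<Lambda> i * pmf (propagate t (Suc d) m i \<Lambda>) \<Lambda>') =
      (\<Sum>i=1..m. \<Sum>j=1..Suc m. stage n m \<Lambda> i * move_prob t m (\<Lambda> m) (\<Lambda> (Suc m)) i j * R (move \<Lambda> (Suc m) j) j)"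
      by (intro sum.cong refl) (simp only: prp sum_distrib_left mult.assoc)
    then show "(\<Sum>i=1..m. stage n m \<Lambda> i * pmf (propagate t (Suc d) m i \<Lambda>) \<Lambda>') =
      (\<Sum>j=1..Suc m. \<Sum>i=1..m. stage n m \<Lambda> i * move_prob t m (\<Lambda> m) (\<Lambda> (Suc m)) i j * R (move \<Lambda> (Suc m) j) j)"
      by (subst (asm) sum.swap)
  qed
  also have "\<alpha> (Suc m) * (\<Sum>\<Lambda>\<in>A. array_weight n \<Lambda> * pmf (insert_letter t N (Suc m) \<Lambda>) \<Lambda>') =
    (\<Sum>\<Lambda>\<in>A. \<Sum>j=1..Suc m. \<alpha> (Suc m) * array_weight n \<Lambda> * (if mover (\<Lambda> m) (\<Lambda> (Suc m)) (Suc m) = j then 1 else 0) * R (move \<Lambda> (Suc m) j) j)"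
    unfolding ins sum_distrib_left by (intro sum.cong refl) (simp only: mult.assoc)
  also have "(\<Sum>\<Lambda>\<in>A. \<Sum>j=1..Suc m. \<Sum>i=1..m. stage n m \<Lambda> i * move_prob t m (\<Lambda> m) (\<Lambda> (Suc m)) i j * R (move \<Lambda> (Suc m) j) j) +
    (\<Sum>\<Lambda>\<in>A. \<Sum>j=1..Suc m. \<alpha> (Suc m) * array_weight n \<Lambda> * (if mover (\<Lambda> m) (\<Lambda> (Suc m)) (Suc m) = j then 1 else 0) * R (move \<Lambda> (Suc m) j) j) =
    (\<Sum>\<Lambda>\<in>A. \<Sum>j=1..Suc m. stage n (Suc m) (move \<Lambda> (Suc m) j) j * R (move \<Lambda> (Suc m) j) j)"
    unfolding sum.distrib[symmetric]
  proof (intro sum.cong refl)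
    fix \<Lambda> j assume "j \<in> {1..Suc m}"
    then have j: "1 \<le> j" "j \<le> Suc m" by auto
    show "(\<Sum>i=1..m. stage n m \<Lambda> i * move_prob t m (\<Lambda> m) (\<Lambda> (Suc m)) i j * R (move \<Lambda> (Suc m) j) j) +
      \<alpha> (Suc m) * array_weight n \<Lambda> * (if mover (\<Lambda> m) (\<Lambda> (Suc m)) (Suc m) = j then 1 else 0) * R (move \<Lambda> (Suc m) j) j =
      stage n (Suc m) (move \<Lambda> (Suc m) j) j * R (move \<Lambda> (Suc m) j) j"
      unfolding stage_step[OF Suc.prems j, symmetric] distrib_right sum_distrib_right ..
  qed
  also have "\<dots> = (\<Sum>j=1..Suc m. \<Sum>\<Lambda>\<in>A. stage n (Suc m) (move \<Lambda> (Suc m) j) j * R (move \<Lambda> (Suc m) j) j)"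
    by (rule sum.swap)
  also have "\<dots> = (\<Sum>j=1..Suc m. \<Sum>\<Lambda>\<in>A. stage n (Suc m) \<Lambda> j * R \<Lambda> j)"
  proof (rule sum.cong[OF refl])
    fix j assume "j \<in> {1..Suc m}"
    then show "(\<Sum>\<Lambda>\<in>A. stage n (Suc m) (move \<Lambda> (Suc m) j) j * R (move \<Lambda> (Suc m) j) j) =
        (\<Sum>\<Lambda>\<in>A. stage n (Suc m) \<Lambda> j * R \<Lambda> j)"
      unfolding A_def using stage_sum_move[OF Suc.prems, where R = "\<lambda>\<Lambda>. R \<Lambda> j" and j = j] by simp
  qed
  also have "\<dots> = (\<Sum>\<Lambda>\<in>A. \<Sum>j=1..Suc m. stage n (Suc m) \<Lambda> j * R \<Lambda> j)"
    by (rule sum.swap)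
  finally show ?case by (simp only: A_def R_def d_def)
qed simp

text \<open>With no level above, summing over the last mover is, by
  \<open>removable_row_bij\<close>, the recursion of \<open>hl_paths\<close>.\<close>

lemma stage_top:
  "(\<Sum>i=1..N. stage n N \<Lambda> i) = array_weight (Suc n) \<Lambda>"
proof (cases "valid N \<Lambda>")
  case False
  then show ?thesis by (simp add: stage_def array_weight_def)
next
  case True
  define f where "f = \<Lambda> N"
  define \<rho> where "\<rho> = row_part N f"
  define W where "W i = row_part N (f(i := f i - 1))" for i
  have f: "decreasing N f" using True by (simp add: valid_def f_def)
  have st: "stage n N \<Lambda> i = (if removable N f i then low N \<Lambda> * (psi t \<rho> (W i) / (1 - t)) * (if sum_mset (W i) = n then hl_paths t (W i) else 0) else 0)" for i
    using True by (simp add: stage_def f_def \<rho>_def W_def)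
  have aw: "array_weight (Suc n) \<Lambda> = low N \<Lambda> * (if sum_mset \<rho> = Suc n then hl_paths t \<rho> else 0)"
    using True tail_low[of N "Suc n" \<Lambda>] by (simp add: array_weight_def f_def \<rho>_def)
  have sW: "sum_mset \<rho> = Suc (sum_mset (W i))" if "removable N f i" for i
    unfolding \<rho>_def W_def by (rule box_sum[OF removable_box[OF that]])
  show ?thesis
  proof (cases "sum_mset \<rho> = Suc n")
    case False
    then show ?thesis unfolding aw st using sW by (intro trans[OF sum.neutral]) auto
  next
    case s: True
    then have \<rho>: "\<rho> \<in> Par (Suc n)" by (simp add: Par_def \<rho>_def)
    have "(\<Sum>i=1..N. stage n N \<Lambda> i) = (\<Sum>i | i \<in> {1..N} \<and> removable N f i. low N \<Lambda> * (psi t \<rho> (W i) / (1 - t) * hl_paths t (W i)))"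
      by (rule sum.mono_neutral_cong_right) (use sW s in \<open>auto simp: st\<close>)
    also have "\<dots> = (\<Sum>\<kappa> | \<kappa> \<in> Par n \<and> hstrip \<rho> \<kappa>. low N \<Lambda> * (psi t \<rho> \<kappa> / (1 - t) * hl_paths t \<kappa>))"
      using sum.reindex_bij_betw[OF removable_row_bij[OF f \<rho>[unfolded \<rho>_def]]] by (simp add: W_def \<rho>_def)
    also have "\<dots> = (\<Sum>\<kappa>\<in>Par n. low N \<Lambda> * (psi t \<rho> \<kappa> / (1 - t) * hl_paths t \<kappa>))"
      by (rule sum.mono_neutral_left) (auto simp: psi_def)
    also have "\<dots> = low N \<Lambda> * hl_paths t \<rho>"
      by (simp only: hl_paths_rec[OF t \<rho>] sum_distrib_left)
    finally show ?thesis using s aw by simp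
  qed
qed

end

end

section \<open>The law of the top row\<close>

lemma row_part_zero: "row_part m (\<lambda>_. 0) = {#}"
proof -
  have "sum_mset (row_part m (\<lambda>_. 0)) = 0" unfolding sum_row by simp
  then have "row_part m (\<lambda>_. 0) \<in> Par 0" unfolding Par_def using row_partition by blast
  then show ?thesis by simp
qed

text \<open>Each variable removes a strip, hence at most one row.\<close>

lemma hlF_eq_0:
  assumes "\<rho> \<in> partitions" "length xs < size \<rho>"
  shows "hlF t \<rho> xs = 0"
  using assms
proof (induction xs arbitrary: \<rho>)
  case (Cons x xs)
  have "phi t \<rho> \<mu> * x ^ (sum_mset \<rho> - sum_mset \<mu>) * hlF t \<mu> xs = 0" if "\<mu> \<in> partitions" for \<mu>
  proof (cases "hstrip \<rho> \<mu>")
    case True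
    then have "length xs < size \<mu>" using hstrip_size(2)[OF True Cons.prems(1) that] Cons.prems(2) by simp
    then show ?thesis using Cons.IH[OF that] by simp
  qed (simp add: phi_def)
  then show ?case unfolding hlF.simps(2) by (intro sum.neutral) blast
qed auto

definition tuple_row :: "nat list \<Rightarrow> nat \<Rightarrow> nat" where
  "tuple_row l i = (if 1 \<le> i \<and> i \<le> length l then l ! (i - 1) else 0)"

lemma map_tuple_row: "map (tuple_row l) [1..<Suc (length l)] = l"
  by (rule nth_equalityI) (auto simp: tuple_row_def simp del: upt_Suc)

lemma row_part_tuple_row: "row_part (length l) (tuple_row l) = partition_of_tuple l"
  by (simp only: row_part_def map_tuple_row)

lemma decreasing_tuple_row:
  assumes "sorted_wrt (\<ge>) l" shows "decreasing (length l) (tuple_row l)"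
  unfolding decreasing_def
proof (intro allI impI)
  fix i j assume ij: "1 \<le> i" "i \<le> j" "j \<le> length l"
  show "tuple_row l j \<le> tuple_row l i"
  proof (cases "i = j")
    case False
    then show ?thesis using ij sorted_wrt_nth_less[OF assms, of "i - 1" "j - 1"] by (simp add: tuple_row_def)
  qed simp
qed

lemma sorted_map_decreasing:
  assumes "decreasing m f" shows "sorted_wrt (\<ge>) (map f [1..<Suc m])"
  unfolding sorted_wrt_iff_nth_less using decreasingD[OF assms] by (auto simp del: upt_Suc)

definition rows :: "nat \<Rightarrow> nat \<Rightarrow> (nat \<Rightarrow> nat) set" where
  "rows m B = {f. (\<forall>i. (i \<in> {1..m} \<longrightarrow> f i \<in> {..B}) \<and> (i \<notin> {1..m} \<longrightarrow> f i = 0)) \<and> decreasing m f}"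

lemma finite_rows [simp]: "finite (rows m B)"
proof (rule finite_subset)
  show "rows m B \<subseteq> {f. \<forall>i. (i \<in> {1..m} \<longrightarrow> f i \<in> {..B}) \<and> (i \<notin> {1..m} \<longrightarrow> f i = 0)}"
    unfolding rows_def by blast
qed (rule finite_set_of_finite_funs, auto)

lemma inj_on_row_part: "inj_on (row_part m) (rows m B)"
proof (rule inj_onI)
  fix f g assume f: "f \<in> rows m B" and g: "g \<in> rows m B" and eq: "row_part m f = row_part m g"
  have d: "decreasing m f" "decreasing m g" using f g by (auto simp: rows_def)
  show "f = g"
  proof
    fix i
    show "f i = g i"
    proof (cases "i \<in> {1..m}")
      case True
      then have "v \<le> f i \<longleftrightarrow> v \<le> g i" if "1 \<le> v" for v
        using le_cols_row[OF d(1), of i v] le_cols_row[OF d(2), of i v] eq that by simp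
      from this[of "f i"] this[of "g i"] show ?thesis by (cases "f i"; cases "g i") auto
    next
      case False
      then show ?thesis using f g unfolding rows_def by auto
    qed
  qed
qed

lemma row_part_surj:
  assumes \<mu>: "\<mu> \<in> partitions" "size \<mu> \<le> m" "\<And>k. k \<in># \<mu> \<Longrightarrow> k \<le> B"
  shows "\<mu> \<in> row_part m ` rows m B"
proof -
  define l where "l = parts \<mu> @ replicate (m - size \<mu>) 0"
  have len: "length l = m" using \<mu>(2) by (simp add: l_def parts_def flip: size_mset)
  have "sorted_wrt (\<ge>) l" unfolding l_def sorted_wrt_append using sorted_parts by (auto simp: sorted_wrt_iff_nth_less)
  then have "decreasing m (tuple_row l)" using decreasing_tuple_row len by metis
  moreover have "tuple_row l i \<le> B" if "i \<in> {1..m}" for i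
  proof -
    have "i - 1 < length l" using that len by auto
    then have "tuple_row l i \<in> set l" using that len nth_mem by (simp add: tuple_row_def)
    then show ?thesis using \<mu>(3) by (auto simp: l_def parts_def)
  qed
  moreover have "tuple_row l i = 0" if "i \<notin> {1..m}" for i using that len by (auto simp: tuple_row_def)
  ultimately have "tuple_row l \<in> rows m B" unfolding rows_def by blast
  moreover have "row_part m (tuple_row l) = \<mu>"
  proof -
    have "filter_mset (\<lambda>k. 0 < k) \<mu> = \<mu>"
      using \<mu>(1) by (auto simp: filter_mset_eq_conv partitions_def intro: Nat.gr0I)
    then show ?thesis
      using row_part_tuple_row[of l] len by (simp add: partition_of_tuple_def l_def mset_parts)
  qed
  ultimately show ?thesis by (metis imageI)
qed

lemma bind_replicate_Suc:
  "bind_pmf (replicate_pmf (Suc n) p) (\<lambda>w. insert_word t N w \<Lambda>) =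
    bind_pmf (bind_pmf p (\<lambda>\<xi>. insert_letter t N \<xi> \<Lambda>)) (\<lambda>\<Lambda>. bind_pmf (replicate_pmf n p) (\<lambda>w. insert_word t N w \<Lambda>))"
proof -
  have "bind_pmf (replicate_pmf (Suc n) p) (\<lambda>w. insert_word t N w \<Lambda>) =
    bind_pmf p (\<lambda>\<xi>. bind_pmf (replicate_pmf n p) (\<lambda>w. bind_pmf (insert_letter t N \<xi> \<Lambda>) (\<lambda>\<Lambda>. insert_word t N w \<Lambda>)))"
    by (simp add: bind_assoc_pmf bind_return_pmf)
  also have "\<dots> = bind_pmf p (\<lambda>\<xi>. bind_pmf (insert_letter t N \<xi> \<Lambda>) (\<lambda>\<Lambda>. bind_pmf (replicate_pmf n p) (\<lambda>w. insert_word t N w \<Lambda>)))"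
    by (intro bind_pmf_cong refl bind_commute_pmf)
  finally show ?thesis by (simp only: bind_assoc_pmf)
qed

text \<open>The recursions split off the first letter, while the induction on arrays needs the last.
  Independent letters make the insertions a Markov chain, and associativity of bind moves the
  bracket.\<close>

lemma bind_replicate_Suc_last:
  "bind_pmf (replicate_pmf (Suc n) p) (\<lambda>w. insert_word t N w \<Lambda>) =
    bind_pmf (bind_pmf (replicate_pmf n p) (\<lambda>w. insert_word t N w \<Lambda>)) (\<lambda>\<Lambda>. bind_pmf p (\<lambda>\<xi>. insert_letter t N \<xi> \<Lambda>))"
proof (induction n arbitrary: \<Lambda>)
  case 0
  show ?case unfolding bind_replicate_Suc by (simp add: bind_return_pmf bind_return_pmf')
next
  case (Suc n)
  let ?step = "\<lambda>\<Lambda>. bind_pmf p (\<lambda>\<xi>. insert_letter t N \<xi> \<Lambda>)"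
  let ?run = "\<lambda>n \<Lambda>. bind_pmf (replicate_pmf n p) (\<lambda>w. insert_word t N w \<Lambda>)"
  have "?run (Suc (Suc n)) \<Lambda> = bind_pmf (?step \<Lambda>) (?run (Suc n))" by (rule bind_replicate_Suc)
  also have "\<dots> = bind_pmf (?step \<Lambda>) (\<lambda>\<Lambda>. bind_pmf (?run n \<Lambda>) ?step)"
    by (rule arg_cong[where f = "bind_pmf _"]) (rule ext, rule Suc.IH)
  also have "\<dots> = bind_pmf (bind_pmf (?step \<Lambda>) (?run n)) ?step" by (rule bind_assoc_pmf[symmetric])
  also have "bind_pmf (?step \<Lambda>) (?run n) = ?run (Suc n) \<Lambda>" by (rule bind_replicate_Suc[symmetric])
  finally show ?case .
qed

context
  fixes t :: real and N :: nat and \<alpha> :: "nat \<Rightarrow> real"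
  assumes t: "0 < t" "t < 1"
begin

text \<open>The mixture over a new letter is \<open>stage_propagate\<close> at \<open>m = N\<close>,
  where nothing is left to propagate, followed by \<open>stage_top\<close>.\<close>

lemma array_law:
  assumes letter: "set_pmf letter \<subseteq> {1..N}" "\<And>k. k \<in> {1..N} \<Longrightarrow> pmf letter k = \<alpha> k"
  shows "pmf (bind_pmf (replicate_pmf n letter) (rsk t N)) \<Lambda> = array_weight t N \<alpha> n \<Lambda>"
proof (induction n arbitrary: \<Lambda>)
  case 0
  define Z :: particles where "Z = (\<lambda>m i. 0)"
  have Zw: "array_weight t N \<alpha> 0 Z = 1"
  proof -
    have "valid N Z" by (simp add: valid_def Z_def decreasing_def)
    moreover have "tail t N \<alpha> 0 N Z {#} = 1"
      unfolding tail_low[OF order_refl]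
      by (simp add: low_def wk_def Z_def row_part_zero phi_self hl_paths_empty[OF t])
    ultimately show ?thesis by (simp add: array_weight_def)
  qed
  have "array_weight t N \<alpha> 0 \<Lambda> = 0" if "\<Lambda> \<noteq> Z"
  proof (rule ccontr)
    assume "array_weight t N \<alpha> 0 \<Lambda> \<noteq> 0"
    then have *: "\<Lambda> \<in> arrays N 0" by (rule array_weight_arrays)
    have "\<Lambda> m i = 0" for m i using * unfolding arrays_def by (auto split: if_splits)
    then show False using that by (auto simp: Z_def fun_eq_iff)
  qed
  then show ?case
    using Zw by (cases "\<Lambda> = Z") (auto simp: bind_return_pmf rsk_def Z_def[symmetric] indicator_def)
next
  case (Suc n)
  have rsk: "rsk t N = (\<lambda>w. insert_word t N w (\<lambda>m i. 0))" by (simp add: rsk_def fun_eq_iff)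
  define A where "A = arrays N (Suc n)"
  have "set_pmf (bind_pmf (replicate_pmf n letter) (rsk t N)) \<subseteq> A"
  proof
    fix \<Lambda>0 assume "\<Lambda>0 \<in> set_pmf (bind_pmf (replicate_pmf n letter) (rsk t N))"
    then have "array_weight t N \<alpha> n \<Lambda>0 \<noteq> 0" using Suc.IH[of \<Lambda>0] by (metis set_pmf_iff)
    then have "\<Lambda>0 \<in> arrays N n" by (rule array_weight_arrays)
    then show "\<Lambda>0 \<in> A" unfolding A_def arrays_def by (auto split: if_splits simp: le_SucI)
  qed
  then have "pmf (bind_pmf (replicate_pmf (Suc n) letter) (rsk t N)) \<Lambda> =
    (\<Sum>\<Lambda>0\<in>A. array_weight t N \<alpha> n \<Lambda>0 * pmf (bind_pmf letter (\<lambda>\<xi>. insert_letter t N \<xi> \<Lambda>0)) \<Lambda>)"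
    unfolding rsk bind_replicate_Suc_last
    by (subst pmf_bind_finite[of A]) (simp_all add: A_def Suc.IH[unfolded rsk])
  also have "\<dots> = (\<Sum>\<Lambda>0\<in>A. \<Sum>\<xi>=1..N. \<alpha> \<xi> * (array_weight t N \<alpha> n \<Lambda>0 * pmf (insert_letter t N \<xi> \<Lambda>0) \<Lambda>))"
  proof (rule sum.cong[OF refl])
    fix \<Lambda>0
    have "pmf (bind_pmf letter (\<lambda>\<xi>. insert_letter t N \<xi> \<Lambda>0)) \<Lambda> = (\<Sum>\<xi>=1..N. \<alpha> \<xi> * pmf (insert_letter t N \<xi> \<Lambda>0) \<Lambda>)"
      using letter by (subst pmf_bind_finite[of "{1..N}"]) auto
    then show "array_weight t N \<alpha> n \<Lambda>0 * pmf (bind_pmf letter (\<lambda>\<xi>. insert_letter t N \<xi> \<Lambda>0)) \<Lambda> =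
      (\<Sum>\<xi>=1..N. \<alpha> \<xi> * (array_weight t N \<alpha> n \<Lambda>0 * pmf (insert_letter t N \<xi> \<Lambda>0) \<Lambda>))"
      by (simp only: sum_distrib_left mult.left_commute)
  qed
  also have "\<dots> = (\<Sum>\<xi>=1..N. \<alpha> \<xi> * (\<Sum>\<Lambda>0\<in>A. array_weight t N \<alpha> n \<Lambda>0 * pmf (insert_letter t N \<xi> \<Lambda>0) \<Lambda>))"
    by (subst sum.swap) (simp only: sum_distrib_left)
  also have "\<dots> = (\<Sum>\<Lambda>0\<in>A. \<Sum>i=1..N. stage t N \<alpha> n N \<Lambda>0 i * pmf (propagate t (N - N) N i \<Lambda>0) \<Lambda>)"
    unfolding A_def by (rule stage_propagate[OF t order_refl])
  also have "\<dots> = (\<Sum>\<Lambda>0\<in>A. if \<Lambda>0 = \<Lambda> then \<Sum>i=1..N. stage t N \<alpha> n N \<Lambda> i else 0)"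
    by (intro sum.cong refl) (simp add: indicator_def)
  also have "\<dots> = (\<Sum>i=1..N. stage t N \<alpha> n N \<Lambda> i)"
  proof (cases "\<Lambda> \<in> A")
    case False
    then have "stage t N \<alpha> n N \<Lambda> i = 0" for i using stage_arrays[OF _ order_refl] unfolding A_def by blast
    then have "(\<Sum>i=1..N. stage t N \<alpha> n N \<Lambda> i) = 0" by (intro sum.neutral) blast
    then show ?thesis by (intro trans[OF sum.neutral]) simp_all
  qed (simp add: A_def)
  also have "\<dots> = array_weight t N \<alpha> (Suc n) \<Lambda>" by (rule stage_top[OF t])
  finally show ?case .
qed

text \<open>Each level is one strip in the recursion of \<open>hlF\<close>. The outermost strip
  belongs to level \<open>m\<close>, whence the reversed variables.\<close>

lemma sum_low:
  assumes "f \<in> rows m B" "sum_mset (row_part m f) \<le> B"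
  shows "(\<Sum>\<Lambda> | \<Lambda> \<in> arrays m B \<and> valid m \<Lambda> \<and> \<Lambda> m = f. low t \<alpha> m \<Lambda>) =
    hlF t (row_part m f) (map \<alpha> (rev [1..<Suc m]))"
  using assms
proof (induction m arbitrary: f)
  case 0
  have "f = (\<lambda>_. 0)" using "0.prems"(1) by (auto simp: rows_def)
  then have "{\<Lambda>. \<Lambda> \<in> arrays 0 B \<and> valid 0 \<Lambda> \<and> \<Lambda> 0 = f} = {\<lambda>_ _. 0}"
    by (auto simp: arrays_def valid_def decreasing_def fun_eq_iff)
  then show ?case by (simp add: low_def)
next
  case (Suc m)
  define \<rho> where "\<rho> = row_part (Suc m) f"
  define xs where "xs = map \<alpha> (rev [1..<Suc m])"
  define A where "A = {\<Lambda>. \<Lambda> \<in> arrays m B \<and> valid m \<Lambda>}"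
  have fz: "f i = 0" if "\<not> (1 \<le> i \<and> i \<le> Suc m)" for i using Suc.prems(1) that unfolding rows_def by auto
  have fB: "f i \<le> B" for i using Suc.prems(1) fz[of i] unfolding rows_def by (cases "i \<in> {1..Suc m}") auto
  have fd: "decreasing (Suc m) f" using Suc.prems(1) by (simp add: rows_def)
  have Aiff: "\<Lambda> \<in> A \<longleftrightarrow> (\<forall>k i. if 1 \<le> i \<and> i \<le> k \<and> k \<le> m then \<Lambda> k i \<le> B else \<Lambda> k i = 0) \<and> (\<forall>k\<le>m. decreasing k (\<Lambda> k))" for \<Lambda>
    by (auto simp: A_def arrays_def valid_def split: if_splits)
  have A: "\<Lambda> (Suc m) = (\<lambda>_. 0)" if "\<Lambda> \<in> A" for \<Lambda> using that by (auto simp: Aiff fun_eq_iff split: if_splits)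
  have "(\<Sum>\<Lambda> | \<Lambda> \<in> arrays (Suc m) B \<and> valid (Suc m) \<Lambda> \<and> \<Lambda> (Suc m) = f. low t \<alpha> (Suc m) \<Lambda>) =
    (\<Sum>\<Lambda>\<in>A. low t \<alpha> m \<Lambda> * wk t \<alpha> (Suc m) \<rho> (row_part m (\<Lambda> m)))"
  proof (rule sum.reindex_bij_witness[where i = "\<lambda>\<Lambda>. \<Lambda>(Suc m := f)" and j = "\<lambda>\<Lambda>. \<Lambda>(Suc m := (\<lambda>_. 0))"])
    fix \<Lambda> assume \<Lambda>: "\<Lambda> \<in> {\<Lambda>. \<Lambda> \<in> arrays (Suc m) B \<and> valid (Suc m) \<Lambda> \<and> \<Lambda> (Suc m) = f}"
    show "(\<Lambda>(Suc m := \<lambda>_. 0))(Suc m := f) = \<Lambda>" using \<Lambda> by (auto simp: fun_eq_iff)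
    have b: "if 1 \<le> i \<and> i \<le> k \<and> k \<le> Suc m then \<Lambda> k i \<le> B else \<Lambda> k i = 0" for k i
      using \<Lambda> unfolding arrays_def by blast
    have "if 1 \<le> i \<and> i \<le> k \<and> k \<le> m then (\<Lambda>(Suc m := \<lambda>_. 0)) k i \<le> B else (\<Lambda>(Suc m := \<lambda>_. 0)) k i = 0" for k i
      using b[of i k] by (auto split: if_splits)
    moreover have "decreasing k ((\<Lambda>(Suc m := \<lambda>_. 0)) k)" if "k \<le> m" for k
      using \<Lambda> that by (simp add: valid_def)
    ultimately show "\<Lambda>(Suc m := \<lambda>_. 0) \<in> A" unfolding Aiff by blast
    have "low t \<alpha> m (\<Lambda>(Suc m := \<lambda>_. 0)) = low t \<alpha> m \<Lambda>" by (rule low_cong) auto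
    then show "low t \<alpha> m (\<Lambda>(Suc m := \<lambda>_. 0)) * wk t \<alpha> (Suc m) \<rho> (row_part m ((\<Lambda>(Suc m := \<lambda>_. 0)) m)) = low t \<alpha> (Suc m) \<Lambda>"
      using \<Lambda> by (simp add: low_Suc \<rho>_def)
  next
    fix \<Lambda> assume \<Lambda>: "\<Lambda> \<in> A"
    show "(\<Lambda>(Suc m := f))(Suc m := \<lambda>_. 0) = \<Lambda>" using A[OF \<Lambda>] by (auto simp: fun_eq_iff)
    have b: "if 1 \<le> i \<and> i \<le> k \<and> k \<le> m then \<Lambda> k i \<le> B else \<Lambda> k i = 0" for k i
      using \<Lambda> unfolding Aiff by blast
    have "if 1 \<le> i \<and> i \<le> k \<and> k \<le> Suc m then (\<Lambda>(Suc m := f)) k i \<le> B else (\<Lambda>(Suc m := f)) k i = 0" for k i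
      using b[of i k] fz[of i] fB[of i] by (auto split: if_splits)
    then have *: "\<Lambda>(Suc m := f) \<in> arrays (Suc m) B" unfolding arrays_def by blast
    moreover have "valid (Suc m) (\<Lambda>(Suc m := f))"
      unfolding valid_def
    proof (intro conjI allI impI)
      fix k i assume "\<not> (1 \<le> i \<and> i \<le> k \<and> k \<le> Suc m)"
      moreover have "if 1 \<le> i \<and> i \<le> k \<and> k \<le> Suc m then (\<Lambda>(Suc m := f)) k i \<le> B else (\<Lambda>(Suc m := f)) k i = 0"
        using * unfolding arrays_def by blast
      ultimately show "(\<Lambda>(Suc m := f)) k i = 0" by presburger
    next
      fix k assume "k \<le> Suc m"
      then show "decreasing k ((\<Lambda>(Suc m := f)) k)" using \<Lambda> fd by (cases "k = Suc m") (auto simp: Aiff)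
    qed
    ultimately show "\<Lambda>(Suc m := f) \<in> {\<Lambda>. \<Lambda> \<in> arrays (Suc m) B \<and> valid (Suc m) \<Lambda> \<and> \<Lambda> (Suc m) = f}" by simp
  qed
  also have "\<dots> = (\<Sum>g\<in>rows m B. \<Sum>\<Lambda> | \<Lambda> \<in> A \<and> \<Lambda> m = g. low t \<alpha> m \<Lambda> * wk t \<alpha> (Suc m) \<rho> (row_part m (\<Lambda> m)))"
  proof (rule sum.group[symmetric])
    show "finite A" unfolding A_def by (rule finite_subset[OF _ finite_arrays[of m B]]) auto
    show "(\<lambda>\<Lambda>. \<Lambda> m) ` A \<subseteq> rows m B"
    proof (rule image_subsetI)
      fix \<Lambda> assume \<Lambda>: "\<Lambda> \<in> A"
      have "if 1 \<le> i \<and> i \<le> m \<and> m \<le> m then \<Lambda> m i \<le> B else \<Lambda> m i = 0" for i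
        using \<Lambda> unfolding Aiff by blast
      then have "(i \<in> {1..m} \<longrightarrow> \<Lambda> m i \<in> {..B}) \<and> (i \<notin> {1..m} \<longrightarrow> \<Lambda> m i = 0)" for i by (auto split: if_splits)
      moreover have "decreasing m (\<Lambda> m)" using \<Lambda> by (simp add: Aiff)
      ultimately show "\<Lambda> m \<in> rows m B" unfolding rows_def by blast
    qed
  qed simp
  also have "\<dots> = (\<Sum>g\<in>rows m B. wk t \<alpha> (Suc m) \<rho> (row_part m g) * hlF t (row_part m g) xs)"
  proof (rule sum.cong[OF refl])
    fix g assume g: "g \<in> rows m B"
    have "(\<Sum>\<Lambda> | \<Lambda> \<in> A \<and> \<Lambda> m = g. low t \<alpha> m \<Lambda> * wk t \<alpha> (Suc m) \<rho> (row_part m (\<Lambda> m))) =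
      wk t \<alpha> (Suc m) \<rho> (row_part m g) * (\<Sum>\<Lambda> | \<Lambda> \<in> A \<and> \<Lambda> m = g. low t \<alpha> m \<Lambda>)"
      unfolding sum_distrib_left by (rule sum.cong) (auto simp: mult.commute)
    moreover have "(\<Sum>\<Lambda> | \<Lambda> \<in> A \<and> \<Lambda> m = g. low t \<alpha> m \<Lambda>) = hlF t (row_part m g) xs" if "hstrip \<rho> (row_part m g)"
      using Suc.IH[OF g] hstrip_sum_le[OF that] Suc.prems(2) by (simp add: A_def xs_def \<rho>_def)
    ultimately show "(\<Sum>\<Lambda> | \<Lambda> \<in> A \<and> \<Lambda> m = g. low t \<alpha> m \<Lambda> * wk t \<alpha> (Suc m) \<rho> (row_part m (\<Lambda> m))) =
      wk t \<alpha> (Suc m) \<rho> (row_part m g) * hlF t (row_part m g) xs"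
      by (cases "hstrip \<rho> (row_part m g)") (simp_all add: wk_def phi_def)
  qed
  also have "\<dots> = (\<Sum>\<mu>\<in>row_part m ` rows m B. wk t \<alpha> (Suc m) \<rho> \<mu> * hlF t \<mu> xs)"
    by (simp only: sum.reindex[OF inj_on_row_part] o_def)
  also have "\<dots> = (\<Sum>\<mu> | \<mu> \<in> partitions \<and> sum_mset \<mu> \<le> sum_mset \<rho>. phi t \<rho> \<mu> * \<alpha> (Suc m) ^ (sum_mset \<rho> - sum_mset \<mu>) * hlF t \<mu> xs)"
  \<comment> \<open>The index sets differ harmlessly: for more than \<open>m\<close> parts
    \<open>hlF\<close> vanishes, and for a size above that of \<open>\<rho>\<close> there is no
    strip.\<close>
  proof (rule sum.mono_neutral_cong)
    fix \<mu> assume \<mu>: "\<mu> \<in> {\<mu> \<in> partitions. sum_mset \<mu> \<le> sum_mset \<rho>} - row_part m ` rows m B"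
    have "k \<le> B" if "k \<in># \<mu>" for k
      using sum_mset.remove[OF that] \<mu> Suc.prems(2) by (simp add: \<rho>_def)
    then have "\<not> size \<mu> \<le> m" using row_part_surj[of \<mu> m B] \<mu> by blast
    then have "hlF t \<mu> xs = 0" using \<mu> by (intro hlF_eq_0) (auto simp: xs_def)
    then show "phi t \<rho> \<mu> * \<alpha> (Suc m) ^ (sum_mset \<rho> - sum_mset \<mu>) * hlF t \<mu> xs = 0" by simp
  next
    fix \<mu> assume \<mu>: "\<mu> \<in> row_part m ` rows m B - {\<mu> \<in> partitions. sum_mset \<mu> \<le> sum_mset \<rho>}"
    then have "\<not> hstrip \<rho> \<mu>" using hstrip_sum_le[of \<rho> \<mu>] by auto
    then show "wk t \<alpha> (Suc m) \<rho> \<mu> * hlF t \<mu> xs = 0" by (simp add: wk_def phi_def)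
  qed (simp_all add: wk_def)
  also have "\<dots> = hlF t \<rho> (\<alpha> (Suc m) # xs)" by (simp add: hlF.simps(2))
  also have "\<alpha> (Suc m) # xs = map \<alpha> (rev [1..<Suc (Suc m)])" by (simp add: xs_def)
  finally show ?case by (simp only: \<rho>_def)
qed

lemma top_row_law:
  assumes letter: "set_pmf letter \<subseteq> {1..N}" "\<And>k. k \<in> {1..N} \<Longrightarrow> pmf letter k = \<alpha> k"
  shows "pmf (map_pmf (top_row N) (bind_pmf (replicate_pmf n letter) (rsk t N))) lam =
    (if length lam = N \<and> sorted_wrt (\<ge>) lam \<and> sum_list lam = n
     then fact n * eval_sym (hl_Q t (partition_of_tuple lam)) (map \<alpha> [1..<Suc N])
                 * plancherel t (hl_P t (partition_of_tuple lam))
     else 0)"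
proof -
  define p where "p = bind_pmf (replicate_pmf n letter) (rsk t N)"
  have p: "pmf p \<Lambda> = array_weight t N \<alpha> n \<Lambda>" for \<Lambda> unfolding p_def by (rule array_law[OF letter])
  have aw: "array_weight t N \<alpha> n \<Lambda> = (if valid N \<Lambda> then low t \<alpha> N \<Lambda> * (if sum_mset (row_part N (\<Lambda> N)) = n then hl_paths t (row_part N (\<Lambda> N)) else 0) else 0)"
    for \<Lambda>
    unfolding array_weight_def using tail_low[OF order_refl, where N = N and t = t and \<alpha> = \<alpha> and n = n and \<Lambda> = \<Lambda>] by simp
  have "set_pmf p \<subseteq> arrays N n" using array_weight_arrays by (auto simp: set_pmf_iff p)
  then have P: "pmf (map_pmf (top_row N) p) lam = (\<Sum>\<Lambda>\<in>arrays N n. array_weight t N \<alpha> n \<Lambda> * (if top_row N \<Lambda> = lam then 1 else 0))"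
    unfolding map_pmf_def pmf_bind_finite[OF finite_arrays \<open>set_pmf p \<subseteq> arrays N n\<close>] p
    by (intro sum.cong refl) (simp add: indicator_def)
  show ?thesis
  proof (cases "length lam = N \<and> sorted_wrt (\<ge>) lam \<and> sum_list lam = n")
    case False
    have "array_weight t N \<alpha> n \<Lambda> * (if top_row N \<Lambda> = lam then 1 else 0) = 0" for \<Lambda>
    proof (rule ccontr)
      assume *: "array_weight t N \<alpha> n \<Lambda> * (if top_row N \<Lambda> = lam then 1 else 0) \<noteq> 0"
      then have lam: "lam = map (\<Lambda> N) [1..<Suc N]" and v: "valid N \<Lambda>" and s: "sum_mset (row_part N (\<Lambda> N)) = n"
        by (auto simp: aw top_row_def split: if_splits)
      have "decreasing N (\<Lambda> N)" using v by (simp add: valid_def)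
      then have "sorted_wrt (\<ge>) lam" unfolding lam by (rule sorted_map_decreasing)
      moreover have "sum_list lam = n" using s unfolding row_part_def sum_partition_of_tuple lam .
      moreover have "length lam = N" unfolding lam by simp
      ultimately show False using False by blast
    qed
    then have "pmf (map_pmf (top_row N) p) lam = 0" unfolding P by (intro sum.neutral) blast
    then show ?thesis unfolding p_def if_not_P[OF False] .
  next
    case True
    define f where "f = tuple_row lam"
    define \<rho> where "\<rho> = partition_of_tuple lam"
    have rf: "row_part N f = \<rho>" using row_part_tuple_row[of lam] True by (simp add: f_def \<rho>_def)
    have s: "sum_mset \<rho> = n" using True by (simp add: \<rho>_def sum_partition_of_tuple)
    have \<rho>: "\<rho> \<in> partitions" by (simp add: \<rho>_def partition_of_tuple_partition)
    have fd: "decreasing N f" using decreasing_tuple_row[of lam] True by (simp add: f_def)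
    have f0: "f i = 0" if "i \<notin> {1..N}" for i using that True by (auto simp: f_def tuple_row_def)
    have "f i \<le> n" if "i \<in> {1..N}" for i using entry_le_sum_row[of i N f] that rf s by simp
    then have frows: "f \<in> rows N n" using fd f0 unfolding rows_def by auto
    have top: "top_row N \<Lambda> = lam \<longleftrightarrow> \<Lambda> N = f" if "valid N \<Lambda>" for \<Lambda>
    proof
      assume *: "top_row N \<Lambda> = lam"
      show "\<Lambda> N = f"
      proof
        fix i
        show "\<Lambda> N i = f i"
        proof (cases "i \<in> {1..N}")
          case True
          then have "i - 1 < N" by auto
          then have "map (\<Lambda> N) [1..<Suc N] ! (i - 1) = \<Lambda> N i" using True by (simp del: upt_Suc)
          then show ?thesis using True unfolding f_def *[symmetric]
            by (simp add: top_row_def tuple_row_def del: upt_Suc)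
        next
          case False
          then show ?thesis using that f0 unfolding valid_def by auto
        qed
      qed
    next
      assume "\<Lambda> N = f"
      then show "top_row N \<Lambda> = lam" using map_tuple_row[of lam] True by (simp add: top_row_def f_def)
    qed
    have "(\<Sum>\<Lambda>\<in>arrays N n. array_weight t N \<alpha> n \<Lambda> * (if top_row N \<Lambda> = lam then 1 else 0)) =
      (\<Sum>\<Lambda> | \<Lambda> \<in> arrays N n \<and> valid N \<Lambda> \<and> \<Lambda> N = f. low t \<alpha> N \<Lambda> * hl_paths t \<rho>)"
      by (rule sum.mono_neutral_cong_right) (use top rf s in \<open>auto simp: aw split: if_splits\<close>)
    also have "\<dots> = hlF t \<rho> (map \<alpha> (rev [1..<Suc N])) * hl_paths t \<rho>"
      using sum_low[OF frows] rf s by (simp only: sum_distrib_right[symmetric])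
    \<comment> \<open>Symmetry undoes the reversal of the variables.\<close>
    also have "hlF t \<rho> (map \<alpha> (rev [1..<Suc N])) = eval_sym (hl_Q t \<rho>) (map \<alpha> [1..<Suc N])"
      unfolding eval_hl_Q[OF t \<rho>] by (rule hlF_mset_cong[OF t \<rho>]) simp
    finally show ?thesis
      using True P s by (simp add: hl_paths_def[OF t] p_def \<rho>_def[symmetric] mult_ac)
  qed
qed

end

theorem theorem1p10:
  fixes q N n :: nat and \<alpha> :: "nat \<Rightarrow> real" and letter :: "nat pmf" and lam :: "nat list"
  assumes "primepow q" and "N \<ge> 1"
    and "antimono_on {1..N} \<alpha>" and "\<forall>k\<in>{1..N}. \<alpha> k \<ge> 0" and "(\<Sum>k=1..N. \<alpha> k) = 1"
    and "\<forall>k\<in>{1..N}. pmf letter k = \<alpha> k"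
  defines "t \<equiv> 1 / real q"
  shows "pmf (map_pmf (top_row N) (bind_pmf (replicate_pmf n letter) (rsk t N))) lam =
    (if length lam = N \<and> sorted_wrt (\<ge>) lam \<and> sum_list lam = n
     then fact n * eval_sym (hl_Q t (partition_of_tuple lam)) (map \<alpha> [1..<Suc N])
                 * plancherel t (hl_P t (partition_of_tuple lam))
     else 0)"
proof (rule top_row_law)
  have "1 < q" using assms(1) by (rule primepow_gt_Suc_0[unfolded One_nat_def[symmetric]])
  then show "0 < t" "t < 1" by (simp_all add: t_def)
  \<comment> \<open>The prescribed probabilities already sum to 1, so no other letter has positive
    probability.\<close>
  have "measure_pmf.prob letter {1..N} = 1"
    using assms(5,6) by (simp add: measure_measure_pmf_finite)
  then have "AE k in measure_pmf letter. k \<in> {1..N}" by (rule measure_pmf.AE_prob_1)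
  then show "set_pmf letter \<subseteq> {1..N}" by (auto simp: AE_measure_pmf_iff)
  show "pmf letter k = \<alpha> k" if "k \<in> {1..N}" for k using assms(6) that by blast
qed

end
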